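(* Fix real numbers $T_L,T_R,D_L,D_R,a_L,a_R,b^*$ such that ($a_L\le0$ and $4D_L-T_L^2>0$, or $a_L>0$) and ($a_R\ge 0$ and $4D_R-T_R^2>0$, or $a_R<0$). For $b\in\mathbb R$ consider the piecewise linear system $$(Z_b):\quad\begin{cases}\dot x=T_Lx-y\\ \dot y=D_Lx-a_L\end{cases}\text{ for }x<0,\qquad \begin{cases}\dot x=T_Rx-y+b\\ \dot y=D_Rx-a_R\end{cases}\text{ for }x>0 .$$ Let $Q=\{(y_0,y_1)\in\mathbb R^2: y_0>0,\ y_1<0\}$, $\phi(y_0,y_1)=(y_0+y_1,y_0y_1)$, and let the half-map graphs $\mathcal O_L,\mathcal O_R^b,\widehat{\mathcal O}_L^b,\widehat{\mathcal O}_R^b$, the vector fields $X_L,X_R$, separating solutions, and the polynomials $\widetilde F_b,\widetilde G_b$ be as defined in the context. Let $\varepsilon>0$ and let $U_b\subset Q$, $b\in(b^*-\varepsilon,b^*+\varepsilon)$, be simply connected domains such that at least one of the following holds: (i) for all $b\in(b^*-\varepsilon,b^*+\varepsilon)$, $\widehat{\mathcal O}_L^b\subset U_b$ and $\mathcal O_L\cap U_b$ is a separating solution of the vector field $X_L(y_0,y_1)|_{U_b}$; (ii) for all $b\in(b^*-\varepsilon,b^*+\varepsilon)$, $\widehat{\mathcal O}_R^b\subset U_b$ and $\mathcal O_R^b\cap U_b$ is a separating solution of the vector field $X_R(y_0-b,y_1-b)|_{U_b}$. Let $N,k$ be nonnegative integers and suppose that, for each $b\in(b^*-\varepsilon,b^*+\varepsilon)$,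 the set $\widetilde\gamma_b=\widetilde F_b^{-1}(\{0\})$ has at most $N$ noncompact (and any number of compact) connected components in $\phi(U_b)$, and that the constrained polynomial system $$\widetilde F_b(Y_0,Y_1)=0,\quad \widetilde G_b(Y_0,Y_1)=0,\quad (Y_0,Y_1)\in\phi(U_b),$$ has at most $k$ isolated real solutions (non-isolated solutions are allowed). Then, for $b\in(b^*-\varepsilon,b^*+\varepsilon)$, the system $(Z_b)$ has at most $N+k+1$ crossing limit cycles.
   Context: Half-maps. Let $y_L:I_L\subset[0,+\infty)\to(-\infty,0]$ be the forward Poincaré half-map of the left system: starting at $(0,y_0)$ the forward orbit of $\dot x=T_Lx-y,\ \dot y=D_Lx-a_L$ runs in $x<0$ and first returns to $\{x=0\}$ at $(0,y_L(y_0))$; $I_L$ is the interval of all $y_0$ for which this is defined (with continuous extension at the left endpoint where appropriate). Let $y_R:I_R\subset[0,+\infty)\to(-\infty,0]$ be the backward half-map of the right system with $b=0$: the backward orbit of $\dot x=T_Rx-y,\ \dot y=D_Rx-a_R$ starting at $(0,y_0)$ runs in $x>0$ and first returns to $\{x=0\}$ at $(0,y_R(y_0))$. For general $b$ the backward half-map of the right system is $y_R^b(y_0)=y_R(y_0-b)+b$, defined on $I_R^b=I_R+b$. Put $I_b=I_L\cap(I_R+b)$. The conditions imposed on $a_L,D_L,T_L,a_R,D_R,T_R$ are precisely those under which both half-maps are well defined. Graphs: $\mathcal O_L=\{(y_0,y_L(y_0)):y_0\in\mathrm{Int}(I_L)\}$, $\mathcal O_R^b=\{(y_0,y_R^b(y_0)):y_0\in\mathrm{Int}(I_R^b)\}$,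 $\widehat{\mathcal O}_L^b=\{(y_0,y_L(y_0)):y_0\in\mathrm{Int}(I_b)\}$, $\widehat{\mathcal O}_R^b=\{(y_0,y_R^b(y_0)):y_0\in\mathrm{Int}(I_b)\}$. Crossing limit cycles. Crossing periodic solutions and crossing limit cycles of $(Z_b)$ correspond bijectively to zeros and isolated zeros, respectively, in $\mathrm{Int}(I_b)$ of the displacement function $\delta_b(y_0)=y_R(y_0-b)+b-y_L(y_0)$; if $\mathrm{Int}(I_b)=\emptyset$ there are none. Vector fields. $W_L(y)=D_Ly^2-a_LT_Ly+a_L^2$, $W_R(y)=D_Ry^2-a_RT_Ry+a_R^2$, $X_L(y_0,y_1)=-(y_1W_L(y_0),\,y_0W_L(y_1))$, $X_R(y_0,y_1)=-(y_1W_R(y_0),\,y_0W_R(y_1))$. Separating solution. An orbit $\mathcal O$ of a vector field $X:U\to\mathbb R^2$, $U\subset\mathbb R^2$ open and simply connected, is a separating solution if it is either a cycle or a noncompact trajectory with $(\overline{\mathcal O}\setminus\mathcal O)\subset\partial U$, closure and boundary being taken in $\mathbb R^2$. Polynomials. With $m_0=a_L^2(a_R^2b+b^3D_R+a_Rb^2T_R)$, $m_1=-a_L^2b(2bD_R+a_RT_R)$, $m_2=-a_R^2(bD_L+a_LT_L)+bD_R(3a_L^2-b^2D_L+a_LbT_L)+a_R(a_L^2-b^2D_L)T_R$, $m_3=a_L^2bD_R$, $m_4=a_R^2D_L-D_R(a_L^2-b^2D_L+a_LbT_L)+a_RbD_LT_R$, $m_5=a_LD_RT_L-a_RD_LT_R-bD_LD_R$,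 set $F_b(y_0,y_1)=m_0+m_1(y_0+y_1)+m_2y_0y_1+m_3(y_0^2+y_1^2)+m_4(y_0y_1^2+y_0^2y_1)+m_5y_0^2y_1^2$ and $G_b(y_0,y_1)=\langle\nabla F_b(y_0,y_1),X_L(y_0,y_1)\rangle$. Both are symmetric polynomials in $(y_0,y_1)$; $\widetilde F_b$ and $\widetilde G_b$ are the unique polynomials with $\widetilde F_b(y_0+y_1,y_0y_1)=F_b(y_0,y_1)$ and $\widetilde G_b(y_0+y_1,y_0y_1)=G_b(y_0,y_1)$. In particular $\widetilde F_b(Y_0,Y_1)=m_0+m_1Y_0+(m_2-2m_3)Y_1+m_3Y_0^2+m_4Y_0Y_1+m_5Y_1^2$, and $\widetilde G_b$ has degree at most $3$. The map $\phi$ is a diffeomorphism from $Q$ onto $\{(Y_0,Y_1):Y_1<0\}$. *)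

theory Defs
  imports "HOL-Analysis.Analysis"
begin

definition lin_field :: "real \<Rightarrow> real \<Rightarrow> real \<Rightarrow> real \<Rightarrow> real \<times> real \<Rightarrow> real \<times> real" where
  "lin_field T D a b = (\<lambda>(x, y). (T * x - y + b, D * x - a))"

definition solves_on :: "(real \<times> real \<Rightarrow> real \<times> real) \<Rightarrow> real set \<Rightarrow> (real \<Rightarrow> real \<times> real) \<Rightarrow> bool" where
  "solves_on X J u \<longleftrightarrow> (\<forall>t\<in>J. (u has_vector_derivative X (u t)) (at t within J))"

definition left_return :: "real \<Rightarrow> real \<Rightarrow> real \<Rightarrow> real \<Rightarrow> real \<Rightarrow> bool" where
  "left_return T D a y0 y1 \<longleftrightarrow>
     (\<exists>u \<tau>. \<tau> > 0 \<and> solves_on (lin_field T D a 0) {0..\<tau>} u \<and>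
        u 0 = (0, y0) \<and> (\<forall>t\<in>{0<..<\<tau>}. fst (u t) < 0) \<and> u \<tau> = (0, y1))"

definition right_return :: "real \<Rightarrow> real \<Rightarrow> real \<Rightarrow> real \<Rightarrow> real \<Rightarrow> bool" where
  "right_return T D a y0 y1 \<longleftrightarrow>
     (\<exists>u \<tau>. \<tau> > 0 \<and> solves_on (lin_field T D a 0) {-\<tau>..0} u \<and>
        u 0 = (0, y0) \<and> (\<forall>t\<in>{-\<tau><..<0}. fst (u t) > 0) \<and> u (-\<tau>) = (0, y1))"

text \<open>
  Only at the infimum of the return domain is a value adjoined, and only if the return value has
  a limit there. This covers \<open>T D a\<close> for which the origin is an equilibrium or its orbit leaves the
  half-plane, so that there is no return from \<open>(0, 0)\<close> itself.
\<close>

definition return_dom :: "(real \<Rightarrow> real \<Rightarrow> bool) \<Rightarrow> real set" where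
  "return_dom R = {y0. 0 \<le> y0 \<and> (\<exists>y1. R y0 y1)}"

definition return_val :: "(real \<Rightarrow> real \<Rightarrow> bool) \<Rightarrow> real \<Rightarrow> real" where
  "return_val R y0 = (THE y1. R y0 y1)"

definition half_dom :: "(real \<Rightarrow> real \<Rightarrow> bool) \<Rightarrow> real set" where
  "half_dom R = return_dom R \<union>
     {m. return_dom R \<noteq> {} \<and> m = Inf (return_dom R) \<and>
         (\<exists>l. (return_val R \<longlongrightarrow> l) (at m within return_dom R))}"

definition half_map :: "(real \<Rightarrow> real \<Rightarrow> bool) \<Rightarrow> real \<Rightarrow> real" where
  "half_map R y0 = (if y0 \<in> return_dom R then return_val R y0
                    else Lim (at y0 within return_dom R) (return_val R))"

definition I_left :: "real \<Rightarrow> real \<Rightarrow> real \<Rightarrow> real set" where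
  "I_left T D a = half_dom (left_return T D a)"

definition y_left :: "real \<Rightarrow> real \<Rightarrow> real \<Rightarrow> real \<Rightarrow> real" where
  "y_left T D a = half_map (left_return T D a)"

definition I_right :: "real \<Rightarrow> real \<Rightarrow> real \<Rightarrow> real \<Rightarrow> real set" where
  "I_right T D a b = (\<lambda>y. y + b) ` half_dom (right_return T D a)"

definition y_right :: "real \<Rightarrow> real \<Rightarrow> real \<Rightarrow> real \<Rightarrow> real \<Rightarrow> real" where
  "y_right T D a b y0 = half_map (right_return T D a) (y0 - b) + b"

definition graph_on :: "real set \<Rightarrow> (real \<Rightarrow> real) \<Rightarrow> (real \<times> real) set" where
  "graph_on S f = (\<lambda>y. (y, f y)) ` S"

text \<open>
  A point \<open>p\<close> of the switching line is a crossing point if the first components of both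
  fields at \<open>p\<close> are nonzero and have the same sign; the solution then follows one field before
  and the other one after passing through \<open>p\<close>, which is expressed by one-sided derivatives.
\<close>

definition crossing_solution ::
  "(real \<times> real \<Rightarrow> real \<times> real) \<Rightarrow> (real \<times> real \<Rightarrow> real \<times> real) \<Rightarrow> (real \<Rightarrow> real \<times> real) \<Rightarrow> bool" where
  "crossing_solution ZL ZR u \<longleftrightarrow>
     (\<forall>t. let p = u t in
        (fst p < 0 \<longrightarrow> (u has_vector_derivative ZL p) (at t)) \<and>
        (fst p > 0 \<longrightarrow> (u has_vector_derivative ZR p) (at t)) \<and>
        (fst p = 0 \<longrightarrow>
           (fst (ZL p) < 0 \<and> fst (ZR p) < 0 \<and>
              (u has_vector_derivative ZR p) (at_left t) \<and>
              (u has_vector_derivative ZL p) (at_right t)) \<or>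
           (fst (ZL p) > 0 \<and> fst (ZR p) > 0 \<and>
              (u has_vector_derivative ZL p) (at_left t) \<and>
              (u has_vector_derivative ZR p) (at_right t))))"

definition crossing_periodic_orbit ::
  "(real \<times> real \<Rightarrow> real \<times> real) \<Rightarrow> (real \<times> real \<Rightarrow> real \<times> real) \<Rightarrow> (real \<times> real) set \<Rightarrow> bool" where
  "crossing_periodic_orbit ZL ZR \<Gamma> \<longleftrightarrow>
     (\<exists>u p. p > 0 \<and> crossing_solution ZL ZR u \<and> (\<forall>t. u (t + p) = u t) \<and>
        (\<exists>t. fst (u t) = 0) \<and> \<Gamma> = range u)"

definition crossing_limit_cycle ::
  "(real \<times> real \<Rightarrow> real \<times> real) \<Rightarrow> (real \<times> real \<Rightarrow> real \<times> real) \<Rightarrow> (real \<times> real) set \<Rightarrow> bool" where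
  "crossing_limit_cycle ZL ZR \<Gamma> \<longleftrightarrow>
     crossing_periodic_orbit ZL ZR \<Gamma> \<and>
     (\<exists>V. open V \<and> \<Gamma> \<subseteq> V \<and>
        (\<forall>\<Gamma>'. crossing_periodic_orbit ZL ZR \<Gamma>' \<and> \<Gamma>' \<subseteq> V \<longrightarrow> \<Gamma>' = \<Gamma>))"

definition integral_curve ::
  "(real \<times> real \<Rightarrow> real \<times> real) \<Rightarrow> (real \<times> real) set \<Rightarrow> real set \<Rightarrow> (real \<Rightarrow> real \<times> real) \<Rightarrow> bool" where
  "integral_curve X U J u \<longleftrightarrow>
     open J \<and> is_interval J \<and> J \<noteq> {} \<and> u ` J \<subseteq> U \<and> solves_on X J u"

definition maximal_integral_curve ::
  "(real \<times> real \<Rightarrow> real \<times> real) \<Rightarrow> (real \<times> real) set \<Rightarrow> real set \<Rightarrow> (real \<Rightarrow> real \<times> real) \<Rightarrow> bool" where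
  "maximal_integral_curve X U J u \<longleftrightarrow>
     integral_curve X U J u \<and>
     (\<forall>J' v. integral_curve X U J' v \<and> J \<subseteq> J' \<and> (\<forall>t\<in>J. v t = u t) \<longrightarrow> J' = J)"

definition is_orbit :: "(real \<times> real \<Rightarrow> real \<times> real) \<Rightarrow> (real \<times> real) set \<Rightarrow> (real \<times> real) set \<Rightarrow> bool" where
  "is_orbit X U C \<longleftrightarrow> (\<exists>J u. maximal_integral_curve X U J u \<and> C = u ` J)"

definition is_cycle :: "(real \<times> real \<Rightarrow> real \<times> real) \<Rightarrow> (real \<times> real) set \<Rightarrow> (real \<times> real) set \<Rightarrow> bool" where
  "is_cycle X U C \<longleftrightarrow>
     (\<exists>u p. integral_curve X U UNIV u \<and> p > 0 \<and> (\<forall>t. u (t + p) = u t) \<and>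
        \<not> u constant_on UNIV \<and> C = range u)"

definition separating_solution ::
  "(real \<times> real \<Rightarrow> real \<times> real) \<Rightarrow> (real \<times> real) set \<Rightarrow> (real \<times> real) set \<Rightarrow> bool" where
  "separating_solution X U C \<longleftrightarrow>
     is_orbit X U C \<and> (is_cycle X U C \<or> (\<not> compact C \<and> closure C - C \<subseteq> frontier U))"

definition simply_connected_domain :: "(real \<times> real) set \<Rightarrow> bool" where
  "simply_connected_domain U \<longleftrightarrow> open U \<and> U \<noteq> {} \<and> simply_connected U"

definition W_poly :: "real \<Rightarrow> real \<Rightarrow> real \<Rightarrow> real \<Rightarrow> real" where
  "W_poly T D a y = D * y^2 - a * T * y + a^2"

definition X_field :: "real \<Rightarrow> real \<Rightarrow> real \<Rightarrow> real \<times> real \<Rightarrow> real \<times> real" where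
  "X_field T D a = (\<lambda>(y0, y1). - (y1 * W_poly T D a y0, y0 * W_poly T D a y1))"

definition Q_quad :: "(real \<times> real) set" where
  "Q_quad = {(y0, y1). y0 > 0 \<and> y1 < 0}"

definition \<phi> :: "real \<times> real \<Rightarrow> real \<times> real" where
  "\<phi> = (\<lambda>(y0, y1). (y0 + y1, y0 * y1))"

text \<open>
  \<open>F_poly\<close> is the contact polynomial of \<open>X_field TL DL aL\<close> and the translate of \<open>X_field TR DR aR\<close> by
  \<open>(b, b)\<close>: the determinant of these two fields at \<open>(y0, y1)\<close> is \<open>(y0 - y1) * F_poly \<dots> (y0, y1)\<close>.
\<close>

context
  fixes TL DL aL TR DR aR b :: real
begin

definition "m0 = aL^2 * (aR^2 * b + b^3 * DR + aR * b^2 * TR)"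
definition "m1 = - (aL^2 * b * (2 * b * DR + aR * TR))"
definition "m2 = - (aR^2 * (b * DL + aL * TL)) + b * DR * (3 * aL^2 - b^2 * DL + aL * b * TL)
                 + aR * (aL^2 - b^2 * DL) * TR"
definition "m3 = aL^2 * b * DR"
definition "m4 = aR^2 * DL - DR * (aL^2 - b^2 * DL + aL * b * TL) + aR * b * DL * TR"
definition "m5 = aL * DR * TL - aR * DL * TR - b * DL * DR"

definition F_poly :: "real \<times> real \<Rightarrow> real" where
  "F_poly = (\<lambda>(y0, y1). m0 + m1 * (y0 + y1) + m2 * (y0 * y1) + m3 * (y0^2 + y1^2)
      + m4 * (y0 * y1^2 + y0^2 * y1) + m5 * (y0^2 * y1^2))"

definition G_poly :: "real \<times> real \<Rightarrow> real" where
  "G_poly = (\<lambda>(y0, y1).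
      (deriv (\<lambda>s. F_poly (s, y1)) y0, deriv (\<lambda>s. F_poly (y0, s)) y1) \<bullet> X_field TL DL aL (y0, y1))"

end

text \<open>
  The description below determines \<open>h\<close> uniquely (\<open>sym_reduct_unique\<close>), since \<open>(y0 + y1, y0 * y1)\<close>
  runs through a set with nonempty interior; existence for \<open>F_poly\<close> and \<open>G_poly\<close> is shown by the
  explicit forms \<open>F_tilde_eq\<close> and \<open>G_tilde_eq\<close>.
\<close>

definition sym_reduct :: "(real \<times> real \<Rightarrow> real) \<Rightarrow> real \<times> real \<Rightarrow> real" where
  "sym_reduct H = (THE h. real_polynomial_function h \<and> (\<forall>y0 y1. h (y0 + y1, y0 * y1) = H (y0, y1)))"

definition F_tilde :: "real \<Rightarrow> real \<Rightarrow> real \<Rightarrow> real \<Rightarrow> real \<Rightarrow> real \<Rightarrow> real \<Rightarrow> real \<times> real \<Rightarrow> real" where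
  "F_tilde TL DL aL TR DR aR b = sym_reduct (F_poly TL DL aL TR DR aR b)"

definition G_tilde :: "real \<Rightarrow> real \<Rightarrow> real \<Rightarrow> real \<Rightarrow> real \<Rightarrow> real \<Rightarrow> real \<Rightarrow> real \<times> real \<Rightarrow> real" where
  "G_tilde TL DL aL TR DR aR b = sym_reduct (G_poly TL DL aL TR DR aR b)"

lemma real_polynomial_function_fst_snd [intro, simp]:
  "real_polynomial_function (fst :: real \<times> real \<Rightarrow> real)"
  "real_polynomial_function (snd :: real \<times> real \<Rightarrow> real)"
  by (auto intro: real_polynomial_function.intros bounded_linear_fst bounded_linear_snd)

lemma real_polynomial_function_zero_on_interval:
  fixes f :: "real \<Rightarrow> real"
  assumes "real_polynomial_function f" and "\<epsilon> > 0" and z: "\<And>t. 0 < t \<Longrightarrow> t < \<epsilon> \<Longrightarrow> f t = 0"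
  shows "f t = 0"
proof -
  obtain c n where f: "f = (\<lambda>x. \<Sum>i\<le>n. c i * x ^ i)"
    using assms(1) real_polynomial_function_iff_sum by blast
  have "{0<..<\<epsilon>} \<subseteq> {x. (\<Sum>i\<le>n. c i * x ^ i) = 0}"
    using z by (auto simp: f)
  moreover have "infinite {0<..<\<epsilon>}"
    using \<open>\<epsilon> > 0\<close> by simp
  ultimately have "\<not> finite {x. (\<Sum>i\<le>n. c i * x ^ i) = 0}"
    using finite_subset by blast
  then have "\<forall>i\<le>n. c i = 0"
    using polyfun_finite_roots[of c n] by blast
  then show ?thesis
    by (simp add: f)
qed

lemma sym_reduct_unique:
  fixes h g :: "real \<times> real \<Rightarrow> real"
  assumes h: "real_polynomial_function h" "\<And>y0 y1. h (y0 + y1, y0 * y1) = H (y0, y1)"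
    and g: "real_polynomial_function g" "\<And>y0 y1. g (y0 + y1, y0 * y1) = H (y0, y1)"
  shows "h = g"
proof
  fix P :: "real \<times> real"
  obtain s q where P: "P = (s, q)" by force
  define d where "d = (\<lambda>p. h p - g p)"
  define l where "l = (\<lambda>t::real. (t * s, t * (q + 1) - 1))"
  have d0: "d (A, B) = 0" if "A^2 \<ge> 4 * B" for A B
  proof -
    define r where "r = sqrt (A^2 - 4 * B)"
    have r: "r * r = A^2 - 4 * B"
      using that by (simp add: r_def)
    have "(A + r) / 2 + (A - r) / 2 = A" "(A + r) / 2 * ((A - r) / 2) = B"
      using r by (auto simp: field_simps power2_eq_square)
    then show ?thesis
      using h(2)[of "(A + r) / 2" "(A - r) / 2"] g(2)[of "(A + r) / 2" "(A - r) / 2"]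
      by (simp add: d_def)
  qed
  have "polynomial_function l"
    unfolding polynomial_function_iff_Basis_inner
    by (auto simp: l_def Basis_prod_def intro!: real_polynomial_function_diff
        real_polynomial_function.intros(2-4)
        real_polynomial_function.intros(1)[OF bounded_linear_ident])
  then have "real_polynomial_function (\<lambda>t. d (l t))"
    using real_polynomial_function_compose[of l d] h(1) g(1)
    by (auto simp: d_def o_def)
  moreover have "d (l t) = 0" if "0 < t" "t < 1 / (\<bar>q\<bar> + 1)" for t
  proof -
    have "t * (q + 1) \<le> t * (\<bar>q\<bar> + 1)"
      using that by (intro mult_left_mono) auto
    also have "\<dots> < 1"
      using that by (simp add: field_simps)
    finally have "4 * (t * (q + 1) - 1) \<le> 0" by simp
    also have "0 \<le> (t * s)^2" by simp
    finally show ?thesis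
      unfolding l_def by (rule d0)
  qed
  ultimately have "d (l 1) = 0"
    using real_polynomial_function_zero_on_interval[of "\<lambda>t. d (l t)" "1 / (\<bar>q\<bar> + 1)" 1] by auto
  then show "h P = g P"
    by (simp add: l_def d_def P)
qed

lemma sym_reduct_eqI:
  assumes "real_polynomial_function h" "\<And>y0 y1. h (y0 + y1, y0 * y1) = H (y0, y1)"
  shows "sym_reduct H = h"
  unfolding sym_reduct_def using assms by (intro the_equality) (auto intro: sym_reduct_unique)

context
  fixes TL DL aL TR DR aR b :: real
begin

private abbreviation "M0 \<equiv> m0 aL TR DR aR b"
private abbreviation "M1 \<equiv> m1 aL TR DR aR b"
private abbreviation "M2 \<equiv> m2 TL DL aL TR DR aR b"
private abbreviation "M3 \<equiv> m3 aL DR b"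
private abbreviation "M4 \<equiv> m4 TL DL aL TR DR aR b"
private abbreviation "M5 \<equiv> m5 TL DL aL TR DR aR b"

lemma F_tilde_eq:
  "F_tilde TL DL aL TR DR aR b = (\<lambda>p. M0 + M1 * fst p + (M2 - 2 * M3) * snd p
      + M3 * (fst p * fst p) + M4 * (fst p * snd p) + M5 * (snd p * snd p))"
  unfolding F_tilde_def
  by (rule sym_reduct_eqI, (intro real_polynomial_function.intros(2-4)
        real_polynomial_function_fst_snd))
     (simp add: F_poly_def algebra_simps power2_eq_square)

lemma G_tilde_eq:
  "G_tilde TL DL aL TR DR aR b = (\<lambda>p.
      - ((M1 + 2 * M3 * fst p + M4 * snd p)
           * (DL * (fst p * snd p) - 2 * aL * TL * snd p + aL^2 * fst p)
         + (M2 - 2 * M3 + M4 * fst p + 2 * M5 * snd p)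
           * (2 * DL * (snd p * snd p) - aL * TL * (fst p * snd p)
              + aL^2 * (fst p * fst p - 2 * snd p))))"
  unfolding G_tilde_def
proof (rule sym_reduct_eqI, goal_cases)
  case 1
  show ?case
    by (intro real_polynomial_function_minus real_polynomial_function.intros(2-4)
        real_polynomial_function_diff real_polynomial_function_fst_snd)
next
  case (2 y0 y1)
  have d0: "deriv (\<lambda>s. F_poly TL DL aL TR DR aR b (s, y1)) y0 =
      M1 + M2 * y1 + 2 * M3 * y0 + M4 * (y1^2 + 2 * y0 * y1) + 2 * M5 * y0 * y1^2"
    unfolding F_poly_def
    by (rule DERIV_imp_deriv) (auto intro!: derivative_eq_intros simp: algebra_simps)
  have d1: "deriv (\<lambda>s. F_poly TL DL aL TR DR aR b (y0, s)) y1 =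
      M1 + M2 * y0 + 2 * M3 * y1 + M4 * (y0^2 + 2 * y0 * y1) + 2 * M5 * y1 * y0^2"
    unfolding F_poly_def
    by (rule DERIV_imp_deriv) (auto intro!: derivative_eq_intros simp: algebra_simps)
  show ?case
    unfolding G_poly_def prod.case d0 d1 X_field_def W_poly_def
    by (simp add: inner_prod_def) algebra
qed

end

end

theory Submission
  imports Defs
begin

text \<open>
  A crossing limit cycle meets the switching line at \<open>(0, z)\<close> with \<open>z\<close> an isolated zero of the
  displacement, that is, an isolated intersection of the graphs of the two half-maps. These graphs
  are leaves of the slope fields of \<open>X_L\<close> and of the translate of \<open>X_R\<close> by \<open>(b, b)\<close>, and the determinant of the
  two fields at \<open>(y0, y1)\<close> is \<open>(y0 - y1) F_b(y0, y1)\<close>. The bound comes from two applications of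
  Rolle's theorem.

  \<^item> Between two consecutive intersections the difference of the two half-maps leaves 0 and returns to
    it, so the determinant changes sign on either graph (\<open>rolle_between\<close>). Hence \<open>n\<close> limit cycles give
    \<open>n - 1\<close> points of the curve \<open>F_b = 0\<close> on the graph that carries the separating solution.

  \<^item> The separating solution cuts the simply connected domain into two sides (\<open>side_function\<close>). An arc of
    the curve that leaves it and meets it again stays on one side in between, so it is somewhere
    tangent to the field (\<open>gap_contact\<close>), and tangency means \<open>G_b = 0\<close>. A component of the curve with
    \<open>j\<close> tangencies therefore meets the separating solution at most \<open>j + 1\<close> times, and at most \<open>j\<close> times if it
    closes up. Summed over the components this is \<open>N + k\<close>.

  Both steps need the curve to be regular and the tangencies to be isolated, and neither is assumed.
  In the variables \<open>(y0 + y1, y0 y1)\<close> the curve is a conic. Apart from finitely many \<open>b\<close>, its equation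
  has a factor \<open>E\<close>, either affine or a nondegenerate conic, that governs the determinant, while the
  remaining factor does not vanish on it at points of the quadrant (\<open>eventually_tame\<close>). Such a curve is parametrized by a
  line or by a circle of directions, and \<open>G_b\<close> along it is given by a polynomial, so it has finitely many
  zeros or vanishes identically. In the latter case a point of the curve on
  the separating solution forces the whole solution into the curve (\<open>all_contact\<close>), whence the two
  graphs coincide (\<open>leaves_coincide\<close>).

  The exceptional \<open>b\<close>, and coinciding graphs, are avoided by moving \<open>b\<close>. The displacement is strictly
  increasing in \<open>b\<close>; so sign changes persist, local minima split in two when \<open>b\<close> decreases and local
  maxima when \<open>b\<close> increases. In the direction favoured by the majority no isolated zeros are
  lost in total (\<open>zeros_persist\<close>), and the count may be carried out at a nearby regular value of \<open>b\<close>.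
\<close>

section \<open>Orbits of a linear field that start on the switching line\<close>

text \<open>
  The solutions of \<open>x'' = \<kappa> x\<close> with initial data \<open>(0, 1)\<close> and \<open>(1, 0)\<close>. With them saddles, nodes and foci
  have a common formula.
\<close>

definition gsin :: "real \<Rightarrow> real \<Rightarrow> real" where
  "gsin \<kappa> t = (if \<kappa> > 0 then sinh (sqrt \<kappa> * t) / sqrt \<kappa> else if \<kappa> = 0 then t
     else sin (sqrt (- \<kappa>) * t) / sqrt (- \<kappa>))"

definition gcos :: "real \<Rightarrow> real \<Rightarrow> real" where
  "gcos \<kappa> t = (if \<kappa> > 0 then cosh (sqrt \<kappa> * t) else if \<kappa> = 0 then 1
     else cos (sqrt (- \<kappa>) * t))"

lemma gsin_deriv: "(gsin \<kappa> has_real_derivative gcos \<kappa> t) (at t)"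
proof -
  consider "\<kappa> > 0" | "\<kappa> = 0" | "\<kappa> < 0" by linarith
  then show ?thesis
  proof cases
    case 1
    then have "gsin \<kappa> = (\<lambda>t. sinh (sqrt \<kappa> * t) / sqrt \<kappa>)" by (auto simp: gsin_def)
    moreover have "cosh (sqrt \<kappa> * t) * sqrt \<kappa> * sqrt \<kappa> / \<kappa> = cosh (sqrt \<kappa> * t)"
      using 1 by (simp add: mult.assoc)
    ultimately show ?thesis using 1 by (auto simp: gcos_def intro!: derivative_eq_intros)
  next
    case 2
    then have "gsin \<kappa> = (\<lambda>t. t)" by (auto simp: gsin_def)
    then show ?thesis using 2 by (auto simp: gcos_def)
  next
    case 3
    then have "gsin \<kappa> = (\<lambda>t. sin (sqrt (- \<kappa>) * t) / sqrt (- \<kappa>))" by (auto simp: gsin_def)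
    moreover have "- (cos (sqrt (- \<kappa>) * t) * sqrt (- \<kappa>) * sqrt (- \<kappa>) / \<kappa>) = cos (sqrt (- \<kappa>) * t)"
      using 3 by (simp add: mult.assoc)
    ultimately show ?thesis using 3 by (auto simp: gcos_def intro!: derivative_eq_intros)
  qed
qed

lemma gcos_deriv: "(gcos \<kappa> has_real_derivative \<kappa> * gsin \<kappa> t) (at t)"
proof -
  consider "\<kappa> > 0" | "\<kappa> = 0" | "\<kappa> < 0" by linarith
  then show ?thesis
  proof cases
    case 1
    then have "gcos \<kappa> = (\<lambda>t. cosh (sqrt \<kappa> * t))" by (auto simp: gcos_def)
    moreover have "sinh (sqrt \<kappa> * t) * sqrt \<kappa> = \<kappa> * sinh (sqrt \<kappa> * t) / sqrt \<kappa>"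
      using 1 by (simp add: field_simps)
    ultimately show ?thesis using 1 
      by (auto simp: gsin_def intro!: derivative_eq_intros)
  next
    case 2
    then have "gcos \<kappa> = (\<lambda>t. 1)" by (auto simp: gcos_def)
    then show ?thesis using 2 by (auto simp: gsin_def)
  next
    case 3
    then have "gcos \<kappa> = (\<lambda>t. cos (sqrt (- \<kappa>) * t))" by (auto simp: gcos_def)
    moreover have "- (sin (sqrt (- \<kappa>) * t) * sqrt (- \<kappa>)) = \<kappa> * sin (sqrt (- \<kappa>) * t) / sqrt (- \<kappa>)"
      using 3 by (simp add: field_simps flip: mult.assoc)
    ultimately show ?thesis using 3 
      by (auto simp: gsin_def intro!: derivative_eq_intros)
  qed
qed

lemma gsin_0 [simp]: "gsin \<kappa> 0 = 0" and gcos_0 [simp]: "gcos \<kappa> 0 = 1"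
  by (auto simp: gsin_def gcos_def)

text \<open>
  The first coordinate \<open>x\<close> of an orbit satisfies \<open>x'' = T x' - D x + a\<close>, and \<open>x' = - q\<close> at a start
  \<open>(0, q)\<close>. Here \<open>alp\<close> is the solution with \<open>a = 0\<close>, \<open>q = 1\<close>, and \<open>bet\<close> the one with \<open>a = 1\<close>, \<open>q = 0\<close>.
\<close>

definition alp :: "real \<Rightarrow> real \<Rightarrow> real \<Rightarrow> real" where
  "alp T D t = - (exp (T * t / 2) * gsin (T\<^sup>2 / 4 - D) t)"

definition alp' :: "real \<Rightarrow> real \<Rightarrow> real \<Rightarrow> real" where
  "alp' T D t = - (exp (T * t / 2) * (gcos (T\<^sup>2 / 4 - D) t + T / 2 * gsin (T\<^sup>2 / 4 - D) t))"

text \<open>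
  The case distinction divides by whichever coefficient of \<open>x'' = T x' - D x + 1\<close> is nonzero.
\<close>

definition bet :: "real \<Rightarrow> real \<Rightarrow> real \<Rightarrow> real" where
  "bet T D t = (if D \<noteq> 0 then (1 + alp' T D t - T * alp T D t) / D
     else if T \<noteq> 0 then (alp T D t + t) / (- T) else t\<^sup>2 / 2)"

lemma alp_0 [simp]: "alp T D 0 = 0" and alp'_0 [simp]: "alp' T D 0 = -1"
  by (auto simp: alp_def alp'_def)

lemma bet_0 [simp]: "bet T D 0 = 0"
  by (auto simp: bet_def)

lemma alp_deriv: "(alp T D has_real_derivative alp' T D t) (at t within S)"
proof (rule has_field_derivative_at_within)
  show "(alp T D has_real_derivative alp' T D t) (at t)"
  unfolding alp_def[abs_def] alp'_def
  by (auto intro!: derivative_eq_intros gsin_deriv simp: algebra_simps)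
qed

lemma alp'_deriv: "(alp' T D has_real_derivative T * alp' T D t - D * alp T D t) (at t within S)"
proof (rule has_field_derivative_at_within)
  show "(alp' T D has_real_derivative T * alp' T D t - D * alp T D t) (at t)"
  unfolding alp_def[abs_def] alp'_def[abs_def]
  by (auto intro!: derivative_eq_intros gsin_deriv gcos_deriv simp: algebra_simps power2_eq_square)
qed

lemma alp_wronskian: "(alp' T D t)\<^sup>2 - T * alp T D t * alp' T D t + D * (alp T D t)\<^sup>2 = exp (T * t)"
proof -
  let ?g = "\<lambda>t. ((alp' T D t)\<^sup>2 - T * alp T D t * alp' T D t + D * (alp T D t)\<^sup>2) * exp (- (T * t))"
  have "(?g has_real_derivative 0) (at t)" for t
    by (auto intro!: derivative_eq_intros alp_deriv alp'_deriv simp: power2_eq_square algebra_simps)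
  then have "?g t = ?g 0" using DERIV_isconst_all[of ?g] by blast
  then show ?thesis by (simp add: exp_minus field_simps)
qed

lemma bet_eq: "D * bet T D t = 1 + alp' T D t - T * alp T D t"
proof (cases "D = 0")
  case True
  let ?g = "\<lambda>t. 1 + alp' T D t - T * alp T D t"
  have "(?g has_real_derivative 0) (at t)" for t
    using True by (auto intro!: derivative_eq_intros alp_deriv alp'_deriv)
  then have "?g t = ?g 0" using DERIV_isconst_all[of ?g] by blast
  then show ?thesis using True by simp
qed (simp add: bet_def)

lemma bet_deriv: "(bet T D has_real_derivative - alp T D t) (at t within S)"
proof (rule has_field_derivative_at_within)
  show "(bet T D has_real_derivative - alp T D t) (at t)"
  proof (cases "D = 0")
    case D: True
    show ?thesis
    proof (cases "T = 0")
      case True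
      then have "bet T D = (\<lambda>t. t\<^sup>2 / 2)" "alp T D t = - t" using D by (auto simp: bet_def alp_def gsin_def)
      then show ?thesis by (auto intro!: derivative_eq_intros)
    next
      case False
      then have "bet T D = (\<lambda>t. (alp T D t + t) / (- T))" using D by (auto simp: bet_def)
      moreover have "alp' T D t + 1 = T * alp T D t" using bet_eq[of D T t] D by simp
      ultimately show ?thesis using False by (auto intro!: derivative_eq_intros alp_deriv)
    qed
  next
    case False
    then have "bet T D = (\<lambda>t. (1 + alp' T D t - T * alp T D t) / D)" by (auto simp: bet_def)
    then show ?thesis using False by (auto intro!: derivative_eq_intros alp_deriv alp'_deriv)
  qed
qed

definition xpos :: "real \<Rightarrow> real \<Rightarrow> real \<Rightarrow> real \<Rightarrow> real \<Rightarrow> real" where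
  "xpos T D a q t = q * alp T D t + a * bet T D t"

definition xvel :: "real \<Rightarrow> real \<Rightarrow> real \<Rightarrow> real \<Rightarrow> real \<Rightarrow> real" where
  "xvel T D a q t = q * alp' T D t - a * alp T D t"

lemma xpos_0 [simp]: "xpos T D a q 0 = 0" and xvel_0 [simp]: "xvel T D a q 0 = - q"
  by (auto simp: xpos_def xvel_def)

lemma xpos_deriv: "(xpos T D a q has_real_derivative xvel T D a q t) (at t within S)"
  unfolding xpos_def[abs_def] xvel_def by (auto intro!: derivative_eq_intros alp_deriv bet_deriv)

lemma xvel_deriv: "(xvel T D a q has_real_derivative T * xvel T D a q t - D * xpos T D a q t + a) (at t within S)"
proof -
  have "a * (D * bet T D t) = a * (1 + alp' T D t - T * alp T D t)" by (simp only: bet_eq)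
  then show ?thesis
  unfolding xpos_def xvel_def[abs_def] by (auto intro!: derivative_eq_intros alp_deriv alp'_deriv simp: algebra_simps)
qed

lemma xpos_cont: "continuous_on S (xpos T D a q)" and xvel_cont: "continuous_on S (xvel T D a q)"
  and alp_cont: "continuous_on S (alp T D)" and alp'_cont: "continuous_on S (alp' T D)"
  and bet_cont: "continuous_on S (bet T D)"
  by (rule DERIV_continuous_on, rule xpos_deriv xvel_deriv alp_deriv alp'_deriv bet_deriv)+

definition left_orbit :: "real \<Rightarrow> real \<Rightarrow> real \<Rightarrow> real \<Rightarrow> real \<Rightarrow> real \<times> real" where
  "left_orbit T D a q t = (xpos T D a q t, T * xpos T D a q t - xvel T D a q t)"

lemma left_orbit_solves: "solves_on (lin_field T D a 0) S (left_orbit T D a q)"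
proof -
  have "((\<lambda>t. (xpos T D a q t, T * xpos T D a q t - xvel T D a q t)) has_vector_derivative 
     (xvel T D a q t, T * xvel T D a q t - (T * xvel T D a q t - D * xpos T D a q t + a))) (at t within S)" for t
    by (intro has_vector_derivative_Pair) (auto intro!: derivative_eq_intros xpos_deriv xvel_deriv
       simp: has_real_derivative_iff_has_vector_derivative[symmetric])
  then show ?thesis by (simp add: solves_on_def left_orbit_def[abs_def] lin_field_def)
qed

lemma deriv_damped_energy:
  assumes "(A has_real_derivative A') (at s)" "(B has_real_derivative B') (at s)"
  shows "((\<lambda>t. ((A t)\<^sup>2 + (B t)\<^sup>2) * exp (- (M * t))) has_real_derivative
    (2 * A s * A' + 2 * B s * B' - M * ((A s)\<^sup>2 + (B s)\<^sup>2)) * exp (- (M * s))) (at s)"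
  by (auto intro!: derivative_eq_intros assms simp: algebra_simps)

text \<open>
  Uniqueness for linear systems by the energy method: the sum of squares, damped by
  a large exponential rate, is nonincreasing and starts at 0.
\<close>

lemma homogeneous_linear_zero:
  fixes A B :: "real \<Rightarrow> real"
  assumes A: "\<And>s. s \<in> {0..\<tau>} \<Longrightarrow> (A has_real_derivative T * A s - B s) (at s within {0..\<tau>})"
    and B: "\<And>s. s \<in> {0..\<tau>} \<Longrightarrow> (B has_real_derivative D * A s) (at s within {0..\<tau>})"
    and 0: "A 0 = 0" "B 0 = 0" and t: "t \<in> {0..\<tau>}"
  shows "A t = 0 \<and> B t = 0"
proof -
  define M where "M = 2 * \<bar>T\<bar> + \<bar>D\<bar> + 1"
  define e where "e = (\<lambda>t. ((A t)\<^sup>2 + (B t)\<^sup>2) * exp (- (M * t)))"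
  have "e t \<le> e 0"
  proof (rule DERIV_nonpos_imp_decreasing_open[of 0 t e])
    show "0 \<le> t" using t by simp
    fix s assume s: "0 < s" "s < t"
    then have s': "s \<in> {0..\<tau>}" "s \<in> interior {0..\<tau>}" using t by auto
    have "(A has_real_derivative T * A s - B s) (at s)" "(B has_real_derivative D * A s) (at s)"
      using A[OF s'(1)] B[OF s'(1)] unfolding at_within_interior[OF s'(2)] by blast+
    then have "(e has_real_derivative
      (2 * A s * (T * A s - B s) + 2 * B s * (D * A s) - M * ((A s)\<^sup>2 + (B s)\<^sup>2)) * exp (- (M * s))) (at s)"
      unfolding e_def by (rule deriv_damped_energy)
    moreover have "2 * A s * (T * A s - B s) + 2 * B s * (D * A s) - M * ((A s)\<^sup>2 + (B s)\<^sup>2) \<le> 0"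
    proof -
      have 1: "2 * \<bar>A s * B s\<bar> \<le> (A s)\<^sup>2 + (B s)\<^sup>2"
        using sum_squares_bound[of "\<bar>A s\<bar>" "\<bar>B s\<bar>"] by (simp add: abs_mult)
      have "2 * A s * (T * A s - B s) + 2 * B s * (D * A s) = 2 * T * (A s)\<^sup>2 + (D - 1) * (2 * (A s * B s))"
        by (simp add: algebra_simps power2_eq_square)
      also have "\<dots> \<le> 2 * \<bar>T\<bar> * ((A s)\<^sup>2 + (B s)\<^sup>2) + (\<bar>D\<bar> + 1) * ((A s)\<^sup>2 + (B s)\<^sup>2)"
      proof (rule add_mono)
        have "2 * T * (A s)\<^sup>2 \<le> 2 * \<bar>T\<bar> * (A s)\<^sup>2" by (intro mult_right_mono) auto
        also have "\<dots> \<le> 2 * \<bar>T\<bar> * ((A s)\<^sup>2 + (B s)\<^sup>2)" by (intro mult_left_mono) auto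
        finally show "2 * T * (A s)\<^sup>2 \<le> 2 * \<bar>T\<bar> * ((A s)\<^sup>2 + (B s)\<^sup>2)" .
        have "(D - 1) * (2 * (A s * B s)) \<le> \<bar>D - 1\<bar> * (2 * \<bar>A s * B s\<bar>)"
          using abs_ge_self[of "(D - 1) * (2 * (A s * B s))"] by (simp add: abs_mult)
        also have "\<dots> \<le> (\<bar>D\<bar> + 1) * ((A s)\<^sup>2 + (B s)\<^sup>2)" using 1 by (intro mult_mono) auto
        finally show "(D - 1) * (2 * (A s * B s)) \<le> (\<bar>D\<bar> + 1) * ((A s)\<^sup>2 + (B s)\<^sup>2)" .
      qed
      finally show ?thesis by (simp add: M_def algebra_simps)
    qed
    ultimately show "\<exists>y. (e has_real_derivative y) (at s) \<and> y \<le> 0"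
      using mult_nonpos_nonneg exp_ge_zero by blast
  next
    have "continuous_on {0..\<tau>} A" by (rule DERIV_continuous_on, erule A)
    moreover have "continuous_on {0..\<tau>} B" by (rule DERIV_continuous_on, erule B)
    ultimately have "continuous_on {0..\<tau>} e"
      unfolding e_def by (intro continuous_intros)
    then show "continuous_on {0..t} e"
      by (rule continuous_on_subset) (use t in auto)
  qed
  then have "(A t)\<^sup>2 + (B t)\<^sup>2 \<le> 0" using 0 by (simp add: e_def mult_le_0_iff)
  then show ?thesis by (simp add: sum_power2_le_zero_iff)
qed

lemma flow_unique:
  assumes u: "solves_on (lin_field T D a 0) {0..\<tau>} u" and u0: "u 0 = (0, q)" and t: "t \<in> {0..\<tau>}"
  shows "u t = left_orbit T D a q t"
proof -
  define v where "v = left_orbit T D a q"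
  define A where "A = (\<lambda>t. fst (u t) - fst (v t))"
  define B where "B = (\<lambda>t. snd (u t) - snd (v t))"
  have comp: "((\<lambda>t. fst (w t)) has_real_derivative T * fst (w s) - snd (w s)) (at s within {0..\<tau>})"
      "((\<lambda>t. snd (w t)) has_real_derivative D * fst (w s) - a) (at s within {0..\<tau>})"
    if "solves_on (lin_field T D a 0) {0..\<tau>} w" "s \<in> {0..\<tau>}" for w s
  proof -
    have "(w has_vector_derivative lin_field T D a 0 (w s)) (at s within {0..\<tau>})"
      using that by (auto simp: solves_on_def)
    from bounded_linear.has_vector_derivative[OF bounded_linear_fst this]
      bounded_linear.has_vector_derivative[OF bounded_linear_snd this]
    show "((\<lambda>t. fst (w t)) has_real_derivative T * fst (w s) - snd (w s)) (at s within {0..\<tau>})"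
      "((\<lambda>t. snd (w t)) has_real_derivative D * fst (w s) - a) (at s within {0..\<tau>})"
      by (auto simp: has_real_derivative_iff_has_vector_derivative lin_field_def case_prod_beta)
  qed
  have v: "solves_on (lin_field T D a 0) {0..\<tau>} v" unfolding v_def by (rule left_orbit_solves)
  have "A t = 0 \<and> B t = 0"
  proof (rule homogeneous_linear_zero[of \<tau> A T B D])
    show "(A has_real_derivative T * A s - B s) (at s within {0..\<tau>})" if "s \<in> {0..\<tau>}" for s
      using DERIV_diff[OF comp(1)[OF u that] comp(1)[OF v that]] by (simp add: A_def B_def algebra_simps)
    show "(B has_real_derivative D * A s) (at s within {0..\<tau>})" if "s \<in> {0..\<tau>}" for s
      using DERIV_diff[OF comp(2)[OF u that] comp(2)[OF v that]] by (simp add: A_def B_def algebra_simps)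
  qed (use t u0 in \<open>auto simp: A_def B_def v_def left_orbit_def\<close>)
  then show ?thesis by (simp add: A_def B_def v_def prod_eq_iff)
qed

section \<open>Return to the switching line\<close>

definition returns_at :: "real \<Rightarrow> real \<Rightarrow> real \<Rightarrow> real \<Rightarrow> real \<Rightarrow> bool" where
  "returns_at T D a q \<tau> \<longleftrightarrow> \<tau> > 0 \<and> (\<forall>t. 0 < t \<and> t < \<tau> \<longrightarrow> xpos T D a q t < 0) \<and> xpos T D a q \<tau> = 0"

text \<open>
  Only transversal returns are admitted, since these depend smoothly on \<open>q\<close>. For the admissible
  parameters only endpoints of the domain are lost (\<open>half_dom_interior\<close>).
\<close>

definition ret_dom :: "real \<Rightarrow> real \<Rightarrow> real \<Rightarrow> real set" where
  "ret_dom T D a = {q. q > 0 \<and> (\<exists>\<tau>. returns_at T D a q \<tau> \<and> xvel T D a q \<tau> > 0)}"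

definition return_time :: "real \<Rightarrow> real \<Rightarrow> real \<Rightarrow> real \<Rightarrow> real" where
  "return_time T D a q = (THE \<tau>. returns_at T D a q \<tau>)"

definition half_return :: "real \<Rightarrow> real \<Rightarrow> real \<Rightarrow> real \<Rightarrow> real" where
  "half_return T D a q = - xvel T D a q (return_time T D a q)"

lemma returns_at_unique: "returns_at T D a q s \<Longrightarrow> returns_at T D a q t \<Longrightarrow> s = t"
  unfolding returns_at_def by (metis less_irrefl linorder_neqE_linordered_idom)

lemma return_time_eq: "returns_at T D a q \<tau> \<Longrightarrow> return_time T D a q = \<tau>"
  unfolding return_time_def using returns_at_unique by blast

lemma left_return_iff:
  "left_return T D a q y1 \<longleftrightarrow> (\<exists>\<tau>. returns_at T D a q \<tau> \<and> y1 = - xvel T D a q \<tau>)"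
proof
  assume "left_return T D a q y1"
  then obtain u \<tau> where u: "\<tau> > 0" "solves_on (lin_field T D a 0) {0..\<tau>} u" "u 0 = (0, q)"
    "\<forall>t\<in>{0<..<\<tau>}. fst (u t) < 0" "u \<tau> = (0, y1)" unfolding left_return_def by blast
  have e: "u t = left_orbit T D a q t" if "t \<in> {0..\<tau>}" for t using flow_unique[OF u(2,3) that] .
  have "returns_at T D a q \<tau>" unfolding returns_at_def
  proof (intro conjI allI impI)
    fix t assume t: "0 < t \<and> t < \<tau>"
    then have "fst (u t) < 0" using u(4) by simp
    then show "xpos T D a q t < 0" using e[of t] t by (simp add: left_orbit_def)
  qed (use u(1,5) e[of \<tau>] in \<open>auto simp: left_orbit_def\<close>)
  moreover have "y1 = - xvel T D a q \<tau>" using u(1,5) e[of \<tau>] by (auto simp: left_orbit_def)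
  ultimately show "\<exists>\<tau>. returns_at T D a q \<tau> \<and> y1 = - xvel T D a q \<tau>" by blast
next
  assume "\<exists>\<tau>. returns_at T D a q \<tau> \<and> y1 = - xvel T D a q \<tau>"
  then obtain \<tau> where t: "returns_at T D a q \<tau>" "y1 = - xvel T D a q \<tau>" by blast
  then show "left_return T D a q y1" unfolding left_return_def
    by (intro exI[of _ "left_orbit T D a q"] exI[of _ \<tau>] conjI left_orbit_solves)
       (auto simp: returns_at_def left_orbit_def)
qed

lemma left_return_unique: "left_return T D a q y \<Longrightarrow> left_return T D a q y' \<Longrightarrow> y = y'"
  unfolding left_return_iff using returns_at_unique by blast

lemma cont_pos_near:
  fixes f :: "real \<Rightarrow> real"
  assumes "isCont f x" "f x > 0"
  shows "\<exists>d>0. \<forall>y. \<bar>y - x\<bar> < d \<longrightarrow> f y > 0"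
proof -
  obtain d where "d > 0" "\<forall>y. \<bar>y - x\<bar> < d \<longrightarrow> \<bar>f y - f x\<bar> < f x"
    using assms unfolding continuous_at_real_range by (metis real_norm_def)
  then show ?thesis by (intro exI[of _ d]) (auto simp: abs_less_iff)
qed

lemma xpos_isCont: "isCont (xpos T D a q) t" and xvel_isCont: "isCont (xvel T D a q) t"
  by (rule DERIV_isCont, rule xpos_deriv, rule DERIV_isCont, rule xvel_deriv)

lemma xpos_neg_init:
  assumes "q > 0" shows "\<exists>e>0. \<forall>t. 0 < t \<and> t < e \<longrightarrow> xpos T D a q t < 0"
proof -
  obtain d where d: "d > 0" "\<And>h. 0 < h \<Longrightarrow> h < d \<Longrightarrow> xpos T D a q 0 > xpos T D a q (0 + h)"
    using has_real_derivative_neg_dec_right[OF xpos_deriv[of T D a q 0 UNIV]] assms by auto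
  then show ?thesis by (intro exI[of _ d]) auto
qed

lemma first_return:
  assumes q: "q > 0" and s: "s > 0" "xpos T D a q s \<ge> 0"
  shows "\<exists>\<tau>\<le>s. returns_at T D a q \<tau>"
proof -
  let ?x = "xpos T D a q"
  obtain e where e: "e > 0" "\<And>t. 0 < t \<Longrightarrow> t < e \<Longrightarrow> ?x t < 0" using xpos_neg_init[OF q] by blast
  define e' where "e' = min e s / 2"
  have e': "0 < e'" "e' < e" "e' < s" using e(1) s(1) by (auto simp: e'_def min_def)
  define Z where "Z = {t \<in> {e'..s}. ?x t \<ge> 0}"
  have "Z = {e'..s} \<inter> ?x -` {0..}" by (auto simp: Z_def)
  then have "closed Z" using continuous_closed_preimage[OF xpos_cont closed_atLeastAtMost closed_atLeast] by simp
  moreover have "bounded Z" by (rule bounded_subset[of "{e'..s}"]) (auto simp: Z_def)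
  ultimately have "compact Z" by (simp add: compact_eq_bounded_closed)
  moreover have "s \<in> Z" using e' s by (auto simp: Z_def)
  ultimately obtain \<tau> where \<tau>: "\<tau> \<in> Z" "\<And>t. t \<in> Z \<Longrightarrow> \<tau> \<le> t"
    using compact_attains_inf[of Z] by blast
  have neg: "?x t < 0" if "0 < t" "t < \<tau>" for t
  proof (cases "t < e'")
    case False
    then have "t \<notin> Z" using \<tau>(2)[of t] that by auto
    then show ?thesis using False that \<tau>(1) by (auto simp: Z_def)
  qed (use e(2) e' that in auto)
  have "?x e' < 0" using e(2) e' by auto
  moreover have "?x \<tau> \<ge> 0" "e' \<le> \<tau>" "\<tau> \<le> s" using \<tau>(1) by (auto simp: Z_def)
  ultimately obtain t where t: "e' \<le> t" "t \<le> \<tau>" "?x t = 0"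
    using IVT[of ?x e' 0 \<tau>] xpos_isCont by (metis less_imp_le)
  then have "t = \<tau>" using neg[of t] e' by force
  then show ?thesis using t neg e' \<open>\<tau> \<le> s\<close> by (intro exI[of _ \<tau>]) (auto simp: returns_at_def)
qed

lemma xvel_return_nonneg: assumes "returns_at T D a q \<tau>" shows "xvel T D a q \<tau> \<ge> 0"
proof (rule ccontr)
  assume "\<not> ?thesis"
  then obtain d where d: "d > 0" "\<And>h. 0 < h \<Longrightarrow> h < d \<Longrightarrow> xpos T D a q \<tau> < xpos T D a q (\<tau> - h)"
    using has_real_derivative_neg_dec_left[OF xpos_deriv[of T D a q \<tau> UNIV]] by auto
  let ?h = "min d \<tau> / 2"
  have "0 < ?h" "?h < d" "0 < \<tau> - ?h" "\<tau> - ?h < \<tau>" using d(1) assms by (auto simp: returns_at_def min_def)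
  then have "xpos T D a q (\<tau> - ?h) > 0" "xpos T D a q (\<tau> - ?h) < 0"
    using d(2)[of ?h] assms unfolding returns_at_def by metis+
  then show False by simp
qed

lemma xpos_shift: "xpos T D a q t = xpos T D a p t + (q - p) * alp T D t"
  by (simp add: xpos_def algebra_simps)

lemma xvel_shift: "xvel T D a q t = xvel T D a p t + (q - p) * alp' T D t"
  by (simp add: xvel_def algebra_simps)

lemma alp_as_xpos: "alp T D t = xpos T D 0 1 t" by (simp add: xpos_def)

lemma xpos_nonpos_upto: "returns_at T D a q \<tau> \<Longrightarrow> 0 \<le> t \<Longrightarrow> t \<le> \<tau> \<Longrightarrow> xpos T D a q t \<le> 0"
  unfolding returns_at_def by (metis less_eq_real_def xpos_0)

lemma bet_pos: assumes "0 < s" "\<And>t. 0 < t \<Longrightarrow> t < s \<Longrightarrow> alp T D t < 0" shows "bet T D s > 0"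
proof -
  have "bet T D 0 < bet T D s"
  proof (rule DERIV_pos_imp_increasing_open[OF assms(1)])
    show "\<exists>y. (bet T D has_real_derivative y) (at t) \<and> 0 < y" if "0 < t" "t < s" for t
      using bet_deriv[of T D t UNIV] assms(2)[OF that] by (intro exI conjI) auto
  qed (rule bet_cont)
  then show ?thesis by simp
qed

text \<open>
  For \<open>a > 0\<close> the forcing pushes \<open>x\<close> to the right: at the first positive zero of the unforced solution the forced
  one has already crossed the line.
\<close>

lemma alp_neg_until_return:
  assumes a: "a > 0" and r: "returns_at T D a q \<tau>" and t: "0 < t" "t \<le> \<tau>"
  shows "alp T D t < 0"
proof (rule ccontr)
  assume "\<not> ?thesis"
  then have "xpos T D 0 1 t \<ge> 0" by (simp add: alp_as_xpos)
  then obtain s where s: "s \<le> t" "returns_at T D 0 1 s" using first_return[of 1 t T D 0] t by auto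
  then have "s > 0" "alp T D s = 0" "\<And>t. 0 < t \<Longrightarrow> t < s \<Longrightarrow> alp T D t < 0"
    by (auto simp: returns_at_def alp_as_xpos)
  then have "xpos T D a q s > 0" using bet_pos[of s T D] a by (simp add: xpos_def)
  moreover have "xpos T D a q s \<le> 0" using xpos_nonpos_upto[OF r] s t \<open>s > 0\<close> by auto
  ultimately show False by simp
qed

lemma ret_dom_down_closed:
  assumes a: "a > 0" and r: "returns_at T D a p \<tau>" and q: "0 < q" "q < p"
  shows "\<exists>s. returns_at T D a q s"
proof -
  have "alp T D \<tau> < 0" using alp_neg_until_return[OF a r] r by (auto simp: returns_at_def)
  then have "xpos T D a q \<tau> > 0" using xpos_shift[of T D a q \<tau> p] r q
    by (auto simp: returns_at_def mult_neg_neg)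
  then show ?thesis using first_return[of q \<tau> T D a] q r by (auto simp: returns_at_def)
qed

text \<open>
  The Wronskian of the homogeneous solution \<open>alp\<close> and of the derivative of \<open>x\<close>, both of which solve
  \<open>v'' = T v' - D v\<close>.
\<close>

lemma alp_xvel_wronskian:
  "alp' T D t * xvel T D a q t - alp T D t * (T * xvel T D a q t - D * xpos T D a q t + a) = exp (T * t) * q"
proof -
  have b: "a * (D * bet T D t) = a * (1 + alp' T D t - T * alp T D t)" by (simp only: bet_eq)
  have "alp' T D t * xvel T D a q t - alp T D t * (T * xvel T D a q t - D * xpos T D a q t + a)
     = q * ((alp' T D t)\<^sup>2 - T * alp T D t * alp' T D t + D * (alp T D t)\<^sup>2)
       + alp T D t * (a * (D * bet T D t) - a * (1 + alp' T D t - T * alp T D t))"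
    unfolding xpos_def xvel_def by algebra
  then show ?thesis unfolding b alp_wronskian by simp
qed

text \<open>
  At a tangential return \<open>x'' = a\<close>. For \<open>a > 0\<close> the orbit would be on the wrong side just before; for
  \<open>a = 0\<close> the Wronskian would vanish.
\<close>

lemma return_transversal:
  assumes a: "a \<ge> 0" and r: "returns_at T D a q \<tau>" and q: "q > 0"
  shows "xvel T D a q \<tau> > 0"
proof (rule ccontr)
  assume "\<not> ?thesis"
  then have 0: "xvel T D a q \<tau> = 0" using xvel_return_nonneg[OF r] by simp
  have x0: "xpos T D a q \<tau> = 0" "\<tau> > 0" using r by (auto simp: returns_at_def)
  have "- alp T D \<tau> * a = exp (T * \<tau>) * q"
    using alp_xvel_wronskian[of T D \<tau> a q] 0 x0 by simp
  then have "a \<noteq> 0" using q by auto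
  then have a: "a > 0" using a by simp
  have "(xvel T D a q has_real_derivative a) (at \<tau>)" using xvel_deriv[of T D a q \<tau> UNIV] 0 x0 by simp
  then obtain d where d: "d > 0" "\<And>h. 0 < h \<Longrightarrow> h < d \<Longrightarrow> xvel T D a q (\<tau> - h) < xvel T D a q \<tau>"
    using has_real_derivative_pos_inc_left[of "xvel T D a q" a \<tau> UNIV] a by auto
  let ?h = "min d \<tau> / 2"
  have h: "0 < ?h" "?h < d" "0 < \<tau> - ?h" "\<tau> - ?h < \<tau>" using d(1) x0 by (auto simp: min_def)
  have "xpos T D a q (\<tau> - ?h) > xpos T D a q \<tau>"
  proof (rule DERIV_neg_imp_decreasing_open[OF h(4)])
    fix t assume t: "\<tau> - ?h < t" "t < \<tau>"
    have "xvel T D a q t < 0" using d(2)[of "\<tau> - t"] t h 0 by auto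
    then show "\<exists>y. (xpos T D a q has_real_derivative y) (at t) \<and> y < 0" using xpos_deriv by blast
  qed (rule xpos_cont)
  moreover have "xpos T D a q (\<tau> - ?h) < 0" using r h(3,4) unfolding returns_at_def by metis
  ultimately show False using x0 by simp
qed

section \<open>Return to the line around a focus\<close>

context
  fixes T D a \<omega> :: real
  assumes w: "\<omega> > 0" "\<omega>\<^sup>2 = D - T\<^sup>2 / 4"
begin

lemma focus_D: "D > 0" using w by (smt (verit) zero_le_power2 zero_less_power divide_nonneg_nonneg)

lemma gsin_focus: "gsin (T\<^sup>2 / 4 - D) t = sin (\<omega> * t) / \<omega>" "gcos (T\<^sup>2 / 4 - D) t = cos (\<omega> * t)"
proof -
  have "T\<^sup>2 / 4 - D = - (\<omega>\<^sup>2)" using w by simp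
  then show "gsin (T\<^sup>2 / 4 - D) t = sin (\<omega> * t) / \<omega>" "gcos (T\<^sup>2 / 4 - D) t = cos (\<omega> * t)" using w(1)
    by (simp_all only: gsin_def gcos_def) (simp_all add: not_less)
qed

lemma alp_focus_neg: assumes "0 < t" "t < pi / \<omega>" shows "alp T D t < 0"
proof -
  have "sin (\<omega> * t) > 0" using assms w by (intro sin_gt_zero) (auto simp: field_simps)
  then show ?thesis using w unfolding alp_def gsin_focus by simp
qed

lemma alp_focus_pos: assumes "pi / \<omega> < t" "t < 2 * pi / \<omega>" shows "alp T D t > 0"
proof -
  have "sin (\<omega> * t) < 0" using assms w by (intro sin_lt_zero) (auto simp: field_simps)
  then show ?thesis using w unfolding alp_def gsin_focus by (simp add: mult_pos_neg divide_neg_pos)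
qed

lemma alp_focus_pi: "alp T D (pi / \<omega>) = 0"
  using w unfolding alp_def gsin_focus by simp

lemma focus_period:
  "alp T D (t + 2 * pi / \<omega>) = exp (T * pi / \<omega>) * alp T D t"
  "alp' T D (t + 2 * pi / \<omega>) = exp (T * pi / \<omega>) * alp' T D t"
proof -
  have 1: "sin (\<omega> * (t + 2 * pi / \<omega>)) = sin (\<omega> * t)" "cos (\<omega> * (t + 2 * pi / \<omega>)) = cos (\<omega> * t)"
    using w by (simp_all add: distrib_left)
  have 2: "exp (T * (t + 2 * pi / \<omega>) / 2) = exp (T * pi / \<omega>) * exp (T * t / 2)"
    by (simp add: exp_add[symmetric] field_simps)
  show "alp T D (t + 2 * pi / \<omega>) = exp (T * pi / \<omega>) * alp T D t"
  "alp' T D (t + 2 * pi / \<omega>) = exp (T * pi / \<omega>) * alp' T D t"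
    unfolding alp_def alp'_def gsin_focus 1 2 by (simp_all add: algebra_simps)
qed

lemma xpos_period: "xpos T D a q (t + 2 * pi / \<omega>) - a / D = exp (T * pi / \<omega>) * (xpos T D a q t - a / D)"
  "xvel T D a q (t + 2 * pi / \<omega>) = exp (T * pi / \<omega>) * xvel T D a q t"
proof -
  have x: "xpos T D a q t - a / D = q * alp T D t + a * (alp' T D t - T * alp T D t) / D" for t
  proof -
    have "bet T D t = (1 + alp' T D t - T * alp T D t) / D" using bet_eq[of D T t] focus_D by (simp add: field_simps)
    then show ?thesis by (simp add: xpos_def diff_divide_distrib add_divide_distrib distrib_left right_diff_distrib)
  qed
  show "xpos T D a q (t + 2 * pi / \<omega>) - a / D = exp (T * pi / \<omega>) * (xpos T D a q t - a / D)"
    unfolding x focus_period by (simp add: algebra_simps)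
  show "xvel T D a q (t + 2 * pi / \<omega>) = exp (T * pi / \<omega>) * xvel T D a q t"
    unfolding xvel_def focus_period by (simp add: algebra_simps)
qed

text \<open>
  Up to half a turn the unforced part is not positive and the forced part is negative, since \<open>a < 0\<close>. A
  return after a full turn would require the focus to be contracting, but then the orbit would already
  have been on the line or to the right of it one turn earlier.
\<close>

lemma focus_return_time:
  assumes a: "a < 0" and q: "q > 0" and r: "returns_at T D a q \<tau>"
  shows "pi / \<omega> < \<tau>" "\<tau> < 2 * pi / \<omega>"
proof -
  have P: "pi / \<omega> > 0" using w by simp
  have \<tau>: "\<tau> > 0" "xpos T D a q \<tau> = 0" using r by (auto simp: returns_at_def)
  show "pi / \<omega> < \<tau>"
  proof (rule ccontr)
    assume n: "\<not> ?thesis"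
    have "bet T D \<tau> > 0" using \<tau> n by (intro bet_pos alp_focus_neg) auto
    moreover have "alp T D \<tau> \<le> 0" using alp_focus_neg[of \<tau>] alp_focus_pi \<tau> n by (cases "\<tau> = pi / \<omega>") auto
    ultimately have "xpos T D a q \<tau> < 0" using a q by (simp add: xpos_def add_nonpos_neg mult_nonneg_nonpos mult_neg_pos)
    then show False using \<tau> by simp
  qed
  show "\<tau> < 2 * pi / \<omega>"
  proof (rule ccontr)
    assume n: "\<not> ?thesis"
    let ?K = "exp (T * pi / \<omega>)"
    have e: "a / D < 0" using a focus_D by (simp add: divide_neg_pos)
    have "xpos T D a q (2 * pi / \<omega>) \<le> 0" using n P by (intro xpos_nonpos_upto[OF r]) auto
    then have "a / D * (1 - ?K) \<le> 0" using xpos_period(1)[of q 0] by (simp add: algebra_simps)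
    then have "1 - ?K \<ge> 0" using e by (metis mult_le_0_iff not_less)
    then have K: "?K \<le> 1" by simp
    let ?s = "\<tau> - 2 * pi / \<omega>"
    have eq: "- (a / D) = ?K * (xpos T D a q ?s - a / D)" using xpos_period(1)[of q ?s] \<tau> by simp
    then have "xpos T D a q ?s - a / D > 0" using e by (metis exp_gt_zero neg_0_less_iff_less zero_less_mult_pos)
    then have "?K * (xpos T D a q ?s - a / D) \<le> 1 * (xpos T D a q ?s - a / D)" using K by (intro mult_right_mono) auto
    then have ge: "xpos T D a q ?s \<ge> 0" using eq by simp
    have "?s = 0"
    proof (rule ccontr)
      assume "?s \<noteq> 0"
      then have "0 < ?s" "?s < \<tau>" using n P by auto
      then have "xpos T D a q ?s < 0" using r unfolding returns_at_def by blast
      then show False using ge by simp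
    qed
    then have "xvel T D a q \<tau> = - (?K * q)" using xpos_period(2)[of q 0] by simp
    moreover have "?K * q > 0" using q by simp
    ultimately show False using xvel_return_nonneg[OF r] by simp
  qed
qed

text \<open>
  Moving the start up shortens the return, because \<open>alp > 0\<close> between half a turn and a full turn. The speed at a
  return, times \<open>alp\<close>, is \<open>a N\<close> with \<open>N\<close> as below, and \<open>exp (- T t) N t\<close> increases there; as the speed at the later return is
  not negative, that at the earlier one is positive.
\<close>

lemma focus_transversal_up:
  assumes a: "a < 0" and p: "p > 0" and r: "returns_at T D a p \<tau>" and q: "q > p"
  shows "q \<in> ret_dom T D a"
proof -
  note t = focus_return_time[OF a p r]
  have \<tau>: "\<tau> > 0" "xpos T D a p \<tau> = 0" using r by (auto simp: returns_at_def)
  have al: "alp T D \<tau> > 0" using alp_focus_pos[OF t] .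
  then have pos: "xpos T D a q \<tau> > 0" using xpos_shift[of T D a q \<tau> p] \<tau> q by auto
  then obtain s where s: "s \<le> \<tau>" "returns_at T D a q s" using first_return[of q \<tau> T D a] p q \<tau> by auto
  have s': "s < \<tau>" using s pos by (cases "s = \<tau>") (auto simp: returns_at_def)
  have ts: "pi / \<omega> < s" "s < 2 * pi / \<omega>" using focus_return_time[OF a _ s(2)] p q by auto
  \<comment> \<open>This comes from eliminating q between x = 0 and the formula for the velocity.\<close>
  define N where "N = (\<lambda>t. - (alp T D t)\<^sup>2 - bet T D t * alp' T D t)"
  have N: "xvel T D a q t * alp T D t = a * N t" if "xpos T D a q t = 0" for q t
  proof -
    have "q * alp T D t = - (a * bet T D t)" using that by (simp add: xpos_def)
    then have "q * alp T D t * alp' T D t = - (a * bet T D t) * alp' T D t" by simp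
    then show ?thesis by (simp add: xvel_def N_def algebra_simps power2_eq_square)
  qed
  have Nd: "(N has_real_derivative T * N t + alp T D t) (at t)" for t
  proof -
    have "(N has_real_derivative - (2 * alp T D t * alp' T D t) - (bet T D t * (T * alp' T D t - D * alp T D t) - alp T D t * alp' T D t)) (at t)"
      unfolding N_def by (auto intro!: derivative_eq_intros alp_deriv alp'_deriv bet_deriv)
    moreover have "- (2 * alp T D t * alp' T D t) - (bet T D t * (T * alp' T D t - D * alp T D t) - alp T D t * alp' T D t)
      = T * N t + alp T D t"
      unfolding N_def using bet_eq[of D T t] by algebra
    ultimately show ?thesis by simp
  qed
  have "exp (- T * s) * N s < exp (- T * \<tau>) * N \<tau>"
  proof (rule DERIV_pos_imp_increasing_open[OF s'])
    fix x assume x: "s < x" "x < \<tau>"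
    have "((\<lambda>x. exp (- T * x) * N x) has_real_derivative exp (- T * x) * alp T D x) (at x)"
      by (auto intro!: derivative_eq_intros Nd simp: algebra_simps)
    moreover have "alp T D x > 0" using alp_focus_pos[of x] x ts t by auto
    ultimately show "\<exists>y. ((\<lambda>x. exp (- T * x) * N x) has_real_derivative y) (at x) \<and> 0 < y" by (metis exp_gt_zero mult_pos_pos)
  next
    have "continuous_on {s..\<tau>} N" by (rule DERIV_continuous_on, rule has_field_derivative_at_within, rule Nd)
    then show "continuous_on {s..\<tau>} (\<lambda>x. exp (- T * x) * N x)" by (intro continuous_intros)
  qed
  moreover have "N \<tau> \<le> 0"
  proof -
    have "a * N \<tau> \<ge> 0" using N[OF \<tau>(2)] al xvel_return_nonneg[OF r] by (metis mult_nonneg_nonneg less_imp_le)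
    then show ?thesis using a by (simp add: zero_le_mult_iff)
  qed
  then have "exp (- T * \<tau>) * N \<tau> \<le> 0" by (simp add: mult_nonneg_nonpos)
  ultimately have "exp (- T * s) * N s < 0" by simp
  then have "N s < 0" by (simp add: mult_less_0_iff)
  then have "xvel T D a q s * alp T D s > 0" using N[of q s] s(2) a by (simp add: returns_at_def mult_neg_neg)
  then have "xvel T D a q s > 0" using alp_focus_pos[OF ts] by (simp add: zero_less_mult_iff)
  then show ?thesis using s(2) p q by (auto simp: ret_dom_def)
qed

lemma center_line: assumes "q > 0" shows "q \<in> ret_dom T D 0"
proof -
  have "\<exists>\<tau>. returns_at T D 0 q \<tau>" using first_return[of q "pi / \<omega>" T D 0] assms alp_focus_pi w by (auto simp: xpos_def)
  then show ?thesis using return_transversal[of 0 T D q] assms by (auto simp: ret_dom_def)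
qed

end

section \<open>Regularity of the half-return map\<close>

lemma alp_bounds: "\<exists>K>0. \<forall>t\<in>{0..s}. \<bar>alp T D t\<bar> \<le> K \<and> \<bar>alp' T D t\<bar> \<le> K"
proof -
  have "bounded (alp T D ` {0..s})" "bounded (alp' T D ` {0..s})"
    by (auto intro!: compact_imp_bounded compact_continuous_image alp_cont alp'_cont)
  then obtain A B where "A > 0" "\<forall>t\<in>{0..s}. \<bar>alp T D t\<bar> \<le> A" "\<forall>t\<in>{0..s}. \<bar>alp' T D t\<bar> \<le> B"
    unfolding bounded_pos by (auto simp: image_iff)
  then show ?thesis by (intro exI[of _ "max A B"]) (auto simp: le_max_iff_disj)
qed

text \<open>
  Two orbits of the family differ by \<open>(q - p) alp\<close>, which is uniformly small on compact time intervals.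
\<close>

lemma return_stable:
  assumes p: "p > 0" and r: "returns_at T D a p \<tau>" and tr: "xvel T D a p \<tau> > 0" and "\<eta> > 0"
  shows "\<exists>\<nu>>0. \<forall>q. \<bar>q - p\<bar> < \<nu> \<longrightarrow> q \<in> ret_dom T D a \<and> \<bar>return_time T D a q - \<tau>\<bar> < \<eta>"
proof -
  have \<tau>: "\<tau> > 0" "xpos T D a p \<tau> = 0" using r by (auto simp: returns_at_def)
  obtain d0 where d0: "d0 > 0" "\<And>y. \<bar>y - \<tau>\<bar> < d0 \<Longrightarrow> xvel T D a p y > 0"
    using cont_pos_near[OF xvel_isCont tr] by blast
  define h where "h = min (min d0 \<tau>) \<eta> / 2"
  have h: "0 < h" "h < d0" "h < \<tau>" "h < \<eta>" using d0 \<tau> \<open>\<eta> > 0\<close> by (auto simp: h_def min_def)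
  define t1 t2 where "t1 = \<tau> - h" and "t2 = \<tau> + h"
  have t12: "0 < t1" "t1 < \<tau>" "\<tau> < t2" using h by (auto simp: t1_def t2_def)
  have pd: "xvel T D a p t > 0" if "t \<in> {t1..t2}" for t using d0(2)[of t] that h by (auto simp: t1_def t2_def)
  obtain K where K: "K > 0" "\<And>t. t \<in> {0..t2} \<Longrightarrow> \<bar>alp T D t\<bar> \<le> K" "\<And>t. t \<in> {0..t2} \<Longrightarrow> \<bar>alp' T D t\<bar> \<le> K"
    using alp_bounds[of t2 T D] by blast
  have "isCont (\<lambda>t. - xvel T D a p t - p / 2) 0" by (intro continuous_intros xvel_isCont)
  then obtain \<epsilon>0 where e0: "\<epsilon>0 > 0" "\<And>y. \<bar>y\<bar> < \<epsilon>0 \<Longrightarrow> - xvel T D a p y - p / 2 > 0"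
    using cont_pos_near[where f="\<lambda>t. - xvel T D a p t - p / 2" and x=0] p by auto
  define \<epsilon> where "\<epsilon> = min \<epsilon>0 t1 / 2"
  have e: "0 < \<epsilon>" "\<epsilon> < \<epsilon>0" "\<epsilon> < t1" using e0 t12 by (auto simp: \<epsilon>_def min_def)
  \<comment> \<open>Away from both ends of the time interval x is bounded away from 0; near them its derivative is, so that a small change of q cannot create or destroy a zero.\<close>
  obtain m1 where m1: "m1 > 0" "\<And>t. t \<in> {\<epsilon>..t1} \<Longrightarrow> xpos T D a p t \<le> - m1"
  proof -
    obtain s where s: "s \<in> {\<epsilon>..t1}" "\<And>t. t \<in> {\<epsilon>..t1} \<Longrightarrow> xpos T D a p t \<le> xpos T D a p s"
      using continuous_attains_sup[of "{\<epsilon>..t1}" "xpos T D a p"] xpos_cont e by auto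
    moreover have "xpos T D a p s < 0" using r s(1) e t12 by (auto simp: returns_at_def)
    ultimately show ?thesis using that[of "- xpos T D a p s"] by auto
  qed
  obtain m2 where m2: "m2 > 0" "\<And>t. t \<in> {t1..t2} \<Longrightarrow> xvel T D a p t \<ge> m2"
  proof -
    obtain s where "s \<in> {t1..t2}" "\<And>t. t \<in> {t1..t2} \<Longrightarrow> xvel T D a p s \<le> xvel T D a p t"
      using continuous_attains_inf[of "{t1..t2}" "xvel T D a p"] xvel_cont t12 by auto
    then show ?thesis using that[of "xvel T D a p s"] pd by auto
  qed
  have m3: "xpos T D a p t2 > 0"
  proof -
    have "xpos T D a p \<tau> < xpos T D a p t2"
    proof (rule DERIV_pos_imp_increasing[OF t12(3)])
      fix x assume "\<tau> \<le> x" "x \<le> t2"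
      then have "xvel T D a p x > 0" using pd[of x] t12 by auto
      then show "\<exists>y. (xpos T D a p has_real_derivative y) (at x) \<and> 0 < y" using xpos_deriv by blast
    qed
    then show ?thesis using \<tau> by simp
  qed
  define m where "m = Min {m1, m2, xpos T D a p t2, p / 2}"
  have m: "0 < m" "m \<le> m1" "m \<le> m2" "m \<le> xpos T D a p t2" "m \<le> p / 2" using m1 m2 m3 p by (auto simp: m_def)
  show ?thesis
  proof (intro exI[of _ "m / K"] conjI allI impI)
    show "m / K > 0" using m K by simp
    fix q assume q: "\<bar>q - p\<bar> < m / K"
    then have mk: "\<bar>q - p\<bar> * K < m" using K by (simp add: field_simps)
    have b: "\<bar>(q - p) * alp T D t\<bar> < m" "\<bar>(q - p) * alp' T D t\<bar> < m" if "t \<in> {0..t2}" for t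
    proof -
      have "\<bar>q - p\<bar> * \<bar>alp T D t\<bar> \<le> \<bar>q - p\<bar> * K" "\<bar>q - p\<bar> * \<bar>alp' T D t\<bar> \<le> \<bar>q - p\<bar> * K"
        using K(2,3)[OF that] by (auto intro: mult_left_mono)
      then show "\<bar>(q - p) * alp T D t\<bar> < m" "\<bar>(q - p) * alp' T D t\<bar> < m" using mk unfolding abs_mult by linarith+
    qed
    have q0: "q > 0" using b(2)[of 0] t12 m p by (auto simp: abs_less_iff)
    have n1: "xpos T D a q t < 0" if t: "0 < t" "t \<le> t1" for t
    proof (cases "t \<le> \<epsilon>")
      case True
      have "xpos T D a q 0 > xpos T D a q t"
      proof (rule DERIV_neg_imp_decreasing[OF t(1)])
        fix s assume s: "0 \<le> s" "s \<le> t"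
        have "xvel T D a q s < 0" using e0(2)[of s] e s True t b(2)[of s] t12 m xvel_shift[of T D a q s p] by auto
        then show "\<exists>y. (xpos T D a q has_real_derivative y) (at s) \<and> y < 0" using xpos_deriv by blast
      qed
      then show ?thesis by simp
    next
      case False
      then show ?thesis using m1(2)[of t] b(1)[of t] t t12 m e xpos_shift[of T D a q t p] by auto
    qed
    have n2: "xpos T D a q t2 > 0" using b(1)[of t2] t12 m xpos_shift[of T D a q t2 p] by auto
    obtain s where s: "s \<le> t2" "returns_at T D a q s" using first_return[of q t2 T D a] q0 n2 t12 by auto
    have "s \<noteq> t2" using s n2 by (auto simp: returns_at_def)
    moreover have "t1 < s" using n1[of s] s by (auto simp: returns_at_def not_less)
    moreover have "xvel T D a q s > 0" using m2(2)[of s] b(2)[of s] m s(1) t12 \<open>t1 < s\<close> xvel_shift[of T D a q s p] by auto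
    ultimately show "q \<in> ret_dom T D a" "\<bar>return_time T D a q - \<tau>\<bar> < \<eta>"
      using s q0 return_time_eq[OF s(2)] h by (auto simp: ret_dom_def t1_def t2_def)
  qed
qed

lemma ret_domD:
  assumes "q \<in> ret_dom T D a"
  shows "q > 0" "returns_at T D a q (return_time T D a q)" "xvel T D a q (return_time T D a q) > 0" "return_time T D a q > 0"
    "xpos T D a q (return_time T D a q) = 0" "half_return T D a q < 0"
proof -
  obtain \<tau> where t: "q > 0" "returns_at T D a q \<tau>" "xvel T D a q \<tau> > 0" using assms by (auto simp: ret_dom_def)
  then show "q > 0" "returns_at T D a q (return_time T D a q)" "xvel T D a q (return_time T D a q) > 0" "return_time T D a q > 0"
    "xpos T D a q (return_time T D a q) = 0" "half_return T D a q < 0"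
    by (simp_all add: return_time_eq[OF t(2)] half_return_def) (simp_all add: returns_at_def)
qed

lemma ret_dom_open: "open (ret_dom T D a)"
  unfolding open_dist dist_real_def
proof
  fix p assume "p \<in> ret_dom T D a"
  from return_stable[OF ret_domD(1,2,3)[OF this] zero_less_one]
  show "\<exists>e>0. \<forall>y. \<bar>y - p\<bar> < e \<longrightarrow> y \<in> ret_dom T D a" by blast
qed

lemma return_time_isCont: assumes "p \<in> ret_dom T D a" shows "isCont (return_time T D a) p"
  unfolding continuous_at_real_range real_norm_def
proof (intro allI impI)
  fix e :: real assume "e > 0"
  from return_stable[OF ret_domD(1,2,3)[OF assms] this]
  show "\<exists>d>0. \<forall>x'. \<bar>x' - p\<bar> < d \<longrightarrow> \<bar>return_time T D a x' - return_time T D a p\<bar> < e" by blast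
qed

lemma return_time_deriv:
  assumes p: "p \<in> ret_dom T D a"
  shows "(return_time T D a has_real_derivative - alp T D (return_time T D a p) / xvel T D a p (return_time T D a p)) (at p)"
proof -
  let ?\<tau> = "return_time T D a p"
  obtain g where g: "\<And>z. xpos T D a p z - xpos T D a p ?\<tau> = g z * (z - ?\<tau>)" "isCont g ?\<tau>" "g ?\<tau> = xvel T D a p ?\<tau>"
    using iffD1[OF CARAT_DERIV xpos_deriv[of T D a p ?\<tau> UNIV]] by blast
  have cg: "isCont (\<lambda>q. g (return_time T D a q)) p" by (rule isCont_o2[OF return_time_isCont[OF p] g(2)])
  have g0: "g (return_time T D a p) > 0" using g(3) ret_domD[OF p] by simp
  have lim: "((\<lambda>q. - alp T D (return_time T D a q) / g (return_time T D a q)) \<longlongrightarrow> - alp T D ?\<tau> / g ?\<tau>) (at p)"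
  proof -
    have "isCont (\<lambda>q. - alp T D (return_time T D a q) / g (return_time T D a q)) p"
      using g0 by (intro continuous_intros isCont_o2[OF return_time_isCont[OF p]] cg DERIV_isCont[OF alp_deriv]) auto
    then show ?thesis by (simp add: isCont_def)
  qed
  have "\<forall>\<^sub>F q in at p. q \<in> ret_dom T D a"
    using ret_dom_open p by (simp add: eventually_at_topological) blast
  moreover have "\<forall>\<^sub>F q in at p. g (return_time T D a q) > 0"
    using order_tendstoD(1)[OF cg[unfolded isCont_def] g0] .
  moreover have "\<forall>\<^sub>F q in at p. q \<noteq> p" by (simp add: eventually_at_filter)
  ultimately have "\<forall>\<^sub>F q in at p. - alp T D (return_time T D a q) / g (return_time T D a q) = (return_time T D a q - ?\<tau>) / (q - p)"
  proof eventually_elim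
    case (elim q)
    have "xpos T D a p (return_time T D a q) = - (q - p) * alp T D (return_time T D a q)"
      using xpos_shift[of T D a q "return_time T D a q" p] ret_domD(5)[OF elim(1)] by (simp add: algebra_simps)
    then have "g (return_time T D a q) * (return_time T D a q - ?\<tau>) = - (q - p) * alp T D (return_time T D a q)"
      using g(1)[of "return_time T D a q"] ret_domD(5)[OF p] by simp
    then show ?case using elim by (simp add: field_simps)
  qed
  with lim have "((\<lambda>q. (return_time T D a q - ?\<tau>) / (q - p)) \<longlongrightarrow> - alp T D ?\<tau> / g ?\<tau>) (at p)"
    by (rule Lim_transform_eventually)
  then show ?thesis using g(3) by (simp add: has_field_derivative_iff)
qed

lemma half_return_deriv_exp:
  assumes p: "p \<in> ret_dom T D a"
  shows "(half_return T D a has_real_derivative exp (T * return_time T D a p) * p / half_return T D a p) (at p)"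
proof -
  let ?\<tau> = "return_time T D a p" let ?x' = "xvel T D a p ?\<tau>"
  have x': "?x' > 0" "xpos T D a p ?\<tau> = 0" using ret_domD[OF p] by auto
  define c where "c = - alp T D ?\<tau> / ?x'"
  have "((\<lambda>q. - (q * alp' T D (return_time T D a q) - a * alp T D (return_time T D a q))) has_real_derivative
    - (alp' T D ?\<tau> + (T * ?x' - D * xpos T D a p ?\<tau> + a) * (- alp T D ?\<tau> / ?x'))) (at p)"
    unfolding c_def[symmetric]
  proof -
    have "((\<lambda>q. - (q * alp' T D (return_time T D a q) - a * alp T D (return_time T D a q))) has_real_derivative
      - (alp' T D ?\<tau> + p * ((T * alp' T D ?\<tau> - D * alp T D ?\<tau>) * c)
         - a * (alp' T D ?\<tau> * c))) (at p)"
      unfolding c_def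
      by (auto intro!: derivative_eq_intros DERIV_chain2[OF alp_deriv return_time_deriv[OF p]] DERIV_chain2[OF alp'_deriv return_time_deriv[OF p]] simp: mult_ac)
    moreover have "p * ((T * alp' T D ?\<tau> - D * alp T D ?\<tau>) * c) - a * (alp' T D ?\<tau> * c) = (T * ?x' - D * xpos T D a p ?\<tau> + a) * c"
      using bet_eq[of D T ?\<tau>] unfolding xpos_def xvel_def by algebra
    ultimately show "((\<lambda>q. - (q * alp' T D (return_time T D a q) - a * alp T D (return_time T D a q))) has_real_derivative
    - (alp' T D ?\<tau> + (T * ?x' - D * xpos T D a p ?\<tau> + a) * c)) (at p)" by (simp only: add_diff_eq[symmetric])
  qed
  moreover have "half_return T D a = (\<lambda>q. - (q * alp' T D (return_time T D a q) - a * alp T D (return_time T D a q)))"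
    by (simp add: half_return_def[abs_def] xvel_def)
  moreover have "- (alp' T D ?\<tau> + (T * ?x' - D * xpos T D a p ?\<tau> + a) * (- alp T D ?\<tau> / ?x')) = exp (T * ?\<tau>) * p / half_return T D a p"
    using alp_xvel_wronskian[of T D ?\<tau> a p] x' unfolding half_return_def by (simp add: field_simps)
  ultimately show ?thesis by simp
qed

text \<open>
  In the velocity \<open>(x', D x - a)\<close> the orbit follows the homogeneous linear system, for which this quadratic form
  is multiplied by \<open>exp (T t)\<close>. On the switching line it is \<open>W_poly\<close>.
\<close>

lemma flow_W:
  "D * (xvel T D a q t)\<^sup>2 - T * xvel T D a q t * (D * xpos T D a q t - a) + (D * xpos T D a q t - a)\<^sup>2 = exp (T * t) * W_poly T D a q"
proof -
  let ?g = "\<lambda>t. (D * (xvel T D a q t)\<^sup>2 - T * xvel T D a q t * (D * xpos T D a q t - a) + (D * xpos T D a q t - a)\<^sup>2) * exp (- (T * t))"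
  have "(?g has_real_derivative 0) (at t)" for t
    by (auto intro!: derivative_eq_intros xpos_deriv xvel_deriv simp: power2_eq_square algebra_simps)
  then have "?g t = ?g 0" using DERIV_isconst_all[of ?g] by blast
  then show ?thesis by (simp add: exp_minus field_simps W_poly_def)
qed

lemma W_half_return: assumes "q \<in> ret_dom T D a" shows "W_poly T D a (half_return T D a q) = exp (T * return_time T D a q) * W_poly T D a q"
  using flow_W[of D T a q "return_time T D a q"] ret_domD(5)[OF assms] by (simp add: half_return_def W_poly_def algebra_simps)

text \<open>
  At a turning point of \<open>x\<close> the form of \<open>flow_W\<close> reduces to a square.
\<close>

lemma W_pos_return: assumes q: "q > 0" and r: "returns_at T D a q \<tau>" shows "W_poly T D a q > 0"
proof -
  have "\<tau> > 0" "xpos T D a q \<tau> = 0" using r by (auto simp: returns_at_def)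
  then obtain t where t: "0 < t" "t < \<tau>" "DERIV (xpos T D a q) t :> 0"
    using Rolle[of 0 \<tau> "xpos T D a q"] xpos_cont xpos_deriv by (metis real_differentiable_def xpos_0)
  have z: "xvel T D a q t = 0" using DERIV_unique[OF t(3) xpos_deriv] by simp
  have "D * xpos T D a q t - a \<noteq> 0"
  proof
    assume "D * xpos T D a q t - a = 0"
    then show False using alp_xvel_wronskian[of T D t a q] z q by simp
  qed
  then have "exp (T * t) * W_poly T D a q > 0" using flow_W[of D T a q t] z by (metis mult_zero_left mult_zero_right power_zero_numeral diff_zero add_0 zero_less_power2)
  then show ?thesis by (simp add: zero_less_mult_iff)
qed

lemma W_pos: assumes "q \<in> ret_dom T D a" shows "W_poly T D a q > 0" "W_poly T D a (half_return T D a q) > 0"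
proof -
  show "W_poly T D a q > 0" using W_pos_return ret_domD[OF assms] by blast
  then show "W_poly T D a (half_return T D a q) > 0" by (simp add: W_half_return[OF assms])
qed

text \<open>
  Thus the graph of the half-return map is a leaf of \<open>X_field\<close>.
\<close>

lemma half_return_deriv:
  assumes p: "p \<in> ret_dom T D a"
  shows "(half_return T D a has_real_derivative p * W_poly T D a (half_return T D a p) / (half_return T D a p * W_poly T D a p)) (at p)"
  using half_return_deriv_exp[OF p] W_pos[OF p] by (simp add: W_half_return[OF p] mult.commute)

lemma admissible_cases:
  assumes "(a \<le> 0 \<and> 4 * D - T\<^sup>2 > 0) \<or> a > (0::real)"
  obtains "a > 0" | "a \<le> 0" "sqrt (D - T\<^sup>2 / 4) > 0" "(sqrt (D - T\<^sup>2 / 4))\<^sup>2 = D - T\<^sup>2 / 4"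
  using assms by force

lemma return_set_interior:
  assumes adm: "(a \<le> 0 \<and> 4 * D - T\<^sup>2 > 0) \<or> a > 0" and pq: "0 < p" "p < q" "q < r"
    and pr: "returns_at T D a p s" "returns_at T D a r s'"
  shows "q \<in> ret_dom T D a"
  using adm
proof (cases rule: admissible_cases)
  case 1
  then obtain t where "returns_at T D a q t" using ret_dom_down_closed[of a T D r s' q] pq pr by auto
  then show ?thesis using return_transversal[of a T D q t] 1 pq by (auto simp: ret_dom_def)
next
  case 2
  then show ?thesis using focus_transversal_up[OF 2(2,3) _ pq(1) pr(1) pq(2)] center_line[OF 2(2,3)] pq
    by (cases "a = 0") auto
qed

lemma return_set_up:
  assumes adm: "(a \<le> 0 \<and> 4 * D - T\<^sup>2 > 0) \<or> a > 0" and p: "p \<in> ret_dom T D a" "r \<in> ret_dom T D a"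
  and q: "p \<le> q" "q \<le> r"
  shows "q \<in> ret_dom T D a"
  using return_set_interior[OF adm, of p q r] ret_domD[OF p(1)] ret_domD[OF p(2)] q p by (metis less_eq_real_def)

lemma ret_dom_interval:
  assumes adm: "(a \<le> 0 \<and> 4 * D - T\<^sup>2 > 0) \<or> a > 0" shows "is_interval (ret_dom T D a)"
  unfolding is_interval_1 using return_set_up[OF adm] by blast

lemma half_return_decreasing:
  assumes adm: "(a \<le> 0 \<and> 4 * D - T\<^sup>2 > 0) \<or> a > 0" and "p \<in> ret_dom T D a" "q \<in> ret_dom T D a" "p < q"
  shows "half_return T D a q < half_return T D a p"
proof (rule DERIV_neg_imp_decreasing[OF \<open>p < q\<close>])
  fix x assume x: "p \<le> x" "x \<le> q"
  have x: "x \<in> ret_dom T D a" using return_set_up[OF adm assms(2,3) x] .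
  have "exp (T * return_time T D a x) * x / half_return T D a x < 0" using ret_domD[OF x] by (simp add: divide_pos_neg)
  then show "\<exists>y. (half_return T D a has_real_derivative y) (at x) \<and> y < 0" using half_return_deriv_exp[OF x] by blast
qed

lemma ret_dom_of_neg_return:
  assumes "left_return T D a q y1" "q > 0" "y1 < 0" shows "q \<in> ret_dom T D a" "half_return T D a q = y1"
  using assms return_time_eq unfolding left_return_iff ret_dom_def half_return_def by fastforce+

lemma left_return_half_return: assumes "q \<in> ret_dom T D a" shows "left_return T D a q (half_return T D a q)"
  using ret_domD[OF assms] unfolding left_return_iff half_return_def by blast

text \<open>
  Between two starting points with a return all returns are transversal, and the adjoined infimum is
  not an interior point.
\<close>

lemma half_dom_interior:
  assumes adm: "(a \<le> 0 \<and> 4 * D - T\<^sup>2 > 0) \<or> a > 0"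
  shows "interior (half_dom (left_return T D a)) = ret_dom T D a"
proof
  let ?R = "return_dom (left_return T D a)" and ?H = "half_dom (left_return T D a)"
  have sub: "ret_dom T D a \<subseteq> ?R" using left_return_half_return ret_domD(1)[THEN less_imp_le] unfolding return_dom_def by blast
  then show "ret_dom T D a \<subseteq> interior ?H"
    by (intro interior_maximal ret_dom_open) (auto simp: half_dom_def)
  have R0: "y \<ge> 0" if "y \<in> ?R" for y using that by (auto simp: return_dom_def)
  have lb: "\<exists>z\<in>?R. z < y + e" if "y \<in> ?H" "e > 0" for y e
  proof (cases "y \<in> ?R")
    case False
    then have "y = Inf ?R" "?R \<noteq> {}" using that(1) by (auto simp: half_dom_def)
    then show ?thesis using cInf_lessD[of ?R "y + e"] that(2) by auto
  next
    case True
    then show ?thesis using that(2) by (intro bexI[of _ y]) auto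
  qed
  have H0: "y \<ge> 0" if "y \<in> ?H" for y
    using that R0 cInf_greatest[of ?R 0] by (auto simp: half_dom_def)
  have ret: "\<exists>s. returns_at T D a y s" if "y \<in> ?R" for y
    using that by (auto simp: return_dom_def left_return_iff)
  have inR: "y \<in> ?R" if zH: "z \<in> ?H" and zy: "z < y" and yH: "y \<in> ?H" for y z
  proof (rule ccontr)
    assume "y \<notin> ?R"
    then have "y = Inf ?R" "?R \<noteq> {}" using yH by (auto simp: half_dom_def)
    moreover obtain x where "x \<in> ?R" "x < y" using lb[OF zH, of "y - z"] zy by auto
    ultimately show False using cInf_lower[of x ?R] R0 by (force simp: bdd_below_def)
  qed
  show "interior ?H \<subseteq> ret_dom T D a"
  proof
    fix y assume "y \<in> interior ?H"
    then obtain e where e: "e > 0" "\<And>z. \<bar>z - y\<bar> < e \<Longrightarrow> z \<in> ?H"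
      unfolding mem_interior by (auto simp: subset_iff dist_real_def abs_minus_commute)
    have H: "y - e / 2 \<in> ?H" "y - e / 3 \<in> ?H" "y \<in> ?H" "y + e / 2 \<in> ?H" using e by auto
    have "y - e / 3 \<in> ?R" "y \<in> ?R" "y + e / 2 \<in> ?R"
      using inR[OF H(1) _ H(2)] inR[OF H(1) _ H(3)] inR[OF H(1) _ H(4)] e(1) by auto
    moreover have "y - e / 3 > 0" using H0[OF H(1)] e(1) by simp
    ultimately show "y \<in> ret_dom T D a"
      using return_set_interior[OF adm, of "y - e / 3" y "y + e / 2"] ret e(1) by fastforce
  qed
qed

lemma half_map_half_return: assumes "q \<in> ret_dom T D a" shows "half_map (left_return T D a) q = half_return T D a q"
proof -
  have "q \<in> return_dom (left_return T D a)" using left_return_half_return[OF assms] ret_domD(1)[OF assms] by (auto simp: return_dom_def)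
  moreover have "return_val (left_return T D a) q = half_return T D a q"
    unfolding return_val_def using left_return_half_return[OF assms] left_return_unique by blast
  ultimately show ?thesis by (simp add: half_map_def)
qed

section \<open>Time reversal, reflection and the corner of a saddle\<close>

lemma solves_on_reverse:
  assumes u: "solves_on X S u" and L: "bounded_linear L" and XY: "\<And>p. - L (X p) = Y (L p)"
  shows "solves_on Y ((\<lambda>t. c - t) ` S) (\<lambda>t. L (u (c - t)))"
  unfolding solves_on_def
proof
  fix t assume "t \<in> (\<lambda>t. c - t) ` S"
  then have t: "c - t \<in> S" by auto
  have im: "(\<lambda>t. c - t) ` (\<lambda>t. c - t) ` S = S" by (force simp: image_iff)
  have "((\<lambda>t. c - t) has_vector_derivative - 1) (at t within (\<lambda>t. c - t) ` S)"
    by (auto intro!: derivative_eq_intros)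
  moreover have "((\<lambda>t. L (u t)) has_vector_derivative L (X (u (c - t)))) (at (c - t) within (\<lambda>t. c - t) ` (\<lambda>t. c - t) ` S)"
    unfolding im using u t by (intro bounded_linear.has_vector_derivative[OF L]) (auto simp: solves_on_def)
  ultimately have "((\<lambda>t. L (u t)) \<circ> (\<lambda>t. c - t) has_vector_derivative - 1 *\<^sub>R L (X (u (c - t)))) (at t within (\<lambda>t. c - t) ` S)"
    by (rule vector_diff_chain_within)
  then show "((\<lambda>t. L (u (c - t))) has_vector_derivative Y (L (u (c - t)))) (at t within (\<lambda>t. c - t) ` S)"
    by (simp add: o_def XY)
qed

lemma bounded_linear_flips:
  "bounded_linear (\<lambda>p::real\<times>real. (- fst p, snd p))" "bounded_linear (\<lambda>p::real\<times>real. (fst p, - snd p))"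
  by (intro bounded_linear_Pair bounded_linear_minus bounded_linear_fst bounded_linear_snd)+

lemma reflect_x_solves:
  assumes "solves_on (lin_field T D a 0) S u"
  shows "solves_on (lin_field (- T) D (- a) 0) ((\<lambda>t. c - t) ` S) (\<lambda>t. (- fst (u (c - t)), snd (u (c - t))))"
  by (rule solves_on_reverse[OF assms bounded_linear_flips(1)]) (auto simp: lin_field_def split: prod.splits)

lemma reflect_y_solves:
  assumes "solves_on (lin_field T D a 0) S u"
  shows "solves_on (lin_field (- T) D a 0) ((\<lambda>t. c - t) ` S) (\<lambda>t. (fst (u (c - t)), - snd (u (c - t))))"
  by (rule solves_on_reverse[OF assms bounded_linear_flips(2)]) (auto simp: lin_field_def split: prod.splits)

lemma reflect_interval: "(\<lambda>t. c - t) ` {l..h} = {c - h..c - l::real}"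
proof
  show "{c - h..c - l} \<subseteq> (\<lambda>t. c - t) ` {l..h}"
  proof
    fix x assume "x \<in> {c - h..c - l}"
    then show "x \<in> (\<lambda>t. c - t) ` {l..h}" by (intro image_eqI[of _ _ "c - x"]) auto
  qed
qed auto

text \<open>
  Reversing time and reflecting \<open>x\<close> turns the backward half-map on the right into a forward half-map on
  the left, so that all results about the left half-plane apply to both zones.
\<close>

lemma right_return_mirror: "right_return T D a = left_return (- T) D (- a)"
proof (intro ext iffI)
  fix y0 y1 assume "right_return T D a y0 y1"
  then obtain u \<tau> where u: "\<tau> > 0" "solves_on (lin_field T D a 0) {-\<tau>..0} u" "u 0 = (0, y0)"
    "\<forall>t\<in>{-\<tau><..<0}. fst (u t) > 0" "u (-\<tau>) = (0, y1)" unfolding right_return_def by blast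
  have "solves_on (lin_field (- T) D (- a) 0) {0..\<tau>} (\<lambda>t. (- fst (u (0 - t)), snd (u (0 - t))))"
    using reflect_x_solves[OF u(2), of 0] by (simp add: reflect_interval[of 0 "-\<tau>" 0, simplified])
  then show "left_return (- T) D (- a) y0 y1" unfolding left_return_def using u
    by (intro exI[of _ "\<lambda>t. (- fst (u (0 - t)), snd (u (0 - t)))"] exI[of _ \<tau>]) auto
next
  fix y0 y1 assume "left_return (- T) D (- a) y0 y1"
  then obtain u \<tau> where u: "\<tau> > 0" "solves_on (lin_field (-T) D (-a) 0) {0..\<tau>} u" "u 0 = (0, y0)"
    "\<forall>t\<in>{0<..<\<tau>}. fst (u t) < 0" "u \<tau> = (0, y1)" unfolding left_return_def by blast
  have "solves_on (lin_field T D a 0) {-\<tau>..0} (\<lambda>t. (- fst (u (0 - t)), snd (u (0 - t))))"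
    using reflect_x_solves[OF u(2), of 0] by (simp add: reflect_interval[of 0 0 \<tau>, simplified])
  then show "right_return T D a y0 y1" unfolding right_return_def using u
    by (intro exI[of _ "\<lambda>t. (- fst (u (0 - t)), snd (u (0 - t)))"] exI[of _ \<tau>]) auto
qed

text \<open>
  Reversing time and reflecting \<open>y\<close> interchanges the start and the end of an orbit segment; it gives the
  inverse of the half-return map.
\<close>

lemma left_return_reversed:
  assumes "left_return T D a q y1" shows "left_return (- T) D a (- y1) (- q)"
proof -
  obtain u \<tau> where u: "\<tau> > 0" "solves_on (lin_field T D a 0) {0..\<tau>} u" "u 0 = (0, q)"
    "\<forall>t\<in>{0<..<\<tau>}. fst (u t) < 0" "u \<tau> = (0, y1)" using assms unfolding left_return_def by blast
  have "solves_on (lin_field (- T) D a 0) {0..\<tau>} (\<lambda>t. (fst (u (\<tau> - t)), - snd (u (\<tau> - t))))"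
    using reflect_y_solves[OF u(2), of \<tau>] by (simp add: reflect_interval)
  then show ?thesis unfolding left_return_def using u
    by (intro exI[of _ "\<lambda>t. (fst (u (\<tau> - t)), - snd (u (\<tau> - t)))"] exI[of _ \<tau>]) auto
qed

lemma ret_dom_reversed:
  assumes q: "q \<in> ret_dom T D a"
  shows "- half_return T D a q \<in> ret_dom (- T) D a" "half_return (- T) D a (- half_return T D a q) = - q"
  using ret_dom_of_neg_return[OF left_return_reversed[OF left_return_half_return[OF q]]] ret_domD[OF q] by auto

lemma W_poly_neg: "W_poly (- T) D a y = W_poly T D a (- y)" "W_poly (- T) D (- a) y = W_poly T D a y"
  by (simp_all add: W_poly_def)

lemma W_pos_below:
  assumes a: "a > 0" and x: "x \<in> ret_dom T D a" and y: "0 < y" "y \<le> x"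
  shows "W_poly T D a y > 0"
proof (cases "y = x")
  case False
  then obtain s where "returns_at T D a y s" using ret_dom_down_closed[OF a ret_domD(2)[OF x] y(1)] y by auto
  then show ?thesis using W_pos_return y by blast
qed (use W_pos[OF x] in simp)

lemma W_pos_between:
  assumes adm: "(a \<le> 0 \<and> 4 * D - T\<^sup>2 > 0) \<or> a > 0" and a: "a \<noteq> 0" and x: "x \<in> ret_dom T D a"
    and y: "half_return T D a x \<le> y" "y \<le> x"
  shows "W_poly T D a y > 0"
proof (cases "a > 0")
  case True
  consider "y > 0" | "y = 0" | "y < 0" by linarith
  then show ?thesis
  proof cases
    case 1 then show ?thesis using W_pos_below[OF True x] y by simp
  next
    case 2 then show ?thesis using a by (simp add: W_poly_def)
  next
    case 3
    then have "W_poly (- T) D a (- y) > 0" using W_pos_below[OF True ret_dom_reversed(1)[OF x], of "- y"] y by simp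
    then show ?thesis by (simp add: W_poly_neg)
  qed
next
  case False
  then have d: "4 * D - T\<^sup>2 > 0" using adm by auto
  then have D: "D > 0" by (smt (verit) zero_le_power2)
  have "4 * D * W_poly T D a y = (2 * D * y - a * T)\<^sup>2 + a\<^sup>2 * (4 * D - T\<^sup>2)"
    by (simp add: W_poly_def power2_eq_square algebra_simps)
  also have "\<dots> > 0" using d a by (simp add: add_nonneg_pos)
  finally show ?thesis using D by (simp add: zero_less_mult_iff)
qed

text \<open>
  The roots of \<open>W_poly\<close> are the points where the separatrices of the saddle meet the line. Below the
  separatrix the unstable component grows exponentially, and it carries the orbit back to the line.
\<close>

lemma saddle_ret_dom:
  assumes a: "a > 0" and D: "D < 0" and r: "r > 0" "W_poly T D a r = 0" and q: "0 < q" "q < r"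
  shows "q \<in> ret_dom T D a"
proof -
  \<comment> \<open>The eigenvalues are l > 0 and m < 0; p below is the unstable component, measured from the saddle.\<close>
  define l m where "l = a / r" and "m = T - l"
  have l: "l > 0" "a = l * r" using a r by (auto simp: l_def)
  have "r\<^sup>2 * (D - T * l + l\<^sup>2) = 0" using r(2) by (simp add: W_poly_def l(2) power2_eq_square algebra_simps)
  then have "D - T * l + l\<^sup>2 = 0" using r(1) by (metis mult_eq_0_iff power_eq_0_iff less_irrefl)
  then have lm: "l * m = D" by (simp add: m_def power2_eq_square algebra_simps)
  then have m: "m < 0" using D l by (metis mult_less_0_iff not_less_iff_gr_or_eq)
  have maD: "m * a / D = r" using l lm D m by (simp add: field_simps)
  have "\<exists>s>0. xpos T D a q s \<ge> 0"
  proof (rule ccontr)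
    assume "\<not> ?thesis"
    then have neg: "xpos T D a q t < 0" if "t > 0" for t using that by force
    define p where "p = (\<lambda>t. xvel T D a q t - m * xpos T D a q t + r)"
    have p: "p t = (r - q) * exp (l * t)" for t
    proof -
      have "((\<lambda>t. p t * exp (- (l * t))) has_real_derivative 0) (at t)" for t
      proof -
        have T: "T = l + m" by (simp add: m_def)
        have "((\<lambda>t. p t * exp (- (l * t))) has_real_derivative
           (T * xvel T D a q t - D * xpos T D a q t + a - m * xvel T D a q t - l * p t) * exp (- (l * t))) (at t)"
          unfolding p_def by (auto intro!: derivative_eq_intros xpos_deriv xvel_deriv simp: algebra_simps)
        moreover have "T * xvel T D a q t - D * xpos T D a q t + a - m * xvel T D a q t - l * p t = 0"
          unfolding p_def T l(2) lm[symmetric] by (simp add: algebra_simps)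
        ultimately show ?thesis by simp
      qed
      then have "p t * exp (- (l * t)) = p 0 * exp (- (l * 0))"
        using DERIV_isconst_all[of "\<lambda>t. p t * exp (- (l * t))"] by blast
      then show ?thesis by (simp add: p_def exp_minus field_simps)
    qed
    \<comment> \<open>The positive zero of a parabola that bounds x from below.\<close>
    define s where "s = 2 * q / (l * (r - q))"
    have s: "s > 0" using q l by (simp add: s_def)
    have "xpos T D a q 0 - (l * (r - q) * 0\<^sup>2 / 2 - q * 0) \<le> xpos T D a q s - (l * (r - q) * s\<^sup>2 / 2 - q * s)"
    proof (rule DERIV_nonneg_imp_nondecreasing[where f = "\<lambda>t. xpos T D a q t - (l * (r - q) * t\<^sup>2 / 2 - q * t)"])
      show "0 \<le> s" using s by simp
      fix t assume t: "0 \<le> t" "t \<le> s"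
      have "((\<lambda>t. xpos T D a q t - (l * (r - q) * t\<^sup>2 / 2 - q * t)) has_real_derivative
        xvel T D a q t - (l * (r - q) * t - q)) (at t)"
        by (auto intro!: derivative_eq_intros xpos_deriv)
      moreover have "xvel T D a q t - (l * (r - q) * t - q) \<ge> 0"
      proof -
        have "m * xpos T D a q t \<ge> 0" using neg[of t] m t by (cases "t = 0") (auto simp: mult_nonpos_nonpos)
        moreover have "(r - q) * exp (l * t) \<ge> (r - q) * (1 + l * t)"
          using q by (intro mult_left_mono exp_ge_add_one_self) auto
        ultimately show ?thesis using p[of t] by (simp add: p_def algebra_simps)
      qed
      ultimately show "\<exists>y. ((\<lambda>t. xpos T D a q t - (l * (r - q) * t\<^sup>2 / 2 - q * t)) has_real_derivative y) (at t) \<and> 0 \<le> y" by blast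
    qed
    moreover have "l * (r - q) * s = 2 * q" using q l by (simp add: s_def)
    then have "l * (r - q) * s\<^sup>2 / 2 - q * s = 0" unfolding power2_eq_square mult.assoc[symmetric] by simp
    ultimately have "xpos T D a q s \<ge> 0" by simp
    then show False using neg[OF s] by simp
  qed
  then obtain \<tau> where "returns_at T D a q \<tau>" using first_return[OF q(1)] by blast
  then show ?thesis using return_transversal[of a T D q \<tau>] a q by (auto simp: ret_dom_def)
qed

lemma saddle_ret_dom_less:
  assumes a: "a > 0" and r: "r > 0" "W_poly T D a r = 0" and q: "q \<in> ret_dom T D a"
  shows "q < r"
  using W_pos_below[OF a q r(1)] r(2) by force

text \<open>
  As the start tends to one separatrix, the return tends to the other one.
\<close>

lemma saddle_corner:
  assumes a: "a > 0" and D: "D < 0" and r: "r > 0" "W_poly T D a r = 0" and r': "r' < 0" "W_poly T D a r' = 0"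
    and e: "\<epsilon> > 0"
  shows "\<exists>x\<in>ret_dom T D a. \<bar>x - r\<bar> < \<epsilon> \<and> \<bar>half_return T D a x - r'\<bar> < \<epsilon>"
proof -
  have adm: "(a \<le> 0 \<and> 4 * D - T\<^sup>2 > 0) \<or> a > 0" using a by simp
  have r'': "- r' > 0" "W_poly (- T) D a (- r') = 0" using r' by (auto simp: W_poly_neg)
  define y where "y = max (- r' / 2) (- r' - \<epsilon> / 2)"
  have y: "0 < y" "y < - r'" "y > - r' - \<epsilon>" using r'' e by (auto simp: y_def)
  have yd: "y \<in> ret_dom (- T) D a" using saddle_ret_dom[OF a D r'' y(1,2)] .
  define x0 where "x0 = - half_return (- T) D a y"
  have x0: "x0 \<in> ret_dom T D a" "half_return T D a x0 = - y" using ret_dom_reversed[OF yd] by (auto simp: x0_def)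
  define x1 where "x1 = max (r / 2) (r - \<epsilon> / 2)"
  have x1: "0 < x1" "x1 < r" "x1 > r - \<epsilon>" using r e by (auto simp: x1_def)
  have x1d: "x1 \<in> ret_dom T D a" using saddle_ret_dom[OF a D r x1(1,2)] .
  define x where "x = max x0 x1"
  have xin: "x \<in> ret_dom T D a" using x0 x1d by (simp add: x_def max_def)
  have "x < r" using saddle_ret_dom_less[OF a r xin] .
  moreover have "half_return T D a x \<le> - y" using half_return_decreasing[OF adm x0(1) xin] x0(2) by (cases "x0 < x1") (auto simp: x_def max_def)
  moreover have "- half_return T D a x < - r'" using saddle_ret_dom_less[OF a r'' ret_dom_reversed(1)[OF xin]] .
  moreover have "x > r - \<epsilon>" using x1 by (simp add: x_def)
  ultimately show ?thesis using xin y by (intro bexI[of _ x]) auto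
qed

lemma right_adm:
  fixes aR DR TR :: real
  assumes "(aR \<ge> 0 \<and> 4 * DR - TR\<^sup>2 > 0) \<or> aR < (0::real)"
  shows "(- aR \<le> 0 \<and> 4 * DR - (- TR)\<^sup>2 > 0) \<or> - aR > 0"
  using assms by simp

lemma interior_I_left:
  "(a \<le> 0 \<and> 4 * D - T\<^sup>2 > 0) \<or> a > 0 \<Longrightarrow> interior (I_left T D a) = ret_dom T D a"
  by (simp add: I_left_def half_dom_interior)

lemma interior_I_right:
  assumes "(a \<ge> 0 \<and> 4 * D - T\<^sup>2 > 0) \<or> a < 0"
  shows "interior (I_right T D a b) = (\<lambda>y. y + b) ` ret_dom (- T) D (- a)"
proof -
  have t: "(\<lambda>y. y + b) = (+) b" by (auto simp: add.commute)
  have "interior (I_right T D a b) = (\<lambda>y. y + b) ` interior (half_dom (right_return T D a))"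
    unfolding I_right_def t by (rule interior_translation)
  then show ?thesis using half_dom_interior[OF right_adm[OF assms]]
    by (simp add: right_return_mirror)
qed

lemma y_left_eq: "q \<in> ret_dom T D a \<Longrightarrow> y_left T D a q = half_return T D a q"
  by (simp add: y_left_def half_map_half_return)

lemma y_right_eq: "q - b \<in> ret_dom (- T) D (- a) \<Longrightarrow> y_right T D a b q = half_return (- T) D (- a) (q - b) + b"
  by (simp add: y_right_def right_return_mirror half_map_half_return)

section \<open>The two sides of a closed decreasing graph\<close>

text \<open>
  McShane's extension, as the infimum of the cones with slope 1 over the graph.
\<close>

lemma lipschitz_extension:
  fixes f :: "real \<Rightarrow> real"
  assumes B: "B \<noteq> {}" and L: "\<And>x y. x \<in> B \<Longrightarrow> y \<in> B \<Longrightarrow> \<bar>f x - f y\<bar> \<le> \<bar>x - y\<bar>"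
  obtains g where "\<And>x. x \<in> B \<Longrightarrow> g x = f x" "\<And>x y. \<bar>g x - g y\<bar> \<le> \<bar>x - y\<bar>"
proof
  let ?g = "\<lambda>x. INF w\<in>B. f w + \<bar>x - w\<bar>"
  have bd: "bdd_below ((\<lambda>w. f w + \<bar>x - w\<bar>) ` B)" for x
  proof -
    obtain w0 where w0: "w0 \<in> B" using B by blast
    show ?thesis
    proof (rule bdd_belowI2)
      fix w assume "w \<in> B"
      then show "f w0 - \<bar>x - w0\<bar> \<le> f w + \<bar>x - w\<bar>" using L[OF w0, of w] by (auto simp: abs_le_iff abs_if split: if_splits)
    qed
  qed
  show "?g x = f x" if "x \<in> B" for x
  proof (rule antisym)
    show "?g x \<le> f x" using cINF_lower[OF bd that, of x] by simp
    show "f x \<le> ?g x"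
    proof (rule cINF_greatest[OF B])
      fix w assume "w \<in> B"
      then show "f x \<le> f w + \<bar>x - w\<bar>" using L[OF that, of w] by (auto simp: abs_le_iff)
    qed
  qed
  have le: "?g x \<le> ?g y + \<bar>x - y\<bar>" for x y
  proof -
    have "?g x - \<bar>x - y\<bar> \<le> ?g y"
    proof (rule cINF_greatest[OF B])
      fix w assume w: "w \<in> B"
      have "?g x \<le> f w + \<bar>x - w\<bar>" by (rule cINF_lower[OF bd w])
      then show "?g x - \<bar>x - y\<bar> \<le> f w + \<bar>y - w\<bar>" by linarith
    qed
    then show ?thesis by simp
  qed
  show "\<bar>?g x - ?g y\<bar> \<le> \<bar>x - y\<bar>" for x y
    using le[of x y] le[of y x] by (simp add: abs_le_iff abs_minus_commute)
qed

text \<open>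
  A replacement for the Jordan curve theorem. A graph that is closed in a simply connected \<open>U\<close> is mapped
  into the positive real axis by a continuous function without zeros on \<open>U\<close>, which takes positive values nowhere else.
  Its logarithm exists on \<open>U\<close>, and the argument \<open>\<theta>\<close>, normalized on the graph, is a function that
  vanishes exactly there. It has different signs on the two sides close to
  the graph, which is all that the counting of intersections requires.
\<close>

lemma side_function:
  fixes f :: "real \<Rightarrow> real" and A :: "real set" and U :: "(real \<times> real) set"
  defines "Gr \<equiv> (\<lambda>y. (y, f y)) ` A"
  assumes U: "open U" "simply_connected U"
    and A: "open A" "is_interval A" "A \<noteq> {}"
    and cont: "continuous_on A f" and dec: "\<And>x y. x \<in> A \<Longrightarrow> y \<in> A \<Longrightarrow> x < y \<Longrightarrow> f y < f x"
    and sub: "Gr \<subseteq> U" and cl: "U \<inter> closure Gr \<subseteq> Gr"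
  obtains \<theta> :: "real \<times> real \<Rightarrow> real" where "continuous_on U \<theta>" "\<And>p. p \<in> U \<Longrightarrow> \<theta> p = 0 \<longleftrightarrow> p \<in> Gr"
    "\<And>y. y \<in> A \<Longrightarrow> \<exists>e>0. \<forall>p\<in>U. dist p (y, f y) < e \<longrightarrow> fst p \<in> A \<and> sgn (\<theta> p) = sgn (snd p - f (fst p))"
proof -
  \<comment> \<open>In the coordinates u and v a decreasing graph is a 1-Lipschitz graph over u.\<close>
  define u v where "u = (\<lambda>p::real\<times>real. fst p - snd p)" and "v = (\<lambda>p::real\<times>real. fst p + snd p)"
  define h where "h = (\<lambda>y. y - f y)"
  have hinc: "h x < h y" if "x \<in> A" "y \<in> A" "x < y" for x y using dec[OF that] that by (simp add: h_def)
  have hinj: "inj_on h A" by (rule linorder_inj_onI') (use hinc in force)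
  define B where "B = h ` A"
  define w where "w = the_inv_into A h"
  have w: "w (h y) = y" if "y \<in> A" for y using that hinj by (simp add: w_def the_inv_into_f_f)
  have pL: "\<bar>(w b + f (w b)) - (w b' + f (w b'))\<bar> \<le> \<bar>b - b'\<bar>" if b: "b \<in> B" "b' \<in> B" for b b'
  proof -
    obtain y y' where y: "y \<in> A" "b = h y" "y' \<in> A" "b' = h y'" using b by (auto simp: B_def)
    have "w b = y" "w b' = y'" "b - b' = (y - y') - (f y - f y')" using y w by (auto simp: h_def)
    then show ?thesis using dec[of y y'] dec[of y' y] y(1,3) by (cases y y' rule: linorder_cases) (auto simp: abs_le_iff)
  qed
  obtain \<psi> where psi: "\<And>b. b \<in> B \<Longrightarrow> \<psi> b = w b + f (w b)" "\<And>x y. \<bar>\<psi> x - \<psi> y\<bar> \<le> \<bar>x - y\<bar>"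
    using lipschitz_extension[of B "\<lambda>b. w b + f (w b)"] pL A(3) unfolding B_def by blast
  have psic: "continuous_on S \<psi>" for S
    unfolding continuous_on_iff dist_real_def using psi(2) by (meson le_less_trans)
  have Ochar: "p \<in> Gr \<longleftrightarrow> u p \<in> B \<and> v p = \<psi> (u p)" for p
  proof
    assume "p \<in> Gr"
    then obtain y where y: "y \<in> A" "p = (y, f y)" by (auto simp: Gr_def)
    then have "u p = h y" "h y \<in> B" by (auto simp: u_def h_def B_def)
    then show "u p \<in> B \<and> v p = \<psi> (u p)" using y psi(1) w by (simp add: v_def)
  next
    assume a: "u p \<in> B \<and> v p = \<psi> (u p)"
    then obtain y where y: "y \<in> A" "u p = h y" by (auto simp: B_def)
    then have "v p = y + f y" using a psi(1) w by (auto simp: B_def)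
    then have "fst p = y" "snd p = f y" using y(2) by (auto simp: u_def v_def h_def)
    then show "p \<in> Gr" using y(1) by (auto simp: Gr_def image_iff prod_eq_iff)
  qed
  define B' where "B' = arctan ` B"
  define a b where "a = Inf B'" and "b = Sup B'"
  have B'bd: "bdd_above B'" "bdd_below B'" "B' \<noteq> {}"
  proof -
    show "bdd_above B'" unfolding B'_def by (rule bdd_aboveI2[of _ _ "pi/2"]) (use arctan_ubound in \<open>auto intro: less_imp_le\<close>)
    show "bdd_below B'" unfolding B'_def by (rule bdd_belowI2[of _ "-(pi/2)"]) (use arctan_lbound in \<open>auto intro: less_imp_le\<close>)
    show "B' \<noteq> {}" using A(3) by (auto simp: B'_def B_def)
  qed
  have nomax: "\<exists>x'\<in>B'. x < x'" "\<exists>x'\<in>B'. x' < x" if xB: "x \<in> B'" for x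
  proof -
    obtain y where y: "y \<in> A" "x = arctan (h y)" using xB by (auto simp: B'_def B_def)
    obtain e where e: "e > 0" "\<And>z. \<bar>z - y\<bar> < e \<Longrightarrow> z \<in> A" using A(1) y(1) unfolding open_dist dist_real_def by blast
    have "y + e / 2 \<in> A" "y - e / 2 \<in> A" using e by auto
    then have "x < arctan (h (y + e/2))" "arctan (h (y - e / 2)) < x" "arctan (h (y + e/2)) \<in> B'" "arctan (h (y - e/2)) \<in> B'"
      using y e(1) hinc by (auto simp: arctan_less_iff B'_def B_def)
    then show "\<exists>x'\<in>B'. x < x'" "\<exists>x'\<in>B'. x' < x" by blast+
  qed
  have B'lt: "a < x \<and> x < b" if x: "x \<in> B'" for x
  proof -
    obtain x1 x2 where "x1 \<in> B'" "x < x1" "x2 \<in> B'" "x2 < x" using nomax[OF x] by blast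
    then show ?thesis using cInf_lower[OF _ B'bd(2), of x2] cSup_upper[OF _ B'bd(1), of x1] by (simp add: a_def b_def)
  qed
  have B'int: "x \<in> B'" if xa: "a < x" and xb: "x < b" for x
  proof -
    have "connected A" using A(2) is_interval_connected by blast
    then have "connected B'" unfolding B'_def B_def image_image
      by (intro connected_continuous_image) (auto simp: h_def intro!: continuous_intros cont)
    moreover obtain x1 where "x1 \<in> B'" "x < x1" using less_cSupE[OF xb[unfolded b_def] B'bd(3)] by blast
    moreover obtain x2 where "x2 \<in> B'" "x2 < x" using cInf_lessD[OF B'bd(3) xa[unfolded a_def]] by blast
    ultimately show ?thesis using connected_contains_Icc[of B' x2 x1] by force
  qed
  have ab: "a < b" using B'lt B'bd(3) by force
  \<comment> \<open>This map flattens the graph to the segment between a and b on the real axis. Its endpoints are omitted on U, as the graph is closed in U.\<close>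
  define z where "z = (\<lambda>p. Complex (arctan (u p)) (v p - \<psi> (u p)))"
  have clO: "p \<in> closure Gr" if vp: "v p = \<psi> (u p)" and near: "\<And>e. e > 0 \<Longrightarrow> \<exists>x\<in>B. \<bar>x - u p\<bar> < e" for p
    unfolding closure_approachable
  proof (intro allI impI)
    fix e :: real assume "e > 0"
    then obtain x where x: "x \<in> B" "\<bar>x - u p\<bar> < e / 2" using near[of "e/2"] by auto
    obtain y where y: "y \<in> A" "x = h y" using x by (auto simp: B_def)
    have q: "(y, f y) \<in> Gr" using y by (auto simp: Gr_def)
    then have "\<bar>v (y, f y) - v p\<bar> \<le> \<bar>x - u p\<bar>" using Ochar[of "(y, f y)"] vp psi(2) y by (auto simp: u_def h_def)
    then have "\<bar>v (y, f y) - v p\<bar> < e / 2" "\<bar>u (y, f y) - u p\<bar> < e / 2" using x(2) y(2) by (simp_all add: u_def h_def)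
    then have "\<bar>y - fst p\<bar> < e / 2" "\<bar>f y - snd p\<bar> < e / 2" unfolding u_def v_def fst_conv snd_conv abs_less_iff by linarith+
    then have "dist (y, f y) p < e" using \<open>e > 0\<close>
      by (auto simp: dist_Pair_Pair prod_eq_iff dist_prod_def dist_real_def intro!: le_less_trans[OF sqrt_sum_squares_le_sum_abs])
    then show "\<exists>y\<in>Gr. dist y p < e" using q by blast
  qed
  have zb: "z p \<noteq> of_real b" if p: "p \<in> U" for p
  proof
    assume eq: "z p = of_real b"
    then have e: "arctan (u p) = b" "v p = \<psi> (u p)" by (auto simp: z_def complex_eq_iff)
    have "p \<in> closure Gr"
    proof (rule clO[OF e(2)])
      fix e' :: real assume "e' > 0"
      then have "arctan (u p - e') < b" using e(1) by (simp add: arctan_less_iff flip: e(1))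
      then obtain x where x: "x \<in> B'" "arctan (u p - e') < x" using less_cSupE[OF _ B'bd(3)] by (metis b_def)
      then obtain s where s: "s \<in> B" "x = arctan s" by (auto simp: B'_def)
      have "s < u p" using B'lt[OF x(1)] s e(1) by (metis arctan_less_iff)
      moreover have "u p - e' < s" using x s by (metis arctan_less_iff)
      ultimately show "\<exists>x\<in>B. \<bar>x - u p\<bar> < e'" using s by (intro bexI[of _ s]) auto
    qed
    then have "p \<in> Gr" using cl p by blast
    then have "arctan (u p) \<in> B'" using Ochar by (auto simp: B'_def)
    then show False using B'lt e(1) by fastforce
  qed
  have za: "z p \<noteq> of_real a" if p: "p \<in> U" for p
  proof
    assume eq: "z p = of_real a"
    then have e: "arctan (u p) = a" "v p = \<psi> (u p)" by (auto simp: z_def complex_eq_iff)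
    have "p \<in> closure Gr"
    proof (rule clO[OF e(2)])
      fix e' :: real assume "e' > 0"
      then have "a < arctan (u p + e')" using e(1) by (simp add: arctan_less_iff flip: e(1))
      then obtain x where x: "x \<in> B'" "x < arctan (u p + e')" using cInf_lessD[OF B'bd(3)] by (metis a_def)
      then obtain s where s: "s \<in> B" "x = arctan s" by (auto simp: B'_def)
      have "u p < s" using B'lt[OF x(1)] s e(1) by (metis arctan_less_iff)
      moreover have "s < u p + e'" using x s by (metis arctan_less_iff)
      ultimately show "\<exists>x\<in>B. \<bar>x - u p\<bar> < e'" using s by (intro bexI[of _ s]) auto
    qed
    then have "p \<in> Gr" using cl p by blast
    then have "arctan (u p) \<in> B'" using Ochar by (auto simp: B'_def)
    then show False using B'lt e(1) by fastforce
  qed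
  \<comment> \<open>The Moebius map sends the segment, and nothing else, to the positive reals.\<close>
  define g where "g = (\<lambda>p. (z p - of_real a) / (of_real b - z p))"
  have zc: "continuous_on U z"
    unfolding z_def u_def v_def Complex_eq
    by (intro continuous_intros continuous_on_compose2[OF psic[of UNIV]] continuous_on_of_real) auto
  have gc: "continuous_on U g" unfolding g_def using zb by (intro continuous_intros zc) force
  have g0: "g p \<noteq> 0" if "p \<in> U" for p using za[OF that] zb[OF that] by (auto simp: g_def)
  obtain l where l: "continuous_on U l" "\<And>p. p \<in> U \<Longrightarrow> g p = exp (l p)"
    using continuous_logarithm_on_simply_connected[OF gc U(2) open_imp_locally_path_connected[OF U(1)] g0] by blast
  have gO: "\<exists>r>0. g p = of_real r" if "p \<in> Gr" for p
  proof -
    have "arctan (u p) \<in> B'" "z p = of_real (arctan (u p))" using Ochar that by (auto simp: B'_def z_def complex_eq_iff)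
    then show ?thesis using B'lt[of "arctan (u p)"]
      by (intro exI[of _ "(arctan (u p) - a) / (b - arctan (u p))"]) (auto simp: g_def)
  qed
  have Im2: "\<exists>k::int. Im (l p) = 2 * pi * k" if pG: "p \<in> Gr" for p
  proof -
    obtain r where r: "r > 0" "exp (l p) = of_real r" using gO[OF pG] l(2) pG sub by (metis subsetD)
    then have "exp (l p) = exp (of_real (ln r))" by (simp add: exp_of_real)
    then obtain n :: int where "l p = of_real (ln r) + of_real (of_int (2 * n) * pi) * \<i>" unfolding exp_eq by blast
    then have "Im (l p) = 2 * pi * n" by simp
    then show ?thesis by blast
  qed
  have "(\<lambda>p. Im (l p)) constant_on Gr"
  proof (rule continuous_discrete_range_constant)
    have "connected A" using A(2) is_interval_connected by blast
    then show "connected Gr" unfolding Gr_def by (intro connected_continuous_image continuous_intros cont)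
    show "continuous_on Gr (\<lambda>p. Im (l p))" using l(1) sub by (intro continuous_intros) (rule continuous_on_subset)
    fix p assume p: "p \<in> Gr"
    show "\<exists>e>0. \<forall>y. y \<in> Gr \<and> Im (l y) \<noteq> Im (l p) \<longrightarrow> e \<le> norm (Im (l y) - Im (l p))"
    proof (intro exI[of _ "2 * pi"] conjI allI impI)
      fix q assume q: "q \<in> Gr \<and> Im (l q) \<noteq> Im (l p)"
      obtain k j :: int where k: "Im (l p) = 2 * pi * k" "Im (l q) = 2 * pi * j" using Im2 p q by metis
      then have "k \<noteq> j" using q by auto
      then have "1 \<le> \<bar>j - k\<bar>" by linarith
      then have "1 \<le> \<bar>real_of_int (j - k)\<bar>" by (metis of_int_1_le_iff of_int_abs)
      then have "2 * pi * 1 \<le> 2 * pi * \<bar>real_of_int (j - k)\<bar>" by (intro mult_left_mono) auto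
      also have "\<dots> = norm (Im (l q) - Im (l p))" unfolding k by (simp add: abs_mult right_diff_distrib[symmetric])
      finally show "2 * pi \<le> norm (Im (l q) - Im (l p))" by simp
    qed simp
  qed
  then obtain c where c: "\<And>p. p \<in> Gr \<Longrightarrow> Im (l p) = c" by (auto simp: constant_on_def)
  obtain p0 where "p0 \<in> Gr" using A(3) by (auto simp: Gr_def)
  then obtain k :: int where k: "c = 2 * pi * k" using Im2 c by metis
  define \<theta> where "\<theta> = (\<lambda>p. Im (l p) - c)"
  have thc: "continuous_on U \<theta>" unfolding \<theta>_def by (intro continuous_intros l(1))
  have ex: "sin (\<theta> p) = sin (Im (l p))" "cos (\<theta> p) = cos (Im (l p))" for p
  proof -
    have "sin c = 0" "cos c = 1" unfolding k by (rule sin_int_2pin, rule cos_int_2pin)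
    then show "sin (\<theta> p) = sin (Im (l p))" "cos (\<theta> p) = cos (Im (l p))" by (simp_all add: \<theta>_def sin_diff cos_diff)
  qed
  have Reg: "Im (g p) = exp (Re (l p)) * sin (\<theta> p)" "Re (g p) = exp (Re (l p)) * cos (\<theta> p)" if "p \<in> U" for p
    using l(2)[OF that] ex by (simp_all add: Im_exp Re_exp)
  have th0: "\<theta> p = 0 \<longleftrightarrow> p \<in> Gr" if p: "p \<in> U" for p
  proof
    assume t: "\<theta> p = 0"
    define r where "r = exp (Re (l p))"
    have r: "r > 0" "g p = of_real r" using Reg[OF p] t by (auto simp: r_def complex_eq_iff)
    then have "z p - of_real a = of_real r * (of_real b - z p)" using zb[OF p] by (auto simp: g_def field_simps)
    then have "Im (z p) = - r * Im (z p)" "Re (z p) - a = r * (b - Re (z p))" by (auto simp: complex_eq_iff)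
    then have zz: "(1 + r) * Im (z p) = 0" "(1 + r) * (Re (z p) - a) = r * (b - a)" "(1 + r) * (b - Re (z p)) = b - a" by (auto simp: algebra_simps)
    then have "Im (z p) = 0" "Re (z p) - a > 0" "b - Re (z p) > 0" using r(1) ab by (auto simp: zero_less_mult_iff mult_eq_0_iff dest!: arg_cong[of _ _ "\<lambda>x. x > 0"])
    then have "v p = \<psi> (u p)" "arctan (u p) \<in> B'" using B'int by (auto simp: z_def)
    then show "p \<in> Gr" using Ochar by (auto simp: B'_def arctan_eq_iff)
  next
    assume "p \<in> Gr" then show "\<theta> p = 0" using c by (simp add: \<theta>_def)
  qed
  have sg: "\<exists>e>0. \<forall>p\<in>U. dist p (y, f y) < e \<longrightarrow> fst p \<in> A \<and> sgn (\<theta> p) = sgn (snd p - f (fst p))" if y: "y \<in> A" for y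
  proof -
    let ?q = "(y, f y)"
    have q: "?q \<in> Gr" "?q \<in> U" using y sub by (auto simp: Gr_def)
    obtain d where d: "d > 0" "\<And>p. p \<in> U \<Longrightarrow> dist p ?q < d \<Longrightarrow> dist (\<theta> p) (\<theta> ?q) < pi"
      using thc q(2) pi_gt_zero unfolding continuous_on_iff by blast
    obtain e where e: "e > 0" "\<And>x. \<bar>x - y\<bar> < e \<Longrightarrow> x \<in> A" using A(1) y unfolding open_dist dist_real_def by blast
    show ?thesis
    proof (intro exI[of _ "min d e"] conjI ballI impI)
      show "min d e > 0" using d e by simp
      fix p assume p: "p \<in> U" "dist p ?q < min d e"
      have "\<bar>fst p - y\<bar> < e" using p(2) dist_fst_le[of p ?q] by (simp add: dist_real_def)
      then show fA: "fst p \<in> A" using e(2) by blast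
      have "\<theta> ?q = 0" using th0[OF q(2)] q(1) by simp
      then have th: "\<bar>\<theta> p\<bar> < pi" using d(2)[OF p(1)] p(2) by (simp add: dist_real_def)
      have s1: "sgn (\<theta> p) = sgn (sin (\<theta> p))"
        using th sin_gt_zero[of "\<theta> p"] sin_gt_zero[of "- \<theta> p"] by (cases "\<theta> p" "0::real" rule: linorder_cases) (auto simp: abs_less_iff)
      have "Im (g p) = Im (z p) * (b - a) / (cmod (of_real b - z p))\<^sup>2"
      proof -
        have "Im (g p) = (Im (z p) * (b - Re (z p)) + (Re (z p) - a) * Im (z p)) / (cmod (of_real b - z p))\<^sup>2"
          by (simp add: g_def Im_divide cmod_power2 algebra_simps)
        then show ?thesis by (simp add: algebra_simps)
      qed
      then have s2: "sgn (Im (g p)) = sgn (Im (z p))" using ab zb[OF p(1)] by (simp add: sgn_mult sgn_divide)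
      have s3: "sgn (Im (g p)) = sgn (sin (\<theta> p))" using Reg(1)[OF p(1)] by (simp add: sgn_mult)
      let ?D = "snd p - f (fst p)"
      have "(fst p, f (fst p)) \<in> Gr" using fA by (auto simp: Gr_def)
      then have "v (fst p, f (fst p)) = \<psi> (u (fst p, f (fst p)))" using Ochar by blast
      then have "\<bar>v p - ?D - \<psi> (u p)\<bar> \<le> \<bar>?D\<bar>" using psi(2)[of "u (fst p, f (fst p))" "u p"] by (simp add: u_def v_def)
      then have im: "?D > 0 \<Longrightarrow> Im (z p) \<ge> 0" "?D < 0 \<Longrightarrow> Im (z p) \<le> 0" by (auto simp: z_def abs_le_iff)
      have pO: "p \<in> Gr \<longleftrightarrow> ?D = 0" using fA by (cases p) (auto simp: Gr_def)
      have "Im (z p) = 0 \<longleftrightarrow> ?D = 0" using s1 s2 s3 th0[OF p(1)] pO by (metis sgn_0 sgn_0_0)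
      then have "sgn (Im (z p)) = sgn ?D" using im by (cases ?D "0::real" rule: linorder_cases) auto
      then show "sgn (\<theta> p) = sgn ?D" using s1 s2 s3 by simp
    qed
  qed
  show ?thesis using that[OF thc th0 sg] .
qed

section \<open>Comparing arcs with a leaf of a slope field\<close>

text \<open>
  Besides the differential equation the definition asks for a Lipschitz bound relative to the graph: only
  deviations from the given leaf have to be estimated.
\<close>

definition leaf_at :: "(real \<times> real \<Rightarrow> real) \<Rightarrow> (real \<Rightarrow> real) \<Rightarrow> real \<Rightarrow> bool" where
  "leaf_at g f y \<longleftrightarrow> (\<exists>e>0. \<exists>K\<ge>0. \<forall>s. \<bar>s - y\<bar> < e \<longrightarrow> (f has_real_derivative g (s, f s)) (at s) \<and>
     (\<forall>w. \<bar>w - f y\<bar> < e \<longrightarrow> \<bar>g (s, w) - g (s, f s)\<bar> \<le> K * \<bar>w - f s\<bar>))"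

text \<open>
  The deviation \<open>h\<close> of an arc from the leaf satisfies \<open>h' = d + k\<close> with \<open>\<bar>k\<bar> \<le> K \<bar>h\<bar>\<close>, where
  \<open>d\<close> measures the failure of the arc to be tangent to the field.
\<close>

lemma leaf_defect:
  assumes leaf: "leaf_at g f (c0 t1)" and eq: "c1 t1 = f (c0 t1)"
    and c0: "isCont c0 t1" and c1: "isCont c1 t1"
  shows "\<exists>d>0. \<exists>K\<ge>0. \<forall>t x0 x1. \<bar>t - t1\<bar> < d \<longrightarrow> (c0 has_real_derivative x0) (at t) \<longrightarrow> (c1 has_real_derivative x1) (at t) \<longrightarrow>
     (\<exists>k. ((\<lambda>t. c1 t - f (c0 t)) has_real_derivative (x1 - g (c0 t, c1 t) * x0) + k) (at t) \<and> \<bar>k\<bar> \<le> K * \<bar>x0\<bar> * \<bar>c1 t - f (c0 t)\<bar>)"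
proof -
  obtain e K where e: "e > 0" "K \<ge> 0" and f': "\<And>s. \<bar>s - c0 t1\<bar> < e \<Longrightarrow> (f has_real_derivative g (s, f s)) (at s)"
    and L: "\<And>s w. \<bar>s - c0 t1\<bar> < e \<Longrightarrow> \<bar>w - f (c0 t1)\<bar> < e \<Longrightarrow> \<bar>g (s, w) - g (s, f s)\<bar> \<le> K * \<bar>w - f s\<bar>"
    using leaf unfolding leaf_at_def by blast
  obtain d0 where d0: "d0 > 0" "\<And>t. \<bar>t - t1\<bar> < d0 \<Longrightarrow> \<bar>c0 t - c0 t1\<bar> < e"
    using c0 e unfolding continuous_at_real_range real_norm_def by blast
  obtain d1 where d1: "d1 > 0" "\<And>t. \<bar>t - t1\<bar> < d1 \<Longrightarrow> \<bar>c1 t - c1 t1\<bar> < e"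
    using c1 e unfolding continuous_at_real_range real_norm_def by blast
  have main: "\<exists>k. ((\<lambda>t. c1 t - f (c0 t)) has_real_derivative (x1 - g (c0 t, c1 t) * x0) + k) (at t) \<and> \<bar>k\<bar> \<le> K * \<bar>x0\<bar> * \<bar>c1 t - f (c0 t)\<bar>"
    if t: "\<bar>t - t1\<bar> < min d0 d1" and x0: "(c0 has_real_derivative x0) (at t)" and x1: "(c1 has_real_derivative x1) (at t)" for t x0 x1
  proof -
    have n: "\<bar>c0 t - c0 t1\<bar> < e" "\<bar>c1 t - f (c0 t1)\<bar> < e" using d0(2) d1(2) t eq by auto
    let ?k = "(g (c0 t, c1 t) - g (c0 t, f (c0 t))) * x0"
    have "((\<lambda>t. c1 t - f (c0 t)) has_real_derivative x1 - g (c0 t, f (c0 t)) * x0) (at t)"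
      by (intro DERIV_diff x1 DERIV_chain2[OF f'[OF n(1)] x0])
    then have "((\<lambda>t. c1 t - f (c0 t)) has_real_derivative (x1 - g (c0 t, c1 t) * x0) + ?k) (at t)"
      by (simp add: algebra_simps)
    moreover have "\<bar>?k\<bar> \<le> K * \<bar>x0\<bar> * \<bar>c1 t - f (c0 t)\<bar>"
      using mult_right_mono[OF L[OF n], of "\<bar>x0\<bar>"] by (simp add: abs_mult mult_ac)
    ultimately show "\<exists>k. ((\<lambda>t. c1 t - f (c0 t)) has_real_derivative (x1 - g (c0 t, c1 t) * x0) + k) (at t) \<and> \<bar>k\<bar> \<le> K * \<bar>x0\<bar> * \<bar>c1 t - f (c0 t)\<bar>"
      by blast
  qed
  have "min d0 d1 > 0" using d0 d1 by simp
  then show ?thesis using main e(2) by blast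
qed

text \<open>
  Otherwise Gronwall's inequality would keep \<open>\<sigma> h\<close>, which starts at 0, from becoming positive.
\<close>

lemma leaf_start:
  assumes leaf: "leaf_at g f (c0 t1)" and eq: "c1 t1 = f (c0 t1)" and d: "d > 0"
    and der: "\<And>t. t1 \<le> t \<Longrightarrow> t < t1 + d \<Longrightarrow> (c0 has_real_derivative c0' t) (at t)"
      "\<And>t. t1 \<le> t \<Longrightarrow> t < t1 + d \<Longrightarrow> (c1 has_real_derivative c1' t) (at t)"
    and bd: "\<And>t. t1 \<le> t \<Longrightarrow> t < t1 + d \<Longrightarrow> \<bar>c0' t\<bar> \<le> C"
    and sg: "\<sigma> = 1 \<or> \<sigma> = -1" and pos: "\<And>t. t1 < t \<Longrightarrow> t < t1 + d \<Longrightarrow> \<sigma> * (c1 t - f (c0 t)) > 0"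
  shows "\<exists>t. t1 < t \<and> t < t1 + d \<and> \<sigma> * (c1' t - g (c0 t, c1 t) * c0' t) > 0"
proof (rule ccontr)
  assume "\<not> ?thesis"
  then have np: "\<sigma> * (c1' t - g (c0 t, c1 t) * c0' t) \<le> 0" if "t1 < t" "t < t1 + d" for t using that by force
  define \<eta> where "\<eta> = (\<lambda>t. c1 t - f (c0 t))"
  have ic: "isCont c0 t1" "isCont c1 t1" using der[of t1] d DERIV_isCont by auto
  obtain d' K where d': "d' > 0" "K \<ge> 0" and D: "\<And>t x0 x1. \<bar>t - t1\<bar> < d' \<Longrightarrow> (c0 has_real_derivative x0) (at t) \<Longrightarrow> (c1 has_real_derivative x1) (at t) \<Longrightarrow>
     (\<exists>k. (\<eta> has_real_derivative (x1 - g (c0 t, c1 t) * x0) + k) (at t) \<and> \<bar>k\<bar> \<le> K * \<bar>x0\<bar> * \<bar>\<eta> t\<bar>)"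
    using leaf_defect[OF leaf eq ic] unfolding \<eta>_def by blast
  define M where "M = K * C"
  define t2 where "t2 = t1 + min d d' / 2"
  have t2: "t1 < t2" "t2 < t1 + d" "t2 < t1 + d'" using d d' by (auto simp: t2_def min_def)
  have dd: "\<exists>k. (\<eta> has_real_derivative (c1' t - g (c0 t, c1 t) * c0' t) + k) (at t) \<and> \<bar>k\<bar> \<le> M * \<bar>\<eta> t\<bar>" if t: "t1 \<le> t" "t \<le> t2" for t
  proof -
    obtain k where k: "(\<eta> has_real_derivative (c1' t - g (c0 t, c1 t) * c0' t) + k) (at t)" "\<bar>k\<bar> \<le> K * \<bar>c0' t\<bar> * \<bar>\<eta> t\<bar>"
      using D[of t, OF _ der(1)[of t] der(2)[of t]] t t2 by auto
    have "K * \<bar>c0' t\<bar> * \<bar>\<eta> t\<bar> \<le> K * C * \<bar>\<eta> t\<bar>" using bd[of t] t t2 d'(2) by (intro mult_right_mono mult_left_mono) auto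
    then show ?thesis using k by (auto simp: M_def)
  qed
  have "\<sigma> * \<eta> t1 * exp (- (M * t1)) \<ge> \<sigma> * \<eta> t2 * exp (- (M * t2))"
  proof (rule DERIV_nonpos_imp_decreasing_open[where f = "\<lambda>t. \<sigma> * \<eta> t * exp (- (M * t))"])
    show "t1 \<le> t2" using t2 by simp
    fix t assume t: "t1 < t" "t < t2"
    obtain k where k: "(\<eta> has_real_derivative (c1' t - g (c0 t, c1 t) * c0' t) + k) (at t)" "\<bar>k\<bar> \<le> M * \<bar>\<eta> t\<bar>"
      using dd[of t] t by auto
    have "((\<lambda>t. \<sigma> * \<eta> t * exp (- (M * t))) has_real_derivative
      (\<sigma> * ((c1' t - g (c0 t, c1 t) * c0' t) + k) - M * (\<sigma> * \<eta> t)) * exp (- (M * t))) (at t)"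
      by (auto intro!: derivative_eq_intros k(1) simp: algebra_simps)
    moreover have "\<sigma> * ((c1' t - g (c0 t, c1 t) * c0' t) + k) - M * (\<sigma> * \<eta> t) \<le> 0"
    proof -
      have "\<bar>\<eta> t\<bar> = \<sigma> * \<eta> t" using pos[of t] t t2 sg by (auto simp: \<eta>_def)
      moreover have "\<sigma> * k \<le> \<bar>k\<bar>" using sg by auto
      ultimately show ?thesis using np[of t] k(2) t t2 by (simp add: distrib_left)
    qed
    ultimately show "\<exists>y. ((\<lambda>t. \<sigma> * \<eta> t * exp (- (M * t))) has_real_derivative y) (at t) \<and> y \<le> 0"
      by (meson mult_nonpos_nonneg exp_ge_zero)
  next
    have "continuous_on {t1..t2} \<eta>" using dd DERIV_isCont by (intro continuous_at_imp_continuous_on) fastforce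
    then show "continuous_on {t1..t2} (\<lambda>t. \<sigma> * \<eta> t * exp (- (M * t)))" by (intro continuous_intros)
  qed
  moreover have "\<eta> t1 = 0" using eq by (simp add: \<eta>_def)
  ultimately have "\<sigma> * \<eta> t2 \<le> 0" by (simp add: mult_le_0_iff)
  then show False using pos[of t2] t2 by (simp add: \<eta>_def)
qed

lemma leaf_end:
  assumes leaf: "leaf_at g f (c0 t2)" and eq: "c1 t2 = f (c0 t2)" and d: "d > 0"
    and der: "\<And>t. t2 - d < t \<Longrightarrow> t \<le> t2 \<Longrightarrow> (c0 has_real_derivative c0' t) (at t)"
      "\<And>t. t2 - d < t \<Longrightarrow> t \<le> t2 \<Longrightarrow> (c1 has_real_derivative c1' t) (at t)"
    and bd: "\<And>t. t2 - d < t \<Longrightarrow> t \<le> t2 \<Longrightarrow> \<bar>c0' t\<bar> \<le> C"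
    and sg: "\<sigma> = 1 \<or> \<sigma> = -1" and pos: "\<And>t. t2 - d < t \<Longrightarrow> t < t2 \<Longrightarrow> \<sigma> * (c1 t - f (c0 t)) > 0"
  shows "\<exists>t. t2 - d < t \<and> t < t2 \<and> \<sigma> * (c1' t - g (c0 t, c1 t) * c0' t) < 0"
proof -
  have "\<exists>t. - t2 < t \<and> t < - t2 + d \<and> \<sigma> * ((- c1' (- t)) - g (c0 (- t), c1 (- t)) * (- c0' (- t))) > 0"
  proof (rule leaf_start[of g f "\<lambda>t. c0 (- t)" "- t2" "\<lambda>t. c1 (- t)" d "\<lambda>t. - c0' (- t)" "\<lambda>t. - c1' (- t)" C \<sigma>])
    fix t assume t: "- t2 \<le> t" "t < - t2 + d"
    show "((\<lambda>t. c0 (- t)) has_real_derivative - c0' (- t)) (at t)"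
      using DERIV_chain2[OF der(1)[of "- t"] DERIV_minus[OF DERIV_ident]] t by auto
    show "((\<lambda>t. c1 (- t)) has_real_derivative - c1' (- t)) (at t)"
      using DERIV_chain2[OF der(2)[of "- t"] DERIV_minus[OF DERIV_ident]] t by auto
    show "\<bar>- c0' (- t)\<bar> \<le> C" using bd[of "- t"] t by auto
  next
    fix t assume "- t2 < t" "t < - t2 + d"
    then show "\<sigma> * (c1 (- t) - f (c0 (- t))) > 0" using pos[of "- t"] by auto
  qed (use leaf eq d sg in auto)
  then obtain t where "- t2 < t" "t < - t2 + d" "\<sigma> * ((- c1' (- t)) - g (c0 (- t), c1 (- t)) * (- c0' (- t))) > 0" by blast
  then show ?thesis by (intro exI[of _ "- t"]) (auto simp: algebra_simps)
qed

text \<open>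
  Without a defect of tangency, Gronwall's inequality makes \<open>h\<close> vanish.
\<close>

lemma leaf_tangent:
  assumes leaf: "leaf_at g f (c0 t1)" and eq: "c1 t1 = f (c0 t1)" and d: "d > 0"
    and der: "\<And>t. \<bar>t - t1\<bar> < d \<Longrightarrow> (c0 has_real_derivative c0' t) (at t)"
      "\<And>t. \<bar>t - t1\<bar> < d \<Longrightarrow> (c1 has_real_derivative c1' t) (at t)"
    and bd: "\<And>t. \<bar>t - t1\<bar> < d \<Longrightarrow> \<bar>c0' t\<bar> \<le> C"
    and tan: "\<And>t. \<bar>t - t1\<bar> < d \<Longrightarrow> c1' t - g (c0 t, c1 t) * c0' t = 0"
  shows "\<exists>e>0. e \<le> d \<and> (\<forall>t. \<bar>t - t1\<bar> < e \<longrightarrow> c1 t = f (c0 t))"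
proof -
  define \<eta> where "\<eta> = (\<lambda>t. c1 t - f (c0 t))"
  have ic: "isCont c0 t1" "isCont c1 t1" using der[of t1] d DERIV_isCont by auto
  obtain d' K where d': "d' > 0" "K \<ge> 0" and D: "\<And>t x0 x1. \<bar>t - t1\<bar> < d' \<Longrightarrow> (c0 has_real_derivative x0) (at t) \<Longrightarrow> (c1 has_real_derivative x1) (at t) \<Longrightarrow>
     (\<exists>k. (\<eta> has_real_derivative (x1 - g (c0 t, c1 t) * x0) + k) (at t) \<and> \<bar>k\<bar> \<le> K * \<bar>x0\<bar> * \<bar>\<eta> t\<bar>)"
    using leaf_defect[OF leaf eq ic] unfolding \<eta>_def by blast
  define M where "M = K * C"
  define e where "e = min d d'"
  have dd: "\<exists>k. (\<eta> has_real_derivative k) (at t) \<and> \<bar>k\<bar> \<le> M * \<bar>\<eta> t\<bar>" if t: "\<bar>t - t1\<bar> < e" for t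
  proof -
    obtain k where k: "(\<eta> has_real_derivative (c1' t - g (c0 t, c1 t) * c0' t) + k) (at t)" "\<bar>k\<bar> \<le> K * \<bar>c0' t\<bar> * \<bar>\<eta> t\<bar>"
      using D[of t, OF _ der(1)[of t] der(2)[of t]] t by (auto simp: e_def)
    have "K * \<bar>c0' t\<bar> * \<bar>\<eta> t\<bar> \<le> K * C * \<bar>\<eta> t\<bar>" using bd[of t] t d'(2) by (intro mult_right_mono mult_left_mono) (auto simp: e_def)
    then show ?thesis using k tan[of t] t by (auto simp: M_def e_def)
  qed
  have ic: "isCont \<eta> t" if "\<bar>t - t1\<bar> < e" for t using dd[OF that] DERIV_isCont by blast
  have z1: "\<eta> t1 = 0" using eq by (simp add: \<eta>_def)
  have sq: "\<bar>\<eta> t * k\<bar> \<le> M * (\<eta> t)\<^sup>2" if "\<bar>k\<bar> \<le> M * \<bar>\<eta> t\<bar>" for t k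
    using mult_left_mono[OF that, of "\<bar>\<eta> t\<bar>"] by (simp add: abs_mult power2_eq_square mult_ac)
  have der2: "((\<lambda>t. (\<eta> t)\<^sup>2 * exp (- (m * t))) has_real_derivative (2 * (\<eta> t * k) - m * (\<eta> t)\<^sup>2) * exp (- (m * t))) (at t)"
    if "(\<eta> has_real_derivative k) (at t)" for t k m
    by (auto intro!: derivative_eq_intros that simp: algebra_simps)
  have r: "\<eta> t = 0" if t: "t1 \<le> t" "t < t1 + e" for t
  proof -
    have "(\<eta> t1)\<^sup>2 * exp (- (2 * M * t1)) \<ge> (\<eta> t)\<^sup>2 * exp (- (2 * M * t))"
    proof (rule DERIV_nonpos_imp_decreasing_open[where f = "\<lambda>t. (\<eta> t)\<^sup>2 * exp (- (2 * M * t))", OF t(1)])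
      fix s assume s: "t1 < s" "s < t"
      obtain k where k: "(\<eta> has_real_derivative k) (at s)" "\<bar>k\<bar> \<le> M * \<bar>\<eta> s\<bar>" using dd[of s] s t by auto
      have "2 * (\<eta> s * k) - 2 * M * (\<eta> s)\<^sup>2 \<le> 0" using sq[OF k(2)] by (auto simp: abs_le_iff)
      then show "\<exists>y. ((\<lambda>t. (\<eta> t)\<^sup>2 * exp (- (2 * M * t))) has_real_derivative y) (at s) \<and> y \<le> 0"
        using der2[OF k(1), of "2 * M"] by (meson mult_nonpos_nonneg exp_ge_zero)
    next
      have "continuous_on {t1..t} \<eta>" using ic t by (intro continuous_at_imp_continuous_on) auto
      then show "continuous_on {t1..t} (\<lambda>t. (\<eta> t)\<^sup>2 * exp (- (2 * M * t)))" by (intro continuous_intros)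
    qed
    then show ?thesis using z1 by (simp add: mult_le_0_iff)
  qed
  have l: "\<eta> t = 0" if t: "t \<le> t1" "t1 - e < t" for t
  proof -
    have "(\<eta> t)\<^sup>2 * exp (- (- (2 * M) * t)) \<le> (\<eta> t1)\<^sup>2 * exp (- (- (2 * M) * t1))"
    proof (rule DERIV_nonneg_imp_increasing_open[where f = "\<lambda>t. (\<eta> t)\<^sup>2 * exp (- (- (2 * M) * t))", OF t(1)])
      fix s assume s: "t < s" "s < t1"
      obtain k where k: "(\<eta> has_real_derivative k) (at s)" "\<bar>k\<bar> \<le> M * \<bar>\<eta> s\<bar>" using dd[of s] s t by auto
      have "2 * (\<eta> s * k) - (- (2 * M)) * (\<eta> s)\<^sup>2 \<ge> 0" using sq[OF k(2)] by (auto simp: abs_le_iff)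
      then show "\<exists>y. ((\<lambda>t. (\<eta> t)\<^sup>2 * exp (- (- (2 * M) * t))) has_real_derivative y) (at s) \<and> y \<ge> 0"
        using der2[OF k(1), of "- (2 * M)"] by (meson mult_nonneg_nonneg exp_ge_zero)
    next
      have "continuous_on {t..t1} \<eta>" using ic t by (intro continuous_at_imp_continuous_on) auto
      then show "continuous_on {t..t1} (\<lambda>t. (\<eta> t)\<^sup>2 * exp (- (- (2 * M) * t)))" by (intro continuous_intros)
    qed
    then show ?thesis using z1 by (simp add: mult_le_0_iff)
  qed
  show ?thesis
  proof (intro exI[of _ e] conjI allI impI)
    fix t assume "\<bar>t - t1\<bar> < e"
    then have "\<eta> t = 0" using r[of t] l[of t] by (cases "t1 \<le> t") auto
    then show "c1 t = f (c0 t)" by (simp add: \<eta>_def)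
  qed (use d d' in \<open>auto simp: e_def\<close>)
qed

lemma maximal_nonzero_interval:
  fixes h :: "real \<Rightarrow> real"
  assumes c: "continuous_on {t1..t2} h" and z: "h t1 = 0" "h t2 = 0" and w: "t1 < w" "w < t2" "h w \<noteq> 0"
  shows "\<exists>s1 s2 \<sigma>. t1 \<le> s1 \<and> s1 < s2 \<and> s2 \<le> t2 \<and> h s1 = 0 \<and> h s2 = 0 \<and> (\<sigma> = 1 \<or> \<sigma> = -1) \<and>
    (\<forall>t. s1 < t \<and> t < s2 \<longrightarrow> \<sigma> * h t > 0)"
proof -
  have cl: "compact {t \<in> {a..b}. h t = 0}" if "{a..b} \<subseteq> {t1..t2}" for a b
  proof -
    have "{t \<in> {a..b}. h t = 0} = {a..b} \<inter> h -` {0}" by auto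
    moreover have "closed ({a..b} \<inter> h -` {0})"
      by (rule continuous_closed_preimage[OF continuous_on_subset[OF c that]]) auto
    ultimately show ?thesis
      by (metis bounded_closed_interval bounded_subset compact_eq_bounded_closed inf_le1)
  qed
  obtain s1 where s1: "s1 \<in> {t \<in> {t1..w}. h t = 0}" "\<And>t. t \<in> {t \<in> {t1..w}. h t = 0} \<Longrightarrow> t \<le> s1"
  proof -
    have "{t1..w} \<subseteq> {t1..t2}" "t1 \<in> {t \<in> {t1..w}. h t = 0}" using w z by auto
    then show ?thesis using compact_attains_sup[OF cl[of t1 w]] that by blast
  qed
  obtain s2 where s2: "s2 \<in> {t \<in> {w..t2}. h t = 0}" "\<And>t. t \<in> {t \<in> {w..t2}. h t = 0} \<Longrightarrow> s2 \<le> t"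
  proof -
    have "{w..t2} \<subseteq> {t1..t2}" "t2 \<in> {t \<in> {w..t2}. h t = 0}" using w z by auto
    then show ?thesis using compact_attains_inf[OF cl[of w t2]] that by blast
  qed
  have lt: "s1 < w" "w < s2" using s1(1) s2(1) w(3) by (auto simp: less_le)
  have nz: "h t \<noteq> 0" if "s1 < t" "t < s2" for t
    using s1(2)[of t] s2(2)[of t] s1(1) s2(1) that by (cases "t \<le> w") auto
  define \<sigma> where "\<sigma> = sgn (h w)"
  have "\<sigma> * h t > 0" if t: "s1 < t" "t < s2" for t
  proof (rule ccontr)
    assume "\<not> ?thesis"
    then have opp: "\<sigma> * h t < 0" using nz[OF t] w(3) by (auto simp: \<sigma>_def sgn_if split: if_splits)
    have cc: "continuous_on {min t w..max t w} h" using c by (rule continuous_on_subset) (use t lt s1 s2 in auto)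
    have "\<exists>x\<in>{min t w..max t w}. h x = 0"
    proof -
      have "connected (h ` {min t w..max t w})" by (rule connected_continuous_image[OF cc]) simp
      moreover have "h t \<in> h ` {min t w..max t w}" "h w \<in> h ` {min t w..max t w}" by auto
      moreover have "min (h t) (h w) \<le> 0" "0 \<le> max (h t) (h w)" using opp w(3) by (auto simp: \<sigma>_def sgn_if split: if_splits)
      ultimately have "0 \<in> h ` {min t w..max t w}"
        using connected_contains_Icc[of "h ` {min t w..max t w}" "min (h t) (h w)" "max (h t) (h w)"]
        by (auto simp: min_def max_def split: if_splits)
      then show ?thesis by auto
    qed
    then obtain x where x: "min t w \<le> x" "x \<le> max t w" "h x = 0" by auto
    then have "s1 < x" "x < s2" using t lt by (auto simp: min_def max_def split: if_splits)
    then show False using nz x by blast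
  qed
  moreover have "\<sigma> = 1 \<or> \<sigma> = -1" using w(3) by (auto simp: \<sigma>_def sgn_if)
  ultimately show ?thesis using s1(1) s2(1) lt by (intro exI[of _ s1] exI[of _ s2] exI[of _ \<sigma>]) auto
qed

text \<open>
  A leaf of \<open>X\<close> over \<open>A\<close>, with a function \<open>\<theta>\<close> that tells the two sides of it apart.
\<close>

locale leaf_separation =
  fixes U :: "(real \<times> real) set" and A :: "real set" and f :: "real \<Rightarrow> real"
    and X :: "real \<times> real \<Rightarrow> real \<times> real" and \<theta> :: "real \<times> real \<Rightarrow> real"
  assumes X_cont: "continuous_on U X" and th_cont: "continuous_on U \<theta>"
    and th_0: "\<And>p. p \<in> U \<Longrightarrow> \<theta> p = 0 \<longleftrightarrow> fst p \<in> A \<and> snd p = f (fst p)"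
    and th_sgn: "\<And>y. y \<in> A \<Longrightarrow> \<exists>e>0. \<forall>p\<in>U. dist p (y, f y) < e \<longrightarrow> fst p \<in> A \<and> sgn (\<theta> p) = sgn (snd p - f (fst p))"
    and in_U: "\<And>y. y \<in> A \<Longrightarrow> (y, f y) \<in> U"
    and leaf: "\<And>y. y \<in> A \<Longrightarrow> leaf_at (\<lambda>p. snd (X p) / fst (X p)) f y"
    and X_pos: "\<And>y. y \<in> A \<Longrightarrow> fst (X (y, f y)) > 0"
begin

lemma near_leaf:
  fixes c0 c1 :: "real \<Rightarrow> real" and t1 d :: real
  assumes c: "isCont c0 t1" "isCont c1 t1" and y: "c0 t1 \<in> A" "c1 t1 = f (c0 t1)"
    and d: "d > 0" "\<And>t. \<bar>t - t1\<bar> < d \<Longrightarrow> (c0 t, c1 t) \<in> U"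
  shows "\<exists>e>0. e \<le> d \<and> (\<forall>t. \<bar>t - t1\<bar> < e \<longrightarrow> sgn (\<theta> (c0 t, c1 t)) = sgn (c1 t - f (c0 t)) \<and> fst (X (c0 t, c1 t)) > 0)"
proof -
  have pc: "isCont (\<lambda>t. (c0 t, c1 t)) t1" by (intro continuous_Pair c)
  obtain e0 where e0: "e0 > 0" "\<And>p. p \<in> U \<Longrightarrow> dist p (c0 t1, f (c0 t1)) < e0 \<Longrightarrow> sgn (\<theta> p) = sgn (snd p - f (fst p))"
    using th_sgn[OF y(1)] by blast
  obtain e1 where e1: "e1 > 0" "\<And>t. \<bar>t - t1\<bar> < e1 \<Longrightarrow> dist (c0 t, c1 t) (c0 t1, c1 t1) < e0"
    using iffD1[OF continuous_at_eps_delta pc, rule_format, OF e0(1)] by (auto simp: dist_real_def)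
  have "continuous_on U (\<lambda>p. fst (X p))" by (intro continuous_intros X_cont)
  then obtain e2 where e2: "e2 > 0" "\<And>p. p \<in> U \<Longrightarrow> dist p (c0 t1, f (c0 t1)) < e2 \<Longrightarrow> dist (fst (X p)) (fst (X (c0 t1, f (c0 t1)))) < fst (X (c0 t1, f (c0 t1)))"
    using in_U[OF y(1)] X_pos[OF y(1)] unfolding continuous_on_iff by blast
  obtain e3 where e3: "e3 > 0" "\<And>t. \<bar>t - t1\<bar> < e3 \<Longrightarrow> dist (c0 t, c1 t) (c0 t1, c1 t1) < e2"
    using iffD1[OF continuous_at_eps_delta pc, rule_format, OF e2(1)] by (auto simp: dist_real_def)
  show ?thesis
  proof (intro exI[of _ "Min {d, e1, e3}"] conjI allI impI)
    fix t assume "\<bar>t - t1\<bar> < Min {d, e1, e3}"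
    then have t: "\<bar>t - t1\<bar> < d" "\<bar>t - t1\<bar> < e1" "\<bar>t - t1\<bar> < e3" by auto
    show "sgn (\<theta> (c0 t, c1 t)) = sgn (c1 t - f (c0 t))" using e0(2)[OF d(2)[OF t(1)]] e1(2)[OF t(2)] y by simp
    show "fst (X (c0 t, c1 t)) > 0" using e2(2)[OF d(2)[OF t(1)]] e3(2)[OF t(3)] y by (simp add: dist_real_def abs_less_iff)
  qed (use d e1 e3 in auto)
qed

text \<open>
  The second Rolle argument: on a maximal interval off the leaf \<open>\<theta>\<close> keeps its sign, so the arc leaves and
  reaches the leaf on the same side, and crosses the field in opposite senses at the two ends.
\<close>

lemma gap_contact:
  fixes c0 c1 c0' c1' :: "real \<Rightarrow> real" and t1 t2 d :: real
  assumes t: "t1 < t2"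
    and der: "\<And>t. t1 - d < t \<Longrightarrow> t < t2 + d \<Longrightarrow> (c0 has_real_derivative c0' t) (at t)"
      "\<And>t. t1 - d < t \<Longrightarrow> t < t2 + d \<Longrightarrow> (c1 has_real_derivative c1' t) (at t)"
    and cc: "continuous_on {t1 - d<..<t2 + d} c0'" "continuous_on {t1 - d<..<t2 + d} c1'" and d: "d > 0"
    and cU: "\<And>t. t1 - d < t \<Longrightarrow> t < t2 + d \<Longrightarrow> (c0 t, c1 t) \<in> U"
    and ends: "c0 t1 \<in> A" "c1 t1 = f (c0 t1)" "c0 t2 \<in> A" "c1 t2 = f (c0 t2)"
  shows "\<exists>t. t1 < t \<and> t < t2 \<and> fst (X (c0 t, c1 t)) * c1' t - snd (X (c0 t, c1 t)) * c0' t = 0"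
proof -
  let ?I = "{t1 - d<..<t2 + d}"
  let ?D = "\<lambda>t. fst (X (c0 t, c1 t)) * c1' t - snd (X (c0 t, c1 t)) * c0' t"
  let ?g = "\<lambda>p. snd (X p) / fst (X p)"
  have ic: "isCont c0 t" "isCont c1 t" if "t \<in> ?I" for t using der[of t] that DERIV_isCont by auto
  have c01: "continuous_on ?I c0" "continuous_on ?I c1" using ic by (auto intro: continuous_at_imp_continuous_on)
  have pc: "continuous_on ?I (\<lambda>t. (c0 t, c1 t))" by (intro continuous_intros c01)
  have thc: "continuous_on ?I (\<lambda>t. \<theta> (c0 t, c1 t))" by (rule continuous_on_compose2[OF th_cont pc]) (use cU in auto)
  have Xc: "continuous_on ?I (\<lambda>t. X (c0 t, c1 t))" by (rule continuous_on_compose2[OF X_cont pc]) (use cU in auto)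
  have Dc: "continuous_on ?I ?D" by (intro continuous_intros Xc cc)
  show ?thesis
  proof (cases "\<forall>w. t1 < w \<and> w < t2 \<longrightarrow> \<theta> (c0 w, c1 w) = 0")
    case True
    define w where "w = (t1 + t2) / 2"
    have w: "t1 < w" "w < t2" using t by (auto simp: w_def)
    have on: "c0 s \<in> A \<and> c1 s = f (c0 s)" if "t1 < s" "s < t2" for s
      using True that th_0[OF cU[of s]] d by auto
    obtain e where "e > 0" and f'': "\<And>s. \<bar>s - c0 w\<bar> < e \<Longrightarrow> (f has_real_derivative ?g (s, f s)) (at s)"
      using leaf[of "c0 w"] on[OF w] unfolding leaf_at_def by blast
    have f': "(f has_real_derivative ?g (c0 w, f (c0 w))) (at (c0 w))" using f''[of "c0 w"] \<open>e > 0\<close> by simp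
    have "((\<lambda>s. f (c0 s)) has_real_derivative ?g (c0 w, f (c0 w)) * c0' w) (at w)"
      by (rule DERIV_chain2[OF f' der(1)]) (use w d in auto)
    moreover have ev: "\<forall>\<^sub>F s in nhds w. f (c0 s) = c1 s"
      using eventually_nhds_in_open[of "{t1<..<t2}" w] w by (auto elim!: eventually_mono simp: on)
    ultimately have "(c1 has_real_derivative ?g (c0 w, f (c0 w)) * c0' w) (at w)"
      using iffD1[OF DERIV_cong_ev[OF refl ev refl]] by blast
    then have "c1' w = ?g (c0 w, c1 w) * c0' w" using DERIV_unique[OF der(2)[of w]] w d on[OF w] by auto
    moreover have "fst (X (c0 w, c1 w)) > 0" using X_pos on[OF w] by auto
    ultimately show ?thesis using w by (intro exI[of _ w]) auto
  next
    case False
    then obtain w where w: "t1 < w" "w < t2" "\<theta> (c0 w, c1 w) \<noteq> 0" by auto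
    have "continuous_on {t1..t2} (\<lambda>t. \<theta> (c0 t, c1 t))" by (rule continuous_on_subset[OF thc]) (use d in auto)
    moreover have "\<theta> (c0 t1, c1 t1) = 0" "\<theta> (c0 t2, c1 t2) = 0" using th_0 cU[of t1] cU[of t2] ends t d by auto
    ultimately have "\<exists>s1 s2 \<sigma>. t1 \<le> s1 \<and> s1 < s2 \<and> s2 \<le> t2 \<and> \<theta> (c0 s1, c1 s1) = 0 \<and> \<theta> (c0 s2, c1 s2) = 0 \<and>
      (\<sigma> = 1 \<or> \<sigma> = -1) \<and> (\<forall>t. s1 < t \<and> t < s2 \<longrightarrow> \<sigma> * \<theta> (c0 t, c1 t) > 0)"
      by (rule maximal_nonzero_interval) (use w in auto)
    then obtain s1 s2 \<sigma> where s: "t1 \<le> s1" "s1 < s2" "s2 \<le> t2" "\<theta> (c0 s1, c1 s1) = 0" "\<theta> (c0 s2, c1 s2) = 0"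
      and sg: "\<sigma> = 1 \<or> \<sigma> = -1" "\<And>t. s1 < t \<Longrightarrow> t < s2 \<Longrightarrow> \<sigma> * \<theta> (c0 t, c1 t) > (0::real)"
      by blast
    have sgs: "\<sigma> * x > 0" if "sgn y = sgn x" "\<sigma> * y > 0" for x y :: real
      using that sg(1) by (auto simp: sgn_if split: if_splits)
    have bdd: "\<exists>C. \<forall>t\<in>{s1..s2}. \<bar>c0' t\<bar> \<le> C"
    proof -
      have "continuous_on {s1..s2} c0'" by (rule continuous_on_subset[OF cc(1)]) (use s d in auto)
      then have "bounded (c0' ` {s1..s2})" by (intro compact_imp_bounded compact_continuous_image) auto
      then show ?thesis unfolding bounded_iff by auto
    qed
    then obtain C where C: "\<And>t. s1 \<le> t \<Longrightarrow> t \<le> s2 \<Longrightarrow> \<bar>c0' t\<bar> \<le> C" by force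
    have on: "c0 s1 \<in> A" "c1 s1 = f (c0 s1)" "c0 s2 \<in> A" "c1 s2 = f (c0 s2)"
      using th_0[OF cU[of s1]] th_0[OF cU[of s2]] s d by auto
    have ics: "isCont c0 s1" "isCont c1 s1" "isCont c0 s2" "isCont c1 s2" using ic[of s1] ic[of s2] s d by auto
    have m: "0 < min d (s2 - s1)" using d s by simp
    have nb: "(c0 t, c1 t) \<in> U" if "\<bar>t - s1\<bar> < min d (s2 - s1) \<or> \<bar>t - s2\<bar> < min d (s2 - s1)" for t
      using that s by (intro cU) (auto simp: abs_less_iff)
    obtain e1 where e1: "e1 > 0" "e1 \<le> min d (s2 - s1)" "\<And>t. \<bar>t - s1\<bar> < e1 \<Longrightarrow> sgn (\<theta> (c0 t, c1 t)) = sgn (c1 t - f (c0 t))"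
      "\<And>t. \<bar>t - s1\<bar> < e1 \<Longrightarrow> fst (X (c0 t, c1 t)) > 0"
      using near_leaf[OF ics(1,2) on(1,2) m] nb by blast
    obtain e2 where e2: "e2 > 0" "e2 \<le> min d (s2 - s1)" "\<And>t. \<bar>t - s2\<bar> < e2 \<Longrightarrow> sgn (\<theta> (c0 t, c1 t)) = sgn (c1 t - f (c0 t))"
      "\<And>t. \<bar>t - s2\<bar> < e2 \<Longrightarrow> fst (X (c0 t, c1 t)) > 0"
      using near_leaf[OF ics(3,4) on(3,4) m] nb by blast
    have "\<exists>t. s1 < t \<and> t < s1 + e1 \<and> \<sigma> * (c1' t - ?g (c0 t, c1 t) * c0' t) > 0"
    proof (rule leaf_start[where C=C])
      fix t assume t: "s1 < t" "t < s1 + e1"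
      show "0 < \<sigma> * (c1 t - f (c0 t))" by (rule sgs[OF e1(3) sg(2)]) (use t e1 in auto)
    qed (use leaf[OF on(1)] on e1 der C sg s in auto)
    then obtain a where a: "s1 < a" "a < s1 + e1" "\<sigma> * (c1' a - ?g (c0 a, c1 a) * c0' a) > 0" by blast
    have "\<exists>t. s2 - e2 < t \<and> t < s2 \<and> \<sigma> * (c1' t - ?g (c0 t, c1 t) * c0' t) < 0"
    proof (rule leaf_end[where C=C])
      fix t assume t: "s2 - e2 < t" "t < s2"
      show "0 < \<sigma> * (c1 t - f (c0 t))" by (rule sgs[OF e2(3) sg(2)]) (use t e2 in auto)
    qed (use leaf[OF on(3)] on e2 der C sg s in auto)
    then obtain b where b: "s2 - e2 < b" "b < s2" "\<sigma> * (c1' b - ?g (c0 b, c1 b) * c0' b) < 0" by blast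
    have Dg: "?D t = fst (X (c0 t, c1 t)) * (c1' t - ?g (c0 t, c1 t) * c0' t)" if "fst (X (c0 t, c1 t)) > 0" for t
      using that by (simp add: field_simps)
    have ab: "a \<in> {s1<..<s2}" "b \<in> {s1<..<s2}" using a b e1 e2 by auto
    have Xa: "fst (X (c0 a, c1 a)) > 0" using e1(4)[of a] a by auto
    have Xb: "fst (X (c0 b, c1 b)) > 0" using e2(4)[of b] b by auto
    have Da: "\<sigma> * ?D a > 0" unfolding Dg[OF Xa] using mult_pos_pos[OF Xa a(3)] by (simp add: mult_ac)
    have Db: "\<sigma> * ?D b < 0" unfolding Dg[OF Xb] using mult_pos_neg[OF Xb b(3)] by (simp add: mult_ac)
    have "connected (?D ` {s1<..<s2})"
      by (rule connected_continuous_image[OF continuous_on_subset[OF Dc]]) (use s d in auto)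
    moreover have "?D a \<in> ?D ` {s1<..<s2}" "?D b \<in> ?D ` {s1<..<s2}" using ab by blast+
    moreover have "?D a \<le> 0 \<and> 0 \<le> ?D b \<or> ?D b \<le> 0 \<and> 0 \<le> ?D a" using Da Db sg(1) by auto
    ultimately have "0 \<in> ?D ` {s1<..<s2}" by (meson connectedD_interval)
    then obtain t where "s1 < t" "t < s2" "?D t = 0" by auto
    then show ?thesis using s by (intro exI[of _ t]) auto
  qed
qed

text \<open>
  A regular arc that is tangent to the field and starts on the leaf runs along it, and covers a neighbourhood because \<open>X\<close>
  is not vertical there.
\<close>

lemma tangent_arc_open:
  fixes c0 c1 c0' c1' :: "real \<Rightarrow> real" and t1 d :: real
  assumes d: "d > 0"
    and der: "\<And>t. \<bar>t - t1\<bar> < d \<Longrightarrow> (c0 has_real_derivative c0' t) (at t)"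
      "\<And>t. \<bar>t - t1\<bar> < d \<Longrightarrow> (c1 has_real_derivative c1' t) (at t)"
    and cc: "isCont c0' t1"
    and cU: "\<And>t. \<bar>t - t1\<bar> < d \<Longrightarrow> (c0 t, c1 t) \<in> U"
    and on: "c0 t1 \<in> A" "c1 t1 = f (c0 t1)"
    and tan: "\<And>t. \<bar>t - t1\<bar> < d \<Longrightarrow> fst (X (c0 t, c1 t)) * c1' t - snd (X (c0 t, c1 t)) * c0' t = 0"
    and reg: "c0' t1 \<noteq> 0 \<or> c1' t1 \<noteq> 0"
  shows "\<exists>e>0. \<forall>y. \<bar>y - c0 t1\<bar> < e \<longrightarrow> (\<exists>t. \<bar>t - t1\<bar> < d \<and> y = c0 t \<and> f y = c1 t)"
proof -
  let ?g = "\<lambda>p. snd (X p) / fst (X p)"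
  have ic: "isCont c0 t1" "isCont c1 t1" using der[of t1] d DERIV_isCont by auto
  obtain e1 where e1: "e1 > 0" "e1 \<le> d" "\<And>t. \<bar>t - t1\<bar> < e1 \<Longrightarrow> fst (X (c0 t, c1 t)) > 0"
    using near_leaf[OF ic on d cU] by blast
  obtain e2 where e2: "e2 > 0" "\<And>t. \<bar>t - t1\<bar> < e2 \<Longrightarrow> \<bar>c0' t - c0' t1\<bar> < 1"
    using cc unfolding continuous_at_real_range real_norm_def by (meson zero_less_one)
  have "\<exists>e>0. e \<le> min e1 e2 \<and> (\<forall>t. \<bar>t - t1\<bar> < e \<longrightarrow> c1 t = f (c0 t))"
  proof (rule leaf_tangent[where C = "\<bar>c0' t1\<bar> + 1" and f = f and ?c0.0 = c0 and ?c1.0 = c1 and g = ?g and c0' = c0' and c1' = c1'])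
    fix t assume t: "\<bar>t - t1\<bar> < min e1 e2"
    show "\<bar>c0' t\<bar> \<le> \<bar>c0' t1\<bar> + 1" using e2(2)[of t] t by auto
    show "c1' t - ?g (c0 t, c1 t) * c0' t = 0" using tan[of t] e1(3)[of t] e1(2) t by (simp add: field_simps)
  qed (use leaf[OF on(1)] on e1 e2 der in auto)
  then obtain e where e: "e > 0" "e \<le> min e1 e2" "\<And>t. \<bar>t - t1\<bar> < e \<Longrightarrow> c1 t = f (c0 t)" by blast
  have "c0' t1 \<noteq> 0" using reg tan[of t1] e1(3)[of t1] e1(1) d by auto
  have dt1: "(c0 has_real_derivative c0' t1) (at t1)" using der(1)[of t1] d by simp
  have "\<exists>a b. \<bar>a - t1\<bar> < e \<and> \<bar>b - t1\<bar> < e \<and> c0 a < c0 t1 \<and> c0 t1 < c0 b"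
  proof (cases "c0' t1 > 0")
    case True
    obtain d1 where d1: "d1 > 0" "\<And>h. 0 < h \<Longrightarrow> h < d1 \<Longrightarrow> c0 t1 < c0 (t1 + h)" using DERIV_pos_inc_right[OF dt1 True] by blast
    obtain d2 where d2: "d2 > 0" "\<And>h. 0 < h \<Longrightarrow> h < d2 \<Longrightarrow> c0 (t1 - h) < c0 t1" using DERIV_pos_inc_left[OF dt1 True] by blast
    define h where "h = Min {d1, d2, e} / 2"
    have h: "0 < h" "h < d1" "h < d2" "h < e" using d1(1) d2(1) e(1) by (auto simp: h_def min_def)
    then show ?thesis using d1(2)[of h] d2(2)[of h] by (intro exI[of _ "t1 - h"] exI[of _ "t1 + h"]) auto
  next
    case False
    then have n: "c0' t1 < 0" using \<open>c0' t1 \<noteq> 0\<close> by simp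
    obtain d1 where d1: "d1 > 0" "\<And>h. 0 < h \<Longrightarrow> h < d1 \<Longrightarrow> c0 t1 > c0 (t1 + h)" using DERIV_neg_dec_right[OF dt1 n] by blast
    obtain d2 where d2: "d2 > 0" "\<And>h. 0 < h \<Longrightarrow> h < d2 \<Longrightarrow> c0 (t1 - h) > c0 t1" using DERIV_neg_dec_left[OF dt1 n] by blast
    define h where "h = Min {d1, d2, e} / 2"
    have h: "0 < h" "h < d1" "h < d2" "h < e" using d1(1) d2(1) e(1) by (auto simp: h_def min_def)
    then show ?thesis using d1(2)[of h] d2(2)[of h] by (intro exI[of _ "t1 + h"] exI[of _ "t1 - h"]) auto
  qed
  then obtain a b where ab: "\<bar>a - t1\<bar> < e" "\<bar>b - t1\<bar> < e" "c0 a < c0 t1" "c0 t1 < c0 b" by blast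
  let ?I = "{t1 - e<..<t1 + e}"
  have "continuous_on ?I c0"
  proof (intro continuous_at_imp_continuous_on ballI)
    fix t assume "t \<in> ?I"
    then have "\<bar>t - t1\<bar> < d" using e(2) e1(2) by (auto simp: abs_less_iff)
    then show "isCont c0 t" using der(1) DERIV_isCont by blast
  qed
  then have con: "connected (c0 ` ?I)" by (intro connected_continuous_image) auto
  have "\<exists>t. \<bar>t - t1\<bar> < d \<and> y = c0 t \<and> f y = c1 t" if y: "\<bar>y - c0 t1\<bar> < min (c0 t1 - c0 a) (c0 b - c0 t1)" for y
  proof -
    have "y \<in> c0 ` ?I"
      by (rule connectedD_interval[OF con, of "c0 a" "c0 b"]) (use y ab in \<open>auto simp: abs_less_iff\<close>)
    then obtain t where t: "t \<in> ?I" "y = c0 t" by auto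
    then have "\<bar>t - t1\<bar> < e" by auto
    then show ?thesis using t e e1 by (intro exI[of _ t]) auto
  qed
  moreover have "min (c0 t1 - c0 a) (c0 b - c0 t1) > 0" using ab by simp
  ultimately show ?thesis by blast
qed

end

section \<open>Symmetric coordinates on the quadrant\<close>

definition phi_inv :: "real \<times> real \<Rightarrow> real \<times> real" where
  "phi_inv P = ((fst P + sqrt ((fst P)\<^sup>2 - 4 * snd P)) / 2, (fst P - sqrt ((fst P)\<^sup>2 - 4 * snd P)) / 2)"

lemma phi_inv_phi: assumes "p \<in> Q_quad" shows "phi_inv (\<phi> p) = p"
proof -
  obtain x y where p: "p = (x, y)" "x > 0" "y < 0" using assms by (auto simp: Q_quad_def)
  have "(x + y)\<^sup>2 - 4 * (x * y) = (x - y)\<^sup>2" by (simp add: power2_eq_square algebra_simps)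
  then show ?thesis using p by (simp add: phi_inv_def \<phi>_def)
qed

lemma phi_phi_inv: assumes "snd P < 0" shows "\<phi> (phi_inv P) = P"
proof -
  have "(fst P)\<^sup>2 - 4 * snd P \<ge> 0" using assms by (smt (verit) zero_le_power2)
  then obtain r where r: "r = sqrt ((fst P)\<^sup>2 - 4 * snd P)" "r * r = (fst P)\<^sup>2 - 4 * snd P" by simp
  have "(fst P + r) / 2 + (fst P - r) / 2 = fst P" by (simp add: field_simps)
  moreover have "(fst P + r) / 2 * ((fst P - r) / 2) = ((fst P)\<^sup>2 - r * r) / 4" by (simp add: field_simps power2_eq_square)
  ultimately show ?thesis using r by (simp add: phi_inv_def \<phi>_def prod_eq_iff)
qed

lemma phi_image_neg: "U \<subseteq> Q_quad \<Longrightarrow> P \<in> \<phi> ` U \<Longrightarrow> snd P < 0"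
  by (auto simp: Q_quad_def \<phi>_def mult_pos_neg)

lemma phi_image_iff: assumes "U \<subseteq> Q_quad" shows "P \<in> \<phi> ` U \<longleftrightarrow> snd P < 0 \<and> phi_inv P \<in> U"
proof
  assume P: "P \<in> \<phi> ` U"
  then obtain p where p: "p \<in> U" "P = \<phi> p" by blast
  then have "phi_inv P = p" using phi_inv_phi[of p] assms by auto
  then show "snd P < 0 \<and> phi_inv P \<in> U" using phi_image_neg[OF assms P] p by simp
next
  assume "snd P < 0 \<and> phi_inv P \<in> U"
  then show "P \<in> \<phi> ` U" using phi_phi_inv by (metis imageI)
qed

lemma phi_image_open: assumes "U \<subseteq> Q_quad" "open U" shows "open (\<phi> ` U)"
proof -
  have "continuous_on UNIV phi_inv" unfolding phi_inv_def by (auto intro!: continuous_intros)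
  then have "open (phi_inv -` U)" using assms(2) by (simp add: open_vimage)
  moreover have "open {P::real\<times>real. snd P < 0}" by (intro open_Collect_less continuous_intros)
  moreover have "\<phi> ` U = phi_inv -` U \<inter> {P. snd P < 0}" using phi_image_iff[OF assms(1)] by auto
  ultimately show ?thesis by (simp add: open_Int)
qed

lemma phi_inv_path_deriv:
  assumes C: "(C0 has_real_derivative C0') (at t)" "(C1 has_real_derivative C1') (at t)" and neg: "C1 t < 0"
  defines "c \<equiv> \<lambda>t. phi_inv (C0 t, C1 t)"
  shows "((\<lambda>t. fst (c t)) has_real_derivative (fst (c t) * C0' - C1') / (fst (c t) - snd (c t))) (at t)"
    "((\<lambda>t. snd (c t)) has_real_derivative (C1' - snd (c t) * C0') / (fst (c t) - snd (c t))) (at t)"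
    "fst (c t) - snd (c t) > 0"
proof -
  define s where "s = (\<lambda>t. sqrt ((C0 t)\<^sup>2 - 4 * C1 t))"
  have pos: "(C0 t)\<^sup>2 - 4 * C1 t > 0" using neg by (smt (verit) zero_le_power2)
  have s0: "s t > 0" using pos by (simp add: s_def)
  have sd: "(s has_real_derivative (C0 t * C0' - 2 * C1') / s t) (at t)"
    unfolding s_def using pos by (auto intro!: derivative_eq_intros C simp: field_simps)
  have c: "(\<lambda>t. fst (c t)) = (\<lambda>t. (C0 t + s t) / 2)" "(\<lambda>t. snd (c t)) = (\<lambda>t. (C0 t - s t) / 2)"
    by (simp_all add: c_def phi_inv_def s_def)
  have cs: "fst (c t) = (C0 t + s t) / 2" "snd (c t) = (C0 t - s t) / 2" "fst (c t) - snd (c t) = s t"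
    by (simp_all add: c_def phi_inv_def s_def field_simps)
  show "fst (c t) - snd (c t) > 0" using cs s0 by simp
  have "((\<lambda>t. (C0 t + s t) / 2) has_real_derivative (C0' + (C0 t * C0' - 2 * C1') / s t) / 2) (at t)"
    by (intro DERIV_cdivide DERIV_add C sd)
  moreover have "(C0' + (C0 t * C0' - 2 * C1') / s t) / 2 = ((C0 t + s t) / 2 * C0' - C1') / s t"
    using s0 by (simp add: field_simps)
  ultimately show "((\<lambda>t. fst (c t)) has_real_derivative (fst (c t) * C0' - C1') / (fst (c t) - snd (c t))) (at t)"
    unfolding c(1) cs(3) unfolding cs(1) by simp
  have "((\<lambda>t. (C0 t - s t) / 2) has_real_derivative (C0' - (C0 t * C0' - 2 * C1') / s t) / 2) (at t)"
    by (intro DERIV_cdivide DERIV_diff C sd)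
  moreover have "(C0' - (C0 t * C0' - 2 * C1') / s t) / 2 = (C1' - (C0 t - s t) / 2 * C0') / s t"
    using s0 by (simp add: field_simps)
  ultimately show "((\<lambda>t. snd (c t)) has_real_derivative (C1' - snd (c t) * C0') / (fst (c t) - snd (c t))) (at t)"
    unfolding c(2) cs(3) unfolding cs(2) by simp
qed

section \<open>Contacts of a regular curve with the field\<close>

text \<open>
  The classes of \<open>\<kappa>\<close>, which occupy consecutive points, stand for components of a curve; consecutive points of
  the same class are separated by an element of \<open>K\<close>.
\<close>

lemma count_by_gaps:
  fixes P K :: "real set"
  assumes "finite P" and K: "finite K"
    and gap: "\<And>a b. a \<in> P \<Longrightarrow> b \<in> P \<Longrightarrow> a < b \<Longrightarrow> \<kappa> a = \<kappa> b \<Longrightarrow> \<exists>s\<in>K. a < s \<and> s < b"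
    and btw: "\<And>a b c. a \<in> P \<Longrightarrow> b \<in> P \<Longrightarrow> c \<in> P \<Longrightarrow> a < b \<Longrightarrow> b < c \<Longrightarrow> \<kappa> a = \<kappa> c \<Longrightarrow> \<kappa> b = \<kappa> c"
  shows "card P \<le> card {s \<in> K. \<exists>p\<in>P. s < p} + card (\<kappa> ` P)"
  using \<open>finite P\<close> gap btw
proof (induction P rule: finite_linorder_max_induct)
  case (insert m P)
  let ?K = "\<lambda>P. {s \<in> K. \<exists>p\<in>P. s < p}"
  have IH: "card P \<le> card (?K P) + card (\<kappa> ` P)"
    by (rule insert.IH) (use insert.prems in \<open>blast+\<close>)
  have sub: "?K P \<subseteq> ?K (insert m P)" by auto
  have c: "card (insert m P) = Suc (card P)" using insert.hyps by auto
  have fK: "finite (?K (insert m P))" using K by simp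
  show ?case
  proof (cases "\<kappa> m \<in> \<kappa> ` P")
    case True
    then obtain a where a: "a \<in> P" "\<kappa> a = \<kappa> m" by auto
    have M: "Max P \<in> P" "a \<le> Max P" using a insert.hyps(1) by (auto intro: Max_in)
    have "\<kappa> (Max P) = \<kappa> m"
    proof (cases "a = Max P")
      case False
      then show ?thesis using insert.prems(2)[of a "Max P" m] a M insert.hyps(2) by auto
    qed (use a in simp)
    then obtain s where s: "s \<in> K" "Max P < s" "s < m" using insert.prems(1)[of "Max P" m] M insert.hyps(2) by auto
    have "s \<notin> ?K P" using s(2) Max_ge[OF insert.hyps(1)] by force
    moreover have "insert s (?K P) \<subseteq> ?K (insert m P)" using s sub by auto
    ultimately have "Suc (card (?K P)) \<le> card (?K (insert m P))"
      using card_mono[OF fK, of "insert s (?K P)"] K by simp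
    moreover have "\<kappa> ` insert m P = \<kappa> ` P" using True by auto
    ultimately show ?thesis using IH c by simp
  next
    case False
    have "card (?K P) \<le> card (?K (insert m P))" using card_mono[OF fK sub] .
    moreover have "card (\<kappa> ` insert m P) = Suc (card (\<kappa> ` P))" using False insert.hyps(1) by simp
    ultimately show ?thesis using IH c by simp
  qed
qed simp

text \<open>
  \<open>Et = 0\<close> is a regular part of the curve \<open>Ft = 0\<close> in the coordinates \<open>\<phi>\<close>, and \<open>Gt = 0\<close> marks the points where it is
  tangent to \<open>X\<close>. At the points of \<open>Z\<close> the function \<open>Gt\<close> may vanish without a tangency; this happens
  at zeros of \<open>X_L\<close> when \<open>X\<close> is the field of the right zone.
\<close>

locale curve_contact = leaf_separation U A f X \<theta>
  for U A f X \<theta> +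
  fixes Et E0 E1 Ft Gt :: "real \<times> real \<Rightarrow> real" and N k :: nat and Z :: "(real \<times> real) set"
  assumes U_Q: "U \<subseteq> Q_quad" and U_open: "open U"
    and A_conn: "connected A"
    and E_F: "\<And>P. P \<in> \<phi> ` U \<Longrightarrow> Et P = 0 \<Longrightarrow> Ft P = 0"
    and S_E: "\<And>P. P \<in> \<phi> ` U \<Longrightarrow> Ft P = 0 \<Longrightarrow> Gt P = 0 \<Longrightarrow> Et P = 0"
    and comps: "finite {C \<in> components {P \<in> \<phi> ` U. Ft P = 0}. \<not> compact C}"
      "card {C \<in> components {P \<in> \<phi> ` U. Ft P = 0}. \<not> compact C} \<le> N"
    and sols: "finite {P. P isolated_in {P \<in> \<phi> ` U. Ft P = 0 \<and> Gt P = 0}}"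
      "card {P. P isolated_in {P \<in> \<phi> ` U. Ft P = 0 \<and> Gt P = 0}} \<le> k"
    and E_deriv: "\<And>P. (Et has_derivative (\<lambda>h. E0 P * fst h + E1 P * snd h)) (at P)"
    and E_reg: "\<And>P. P \<in> \<phi> ` U \<Longrightarrow> Et P = 0 \<Longrightarrow> E0 P \<noteq> 0 \<or> E1 P \<noteq> 0"
    and contact_G: "\<And>p. p \<in> U \<Longrightarrow> Et (\<phi> p) = 0 \<Longrightarrow>
        E0 (\<phi> p) * (fst (X p) + snd (X p)) + E1 (\<phi> p) * (fst (X p) * snd p + fst p * snd (X p)) = 0 \<Longrightarrow> Gt (\<phi> p) = 0"
    and G_contact: "\<And>p. p \<in> U - Z \<Longrightarrow> Et (\<phi> p) = 0 \<Longrightarrow> Gt (\<phi> p) = 0 \<Longrightarrow>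
        E0 (\<phi> p) * (fst (X p) + snd (X p)) + E1 (\<phi> p) * (fst (X p) * snd p + fst p * snd (X p)) = 0"
    and Z_fin: "finite Z"
begin

definition "V = \<phi> ` U"
definition "\<Gamma> = {P \<in> V. Ft P = 0}"
definition "S = {P \<in> V. Ft P = 0 \<and> Gt P = 0}"

lemma V_neg: "P \<in> V \<Longrightarrow> snd P < 0" using phi_image_neg[OF U_Q] by (auto simp: V_def)

lemma V_phi_inv: "P \<in> V \<Longrightarrow> phi_inv P \<in> U \<and> \<phi> (phi_inv P) = P"
  using phi_image_iff[OF U_Q] phi_phi_inv by (auto simp: V_def)

lemma V_open: "open V" unfolding V_def by (rule phi_image_open[OF U_Q U_open])

definition arc :: "real set \<Rightarrow> (real \<Rightarrow> real) \<Rightarrow> (real \<Rightarrow> real) \<Rightarrow> (real \<Rightarrow> real) \<Rightarrow> (real \<Rightarrow> real) \<Rightarrow> bool" where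
  "arc T C0 C1 C0' C1' \<longleftrightarrow> open T \<and> (\<forall>t\<in>T. (C0 has_real_derivative C0' t) (at t) \<and> (C1 has_real_derivative C1' t) (at t)
     \<and> (C0' t \<noteq> 0 \<or> C1' t \<noteq> 0) \<and> (C0 t, C1 t) \<in> V \<and> Et (C0 t, C1 t) = 0) \<and> continuous_on T C0' \<and> continuous_on T C1'"

context
  fixes T C0 C1 C0' C1' assumes arc: "arc T C0 C1 C0' C1'"
begin

definition "c0 t = fst (phi_inv (C0 t, C1 t))"
definition "c1 t = snd (phi_inv (C0 t, C1 t))"
definition "c0' t = (c0 t * C0' t - C1' t) / (c0 t - c1 t)"
definition "c1' t = (C1' t - c1 t * C0' t) / (c0 t - c1 t)"

lemma arcD: assumes "t \<in> T"
  shows "(C0 has_real_derivative C0' t) (at t)" "(C1 has_real_derivative C1' t) (at t)"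
    "C0' t \<noteq> 0 \<or> C1' t \<noteq> 0" "(C0 t, C1 t) \<in> V" "Et (C0 t, C1 t) = 0"
  using arc assms unfolding arc_def by auto

lemma arc_open: "open T" and arc_cont: "continuous_on T C0'" "continuous_on T C1'"
  using arc unfolding arc_def by auto

lemma lift_deriv: assumes "t \<in> T"
  shows "(c0 has_real_derivative c0' t) (at t)" "(c1 has_real_derivative c1' t) (at t)" "c0 t - c1 t > 0"
    "(c0 t, c1 t) \<in> U" "\<phi> (c0 t, c1 t) = (C0 t, C1 t)"
    "C0' t = c0' t + c1' t" "C1' t = c0' t * c1 t + c0 t * c1' t"
proof -
  have n: "C1 t < 0" using V_neg[OF arcD(4)[OF assms]] by simp
  note d = phi_inv_path_deriv[OF arcD(1,2)[OF assms] n]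
  show p: "c0 t - c1 t > 0" using d(3) by (simp add: c0_def c1_def)
  show "(c0 has_real_derivative c0' t) (at t)" "(c1 has_real_derivative c1' t) (at t)"
    using d(1,2) by (simp_all add: c0_def[abs_def] c1_def[abs_def] c0'_def c1'_def)
  show "(c0 t, c1 t) \<in> U" "\<phi> (c0 t, c1 t) = (C0 t, C1 t)"
    using V_phi_inv[OF arcD(4)[OF assms]] by (simp_all add: c0_def c1_def)
  show "C0' t = c0' t + c1' t" "C1' t = c0' t * c1 t + c0 t * c1' t"
    using p unfolding c0'_def c1'_def by (simp_all add: add_divide_distrib[symmetric] field_simps)
qed

lemma lift_cont: "continuous_on T c0" "continuous_on T c1" "continuous_on T c0'" "continuous_on T c1'"
proof -
  show 1: "continuous_on T c0" "continuous_on T c1"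
    using lift_deriv(1,2) by (auto intro!: continuous_at_imp_continuous_on DERIV_isCont)
  show "continuous_on T c0'" "continuous_on T c1'"
    unfolding c0'_def[abs_def] c1'_def[abs_def] using lift_deriv(3)
    by (auto intro!: continuous_intros 1 arc_cont simp: less_imp_neq[THEN not_sym])
qed

lemma E_tangent: assumes "t \<in> T" shows "E0 (C0 t, C1 t) * C0' t + E1 (C0 t, C1 t) * C1' t = 0"
proof -
  let ?P = "(C0 t, C1 t)"
  have pd: "((\<lambda>t. (C0 t, C1 t)) has_derivative (\<lambda>h. (C0' t * h, C1' t * h))) (at t)"
    using arcD(1,2)[OF assms] by (auto intro!: has_derivative_Pair simp: has_field_derivative_def)
  have "((\<lambda>t. Et (C0 t, C1 t)) has_real_derivative E0 ?P * C0' t + E1 ?P * C1' t) (at t)"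
  proof -
    have eq: "(\<lambda>h. E0 ?P * fst (C0' t * h, C1' t * h) + E1 ?P * snd (C0' t * h, C1' t * h)) = (*) (E0 ?P * C0' t + E1 ?P * C1' t)"
      by (auto simp: fun_eq_iff algebra_simps)
    show ?thesis using has_derivative_compose[OF pd E_deriv[of ?P]] unfolding eq has_field_derivative_def by simp
  qed
  moreover have "((\<lambda>t. Et (C0 t, C1 t)) has_real_derivative 0) (at t)"
  proof -
    have ev: "\<forall>\<^sub>F t in nhds t. Et (C0 t, C1 t) = 0"
      using eventually_nhds_in_open[OF arc_open assms] by (auto elim!: eventually_mono dest: arcD(5))
    show ?thesis using iffD2[OF DERIV_cong_ev[OF refl ev refl] DERIV_const] .
  qed
  ultimately show ?thesis by (rule DERIV_unique)
qed

text \<open>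
  Tangency of the lifted arc to \<open>X\<close> is expressed by the gradient of \<open>Et\<close>, which no longer refers to the
  parametrization.
\<close>

lemma contact_iff:
  assumes t: "t \<in> T"
  defines "p \<equiv> (c0 t, c1 t)"
  shows "fst (X p) * c1' t - snd (X p) * c0' t = 0 \<longleftrightarrow>
    E0 (\<phi> p) * (fst (X p) + snd (X p)) + E1 (\<phi> p) * (fst (X p) * snd p + fst p * snd (X p)) = 0"
proof -
  note l = lift_deriv[OF t]
  let ?a = "E0 (\<phi> p)" and ?b = "E1 (\<phi> p)" and ?x = "fst (X p)" and ?y = "snd (X p)"
  have e: "?a * C0' t + ?b * C1' t = 0" using E_tangent[OF t] l(5) by (simp add: p_def)
  have ab: "?a \<noteq> 0 \<or> ?b \<noteq> 0" using E_reg arcD(4,5)[OF t] l(5) by (simp add: p_def V_def)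
  have cr: "(?x + ?y) * C1' t - (?x * snd p + fst p * ?y) * C0' t = (c0 t - c1 t) * (?x * c1' t - ?y * c0' t)"
    unfolding l(6,7) p_def by (simp add: algebra_simps)
  have "?a * (?x + ?y) + ?b * (?x * snd p + fst p * ?y) = 0 \<longleftrightarrow> (?x + ?y) * C1' t - (?x * snd p + fst p * ?y) * C0' t = 0"
    (is "?L \<longleftrightarrow> ?R")
  proof
    assume L: ?L
    have "?a * ((?x + ?y) * C1' t - (?x * snd p + fst p * ?y) * C0' t) = 0"
      "?b * ((?x + ?y) * C1' t - (?x * snd p + fst p * ?y) * C0' t) = 0" using L e by algebra+
    then show ?R using ab by auto
  next
    assume R: ?R
    have "C0' t * (?a * (?x + ?y) + ?b * (?x * snd p + fst p * ?y)) = 0"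
      "C1' t * (?a * (?x + ?y) + ?b * (?x * snd p + fst p * ?y)) = 0" using R e by algebra+
    then show ?L using arcD(3)[OF t] by auto
  qed
  then show ?thesis using cr l(3) by auto
qed

lemma arc_on_leaf: assumes "t \<in> T" "y \<in> A" "(C0 t, C1 t) = \<phi> (y, f y)" shows "c0 t = y" "c1 t = f y"
proof -
  have "(y, f y) \<in> Q_quad" using in_U[OF assms(2)] U_Q by blast
  then have "phi_inv (C0 t, C1 t) = (y, f y)" unfolding assms(3) by (rule phi_inv_phi)
  then show "c0 t = y" "c1 t = f y" by (simp_all add: c0_def c1_def)
qed

lemma contact_between:
  assumes ab: "a < b" "{a..b} \<subseteq> T" and y: "y \<in> A" "(C0 a, C1 a) = \<phi> (y, f y)" "z \<in> A" "(C0 b, C1 b) = \<phi> (z, f z)"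
  shows "\<exists>s. a < s \<and> s < b \<and> Gt (C0 s, C1 s) = 0"
proof -
  have aT: "a \<in> T" "b \<in> T" using ab by auto
  obtain e1 where e1: "e1 > 0" "\<And>t. \<bar>t - a\<bar> < e1 \<Longrightarrow> t \<in> T" using arc_open aT(1) unfolding open_dist dist_real_def by blast
  obtain e2 where e2: "e2 > 0" "\<And>t. \<bar>t - b\<bar> < e2 \<Longrightarrow> t \<in> T" using arc_open aT(2) unfolding open_dist dist_real_def by blast
  define d where "d = min e1 e2"
  have d: "d > 0" using e1 e2 by (simp add: d_def)
  have inT: "t \<in> T" if t: "a - d < t" "t < b + d" for t
  proof -
    consider "t < a" | "t \<in> {a..b}" | "t > b" by force
    then show ?thesis
    proof cases
      case 1 then show ?thesis using t by (intro e1(2)) (auto simp: d_def)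
    next
      case 2 then show ?thesis using ab by blast
    next
      case 3 then show ?thesis using t by (intro e2(2)) (auto simp: d_def)
    qed
  qed
  have sub: "{a - d<..<b + d} \<subseteq> T" using inT by auto
  have "\<exists>t. a < t \<and> t < b \<and> fst (X (c0 t, c1 t)) * c1' t - snd (X (c0 t, c1 t)) * c0' t = 0"
  proof (rule gap_contact[OF ab(1) _ _ _ _ d])
    show "continuous_on {a - d<..<b + d} c0'" "continuous_on {a - d<..<b + d} c1'"
      using lift_cont(3,4) sub continuous_on_subset by blast+
    show "c0 a \<in> A" "c1 a = f (c0 a)" "c0 b \<in> A" "c1 b = f (c0 b)"
      using arc_on_leaf[OF aT(1) y(1,2)] arc_on_leaf[OF aT(2) y(3,4)] y by auto
  qed (use lift_deriv inT in auto)
  then obtain t where t: "a < t" "t < b" "fst (X (c0 t, c1 t)) * c1' t - snd (X (c0 t, c1 t)) * c0' t = 0" by blast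
  then have tT: "t \<in> T" using ab by auto
  have "Gt (\<phi> (c0 t, c1 t)) = 0"
    using contact_G[OF lift_deriv(4)[OF tT]] contact_iff[OF tT] t(3) lift_deriv(5)[OF tT] arcD(5)[OF tT] by simp
  then show ?thesis using t lift_deriv(5)[OF tT] by auto
qed

text \<open>
  If \<open>Gt\<close> vanishes along an arc, the lift is tangent to \<open>X\<close>, first outside the finite set \<open>Z\<close> and then everywhere by
  continuity.
\<close>

lemma all_contact_open:
  assumes G: "\<And>t. t \<in> T \<Longrightarrow> Gt (C0 t, C1 t) = 0"
    and inj: "\<exists>d>0. inj_on (\<lambda>t. (C0 t, C1 t)) (T \<inter> {t1 - d<..<t1 + d})"
    and t1: "t1 \<in> T" and y: "y \<in> A" "(C0 t1, C1 t1) = \<phi> (y, f y)"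
  shows "\<exists>e>0. \<forall>z. \<bar>z - y\<bar> < e \<longrightarrow> Et (\<phi> (z, f z)) = 0"
proof -
  obtain d1 where d1: "d1 > 0" "inj_on (\<lambda>t. (C0 t, C1 t)) (T \<inter> {t1 - d1<..<t1 + d1})" using inj by blast
  have "finite {t \<in> T \<inter> {t1 - d1<..<t1 + d1}. (C0 t, C1 t) \<in> \<phi> ` Z}" (is "finite ?B")
    by (rule finite_imageD[of "\<lambda>t. (C0 t, C1 t)"]) (use Z_fin d1(2) in \<open>auto intro: finite_subset[of _ "\<phi> ` Z"] inj_on_subset\<close>)
  then have "open (T \<inter> {t1 - d1<..<t1 + d1} - (?B - {t1}))"
    by (intro open_Diff open_Int arc_open finite_imp_closed) auto
  moreover have "t1 \<in> T \<inter> {t1 - d1<..<t1 + d1} - (?B - {t1})" using t1 d1(1) by auto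
  ultimately obtain d where d: "d > 0" "\<And>t. \<bar>t - t1\<bar> < d \<Longrightarrow> t \<in> T \<inter> {t1 - d1<..<t1 + d1} - (?B - {t1})"
    unfolding open_dist dist_real_def by blast
  have dT: "t \<in> T" if "\<bar>t - t1\<bar> < d" for t using d(2)[OF that] by simp
  let ?D = "\<lambda>t. fst (X (c0 t, c1 t)) * c1' t - snd (X (c0 t, c1 t)) * c0' t"
  have D0: "?D t = 0" if t: "\<bar>t - t1\<bar> < d" "t \<noteq> t1" for t
  proof -
    note tT = dT[OF t(1)]
    have nZ: "(C0 t, C1 t) \<notin> \<phi> ` Z" using d(2)[OF t(1)] t(2) tT by auto
    have "(c0 t, c1 t) \<notin> Z" using nZ lift_deriv(5)[OF tT] by (metis imageI)
    then show ?thesis using contact_iff[OF tT] G_contact[of "(c0 t, c1 t)"] lift_deriv(4,5)[OF tT] arcD(5)[OF tT] G[OF tT] by auto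
  qed
  have pc: "continuous_on T (\<lambda>t. (c0 t, c1 t))" by (intro continuous_intros lift_cont)
  have Xc: "continuous_on T (\<lambda>t. X (c0 t, c1 t))" by (rule continuous_on_compose2[OF X_cont pc]) (use lift_deriv(4) in auto)
  have "continuous_on T ?D" by (intro continuous_intros Xc lift_cont)
  then have "isCont ?D t1" using arc_open t1 by (simp add: continuous_on_eq_continuous_at)
  then have lim: "(?D \<longlongrightarrow> ?D t1) (at t1)" by (simp add: isCont_def)
  have "\<forall>\<^sub>F t in at t1. ?D t = 0"
    unfolding eventually_at using d(1) D0 by (intro exI[of _ d]) (auto simp: dist_real_def)
  then have "((\<lambda>t. 0) \<longlongrightarrow> ?D t1) (at t1)" by (rule Lim_transform_eventually[OF lim])
  then have D1: "?D t1 = 0" using tendsto_unique[of "at t1" "\<lambda>t. 0" "?D t1" 0] by auto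
  note on = arc_on_leaf[OF t1 y]
  have "\<exists>e>0. \<forall>z. \<bar>z - c0 t1\<bar> < e \<longrightarrow> (\<exists>t. \<bar>t - t1\<bar> < d \<and> z = c0 t \<and> f z = c1 t)"
  proof (rule tangent_arc_open[OF d(1), where c0' = c0' and c1' = c1'])
    show "isCont c0' t1" using lift_cont(3) arc_open t1 by (simp add: continuous_on_eq_continuous_at)
    show "c0 t1 \<in> A" "c1 t1 = f (c0 t1)" using on y by auto
    show "c0' t1 \<noteq> 0 \<or> c1' t1 \<noteq> 0" using lift_deriv(6,7)[OF t1] arcD(3)[OF t1] by auto
    fix t assume t: "\<bar>t - t1\<bar> < d"
    show "?D t = 0" using D0[OF t] D1 by (cases "t = t1") auto
  qed (use lift_deriv dT in auto)
  then obtain e where e: "e > 0" "\<And>z. \<bar>z - y\<bar> < e \<Longrightarrow> \<exists>t. \<bar>t - t1\<bar> < d \<and> z = c0 t \<and> f z = c1 t" using on(1) by auto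
  have "Et (\<phi> (z, f z)) = 0" if zy: "\<bar>z - y\<bar> < e" for z
  proof -
    obtain t where t: "\<bar>t - t1\<bar> < d" "z = c0 t" "f z = c1 t" using e(2)[OF zy] by blast
    then show ?thesis using lift_deriv(5)[OF dT[OF t(1)]] arcD(5)[OF dT[OF t(1)]] by (metis)
  qed
  then show ?thesis using e(1) by blast
qed

end

lemma f_cont: "continuous_on A f"
proof (intro continuous_at_imp_continuous_on ballI)
  fix y assume "y \<in> A"
  then obtain e where "e > 0" and d: "\<And>s. \<bar>s - y\<bar> < e \<Longrightarrow> (f has_real_derivative snd (X (s, f s)) / fst (X (s, f s))) (at s)"
    using leaf[of y] unfolding leaf_at_def by blast
  then show "isCont f y" using d[of y] DERIV_isCont by force
qed

lemma all_contact:
  assumes op: "\<And>y. y \<in> A \<Longrightarrow> Et (\<phi> (y, f y)) = 0 \<Longrightarrow> \<exists>e>0. \<forall>z. \<bar>z - y\<bar> < e \<longrightarrow> Et (\<phi> (z, f z)) = 0"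
    and y: "y0 \<in> A" "Et (\<phi> (y0, f y0)) = 0" and z: "z \<in> A"
  shows "Et (\<phi> (z, f z)) = 0"
proof -
  have Ec: "continuous_on S Et" for S using E_deriv by (auto intro!: continuous_at_imp_continuous_on has_derivative_continuous)
  have "continuous_on A (\<lambda>y. Et (\<phi> (y, f y)))"
    unfolding \<phi>_def by (intro continuous_on_compose2[OF Ec[of UNIV]]) (auto intro!: continuous_intros f_cont)
  then have cl: "closedin (top_of_set A) {y \<in> A. Et (\<phi> (y, f y)) = 0}"
    using continuous_closedin_preimage_constant by blast
  have "openin (top_of_set A) {y \<in> A. Et (\<phi> (y, f y)) = 0}"
    unfolding openin_euclidean_subtopology_iff
  proof (intro conjI ballI)
    fix x assume "x \<in> {y \<in> A. Et (\<phi> (y, f y)) = 0}"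
    then obtain e where "e > 0" "\<forall>z. \<bar>z - x\<bar> < e \<longrightarrow> Et (\<phi> (z, f z)) = 0" using op by blast
    then show "\<exists>e>0. \<forall>x'\<in>A. dist x' x < e \<longrightarrow> x' \<in> {y \<in> A. Et (\<phi> (y, f y)) = 0}" by (auto simp: dist_real_def)
  qed auto
  then have "{y \<in> A. Et (\<phi> (y, f y)) = 0} = {} \<or> {y \<in> A. Et (\<phi> (y, f y)) = 0} = A"
    using A_conn cl unfolding connected_clopen by blast
  then show ?thesis using y z by blast
qed

text \<open>
  Points of a finite set are isolated, so the bound on the isolated solutions applies to all of them.
\<close>

lemma contacts_bound:
  assumes fin: "finite {P \<in> V. Et P = 0 \<and> Gt P = 0}" and K: "K \<subseteq> {P \<in> V. Et P = 0 \<and> Gt P = 0}"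
  shows "card K \<le> k"
proof -
  have "S = {P \<in> V. Et P = 0 \<and> Gt P = 0}" using E_F S_E unfolding S_def V_def by blast
  then have "finite S" "K \<subseteq> S" using fin K by auto
  have "P isolated_in S" if "P \<in> S" for P
    unfolding isolated_in_def
  proof (intro conjI exI[of _ "- (S - {P})"])
    show "open (- (S - {P}))" using finite_imp_closed[of "S - {P}"] \<open>finite S\<close> by (metis finite_Diff open_Compl)
  qed (use that in auto)
  then have "K \<subseteq> {P. P isolated_in S}" using \<open>K \<subseteq> S\<close> by blast
  then have "card K \<le> card {P. P isolated_in S}" using sols(1)[folded V_def, folded S_def] by (intro card_mono)
  then show ?thesis using sols(2)[folded V_def, folded S_def] by simp
qed

text \<open>
  On each component there is at most one more intersection than there are contacts. The first condition on components
  says that they are intervals of the parameter, the second that none of them is compact.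
\<close>

lemma line_chart_count:
  assumes arc: "arc T C0 C1 C0' C1'"
    and inj: "inj_on (\<lambda>t. (C0 t, C1 t)) T"
    and cover: "\<And>P. P \<in> V \<Longrightarrow> Et P = 0 \<Longrightarrow> \<exists>t\<in>T. P = (C0 t, C1 t)"
    and fin: "finite {t \<in> T. Gt (C0 t, C1 t) = 0} \<or> (\<forall>t\<in>T. Gt (C0 t, C1 t) = 0)"
    and H1: "\<And>a b. a \<in> T \<Longrightarrow> b \<in> T \<Longrightarrow> a < b \<Longrightarrow>
        connected_component_set \<Gamma> (C0 a, C1 a) = connected_component_set \<Gamma> (C0 b, C1 b) \<Longrightarrow> {a..b} \<subseteq> T"
    and H2: "\<And>t. t \<in> T \<Longrightarrow> \<not> compact (connected_component_set \<Gamma> (C0 t, C1 t))"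
    and B: "finite B" "B \<subseteq> A" "\<And>y. y \<in> B \<Longrightarrow> Et (\<phi> (y, f y)) = 0"
    and notall: "\<exists>y\<in>A. Et (\<phi> (y, f y)) \<noteq> 0"
  shows "card B \<le> N + k"
proof (cases "B = {}")
  case False
  then obtain y0 where y0: "y0 \<in> B" by blast
  have inV: "\<phi> (y, f y) \<in> V" if "y \<in> A" for y using in_U[OF that] by (auto simp: V_def)
  have fin: "finite {t \<in> T. Gt (C0 t, C1 t) = 0}"
  proof (rule ccontr)
    assume "\<not> ?thesis"
    then have G: "\<And>t. t \<in> T \<Longrightarrow> Gt (C0 t, C1 t) = 0" using fin by blast
    have "Et (\<phi> (z, f z)) = 0" if "z \<in> A" for z
    proof (rule all_contact[of y0])
      fix y assume y: "y \<in> A" "Et (\<phi> (y, f y)) = 0"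
      obtain t where t: "t \<in> T" "\<phi> (y, f y) = (C0 t, C1 t)" using cover[OF inV[OF y(1)] y(2)] by blast
      show "\<exists>e>0. \<forall>z. \<bar>z - y\<bar> < e \<longrightarrow> Et (\<phi> (z, f z)) = 0"
        by (rule all_contact_open[OF arc G _ t(1) y(1)]) (use inj t in \<open>auto intro!: exI[of _ 1] intro: inj_on_subset\<close>)
    qed (use y0 B that in auto)
    then show False using notall by blast
  qed
  define K where "K = {t \<in> T. Gt (C0 t, C1 t) = 0}"
  have "\<exists>t\<in>T. \<phi> (y, f y) = (C0 t, C1 t)" if "y \<in> B" for y using cover inV B that by blast
  then obtain \<tau> where \<tau>: "\<And>y. y \<in> B \<Longrightarrow> \<tau> y \<in> T" "\<And>y. y \<in> B \<Longrightarrow> (C0 (\<tau> y), C1 (\<tau> y)) = \<phi> (y, f y)" by metis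
  have \<tau>inj: "inj_on \<tau> B"
  proof (rule inj_onI)
    fix x y assume xy: "x \<in> B" "y \<in> B" "\<tau> x = \<tau> y"
    then have "\<phi> (x, f x) = \<phi> (y, f y)" using \<tau>(2) by metis
    then have "(x, f x) = (y, f y)" using phi_inv_phi in_U U_Q B(2) xy by (metis subsetD)
    then show "x = y" by simp
  qed
  define \<kappa> where "\<kappa> = (\<lambda>t. connected_component_set \<Gamma> (C0 t, C1 t))"
  have TG: "(C0 t, C1 t) \<in> \<Gamma>" if "t \<in> T" for t using arcD(4,5)[OF arc that] E_F by (auto simp: \<Gamma>_def V_def)
  have same: "\<kappa> a = \<kappa> b" if ab: "a \<le> b" "{a..b} \<subseteq> T" for a b
  proof -
    have "continuous_on T C0" "continuous_on T C1"
      using arcD(1,2)[OF arc] by (auto intro!: continuous_at_imp_continuous_on DERIV_isCont)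
    then have "continuous_on {a..b} (\<lambda>t. (C0 t, C1 t))" using ab(2) continuous_on_subset by (intro continuous_on_Pair) blast+
    then have "connected ((\<lambda>t. (C0 t, C1 t)) ` {a..b})" by (intro connected_continuous_image) auto
    moreover have "(\<lambda>t. (C0 t, C1 t)) ` {a..b} \<subseteq> \<Gamma>" using TG ab(2) by auto
    ultimately have "connected_component \<Gamma> (C0 a, C1 a) (C0 b, C1 b)"
      unfolding connected_component_def using ab(1) by (intro exI[of _ "(\<lambda>t. (C0 t, C1 t)) ` {a..b}"]) auto
    then show ?thesis unfolding \<kappa>_def by (simp add: connected_component_eq_eq connected_component_eq)
  qed
  have "card (\<tau> ` B) \<le> card {s \<in> K. \<exists>p\<in>\<tau> ` B. s < p} + card (\<kappa> ` \<tau> ` B)"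
  proof (rule count_by_gaps)
    show "finite (\<tau> ` B)" "finite K" using B fin by (auto simp: K_def)
    fix a b assume ab: "a \<in> \<tau> ` B" "b \<in> \<tau> ` B" "a < b" "\<kappa> a = \<kappa> b"
    then obtain y z where yz: "y \<in> B" "a = \<tau> y" "z \<in> B" "b = \<tau> z" by auto
    have sub: "{a..b} \<subseteq> T" using H1[of a b] ab yz \<tau>(1) by (auto simp: \<kappa>_def)
    obtain s where s: "a < s" "s < b" "Gt (C0 s, C1 s) = 0"
      using contact_between[OF arc ab(3) sub, of y z] yz \<tau>(2) B(2) by blast
    moreover have "s \<in> T" using s sub by auto
    ultimately show "\<exists>s\<in>K. a < s \<and> s < b" by (auto simp: K_def)
  next
    fix a b c assume abc: "a \<in> \<tau> ` B" "b \<in> \<tau> ` B" "c \<in> \<tau> ` B" "a < b" "b < c" "\<kappa> a = \<kappa> c"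
    have "{a..c} \<subseteq> T" using H1[of a c] abc \<tau>(1) by (auto simp: \<kappa>_def)
    then show "\<kappa> b = \<kappa> c" using abc by (intro same) auto
  qed
  moreover have "card {s \<in> K. \<exists>p\<in>\<tau> ` B. s < p} \<le> card K" using fin by (intro card_mono) (auto simp: K_def)
  moreover have "card K \<le> k"
  proof -
    have c: "card ((\<lambda>t. (C0 t, C1 t)) ` K) = card K" by (rule card_image, rule inj_on_subset[OF inj]) (auto simp: K_def)
    have "{P \<in> V. Et P = 0 \<and> Gt P = 0} \<subseteq> (\<lambda>t. (C0 t, C1 t)) ` K" using cover by (fastforce simp: K_def)
    then have "finite {P \<in> V. Et P = 0 \<and> Gt P = 0}" using fin finite_subset by (auto simp: K_def)
    then have "card ((\<lambda>t. (C0 t, C1 t)) ` K) \<le> k" by (rule contacts_bound) (use arcD(4,5)[OF arc] in \<open>auto simp: K_def\<close>)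
    then show ?thesis using c by simp
  qed
  moreover have "card (\<kappa> ` \<tau> ` B) \<le> N"
  proof -
    have "\<kappa> ` \<tau> ` B \<subseteq> {C \<in> components \<Gamma>. \<not> compact C}"
      using \<tau>(1) H2 TG by (auto simp: \<kappa>_def components_def)
    then have "card (\<kappa> ` \<tau> ` B) \<le> card {C \<in> components \<Gamma>. \<not> compact C}"
      using comps(1)[folded V_def, folded \<Gamma>_def] by (intro card_mono)
    then show ?thesis using comps(2)[folded V_def, folded \<Gamma>_def] by simp
  qed
  moreover have "card (\<tau> ` B) = card B" by (rule card_image[OF \<tau>inj])
  ultimately show ?thesis by linarith
qed simp

text \<open>
  Around a closed curve there are at least as many contacts as intersections.
\<close>

lemma circle_chart_count:
  assumes arc: "arc UNIV C0 C1 C0' C1'" and w: "w > 0"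
    and per: "\<And>t. (C0 (t + w), C1 (t + w)) = (C0 t, C1 t)"
    and inj: "\<And>s. inj_on (\<lambda>t. (C0 t, C1 t)) {s..<s + w}"
    and cover: "\<And>s P. P \<in> V \<Longrightarrow> Et P = 0 \<Longrightarrow> \<exists>t\<in>{s..<s + w}. P = (C0 t, C1 t)"
    and fin: "(\<forall>s. finite {t \<in> {s..<s + w}. Gt (C0 t, C1 t) = 0}) \<or> (\<forall>t. Gt (C0 t, C1 t) = 0)"
    and B: "finite B" "B \<subseteq> A" "\<And>y. y \<in> B \<Longrightarrow> Et (\<phi> (y, f y)) = 0"
    and notall: "\<exists>y\<in>A. Et (\<phi> (y, f y)) \<noteq> 0"
  shows "card B \<le> k"
proof (cases "B = {}")
  case False
  then obtain y0 where y0: "y0 \<in> B" by blast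
  have inV: "\<phi> (y, f y) \<in> V" if "y \<in> A" for y using in_U[OF that] by (auto simp: V_def)
  have fin: "finite {t \<in> {s..<s + w}. Gt (C0 t, C1 t) = 0}" for s
  proof (rule ccontr)
    assume nf: "\<not> ?thesis"
    have "\<forall>t. Gt (C0 t, C1 t) = 0"
      using fin
    proof (elim disjE)
      assume "\<forall>s. finite {t \<in> {s..<s + w}. Gt (C0 t, C1 t) = 0}"
      from this[rule_format, of s] nf show ?thesis by (rule notE[rotated])
    qed
    then have G: "\<And>t. Gt (C0 t, C1 t) = 0" by (rule spec)
    have "Et (\<phi> (z, f z)) = 0" if "z \<in> A" for z
    proof (rule all_contact[of y0])
      fix y assume y: "y \<in> A" "Et (\<phi> (y, f y)) = 0"
      obtain t where t: "\<phi> (y, f y) = (C0 t, C1 t)" using cover[OF inV[OF y(1)] y(2)] by blast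
      show "\<exists>e>0. \<forall>z. \<bar>z - y\<bar> < e \<longrightarrow> Et (\<phi> (z, f z)) = 0"
        by (rule all_contact_open[OF arc G _ _ y(1)])
          (use inj[of "t - w / 2"] w t in \<open>auto intro!: exI[of _ "w / 2"] elim!: inj_on_subset\<close>)
    qed (use y0 B that in auto)
    then show False using notall by blast
  qed
  obtain s0 where s0: "\<phi> (y0, f y0) = (C0 s0, C1 s0)" using cover[OF inV] y0 B by blast
  define K where "K = {t \<in> {s0..<s0 + w}. Gt (C0 t, C1 t) = 0}"
  have "\<exists>t\<in>{s0..<s0 + w}. \<phi> (y, f y) = (C0 t, C1 t)" if "y \<in> B" for y using cover inV B that by blast
  then obtain \<tau> where \<tau>: "\<And>y. y \<in> B \<Longrightarrow> \<tau> y \<in> {s0..<s0 + w}" "\<And>y. y \<in> B \<Longrightarrow> (C0 (\<tau> y), C1 (\<tau> y)) = \<phi> (y, f y)" by metis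
  have \<tau>inj: "inj_on \<tau> B"
  proof (rule inj_onI)
    fix x y assume xy: "x \<in> B" "y \<in> B" "\<tau> x = \<tau> y"
    then have "\<phi> (x, f x) = \<phi> (y, f y)" using \<tau>(2) by metis
    then have "(x, f x) = (y, f y)" using phi_inv_phi in_U U_Q B(2) xy by (metis subsetD)
    then show "x = y" by simp
  qed
  \<comment> \<open>The circle is cut at an intersection, which then occurs at both ends and makes up for the additional point of an interval.\<close>
  define P where "P = insert (s0 + w) (\<tau> ` B)"
  have onleaf: "\<exists>y\<in>A. (C0 t, C1 t) = \<phi> (y, f y)" if tP: "t \<in> P" for t
  proof (cases "t = s0 + w")
    case True
    then have "(C0 t, C1 t) = \<phi> (y0, f y0)" using per[of s0] s0 by simp
    then show ?thesis using y0 B(2) by blast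
  next
    case False
    then obtain y where "y \<in> B" "t = \<tau> y" using tP by (auto simp: P_def)
    then show ?thesis using \<tau>(2) B(2) by blast
  qed
  have range: "s0 \<le> t \<and> t \<le> s0 + w" if "t \<in> P" for t using that \<tau>(1) w by (fastforce simp: P_def)
  have fK: "finite K" using fin by (simp add: K_def)
  have "card P \<le> card {s \<in> K. \<exists>p\<in>P. s < p} + card ((\<lambda>_. ()) ` P)"
  proof (rule count_by_gaps)
    show "finite P" "finite K" using B fK by (auto simp: P_def)
    fix a b assume ab: "a \<in> P" "b \<in> P" "a < b"
    obtain y z where yz: "y \<in> A" "(C0 a, C1 a) = \<phi> (y, f y)" "z \<in> A" "(C0 b, C1 b) = \<phi> (z, f z)" using onleaf ab by metis
    obtain s where s: "a < s" "s < b" "Gt (C0 s, C1 s) = 0"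
      using contact_between[OF arc ab(3) _ yz] by blast
    moreover have "s \<in> {s0..<s0 + w}" using s range[OF ab(1)] range[OF ab(2)] by auto
    ultimately show "\<exists>s\<in>K. a < s \<and> s < b" by (auto simp: K_def)
  qed simp
  moreover have "card {s \<in> K. \<exists>p\<in>P. s < p} \<le> card K" using fK by (intro card_mono) auto
  moreover have "card ((\<lambda>_. ()) ` P) \<le> 1" using card_mono[of "{()}" "(\<lambda>_. ()) ` P"] by fastforce
  moreover have "card P = Suc (card B)"
  proof -
    have "s0 + w \<notin> \<tau> ` B" using \<tau>(1) by fastforce
    then show ?thesis using B(1) card_image[OF \<tau>inj] by (simp add: P_def)
  qed
  moreover have "card K \<le> k"
  proof -
    have c: "card ((\<lambda>t. (C0 t, C1 t)) ` K) = card K" by (rule card_image, rule inj_on_subset[OF inj[of s0]]) (auto simp: K_def)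
    have "{P \<in> V. Et P = 0 \<and> Gt P = 0} \<subseteq> (\<lambda>t. (C0 t, C1 t)) ` K" using cover[of _ s0] by (fastforce simp: K_def)
    then have "finite {P \<in> V. Et P = 0 \<and> Gt P = 0}" using fK finite_subset by blast
    then have "card ((\<lambda>t. (C0 t, C1 t)) ` K) \<le> k" by (rule contacts_bound) (use arcD(4,5)[OF arc] in \<open>auto simp: K_def\<close>)
    then show ?thesis using c by simp
  qed
  ultimately show ?thesis by linarith
qed simp

end

section \<open>Lines and conics\<close>

lemma real_poly_finite_or_zero:
  fixes h :: "real \<Rightarrow> real"
  assumes "real_polynomial_function h" shows "finite {t. h t = 0} \<or> (\<forall>t. h t = 0)"
proof -
  obtain c n where h: "h = (\<lambda>x. \<Sum>i\<le>n. c i * x ^ i)" using assms real_polynomial_function_iff_sum by blast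
  show ?thesis
  proof (cases "\<forall>i\<le>n. c i = 0")
    case True then show ?thesis by (simp add: h)
  next
    case False then show ?thesis using polyfun_finite_roots[of c n] by (auto simp: h)
  qed
qed

lemma real_poly_id: "real_polynomial_function (\<lambda>x::real. x)"
  by (rule real_polynomial_function.intros(1)) (rule bounded_linear_ident)

lemmas real_poly_intros = real_polynomial_function.intros(2-4) real_polynomial_function_diff
  real_polynomial_function_minus real_polynomial_function_power real_poly_id

text \<open>
  All that matters about \<open>G_tilde\<close> is its degree; \<open>cubic_hom\<close> is the homogenized polynomial.
\<close>

definition cubic :: "(nat \<Rightarrow> real) \<Rightarrow> real \<times> real \<Rightarrow> real" where
  "cubic g P = g 0 + g 1 * fst P + g 2 * snd P + g 3 * (fst P)^2 + g 4 * fst P * snd P + g 5 * (snd P)^2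
     + g 6 * (fst P)^3 + g 7 * (fst P)^2 * snd P + g 8 * fst P * (snd P)^2 + g 9 * (snd P)^3"

definition cubic_hom :: "(nat \<Rightarrow> real) \<Rightarrow> real \<Rightarrow> real \<Rightarrow> real \<Rightarrow> real" where
  "cubic_hom g x y r = g 0 * r^3 + g 1 * x * r^2 + g 2 * y * r^2 + g 3 * x^2 * r + g 4 * x * y * r + g 5 * y^2 * r
     + g 6 * x^3 + g 7 * x^2 * y + g 8 * x * y^2 + g 9 * y^3"

lemma cubic_hom_eq: "r \<noteq> 0 \<Longrightarrow> cubic_hom g (x * r) (y * r) r = cubic g (x, y) * r^3"
  by (simp add: cubic_hom_def cubic_def power_mult_distrib algebra_simps power2_eq_square power3_eq_cube)

lemma cubic_hom_scale: "cubic_hom g (l * x) (l * y) (l * r) = l^3 * cubic_hom g x y r"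
  by (simp add: cubic_hom_def power_mult_distrib algebra_simps power2_eq_square power3_eq_cube)

lemma sin_zero_small: "sin x = 0 \<Longrightarrow> \<bar>x\<bar> < pi \<Longrightarrow> x = 0"
  by (metis abs_less_iff minus_less_iff sin_eq_0_pi)

lemma polar_mod_pi:
  obtains t r where "s \<le> t" "t < s + pi" "x = r * cos t" "y = r * sin t"
proof -
  define \<rho> where "\<rho> = sqrt (x\<^sup>2 + y\<^sup>2)"
  have "\<exists>t. x = \<rho> * cos t \<and> y = \<rho> * sin t"
  proof (cases "x = 0 \<and> y = 0")
    case False
    then have "\<rho> > 0" by (auto simp: \<rho>_def sum_power2_gt_zero_iff)
    then have "(x / \<rho>)\<^sup>2 + (y / \<rho>)\<^sup>2 = 1"
      by (simp add: power_divide add_divide_distrib[symmetric]) (simp add: \<rho>_def sum_power2_eq_zero_iff False)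
    then obtain t where "x / \<rho> = cos t" "y / \<rho> = sin t" using sincos_total_2pi by blast
    then show ?thesis using \<open>\<rho> > 0\<close> by (intro exI[of _ t]) (auto simp: field_simps)
  qed (auto simp: \<rho>_def)
  then obtain u where u: "x = \<rho> * cos u" "y = \<rho> * sin u" by blast
  define k where "k = \<lfloor>(u - s) / pi\<rfloor>"
  define e where "e = cos (k * pi)"
  have sk: "sin (k * pi) = 0" by (simp add: sin_zero_iff_int2)
  then have e2: "e * e = 1" using sin_cos_squared_add[of "k * pi"] by (simp add: e_def power2_eq_square)
  have ct: "cos (u - k * pi) = cos u * e" "sin (u - k * pi) = sin u * e" using sk by (simp_all add: cos_diff sin_diff e_def)
  have "real_of_int k \<le> (u - s) / pi" "(u - s) / pi < real_of_int k + 1" by (simp_all add: k_def)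
  then have "s \<le> u - k * pi" "u - k * pi < s + pi" by (simp_all add: field_simps)
  moreover have "x = (\<rho> * e) * cos (u - k * pi)" "y = (\<rho> * e) * sin (u - k * pi)" using u ct e2 by (simp_all add: algebra_simps)
  ultimately show ?thesis using that by blast
qed

context curve_contact
begin

text \<open>
  Together with a point of the arc a component contains the points with slightly larger parameters, so the continuous
  parameter \<open>\<sigma>\<close> has no maximum on it.
\<close>

lemma chart_noncompact:
  assumes arc: "arc T C0 C1 C0' C1'"
    and cover: "\<And>P. P \<in> V \<Longrightarrow> Et P = 0 \<Longrightarrow> \<exists>t\<in>T. P = (C0 t, C1 t)"
    and \<sigma>: "continuous_on {P \<in> V. Et P = 0} \<sigma>" "\<And>t. t \<in> T \<Longrightarrow> \<sigma> (C0 t, C1 t) = t"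
    and t: "t \<in> T"
  shows "\<not> compact (connected_component_set \<Gamma> (C0 t, C1 t))"
proof
  let ?K = "connected_component_set \<Gamma> (C0 t, C1 t)"
  assume c: "compact ?K"
  have KG: "?K \<subseteq> \<Gamma>" by (rule connected_component_subset)
  have Ec: "continuous_on S Et" for S using E_deriv by (auto intro!: continuous_at_imp_continuous_on has_derivative_continuous)
  have "?K \<inter> {P. Et P = 0} = {P \<in> ?K. Et P = 0}" by auto
  moreover have "closed {P. Et P = 0}" by (intro closed_Collect_eq Ec continuous_on_const)
  ultimately have "compact {P \<in> ?K. Et P = 0}" using compact_Int_closed[OF c] by metis
  then have "compact (\<sigma> ` {P \<in> ?K. Et P = 0})"
    by (intro compact_continuous_image continuous_on_subset[OF \<sigma>(1)]) (use KG in \<open>auto simp: \<Gamma>_def\<close>)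
  moreover have TG: "(C0 s, C1 s) \<in> \<Gamma>" if "s \<in> T" for s using arcD(4,5)[OF arc that] E_F by (auto simp: \<Gamma>_def V_def)
  then have "(C0 t, C1 t) \<in> {P \<in> ?K. Et P = 0}" using t arcD(5)[OF arc t] by auto
  ultimately obtain e where e: "e \<in> \<sigma> ` {P \<in> ?K. Et P = 0}" "\<And>x. x \<in> \<sigma> ` {P \<in> ?K. Et P = 0} \<Longrightarrow> x \<le> e"
    using compact_attains_sup[of "\<sigma> ` {P \<in> ?K. Et P = 0}"] by blast
  then obtain P where P: "P \<in> ?K" "Et P = 0" "e = \<sigma> P" by auto
  then have "P \<in> V" using KG unfolding \<Gamma>_def by blast
  then obtain t1 where t1: "t1 \<in> T" "P = (C0 t1, C1 t1)" using cover P(2) by blast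
  then have "e = t1" using P \<sigma>(2) by simp
  then have eT: "e \<in> T" "(C0 e, C1 e) \<in> ?K" using t1 P by auto
  obtain d where d: "d > 0" "\<And>s. \<bar>s - e\<bar> < d \<Longrightarrow> s \<in> T" using arc_open[OF arc] eT(1) unfolding open_dist dist_real_def by blast
  have sub: "{e..e + d / 2} \<subseteq> T" using d by auto
  have "continuous_on T C0" "continuous_on T C1"
    using arcD(1,2)[OF arc] by (auto intro!: continuous_at_imp_continuous_on DERIV_isCont)
  then have "continuous_on {e..e + d / 2} (\<lambda>t. (C0 t, C1 t))" using sub continuous_on_subset by (intro continuous_on_Pair) blast+
  then have "connected ((\<lambda>t. (C0 t, C1 t)) ` {e..e + d / 2})" by (intro connected_continuous_image) auto
  then have "connected_component \<Gamma> (C0 e, C1 e) (C0 (e + d / 2), C1 (e + d / 2))"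
    unfolding connected_component_def using d(1) TG sub
    by (intro exI[of _ "(\<lambda>t. (C0 t, C1 t)) ` {e..e + d / 2}"]) auto
  then have "(C0 (e + d / 2), C1 (e + d / 2)) \<in> ?K" using eT(2) connected_component_trans by (metis mem_Collect_eq)
  moreover have e2: "e + d / 2 \<in> T" using sub d(1) by auto
  ultimately have "e + d / 2 \<in> \<sigma> ` {P \<in> ?K. Et P = 0}"
    using \<sigma>(2)[OF e2] arcD(5)[OF arc e2] by (intro image_eqI[of _ _ "(C0 (e + d / 2), C1 (e + d / 2))"]) auto
  then show False using e(2) d(1) by fastforce
qed

text \<open>
  Here the curve may contain a second line, on which \<open>n0 + n1 Y0 + n2 Y1 = 0\<close>. It meets the first one at most once, hence
  cannot connect two intervals of the first line that are separated by a point outside \<open>V\<close>.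
\<close>

lemma affine_count:
  assumes Et: "\<And>P. Et P = e0 + e1 * fst P + e2 * snd P" and nz: "e1 \<noteq> 0 \<or> e2 \<noteq> 0"
    and F: "\<And>P. P \<in> V \<Longrightarrow> Ft P = 0 \<longleftrightarrow> Et P = 0 \<or> n0 + n1 * fst P + n2 * snd P = 0"
    and M: "\<exists>P. Et P = 0 \<and> n0 + n1 * fst P + n2 * snd P \<noteq> 0"
    and Gc: "\<And>P. Gt P = cubic g P"
    and B: "finite B" "B \<subseteq> A" "\<And>y. y \<in> B \<Longrightarrow> Et (\<phi> (y, f y)) = 0"
    and notall: "\<exists>y\<in>A. Et (\<phi> (y, f y)) \<noteq> 0"
  shows "card B \<le> N + k"
proof -
  define q where "q = e1\<^sup>2 + e2\<^sup>2"
  have q: "q > 0" using nz by (auto simp: q_def sum_power2_gt_zero_iff)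
  define C0 where "C0 = (\<lambda>t. - (e0 * e1 / q) - e2 * t)"
  define C1 where "C1 = (\<lambda>t. - (e0 * e2 / q) + e1 * t)"
  define \<sigma> where "\<sigma> = (\<lambda>P::real\<times>real. (e1 * snd P - e2 * fst P) / q)"
  define T where "T = {t. (C0 t, C1 t) \<in> V}"
  have EC: "Et (C0 t, C1 t) = 0" for t
  proof -
    have "Et (C0 t, C1 t) = e0 - e0 * ((e1\<^sup>2 + e2\<^sup>2) / q)"
      by (simp add: Et C0_def C1_def algebra_simps power2_eq_square add_divide_distrib)
    then show ?thesis using q unfolding q_def[symmetric] by simp
  qed
  have sC: "\<sigma> (C0 t, C1 t) = t" for t
  proof -
    have "\<sigma> (C0 t, C1 t) = t * (e1\<^sup>2 + e2\<^sup>2) / q" by (simp add: \<sigma>_def C0_def C1_def algebra_simps power2_eq_square)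
    then show ?thesis using q unfolding q_def[symmetric] by simp
  qed
  have Cs: "(C0 (\<sigma> P), C1 (\<sigma> P)) = P" if "Et P = 0" for P
  proof -
    have z: "e0 = - e1 * fst P - e2 * snd P" using that Et[of P] by simp
    have "C0 (\<sigma> P) = fst P * (e1\<^sup>2 + e2\<^sup>2) / q" "C1 (\<sigma> P) = snd P * (e1\<^sup>2 + e2\<^sup>2) / q"
      unfolding C0_def C1_def \<sigma>_def z using q by (simp_all add: field_simps power2_eq_square)
    then show ?thesis using q unfolding q_def[symmetric] by (simp add: prod_eq_iff)
  qed
  have Cc: "continuous_on S C0" "continuous_on S C1" for S unfolding C0_def C1_def by (intro continuous_intros)+
  have Topen: "open T"
  proof -
    have "continuous_on UNIV (\<lambda>t. (C0 t, C1 t))" by (intro continuous_on_Pair Cc)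
    then have "open ((\<lambda>t. (C0 t, C1 t)) -` V)" using V_open by (simp add: open_vimage)
    then show ?thesis by (simp add: T_def vimage_def)
  qed
  have dC: "(C0 has_real_derivative - e2) (at t)" "(C1 has_real_derivative e1) (at t)" for t
    unfolding C0_def C1_def by (auto intro!: derivative_eq_intros)
  have ar: "arc T C0 C1 (\<lambda>_. - e2) (\<lambda>_. e1)"
    unfolding arc_def using Topen dC EC nz by (auto simp: T_def)
  have inj: "inj_on (\<lambda>t. (C0 t, C1 t)) T" by (rule inj_on_inverseI[of _ \<sigma>]) (rule sC)
  have cover: "\<exists>t\<in>T. P = (C0 t, C1 t)" if "P \<in> V" "Et P = 0" for P
    using Cs[OF that(2)] that(1) by (intro bexI[of _ "\<sigma> P"]) (auto simp: T_def)
  have \<sigma>c: "continuous_on S \<sigma>" for S unfolding \<sigma>_def using q by (auto intro!: continuous_intros)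
  have "finite {t. Gt (C0 t, C1 t) = 0} \<or> (\<forall>t. Gt (C0 t, C1 t) = 0)"
    unfolding Gc cubic_def fst_conv snd_conv C0_def C1_def by (intro real_poly_finite_or_zero real_poly_intros)
  then have fin: "finite {t \<in> T. Gt (C0 t, C1 t) = 0} \<or> (\<forall>t\<in>T. Gt (C0 t, C1 t) = 0)"
    using finite_subset[of "{t \<in> T. Gt (C0 t, C1 t) = 0}" "{t. Gt (C0 t, C1 t) = 0}"] by blast
  define m where "m = (\<lambda>P::real\<times>real. n0 + n1 * fst P + n2 * snd P)"
  have root: "t = s" if "m (C0 t, C1 t) = 0" "m (C0 s, C1 s) = 0" for s t
  proof (rule ccontr)
    assume "t \<noteq> s"
    define u where "u = n0 - n1 * (e0 * e1 / q) - n2 * (e0 * e2 / q)"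
    define w where "w = n2 * e1 - n1 * e2"
    have mC: "m (C0 t, C1 t) = u + w * t" for t by (simp add: m_def C0_def C1_def u_def w_def algebra_simps)
    have "w * (t - s) = 0" using that[unfolded mC] by algebra
    then have "w = 0" using \<open>t \<noteq> s\<close> by simp
    then have "u = 0" using that(1) mC by simp
    obtain P where P: "Et P = 0" "m P \<noteq> 0" using M by (auto simp: m_def)
    then show False using mC[of "\<sigma> P"] Cs[OF P(1)] \<open>w = 0\<close> \<open>u = 0\<close> by simp
  qed
  have mc: "continuous_on S m" for S unfolding m_def by (intro continuous_intros)
  have Ec: "continuous_on S Et" for S using E_deriv by (auto intro!: continuous_at_imp_continuous_on has_derivative_continuous)
  have GE: "P \<in> \<Gamma> \<longleftrightarrow> P \<in> V \<and> (Et P = 0 \<or> m P = 0)" for P using F unfolding \<Gamma>_def m_def by blast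
  have H1: "{a..b} \<subseteq> T" if ab: "a \<in> T" "b \<in> T" "a < b"
    and eq: "connected_component_set \<Gamma> (C0 a, C1 a) = connected_component_set \<Gamma> (C0 b, C1 b)" for a b
  proof (rule ccontr)
    assume "\<not> ?thesis"
    then obtain s where "s \<in> {a..b}" and sT: "s \<notin> T" by blast
    then have s: "a \<le> s" "s \<le> b" "s \<notin> T" by auto
    then have s': "a < s" "s < b" using ab by (auto simp: less_le)
    let ?K = "connected_component_set \<Gamma> (C0 a, C1 a)"
    have abG: "(C0 a, C1 a) \<in> \<Gamma>" "(C0 b, C1 b) \<in> \<Gamma>" using ab EC by (auto simp: GE T_def)
    then have abK: "(C0 a, C1 a) \<in> ?K" "(C0 b, C1 b) \<in> ?K" unfolding eq by auto (metis abG connected_component_refl_eq eq mem_Collect_eq)+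
    have con: "connected ?K" and KG: "?K \<subseteq> \<Gamma>" by (rule connected_connected_component, rule connected_component_subset)
    have cl: "closed {P. Et P = 0}" "closed {P. m P = 0}" "closed {P. \<sigma> P \<le> s}" "closed {P. \<sigma> P \<ge> s}"
      by (intro closed_Collect_eq closed_Collect_le Ec mc \<sigma>c continuous_on_const)+
    have PT: "P \<in> \<Gamma> \<Longrightarrow> Et P = 0 \<Longrightarrow> \<sigma> P \<noteq> s" for P using Cs[of P] s(3) by (auto simp: GE T_def)
    let ?R = "{P. Et P = 0} \<inter> {P. \<sigma> P \<ge> s}" and ?L = "{P. Et P = 0} \<inter> {P. \<sigma> P \<le> s}"
    \<comment> \<open>On one side of the missing parameter s the first line is not met by the second one, so it is separated from the rest of the component.\<close>
    have "(\<forall>t>s. m (C0 t, C1 t) \<noteq> 0) \<or> (\<forall>t<s. m (C0 t, C1 t) \<noteq> 0)" using root by (metis less_asym)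
    then show False
    proof
      assume r: "\<forall>t>s. m (C0 t, C1 t) \<noteq> 0"
      have "?R \<inter> (?L \<union> {P. m P = 0}) \<inter> ?K = {}"
      proof (rule equals0I)
        fix P assume P: "P \<in> ?R \<inter> (?L \<union> {P. m P = 0}) \<inter> ?K"
        then have "\<sigma> P > s" using PT[of P] KG by (auto simp: less_le)
        then show False using r[rule_format, of "\<sigma> P"] Cs[of P] P by auto
      qed
      moreover have "?K \<subseteq> ?R \<union> (?L \<union> {P. m P = 0})" using KG GE by force
      moreover have "closed ?R" "closed (?L \<union> {P. m P = 0})" using cl by (auto intro: closed_Int closed_Un)
      moreover have "(C0 b, C1 b) \<in> ?R \<inter> ?K" "(C0 a, C1 a) \<in> (?L \<union> {P. m P = 0}) \<inter> ?K" using abK EC sC s' by auto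
      ultimately show False using con unfolding connected_closed by blast
    next
      assume r: "\<forall>t<s. m (C0 t, C1 t) \<noteq> 0"
      have "?L \<inter> (?R \<union> {P. m P = 0}) \<inter> ?K = {}"
      proof (rule equals0I)
        fix P assume P: "P \<in> ?L \<inter> (?R \<union> {P. m P = 0}) \<inter> ?K"
        then have "\<sigma> P < s" using PT[of P] KG by (auto simp: less_le)
        then show False using r[rule_format, of "\<sigma> P"] Cs[of P] P by auto
      qed
      moreover have "?K \<subseteq> ?L \<union> (?R \<union> {P. m P = 0})" using KG GE by force
      moreover have "closed ?L" "closed (?R \<union> {P. m P = 0})" using cl by (auto intro: closed_Int closed_Un)
      moreover have "(C0 a, C1 a) \<in> ?L \<inter> ?K" "(C0 b, C1 b) \<in> (?R \<union> {P. m P = 0}) \<inter> ?K" using abK EC sC s' by auto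
      ultimately show False using con unfolding connected_closed by blast
    qed
  qed
  show ?thesis
    by (rule line_chart_count[OF ar inj cover fin H1 chart_noncompact[OF ar cover \<sigma>c sC] B notall])
qed

text \<open>
  A nondegenerate conic is parametrized by the directions of the lines through one of its points. These
  form a circle; either the whole circle is used, or it is cut at a direction whose point is at
  infinity or outside \<open>V\<close>. The determinant is, up to a factor, that of the matrix of the conic.
\<close>

lemma conic_count:
  assumes Et: "\<And>P. Et P = q0 + q1 * fst P + q2 * snd P + a * (fst P)\<^sup>2 + b * (fst P * snd P) + c * (snd P)\<^sup>2"
    and det: "4 * a * c * q0 + q1 * b * q2 - a * q2\<^sup>2 - c * q1\<^sup>2 - q0 * b\<^sup>2 \<noteq> 0"
    and F: "\<And>P. P \<in> V \<Longrightarrow> Ft P = 0 \<longleftrightarrow> Et P = 0"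
    and Gc: "\<And>P. Gt P = cubic g P"
    and B: "finite B" "B \<subseteq> A" "\<And>y. y \<in> B \<Longrightarrow> Et (\<phi> (y, f y)) = 0"
    and notall: "\<exists>y\<in>A. Et (\<phi> (y, f y)) \<noteq> 0"
  shows "card B \<le> N + k"
proof (cases "B = {}")
  case False
  then obtain yb where yb: "yb \<in> B" by blast
  obtain x0 y0 where P0: "\<phi> (yb, f yb) = (x0, y0)" by fastforce
  have E0: "Et (x0, y0) = 0" using B(3)[OF yb] P0 by simp
  define g0 where "g0 = q1 + 2 * a * x0 + b * y0"
  define g1 where "g1 = q2 + b * x0 + 2 * c * y0"
  have "a * g1\<^sup>2 - b * g0 * g1 + c * g0\<^sup>2 = (4 * a * c - b\<^sup>2) * Et (x0, y0) - (4 * a * c * q0 + q1 * b * q2 - a * q2\<^sup>2 - c * q1\<^sup>2 - q0 * b\<^sup>2)"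
    unfolding Et g0_def g1_def fst_conv snd_conv by algebra
  then have nd: "a * g1\<^sup>2 - b * g0 * g1 + c * g0\<^sup>2 \<noteq> 0" using det E0 by simp
  \<comment> \<open>The line with direction t through the base point meets the conic again at distance r t.\<close>
  define R where "R = (\<lambda>t. a * (cos t)\<^sup>2 + b * (cos t * sin t) + c * (sin t)\<^sup>2)"
  define L where "L = (\<lambda>t. g0 * cos t + g1 * sin t)"
  define r where "r = (\<lambda>t. - L t / R t)"
  define C0 where "C0 = (\<lambda>t. x0 + r t * cos t)"
  define C1 where "C1 = (\<lambda>t. y0 + r t * sin t)"
  have cs: "(cos t)\<^sup>2 + (sin t)\<^sup>2 = 1" for t :: real by (simp add: add.commute)
  have Ev: "Et (x0 + v0, y0 + v1) = g0 * v0 + g1 * v1 + a * v0\<^sup>2 + b * (v0 * v1) + c * v1\<^sup>2" for v0 v1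
  proof -
    have "Et (x0 + v0, y0 + v1) = Et (x0, y0) + (g0 * v0 + g1 * v1 + a * v0\<^sup>2 + b * (v0 * v1) + c * v1\<^sup>2)"
      unfolding Et g0_def g1_def fst_conv snd_conv by algebra
    then show ?thesis using E0 by simp
  qed
  define kp where "kp = (\<lambda>t. g1 * cos t - g0 * sin t)"
  have gk: "g1 = L t * sin t + kp t * cos t" "g0 = L t * cos t - kp t * sin t" for t
    using cs[of t] unfolding L_def kp_def by algebra+
  have RL: "R t \<noteq> 0" if "L t = 0" for t
  proof
    assume "R t = 0"
    have "a * g1\<^sup>2 - b * g0 * g1 + c * g0\<^sup>2 = (kp t)\<^sup>2 * R t"
      using gk[of t] that unfolding R_def by (simp add: power2_eq_square algebra_simps)
    then show False using nd \<open>R t = 0\<close> by simp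
  qed
  have kp0: "kp t \<noteq> 0" if "L t = 0" for t
  proof
    assume "kp t = 0"
    then have "g0 = 0" "g1 = 0" using gk[of t] that by simp_all
    then show False using nd by simp
  qed
  have EC: "Et (C0 t, C1 t) = 0" if "R t \<noteq> 0" for t
  proof -
    have "Et (C0 t, C1 t) = r t * L t + (r t)\<^sup>2 * R t"
      unfolding C0_def C1_def Ev L_def R_def by (simp add: algebra_simps power2_eq_square)
    also have "\<dots> = r t * (L t + r t * R t)" by (simp add: algebra_simps power2_eq_square)
    also have "\<dots> = 0" using that by (simp add: r_def)
    finally show ?thesis .
  qed
  define R' where "R' = (\<lambda>t. 2 * (c - a) * (cos t * sin t) + b * ((cos t)\<^sup>2 - (sin t)\<^sup>2))"
  define r' where "r' = (\<lambda>t. (- kp t * R t + L t * R' t) / (R t)\<^sup>2)"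
  define C0' where "C0' = (\<lambda>t. r' t * cos t - r t * sin t)"
  define C1' where "C1' = (\<lambda>t. r' t * sin t + r t * cos t)"
  have Rd: "(R has_real_derivative R' t) (at t)" for t
    unfolding R_def R'_def by (auto intro!: derivative_eq_intros simp: power2_eq_square algebra_simps)
  have Ld: "(L has_real_derivative kp t) (at t)" for t
    unfolding L_def kp_def by (auto intro!: derivative_eq_intros simp: algebra_simps)
  have rd: "(r has_real_derivative r' t) (at t)" if "R t \<noteq> 0" for t
    unfolding r_def r'_def
    by (rule DERIV_cong[OF DERIV_divide[OF DERIV_minus[OF Ld] Rd that]]) (simp add: power2_eq_square)
  have dC: "(C0 has_real_derivative C0' t) (at t)" "(C1 has_real_derivative C1' t) (at t)" if "R t \<noteq> 0" for t
    unfolding C0_def C1_def C0'_def C1'_def using that by (auto intro!: derivative_eq_intros rd)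
  have reg: "C0' t \<noteq> 0 \<or> C1' t \<noteq> 0" if "R t \<noteq> 0" for t
  proof (rule ccontr)
    assume "\<not> ?thesis"
    then have z: "C0' t = 0" "C1' t = 0" by auto
    have "r' t = C0' t * cos t + C1' t * sin t" "r t = C1' t * cos t - C0' t * sin t"
      using cs[of t] unfolding C0'_def C1'_def by algebra+
    then have "r' t = 0" "r t = 0" using z by auto
    then have "L t = 0" using that by (simp add: r_def)
    then have "kp t = 0" using \<open>r' t = 0\<close> that by (simp add: r'_def)
    then show False using kp0 \<open>L t = 0\<close> by blast
  qed
  have Rc: "continuous_on S R" and R'c: "continuous_on S R'" and Lc: "continuous_on S L" and kc: "continuous_on S kp" for S
    unfolding R_def R'_def L_def kp_def by (intro continuous_intros)+
  have c': "continuous_on S C0'" "continuous_on S C1'" if "\<And>t. t \<in> S \<Longrightarrow> R t \<noteq> 0" for S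
    unfolding C0'_def C1'_def r'_def r_def using that by (auto intro!: continuous_intros Rc R'c Lc kc)
  have Cc: "continuous_on S (\<lambda>t. (C0 t, C1 t))" if "\<And>t. t \<in> S \<Longrightarrow> R t \<noteq> 0" for S
    unfolding C0_def C1_def r_def using that by (auto intro!: continuous_intros Rc Lc)
  have per: "R (t + pi) = R t" "(C0 (t + pi), C1 (t + pi)) = (C0 t, C1 t)" for t
  proof -
    show Rp: "R (t + pi) = R t" by (simp add: R_def)
    have "L (t + pi) = - L t" by (simp add: L_def)
    then have "r (t + pi) = - r t" by (simp add: r_def Rp)
    then show "(C0 (t + pi), C1 (t + pi)) = (C0 t, C1 t)" by (simp add: C0_def C1_def)
  qed
  have sd: "sin (t - s) = sin t * cos s - cos t * sin s" for s t :: real by (rule sin_diff)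
  \<comment> \<open>Over the base point r t = 0 and C determines no direction; the multiple (w0, w1) of the direction (cos t, sin t) does so there.\<close>
  define w0 where "w0 = (\<lambda>P::real\<times>real. - (g1 + c * (snd P - y0)))"
  define w1 where "w1 = (\<lambda>P::real\<times>real. g0 + a * (fst P - x0) + b * (snd P - y0))"
  have dirs: "\<exists>\<beta>. w0 (C0 t, C1 t) = \<beta> * cos t \<and> w1 (C0 t, C1 t) = \<beta> * sin t \<and> (r t \<noteq> 0 \<or> \<beta> \<noteq> 0)" if R: "R t \<noteq> 0" for t
  proof -
    let ?w0 = "w0 (C0 t, C1 t)" and ?w1 = "w1 (C0 t, C1 t)"
    define \<beta> where "\<beta> = ?w0 * cos t + ?w1 * sin t"
    have "L t + r t * R t = 0" using R by (simp add: r_def)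
    then have p: "cos t * ?w1 - sin t * ?w0 = 0"
      unfolding w0_def w1_def C0_def C1_def L_def R_def fst_conv snd_conv by algebra
    have "?w0 = \<beta> * cos t" "?w1 = \<beta> * sin t" using p cs[of t] unfolding \<beta>_def by algebra+
    moreover have "r t \<noteq> 0 \<or> \<beta> \<noteq> 0"
    proof (rule ccontr)
      assume "\<not> ?thesis"
      then have "r t = 0" "?w0 = 0" "?w1 = 0" using calculation by auto
      then have "g1 = 0" "g0 = 0" by (auto simp: w0_def w1_def C0_def C1_def)
      then show False using nd by simp
    qed
    ultimately show ?thesis by blast
  qed
  have cov: "\<exists>t. s \<le> t \<and> t < s + pi \<and> R t \<noteq> 0 \<and> P = (C0 t, C1 t)" if "Et P = 0" for P s
  proof -
    obtain x y where P: "P = (x0 + x, y0 + y)" by (metis prod.collapse add_diff_cancel_left' diff_add_cancel add.commute)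
    have e: "g0 * x + g1 * y + a * x\<^sup>2 + b * (x * y) + c * y\<^sup>2 = 0" using that Ev P by simp
    show ?thesis
    proof (cases "x = 0 \<and> y = 0")
      case True
      obtain t \<rho> where t: "s \<le> t" "t < s + pi" "- g1 = \<rho> * cos t" "g0 = \<rho> * sin t" by (rule polar_mod_pi)
      have g1: "g1 = - (\<rho> * cos t)" using t(3) by simp
      have "L t = 0" unfolding L_def g1 t(4) by (simp add: algebra_simps)
      then show ?thesis using RL t P True by (intro exI[of _ t]) (auto simp: C0_def C1_def r_def)
    next
      case False
      obtain t \<rho> where t: "s \<le> t" "t < s + pi" "x = \<rho> * cos t" "y = \<rho> * sin t" by (rule polar_mod_pi)
      have \<rho>: "\<rho> \<noteq> 0" using False t by auto
      have "\<rho> * (L t + \<rho> * R t) = 0" using e unfolding t(3,4) L_def R_def by (simp add: algebra_simps power2_eq_square)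
      then have LR: "L t = - \<rho> * R t" using \<rho> by simp
      then have R: "R t \<noteq> 0" using RL by auto
      then have "r t = \<rho>" using LR by (simp add: r_def)
      then show ?thesis using t R P by (intro exI[of _ t]) (auto simp: C0_def C1_def)
    qed
  qed
  have inj: "t = s" if R: "R t \<noteq> 0" "R s \<noteq> 0" and eq: "(C0 t, C1 t) = (C0 s, C1 s)" and d: "\<bar>t - s\<bar> < pi" for s t
  proof -
    obtain \<beta> where \<beta>: "w0 (C0 t, C1 t) = \<beta> * cos t" "w1 (C0 t, C1 t) = \<beta> * sin t" "r t \<noteq> 0 \<or> \<beta> \<noteq> 0" using dirs[OF R(1)] by blast
    obtain \<beta>' where \<beta>': "w0 (C0 s, C1 s) = \<beta>' * cos s" "w1 (C0 s, C1 s) = \<beta>' * sin s" using dirs[OF R(2)] by blast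
    have e: "r t * cos t = r s * cos s" "r t * sin t = r s * sin s" "\<beta> * cos t = \<beta>' * cos s" "\<beta> * sin t = \<beta>' * sin s"
      using eq \<beta> \<beta>' by (auto simp: C0_def C1_def)
    have "r t * sin (t - s) = 0" "\<beta> * sin (t - s) = 0" unfolding sd using e by algebra+
    then have "sin (t - s) = 0" using \<beta>(3) by auto
    then show ?thesis using sin_zero_small d by force
  qed
  \<comment> \<open>With the denominator R cleared, G along the conic is a form H of degree 6 in (cos t, sin t).\<close>
  define Hx where "Hx = (\<lambda>x y. x0 * (a * x\<^sup>2 + b * (x * y) + c * y\<^sup>2) - (g0 * x + g1 * y) * x)"
  define Hy where "Hy = (\<lambda>x y. y0 * (a * x\<^sup>2 + b * (x * y) + c * y\<^sup>2) - (g0 * x + g1 * y) * y)"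
  define Hr where "Hr = (\<lambda>x y. a * x\<^sup>2 + b * (x * y) + c * y\<^sup>2)"
  define H where "H = (\<lambda>x y. cubic_hom g (Hx x y) (Hy x y) (Hr x y))"
  have HG: "H (cos t) (sin t) = Gt (C0 t, C1 t) * (R t)^3" if R: "R t \<noteq> 0" for t
  proof -
    have "Hx (cos t) (sin t) = C0 t * R t" "Hy (cos t) (sin t) = C1 t * R t" "Hr (cos t) (sin t) = R t"
    proof -
      have rR: "r t * R t = - L t" using R by (simp add: r_def)
      have "C0 t * R t = x0 * R t - L t * cos t" "C1 t * R t = y0 * R t - L t * sin t"
        using rR unfolding C0_def C1_def by algebra+
      then show "Hx (cos t) (sin t) = C0 t * R t" "Hy (cos t) (sin t) = C1 t * R t" "Hr (cos t) (sin t) = R t"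
        unfolding Hx_def Hy_def Hr_def R_def L_def by simp_all
    qed
    then show ?thesis unfolding H_def using cubic_hom_eq[OF R] by (simp add: Gc)
  qed
  have hom: "H (l * x) (l * y) = l^6 * H x y" for l x y
  proof -
    have "Hx (l * x) (l * y) = l^2 * Hx x y" "Hy (l * x) (l * y) = l^2 * Hy x y" "Hr (l * x) (l * y) = l^2 * Hr x y"
      by (simp_all add: Hx_def Hy_def Hr_def algebra_simps power2_eq_square)
    then show ?thesis unfolding H_def by (simp add: cubic_hom_scale power_mult[symmetric])
  qed
  have Hp: "real_polynomial_function (\<lambda>\<tau>. H 1 \<tau>)" "real_polynomial_function (\<lambda>x. H x y)" for y
    unfolding H_def cubic_hom_def Hx_def Hy_def Hr_def by (intro real_poly_intros)+
  have Hfin: "(\<forall>s. finite {t \<in> {s..<s + pi}. H (cos t) (sin t) = 0}) \<or> (\<forall>t. H (cos t) (sin t) = 0)"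
  proof (cases "\<forall>\<tau>. H 1 \<tau> = 0")
    case True
    have nz: "H x y = 0" if "x \<noteq> 0" for x y using hom[of x 1 "y / x"] that True by simp
    have "H 0 y = 0" for y
    proof -
      have "infinite {x. H x y = 0}"
        by (rule infinite_super[of "{0<..<1}"]) (use nz in auto)
      then show ?thesis using real_poly_finite_or_zero[OF Hp(2)[of y]] by blast
    qed
    then have "H x y = 0" for x y using nz by (cases "x = 0") auto
    then show ?thesis by simp
  next
    case False
    then have fz: "finite {\<tau>. H 1 \<tau> = 0}" using real_poly_finite_or_zero[OF Hp(1)] by blast
    have "finite {t \<in> {s..<s + pi}. H (cos t) (sin t) = 0}" for s
    proof -
      let ?A = "{t \<in> {s..<s + pi}. H (cos t) (sin t) = 0 \<and> cos t \<noteq> 0}"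
      let ?B = "{t \<in> {s..<s + pi}. cos t = 0}"
      have "tan ` ?A \<subseteq> {\<tau>. H 1 \<tau> = 0}"
      proof
        fix x assume "x \<in> tan ` ?A"
        then obtain t where t: "x = tan t" "H (cos t) (sin t) = 0" "cos t \<noteq> 0" by auto
        have "H (cos t * 1) (cos t * tan t) = (cos t)^6 * H 1 (tan t)" by (rule hom)
        then show "x \<in> {\<tau>. H 1 \<tau> = 0}" using t by (simp add: tan_def)
      qed
      then have "finite (tan ` ?A)" using fz finite_subset by blast
      moreover have "inj_on tan ?A"
      proof (rule inj_onI)
        fix t u assume tu: "t \<in> ?A" "u \<in> ?A" "tan t = tan u"
        then have "sin (t - u) = 0" unfolding sd by (simp add: tan_def field_simps)
        moreover have "\<bar>t - u\<bar> < pi" using tu by auto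
        ultimately show "t = u" using sin_zero_small by force
      qed
      ultimately have "finite ?A" by (rule finite_imageD)
      moreover have "finite ?B"
      proof (cases "?B = {}")
        case False
        then obtain u where u: "u \<in> ?B" by blast
        have "t = u" if t: "t \<in> ?B" for t
        proof -
          have "sin (t - u) = 0" using t u unfolding sd by simp
          moreover have "\<bar>t - u\<bar> < pi" using t u by auto
          ultimately show ?thesis using sin_zero_small by force
        qed
        then have "?B \<subseteq> {u}" by blast
        then show ?thesis using finite_subset by blast
      qed (metis finite.emptyI)
      ultimately have "finite (?A \<union> ?B)" by simp
      then show ?thesis by (rule rev_finite_subset) auto
    qed
    then show ?thesis by blast
  qed
  have GH: "Gt (C0 t, C1 t) = 0 \<longleftrightarrow> H (cos t) (sin t) = 0" if "R t \<noteq> 0" for t using HG[OF that] that by simp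
  show ?thesis
  proof (cases "\<exists>s0. R s0 = 0 \<or> (C0 s0, C1 s0) \<notin> V")
    case False
    then have al: "\<And>t. R t \<noteq> 0" "\<And>t. (C0 t, C1 t) \<in> V" by auto
    have ar: "arc UNIV C0 C1 C0' C1'" unfolding arc_def using al dC reg EC c' by auto
    have "card B \<le> k"
    proof (rule circle_chart_count[OF ar pi_gt_zero per(2) _ _ _ B notall])
      show "inj_on (\<lambda>t. (C0 t, C1 t)) {s..<s + pi}" for s
      proof (rule inj_onI)
        fix t u assume "t \<in> {s..<s + pi}" "u \<in> {s..<s + pi}" "(C0 t, C1 t) = (C0 u, C1 u)"
        then show "t = u" by (intro inj al) auto
      qed
      show "\<exists>t\<in>{s..<s + pi}. P = (C0 t, C1 t)" if "P \<in> V" "Et P = 0" for s P using cov[OF that(2), of s] by auto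
      show "(\<forall>s. finite {t \<in> {s..<s + pi}. Gt (C0 t, C1 t) = 0}) \<or> (\<forall>t. Gt (C0 t, C1 t) = 0)"
        unfolding GH[OF al(1)] by (rule Hfin)
    qed
    then show ?thesis by simp
  next
    case True
    then obtain s0 where s0: "R s0 = 0 \<or> (C0 s0, C1 s0) \<notin> V" by blast
    define T where "T = {t. s0 < t \<and> t < s0 + pi \<and> R t \<noteq> 0 \<and> (C0 t, C1 t) \<in> V}"
    have Topen: "open T"
    proof -
      have o: "open {t. R t \<noteq> 0}" by (intro open_Collect_neq Rc continuous_on_const)
      have "open ({t. R t \<noteq> 0} \<inter> (\<lambda>t. (C0 t, C1 t)) -` V)"
        by (rule continuous_open_preimage[OF Cc o V_open]) simp
      then have "open ({s0<..<s0 + pi} \<inter> ({t. R t \<noteq> 0} \<inter> (\<lambda>t. (C0 t, C1 t)) -` V))" by (rule open_Int[OF open_greaterThanLessThan])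
      moreover have "T = {s0<..<s0 + pi} \<inter> ({t. R t \<noteq> 0} \<inter> (\<lambda>t. (C0 t, C1 t)) -` V)" by (auto simp: T_def)
      ultimately show ?thesis by simp
    qed
    have ar: "arc T C0 C1 C0' C1'" unfolding arc_def using Topen dC reg EC c'[of T] by (auto simp: T_def)
    have injT: "inj_on (\<lambda>t. (C0 t, C1 t)) T"
    proof (rule inj_onI)
      fix t u assume "t \<in> T" "u \<in> T" "(C0 t, C1 t) = (C0 u, C1 u)"
      then show "t = u" by (intro inj) (auto simp: T_def)
    qed
    have cover: "\<exists>t\<in>T. P = (C0 t, C1 t)" if P: "P \<in> V" "Et P = 0" for P
    proof -
      obtain t where t: "s0 \<le> t" "t < s0 + pi" "R t \<noteq> 0" "P = (C0 t, C1 t)" using cov[OF P(2), of s0] by blast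
      then have "t \<noteq> s0" using s0 P(1) by auto
      then show ?thesis using t P by (intro bexI[of _ t]) (auto simp: T_def)
    qed
    have "finite {t \<in> T. Gt (C0 t, C1 t) = 0} \<or> (\<forall>t\<in>T. Gt (C0 t, C1 t) = 0)"
      using Hfin
    proof
      assume "\<forall>s. finite {t \<in> {s..<s + pi}. H (cos t) (sin t) = 0}"
      then have "finite {t \<in> {s0..<s0 + pi}. H (cos t) (sin t) = 0}" by (rule spec)
      then have "finite {t \<in> T. Gt (C0 t, C1 t) = 0}"
        by (rule rev_finite_subset) (use GH in \<open>auto simp: T_def\<close>)
      then show ?thesis by blast
    next
      assume "\<forall>t. H (cos t) (sin t) = 0"
      then show ?thesis using GH by (auto simp: T_def)
    qed
    note fin = this
    \<comment> \<open>The quotient num / den is the cotangent of t - s0, which recovers the parameter from the point.\<close>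
    define num where "num = (\<lambda>P::real\<times>real. ((fst P - x0) * cos s0 + (snd P - y0) * sin s0) * ((snd P - y0) * cos s0 - (fst P - x0) * sin s0)
        + (w0 P * cos s0 + w1 P * sin s0) * (w1 P * cos s0 - w0 P * sin s0))"
    define den where "den = (\<lambda>P::real\<times>real. ((snd P - y0) * cos s0 - (fst P - x0) * sin s0)\<^sup>2 + (w1 P * cos s0 - w0 P * sin s0)\<^sup>2)"
    define \<sigma> where "\<sigma> = (\<lambda>P. s0 + pi / 2 - arctan (num P / den P))"
    have \<sigma>T: "den (C0 t, C1 t) > 0 \<and> \<sigma> (C0 t, C1 t) = t" if t: "t \<in> T" for t
    proof -
      have R: "R t \<noteq> 0" and tt: "0 < t - s0" "t - s0 < pi" using t by (auto simp: T_def)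
      obtain \<beta> where \<beta>: "w0 (C0 t, C1 t) = \<beta> * cos t" "w1 (C0 t, C1 t) = \<beta> * sin t" "r t \<noteq> 0 \<or> \<beta> \<noteq> 0" using dirs[OF R] by blast
      define h where "h = (r t)\<^sup>2 + \<beta>\<^sup>2"
      have h: "h > 0" using \<beta>(3) by (auto simp: h_def sum_power2_gt_zero_iff)
      have n: "num (C0 t, C1 t) = h * (cos (t - s0) * sin (t - s0))" "den (C0 t, C1 t) = h * (sin (t - s0))\<^sup>2"
      proof -
        have d: "C0 t - x0 = r t * cos t" "C1 t - y0 = r t * sin t" by (simp_all add: C0_def C1_def)
        show "num (C0 t, C1 t) = h * (cos (t - s0) * sin (t - s0))" "den (C0 t, C1 t) = h * (sin (t - s0))\<^sup>2"
          unfolding num_def den_def \<beta>(1,2) fst_conv snd_conv d h_def sin_diff cos_diff by algebra+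
      qed
      have s: "sin (t - s0) > 0" using sin_gt_zero tt by auto
      have "num (C0 t, C1 t) / den (C0 t, C1 t) = cos (t - s0) / sin (t - s0)" using h s n by (simp add: power2_eq_square)
      also have "\<dots> = tan (pi / 2 - (t - s0))" by (simp add: tan_def sin_diff cos_diff)
      finally have "arctan (num (C0 t, C1 t) / den (C0 t, C1 t)) = pi / 2 - (t - s0)" using arctan_tan[of "pi / 2 - (t - s0)"] tt by simp
      moreover have "den (C0 t, C1 t) > 0" using n h s by simp
      ultimately show ?thesis by (simp add: \<sigma>_def)
    qed
    have den0: "den P \<noteq> 0" if P: "P \<in> V" "Et P = 0" for P using cover[OF P] \<sigma>T by fastforce
    have \<sigma>c: "continuous_on {P \<in> V. Et P = 0} \<sigma>"
      unfolding \<sigma>_def by (intro continuous_intros) (use den0 in \<open>auto simp: num_def den_def w0_def w1_def intro!: continuous_intros\<close>)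
    have GE: "\<Gamma> = {P \<in> V. Et P = 0}" using F by (auto simp: \<Gamma>_def)
    have H1: "{x..y} \<subseteq> T" if xy: "x \<in> T" "y \<in> T" "x < y"
      and eq: "connected_component_set \<Gamma> (C0 x, C1 x) = connected_component_set \<Gamma> (C0 y, C1 y)" for x y
    proof -
      let ?K = "connected_component_set \<Gamma> (C0 x, C1 x)"
      have G: "(C0 t, C1 t) \<in> \<Gamma>" if "t \<in> T" for t using arcD(4,5)[OF ar that] by (simp add: GE)
      have K: "(C0 x, C1 x) \<in> ?K" using G[OF xy(1)] by simp
      have K2: "(C0 y, C1 y) \<in> ?K" unfolding eq using G[OF xy(2)] by simp
      have KG: "?K \<subseteq> {P \<in> V. Et P = 0}" using connected_component_subset unfolding GE .
      have "connected (\<sigma> ` ?K)"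
        by (intro connected_continuous_image connected_connected_component continuous_on_subset[OF \<sigma>c KG])
      moreover have "x \<in> \<sigma> ` ?K" "y \<in> \<sigma> ` ?K" using K K2 \<sigma>T xy by (metis imageI)+
      ultimately have "{x..y} \<subseteq> \<sigma> ` ?K" by (rule connected_contains_Icc)
      also have "\<dots> \<subseteq> T"
      proof
        fix z assume "z \<in> \<sigma> ` ?K"
        then obtain P where P: "P \<in> ?K" "z = \<sigma> P" by blast
        then obtain t where "t \<in> T" "P = (C0 t, C1 t)" using cover KG by blast
        then show "z \<in> T" using \<sigma>T P by simp
      qed
      finally show ?thesis .
    qed
    show ?thesis
      by (rule line_chart_count[OF ar injT cover fin H1 chart_noncompact[OF ar cover \<sigma>c] B notall]) (use \<sigma>T in auto)
  qed
qed simp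

end

section \<open>Crossing limit cycles and isolated zeros of the displacement\<close>

lemma first_zero:
  fixes g :: "real \<Rightarrow> real"
  assumes c: "continuous_on {s..t} g" and e: "e > 0" "\<And>r. s < r \<Longrightarrow> r < s + e \<Longrightarrow> g r < 0" and t: "s < t" "g t = 0"
  shows "\<exists>\<tau>>s. \<tau> \<le> t \<and> g \<tau> = 0 \<and> (\<forall>r. s < r \<longrightarrow> r < \<tau> \<longrightarrow> g r < 0)"
proof -
  define s' where "s' = s + min e (t - s) / 2"
  have s': "s < s'" "s' < s + e" "s' < t" using e t by (auto simp: s'_def min_def field_simps)
  define Z where "Z = {r \<in> {s'..t}. g r = 0}"
  have "Z = {s'..t} \<inter> g -` {0}" by (auto simp: Z_def)
  moreover have "closed ({s'..t} \<inter> g -` {0})"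
    by (rule continuous_closed_preimage[OF continuous_on_subset[OF c]]) (use s' in auto)
  ultimately have "closed Z" by simp
  moreover have "bounded Z" by (rule bounded_subset[of "{s'..t}"]) (auto simp: Z_def)
  ultimately have "compact Z" by (simp add: compact_eq_bounded_closed)
  moreover have "t \<in> Z" using t s' by (auto simp: Z_def)
  ultimately obtain \<tau> where \<tau>: "\<tau> \<in> Z" "\<And>r. r \<in> Z \<Longrightarrow> \<tau> \<le> r" using compact_attains_inf[of Z] by blast
  have n: "g r < 0" if r: "s < r" "r < \<tau>" for r
  proof (cases "r < s + e")
    case False
    then have rs: "s' \<le> r" "r \<le> t" using s' r \<tau>(1) by (auto simp: Z_def)
    show ?thesis
    proof (rule ccontr)
      assume "\<not> ?thesis"
      moreover have "g s' < 0" using e(2) s' by simp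
      moreover have "continuous_on {s'..r} g" by (rule continuous_on_subset[OF c]) (use s' rs in auto)
      ultimately obtain x where "s' \<le> x" "x \<le> r" "g x = 0" using IVT'[of g s' 0 r] rs by auto
      then show False using \<tau>(2)[of x] rs r by (auto simp: Z_def)
    qed
  qed (use e(2) r in auto)
  show ?thesis using \<tau>(1) s' n by (intro exI[of _ \<tau>]) (auto simp: Z_def)
qed

lemma has_vector_derivative_join:
  assumes "(w has_vector_derivative D) (at t)" and e: "e > 0"
  shows "(\<And>s. t - e < s \<Longrightarrow> s \<le> t \<Longrightarrow> u s = w s) \<Longrightarrow> (u has_vector_derivative D) (at_left t)"
    "(\<And>s. t \<le> s \<Longrightarrow> s < t + e \<Longrightarrow> u s = w s) \<Longrightarrow> (u has_vector_derivative D) (at_right t)"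
    "(\<And>s. t - e < s \<Longrightarrow> s < t + e \<Longrightarrow> u s = w s) \<Longrightarrow> (u has_vector_derivative D) (at t)"
proof -
  show "(u has_vector_derivative D) (at_left t)" if h: "\<And>s. t - e < s \<Longrightarrow> s \<le> t \<Longrightarrow> u s = w s"
  proof -
    have "(w has_vector_derivative D) (at t within {..t})" by (rule has_vector_derivative_at_within[OF assms(1)])
    then have "(u has_vector_derivative D) (at t within {..t})"
      by (rule has_vector_derivative_transform_within[OF _ e]) (use h in \<open>auto simp: dist_real_def\<close>)
    then show ?thesis by (rule has_vector_derivative_within_subset) auto
  qed
  show "(u has_vector_derivative D) (at_right t)" if h: "\<And>s. t \<le> s \<Longrightarrow> s < t + e \<Longrightarrow> u s = w s"
  proof -
    have "(w has_vector_derivative D) (at t within {t..})" by (rule has_vector_derivative_at_within[OF assms(1)])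
    then have "(u has_vector_derivative D) (at t within {t..})"
      by (rule has_vector_derivative_transform_within[OF _ e]) (use h in \<open>auto simp: dist_real_def\<close>)
    then show ?thesis by (rule has_vector_derivative_within_subset) auto
  qed
  show "(u has_vector_derivative D) (at t)" if h: "\<And>s. t - e < s \<Longrightarrow> s < t + e \<Longrightarrow> u s = w s"
    by (rule has_vector_derivative_transform_within[OF assms(1) e]) (use h in \<open>auto simp: dist_real_def abs_less_iff\<close>)
qed

lemma shift_b_solves:
  "solves_on (lin_field T D a b) S u \<longleftrightarrow> solves_on (lin_field T D a 0) S (\<lambda>t. u t - (0, b))"
proof -
  have e: "((\<lambda>t. u t - (0, b)) has_vector_derivative v) (at t within S) \<longleftrightarrow> (u has_vector_derivative v) (at t within S)" for v t
  proof
    assume "((\<lambda>t. u t - (0, b)) has_vector_derivative v) (at t within S)"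
    from has_vector_derivative_add[OF this has_vector_derivative_const[of "(0, b)"]]
    show "(u has_vector_derivative v) (at t within S)" by simp
  next
    assume "(u has_vector_derivative v) (at t within S)"
    from has_vector_derivative_diff[OF this has_vector_derivative_const[of "(0, b)"]]
    show "((\<lambda>t. u t - (0, b)) has_vector_derivative v) (at t within S)" by simp
  qed
  have f: "lin_field T D a 0 (u t - (0, b)) = lin_field T D a b (u t)" for t
    by (cases "u t") (simp add: lin_field_def)
  show ?thesis unfolding solves_on_def e f ..
qed

lemma solves_shift: assumes "solves_on X ((+) s ` S) u" shows "solves_on X S (\<lambda>t. u (s + t))"
  unfolding solves_on_def
proof
  fix t assume t: "t \<in> S"
  have "((+) s has_vector_derivative 1) (at t within S)" by (auto intro!: derivative_eq_intros)
  moreover have "(u has_vector_derivative X (u (s + t))) (at (s + t) within (+) s ` S)"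
    using assms t unfolding solves_on_def by auto
  ultimately have "(u \<circ> (+) s has_vector_derivative 1 *\<^sub>R X (u (s + t))) (at t within S)" by (rule vector_diff_chain_within)
  then show "((\<lambda>t. u (s + t)) has_vector_derivative X (u (s + t))) (at t within S)" by (simp add: o_def)
qed

text \<open>
  The orbit in the right zone with reversed time, in the coordinates of \<open>right_return_mirror\<close>.
\<close>

definition right_orbit :: "real \<Rightarrow> real \<Rightarrow> real \<Rightarrow> real \<Rightarrow> real \<Rightarrow> real \<Rightarrow> real \<times> real" where
  "right_orbit T D a b y t = (- fst (left_orbit (- T) D (- a) (y - b) t), snd (left_orbit (- T) D (- a) (y - b) t) + b)"

lemma right_orbit_solves: "solves_on (lin_field T D a b) S (\<lambda>t. right_orbit T D a b y (c - t))"
proof -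
  have "solves_on (lin_field T D a 0) ((\<lambda>t. c - t) ` ((\<lambda>t. c - t) ` S))
    (\<lambda>t. (- fst (left_orbit (- T) D (- a) (y - b) (c - t)), snd (left_orbit (- T) D (- a) (y - b) (c - t))))"
    using reflect_x_solves[OF left_orbit_solves[of "- T" D "- a" "(\<lambda>t. c - t) ` S" "y - b"], of c] by simp
  moreover have "(\<lambda>t. c - t) ` ((\<lambda>t. c - t) ` S) = S" by (force simp: image_iff)
  ultimately show ?thesis unfolding shift_b_solves[of T D a b] by (simp add: right_orbit_def)
qed

locale two_zones =
  fixes TL DL aL TR DR aR b :: real
  assumes admL: "(aL \<le> 0 \<and> 4 * DL - TL\<^sup>2 > 0) \<or> aL > 0"
    and admR: "(aR \<ge> 0 \<and> 4 * DR - TR\<^sup>2 > 0) \<or> aR < 0"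
begin

abbreviation "ZL \<equiv> lin_field TL DL aL 0"
abbreviation "ZR \<equiv> lin_field TR DR aR b"
abbreviation "JL \<equiv> ret_dom TL DL aL"
abbreviation "JR \<equiv> ret_dom (- TR) DR (- aR)"
abbreviation "fL \<equiv> half_return TL DL aL"
abbreviation "fR \<equiv> half_return (- TR) DR (- aR)"
abbreviation "tL \<equiv> return_time TL DL aL"
abbreviation "tR \<equiv> return_time (- TR) DR (- aR)"

lemmas admR' = right_adm[OF admR]

definition "per_zero z \<longleftrightarrow> z \<in> JL \<and> z - b \<in> JR \<and> fR (z - b) + b = fL z"

definition "loop z = left_orbit TL DL aL z ` {0..tL z} \<union> right_orbit TR DR aR b z ` {0..tR (z - b)}"

lemma fst_Z: "fst (ZL (x, y)) = TL * x - y" "fst (ZR (x, y)) = TR * x - y + b"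
  by (simp_all add: lin_field_def)

context
  fixes u assumes u: "crossing_solution ZL ZR u"
begin

lemma u_neg: "fst (u t) < 0 \<Longrightarrow> (u has_vector_derivative ZL (u t)) (at t)"
  and u_pos: "fst (u t) > 0 \<Longrightarrow> (u has_vector_derivative ZR (u t)) (at t)"
  using u unfolding crossing_solution_def Let_def by blast+

lemma u_cross:
  assumes "u t = (0, y)"
  shows "(y > 0 \<and> y > b \<and> (u has_vector_derivative ZR (u t)) (at_left t) \<and> (u has_vector_derivative ZL (u t)) (at_right t))
    \<or> (y < 0 \<and> y < b \<and> (u has_vector_derivative ZL (u t)) (at_left t) \<and> (u has_vector_derivative ZR (u t)) (at_right t))"
proof -
  have "fst (u t) = 0" using assms by simp
  then show ?thesis using u[unfolded crossing_solution_def Let_def, rule_format, of t] unfolding assms fst_Z by auto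
qed

lemma u_cont: "isCont u t"
proof -
  consider "fst (u t) < 0" | "fst (u t) > 0" | "fst (u t) = 0" by linarith
  then show ?thesis
  proof cases
    case 3
    then obtain y where "u t = (0, y)" by (metis prod.collapse)
    then have "\<exists>D. (u has_vector_derivative D) (at_left t)" "\<exists>D. (u has_vector_derivative D) (at_right t)" using u_cross by blast+
    then have "continuous (at_left t) u" "continuous (at_right t) u" using has_vector_derivative_continuous by blast+
    then show ?thesis by (simp add: continuous_at_split)
  qed (use u_neg u_pos has_vector_derivative_continuous in blast)+
qed

lemma u_fst_cont: "continuous_on S (\<lambda>t. fst (u t))"
  by (intro continuous_at_imp_continuous_on ballI continuous_fst u_cont)

lemma fst_deriv: "(u has_vector_derivative D) F \<Longrightarrow> ((\<lambda>t. fst (u t)) has_vector_derivative fst D) F"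
  by (rule bounded_linear.has_vector_derivative[OF bounded_linear_fst])

lemma down_right: assumes "u s = (0, y)" "y > 0" shows "\<exists>e>0. \<forall>r. s < r \<and> r < s + e \<longrightarrow> fst (u r) < 0"
proof -
  have "(u has_vector_derivative ZL (u s)) (at_right s)" using u_cross[OF assms(1)] assms(2) by auto
  from fst_deriv[OF this] have "((\<lambda>t. fst (u t)) has_real_derivative - y) (at s within {s<..})"
    using assms(1) by (simp add: fst_Z has_real_derivative_iff_has_vector_derivative)
  from has_real_derivative_neg_dec_right[OF this] assms(2)
  obtain d where d: "d > 0" "\<And>h. 0 < h \<Longrightarrow> s + h \<in> {s<..} \<Longrightarrow> h < d \<Longrightarrow> fst (u s) > fst (u (s + h))" by auto
  show ?thesis
  proof (intro exI[of _ d] conjI allI impI)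
    fix r assume r: "s < r \<and> r < s + d"
    show "fst (u r) < 0" using d(2)[of "r - s"] r assms(1) by auto
  qed (use d in auto)
qed

lemma up_right: assumes "u s = (0, y)" "y < 0" shows "\<exists>e>0. \<forall>r. s < r \<and> r < s + e \<longrightarrow> fst (u r) > 0"
proof -
  have c: "(u has_vector_derivative ZR (u s)) (at_right s)" "y < b" using u_cross[OF assms(1)] assms(2) by auto
  from fst_deriv[OF c(1)] have "((\<lambda>t. fst (u t)) has_real_derivative b - y) (at s within {s<..})"
    using assms(1) by (simp add: fst_Z has_real_derivative_iff_has_vector_derivative)
  from has_real_derivative_pos_inc_right[OF this] c(2)
  obtain d where d: "d > 0" "\<And>h. 0 < h \<Longrightarrow> s + h \<in> {s<..} \<Longrightarrow> h < d \<Longrightarrow> fst (u s) < fst (u (s + h))" by auto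
  show ?thesis
  proof (intro exI[of _ d] conjI allI impI)
    fix r assume r: "s < r \<and> r < s + d"
    show "fst (u r) > 0" using d(2)[of "r - s"] r assms(1) by auto
  qed (use d in auto)
qed

lemma down_left: assumes "u s = (0, y)" "y > 0" shows "\<exists>e>0. \<forall>r. s - e < r \<and> r < s \<longrightarrow> fst (u r) > 0"
proof -
  have c: "(u has_vector_derivative ZR (u s)) (at_left s)" "y > b" using u_cross[OF assms(1)] assms(2) by auto
  from fst_deriv[OF c(1)] have "((\<lambda>t. fst (u t)) has_real_derivative b - y) (at s within {..<s})"
    using assms(1) by (simp add: fst_Z has_real_derivative_iff_has_vector_derivative)
  from has_real_derivative_neg_dec_left[OF this] c(2)
  obtain d where d: "d > 0" "\<And>h. 0 < h \<Longrightarrow> s - h \<in> {..<s} \<Longrightarrow> h < d \<Longrightarrow> fst (u s) < fst (u (s - h))" by auto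
  show ?thesis
  proof (intro exI[of _ d] conjI allI impI)
    fix r assume r: "s - d < r \<and> r < s"
    show "fst (u r) > 0" using d(2)[of "s - r"] r assms(1) by auto
  qed (use d in auto)
qed

lemma up_left: assumes "u s = (0, y)" "y < 0" shows "\<exists>e>0. \<forall>r. s - e < r \<and> r < s \<longrightarrow> fst (u r) < 0"
proof -
  have c: "(u has_vector_derivative ZL (u s)) (at_left s)" using u_cross[OF assms(1)] assms(2) by auto
  from fst_deriv[OF c(1)] have "((\<lambda>t. fst (u t)) has_real_derivative - y) (at s within {..<s})"
    using assms(1) by (simp add: fst_Z has_real_derivative_iff_has_vector_derivative)
  from has_real_derivative_pos_inc_left[OF this] assms(2)
  obtain d where d: "d > 0" "\<And>h. 0 < h \<Longrightarrow> s - h \<in> {..<s} \<Longrightarrow> h < d \<Longrightarrow> fst (u (s - h)) < fst (u s)" by auto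
  show ?thesis
  proof (intro exI[of _ d] conjI allI impI)
    fix r assume r: "s - d < r \<and> r < s"
    show "fst (u r) < 0" using d(2)[of "s - r"] r assms(1) by auto
  qed (use d in auto)
qed

text \<open>
  A crossing solution enters the left zone at points with \<open>y > 0\<close> only, where the line can only be crossed from right to left, and
  it can only leave the zone at points with \<open>y < 0\<close>; so a complete passage is a value of the half-map.
\<close>

lemma left_passage:
  assumes s: "u s = (0, y)" "y > 0" and later: "s < t" "fst (u t) = 0"
  shows "y \<in> JL \<and> u (s + tL y) = (0, fL y) \<and> fL y < b \<and> (\<forall>r\<in>{0..tL y}. u (s + r) = left_orbit TL DL aL y r)"
proof -
  obtain e where e: "e > 0" "\<And>r. s < r \<Longrightarrow> r < s + e \<Longrightarrow> fst (u r) < 0" using down_right[OF s] by blast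
  obtain t1 where t1: "s < t1" "fst (u t1) = 0" "\<And>r. s < r \<Longrightarrow> r < t1 \<Longrightarrow> fst (u r) < 0"
    using first_zero[OF u_fst_cont e later] by blast
  obtain y1 where y1: "u t1 = (0, y1)" using t1(2) by (metis prod.collapse)
  have y1n: "y1 < 0" "y1 < b" "(u has_vector_derivative ZL (u t1)) (at_left t1)"
  proof -
    have "\<not> y1 > 0"
    proof
      assume "y1 > 0"
      then obtain e where e: "e > 0" "\<And>r. t1 - e < r \<Longrightarrow> r < t1 \<Longrightarrow> fst (u r) > 0" using down_left[OF y1] by blast
      define r where "r = t1 - min e (t1 - s) / 2"
      have "t1 - e < r" "s < r" "r < t1" using e(1) t1(1) by (auto simp: r_def min_def field_simps)
      then show False using e(2)[of r] t1(3)[of r] by simp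
    qed
    then show "y1 < 0" "y1 < b" "(u has_vector_derivative ZL (u t1)) (at_left t1)" using u_cross[OF y1] by auto
  qed
  define \<tau> where "\<tau> = t1 - s"
  have \<tau>: "\<tau> > 0" "s + \<tau> = t1" using t1(1) by (auto simp: \<tau>_def)
  have "solves_on ZL {s..t1} u" unfolding solves_on_def
  proof
    fix r assume r: "r \<in> {s..t1}"
    consider "r = s" | "r = t1" | "s < r" "r < t1" using r by force
    then show "(u has_vector_derivative ZL (u r)) (at r within {s..t1})"
    proof cases
      case 1
      have "(u has_vector_derivative ZL (u s)) (at_right s)" using u_cross[OF s(1)] s(2) by auto
      then show ?thesis using 1 t1(1) by (simp add: at_within_Icc_at_right)
    next
      case 2
      then show ?thesis using y1n(3) t1(1) by (simp add: at_within_Icc_at_left)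
    next
      case 3
      then show ?thesis using u_neg[OF t1(3)[OF 3]] by (rule_tac has_vector_derivative_at_within)
    qed
  qed
  moreover have im: "(+) s ` {0..\<tau>} = {s..t1}" using image_add_atLeastAtMost[of s 0 \<tau>] \<tau>(2) by simp
  ultimately have sol: "solves_on ZL {0..\<tau>} (\<lambda>t. u (s + t))" by (intro solves_shift) (simp only: im)
  have fl: "u (s + r) = left_orbit TL DL aL y r" if "r \<in> {0..\<tau>}" for r
    using flow_unique[OF sol _ that, of y] s by simp
  have "left_return TL DL aL y y1" unfolding left_return_def
    by (intro exI[of _ "\<lambda>t. u (s + t)"] exI[of _ \<tau>]) (use \<tau> sol s y1 t1 in auto)
  then have J: "y \<in> JL" "fL y = y1" using ret_dom_of_neg_return s(2) y1n(1) by blast+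
  have "returns_at TL DL aL y \<tau>" unfolding returns_at_def
  proof (intro conjI allI impI)
    fix r assume r: "0 < r \<and> r < \<tau>"
    show "xpos TL DL aL y r < 0" using t1(3)[of "s + r"] fl[of r] r \<tau> by (simp add: left_orbit_def)
  qed (use \<tau> fl[of \<tau>] y1 in \<open>auto simp: left_orbit_def\<close>)
  then have "tL y = \<tau>" by (rule return_time_eq)
  then show ?thesis using J fl y1 y1n \<tau> by simp
qed

lemma right_passage:
  assumes s: "u s = (0, y1)" "y1 < 0" and later: "s < t" "fst (u t) = 0"
  shows "\<exists>y. y > 0 \<and> y > b \<and> y - b \<in> JR \<and> fR (y - b) + b = y1 \<and> u (s + tR (y - b)) = (0, y) \<and>
    (\<forall>r\<in>{0..tR (y - b)}. u (s + tR (y - b) - r) = right_orbit TR DR aR b y r)"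
proof -
  obtain e where e: "e > 0" "\<And>r. s < r \<Longrightarrow> r < s + e \<Longrightarrow> - fst (u r) < 0" using up_right[OF s] by force
  have "continuous_on {s..t} (\<lambda>t. - fst (u t))" by (intro continuous_on_minus u_fst_cont)
  then obtain t1 where t1: "s < t1" "- fst (u t1) = 0" "\<And>r. s < r \<Longrightarrow> r < t1 \<Longrightarrow> - fst (u r) < 0"
    using first_zero[of s t "\<lambda>t. - fst (u t)" e] e later by auto
  obtain y where y: "u t1 = (0, y)" using t1(2) by (metis prod.collapse neg_equal_0_iff_equal)
  have yp: "y > 0" "y > b" "(u has_vector_derivative ZR (u t1)) (at_left t1)"
  proof -
    have "\<not> y < 0"
    proof
      assume "y < 0"
      then obtain e where e: "e > 0" "\<And>r. t1 - e < r \<Longrightarrow> r < t1 \<Longrightarrow> fst (u r) < 0" using up_left[OF y] by blast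
      define r where "r = t1 - min e (t1 - s) / 2"
      have "t1 - e < r" "s < r" "r < t1" using e(1) t1(1) by (auto simp: r_def min_def field_simps)
      then show False using e(2)[of r] t1(3)[of r] by simp
    qed
    then show "y > 0" "y > b" "(u has_vector_derivative ZR (u t1)) (at_left t1)" using u_cross[OF y] by auto
  qed
  have y1b: "y1 < b" using u_cross[OF s(1)] s(2) by auto
  define \<tau> where "\<tau> = t1 - s"
  have \<tau>: "\<tau> > 0" "s + \<tau> = t1" using t1(1) by (auto simp: \<tau>_def)
  have "solves_on ZR {s..t1} u" unfolding solves_on_def
  proof
    fix r assume r: "r \<in> {s..t1}"
    consider "r = s" | "r = t1" | "s < r" "r < t1" using r by force
    then show "(u has_vector_derivative ZR (u r)) (at r within {s..t1})"
    proof cases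
      case 1
      have "(u has_vector_derivative ZR (u s)) (at_right s)" using u_cross[OF s(1)] s(2) by auto
      then show ?thesis using 1 t1(1) by (simp add: at_within_Icc_at_right)
    next
      case 2
      then show ?thesis using yp(3) t1(1) by (simp add: at_within_Icc_at_left)
    next
      case 3
      then have "fst (u r) > 0" using t1(3)[OF 3] by simp
      then show ?thesis using u_pos by (rule_tac has_vector_derivative_at_within)
    qed
  qed
  then have "solves_on (lin_field TR DR aR 0) {s..t1} (\<lambda>t. u t - (0, b))" unfolding shift_b_solves[of TR DR aR b] .
  from reflect_x_solves[OF this, of t1]
  have sol: "solves_on (lin_field (- TR) DR (- aR) 0) {0..\<tau>} (\<lambda>t. (- fst (u (t1 - t)), snd (u (t1 - t)) - b))"
    by (simp add: reflect_interval \<tau>_def)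
  let ?v = "\<lambda>t. (- fst (u (t1 - t)), snd (u (t1 - t)) - b)"
  have v0: "?v 0 = (0, y - b)" and v1: "?v \<tau> = (0, y1 - b)" using y s(1) \<tau> by (simp_all add: \<tau>_def)
  have fl: "?v r = left_orbit (- TR) DR (- aR) (y - b) r" if "r \<in> {0..\<tau>}" for r
    using flow_unique[OF sol v0 that] .
  have neg: "fst (?v r) < 0" if "0 < r" "r < \<tau>" for r using t1(3)[of "t1 - r"] that \<tau> by auto
  have "left_return (- TR) DR (- aR) (y - b) (y1 - b)" unfolding left_return_def
    by (intro exI[of _ ?v] exI[of _ \<tau>] conjI ballI \<tau> sol v0 v1) (use neg in auto)
  then have J: "y - b \<in> JR" "fR (y - b) = y1 - b" using ret_dom_of_neg_return[of "- TR" DR "- aR" "y - b" "y1 - b"] yp(2) y1b by auto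
  have "returns_at (- TR) DR (- aR) (y - b) \<tau>" unfolding returns_at_def
  proof (intro conjI allI impI)
    fix r assume r: "0 < r \<and> r < \<tau>"
    show "xpos (- TR) DR (- aR) (y - b) r < 0" using neg[of r] fl[of r] r by (simp add: left_orbit_def)
  qed (use \<tau> fl[of \<tau>] v1 in \<open>auto simp: left_orbit_def\<close>)
  then have t: "tR (y - b) = \<tau>" by (rule return_time_eq)
  have "u (s + tR (y - b) - r) = right_orbit TR DR aR b y r" if r: "r \<in> {0..tR (y - b)}" for r
  proof -
    have "s + tR (y - b) - r = t1 - r" using t \<tau> by simp
    then show ?thesis using fl[of r] r t unfolding right_orbit_def by (metis add.inverse_inverse diff_add_cancel fst_conv prod.collapse snd_conv)
  qed
  then show ?thesis using J yp y t \<tau> by (intro exI[of _ y]) auto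
qed

lemma full_passage:
  assumes s: "u s = (0, y)" "y > 0" and p: "p > 0" "\<And>t. u (t + p) = u t"
  shows "y \<in> JL \<and> (\<exists>y'. y' > 0 \<and> y' > b \<and> y' - b \<in> JR \<and> fR (y' - b) + b = fL y \<and> u (s + (tL y + tR (y' - b))) = (0, y') \<and>
    u ` {s..s + (tL y + tR (y' - b))} = left_orbit TL DL aL y ` {0..tL y} \<union> right_orbit TR DR aR b y' ` {0..tR (y' - b)})"
proof -
  have later: "\<exists>t>s. fst (u t) = 0" if "fst (u s) = 0" for s using that p by (intro exI[of _ "s + p"]) auto
  obtain t where "s < t" "fst (u t) = 0" using later[of s] s by auto
  note L = left_passage[OF s this]
  then have J: "y \<in> JL" "u (s + tL y) = (0, fL y)" "\<And>r. r \<in> {0..tL y} \<Longrightarrow> u (s + r) = left_orbit TL DL aL y r" by auto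
  have fn: "fL y < 0" "tL y > 0" using ret_domD[OF J(1)] by auto
  obtain t where t: "s + tL y < t" "fst (u t) = 0" using later[of "s + tL y"] J by auto
  obtain y' where y': "y' > 0" "y' > b" "y' - b \<in> JR" "fR (y' - b) + b = fL y" "u (s + tL y + tR (y' - b)) = (0, y')"
    "\<And>r. r \<in> {0..tR (y' - b)} \<Longrightarrow> u (s + tL y + tR (y' - b) - r) = right_orbit TR DR aR b y' r"
    using right_passage[OF J(2) fn(1) t] by blast
  have tp: "tR (y' - b) > 0" using ret_domD[OF y'(3)] by auto
  let ?e = "s + tL y + tR (y' - b)"
  have i1: "{s..s + tL y} = (+) s ` {0..tL y}" by (simp add: image_add_atLeastAtMost)
  have i2: "{s + tL y..?e} = (\<lambda>r. ?e - r) ` {0..tR (y' - b)}" by (simp add: reflect_interval)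
  have "u ` {s..?e} = u ` {s..s + tL y} \<union> u ` {s + tL y..?e}"
  proof -
    have "{s..?e} = {s..s + tL y} \<union> {s + tL y..?e}" using fn(2) tp by auto
    then show ?thesis by (metis image_Un)
  qed
  also have "u ` {s..s + tL y} = left_orbit TL DL aL y ` {0..tL y}" unfolding i1 image_image using J(3) by (intro image_cong) auto
  also have "u ` {s + tL y..?e} = right_orbit TR DR aR b y' ` {0..tR (y' - b)}" unfolding i2 image_image using y'(6) by (intro image_cong) auto
  finally have "u ` {s..?e} = left_orbit TL DL aL y ` {0..tL y} \<union> right_orbit TR DR aR b y' ` {0..tR (y' - b)}" .
  then show ?thesis using J y' by (simp add: add.assoc) blast
qed

text \<open>
  The upper crossings of a periodic orbit form a compact set, which the monotone first return map \<open>P\<close> sends into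
  itself. Such a map has a fixed point, and this is a zero of the displacement.
\<close>

lemma periodic_orbit_is_loop:
  assumes p: "p > 0" "\<And>t. u (t + p) = u t" and hit: "\<exists>t. fst (u t) = 0"
  shows "\<exists>z. per_zero z \<and> range u = loop z"
proof -
  have pn: "u (t + real n * p) = u t" for t n
  proof (induction n)
    case (Suc n)
    have "u (t + real (Suc n) * p) = u (t + real n * p + p)" by (simp add: algebra_simps)
    then show ?case using p(2) Suc by simp
  qed simp
  have ran: "range u = u ` {s..}" for s
  proof
    show "range u \<subseteq> u ` {s..}"
    proof
      fix x assume "x \<in> range u"
      then obtain t where t: "x = u t" by blast
      obtain n where "s - t < real n * p" using p(1) reals_Archimedean3 by blast
      then have "t + real n * p \<in> {s..}" by auto
      then show "x \<in> u ` {s..}" using pn[of t n] t by (metis imageI)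
    qed
  qed auto
  have ran0: "range u = u ` {0..p}"
  proof
    show "range u \<subseteq> u ` {0..p}"
    proof
      fix x assume "x \<in> range u"
      then obtain t where t: "x = u t" "t \<ge> 0" using ran[of 0] by auto
      define n where "n = nat \<lfloor>t / p\<rfloor>"
      have n: "real n = \<lfloor>t / p\<rfloor>" using t p by (simp add: n_def)
      have "real n \<le> t / p" "t / p < real n + 1" unfolding n by linarith+
      then have "real n * p \<le> t" "t \<le> (real n + 1) * p" using p by (simp_all add: field_simps)
      then have "t - real n * p \<in> {0..p}" by (simp add: algebra_simps)
      moreover have "x = u (t - real n * p)" using pn[of "t - real n * p" n] t by simp
      ultimately show "x \<in> u ` {0..p}" by blast
    qed
  qed auto
  define A where "A = {y. (0, y) \<in> range u \<and> y \<ge> max 0 b}"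
  have hitA: "\<exists>t. u t = (0, y)" if "y \<in> A" for y
  proof -
    have "(0, y) \<in> range u" using that by (simp add: A_def)
    then show ?thesis by (metis rangeE)
  qed
  have Ap: "y > 0 \<and> y > b" if yA: "y \<in> A" for y
  proof -
    obtain t where "u t = (0, y)" using hitA[OF yA] by blast
    then show ?thesis using u_cross[of t y] yA by (auto simp: A_def)
  qed
  have "compact (range u)" unfolding ran0
    by (intro compact_continuous_image continuous_at_imp_continuous_on ballI u_cont) auto
  then have cr: "closed (range u)" "bounded (range u)" by (auto simp: compact_eq_bounded_closed)
  have "A = Pair 0 -` range u \<inter> {max 0 b..}" by (auto simp: A_def)
  moreover have "closed (Pair (0::real) -` range u)" by (rule closed_vimage[OF cr(1)]) (intro continuous_intros)
  ultimately have Acl: "closed A" by (metis closed_Int closed_atLeast)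
  have "bounded (snd ` range u)" by (rule bounded_snd[OF cr(2)])
  moreover have "A \<subseteq> snd ` range u"
  proof
    fix y assume "y \<in> A"
    then have "(0, y) \<in> range u" by (simp add: A_def)
    then show "y \<in> snd ` range u" by (metis imageI snd_conv)
  qed
  ultimately have Abd: "bounded A" using bounded_subset by blast
  have step: "y \<in> JL \<and> (\<exists>y'. y' \<in> A \<and> y' - b \<in> JR \<and> fR (y' - b) + b = fL y)" if yA: "y \<in> A" for y
  proof -
    obtain s where "u s = (0, y)" using hitA[OF yA] by blast
    from full_passage[OF this _ p] Ap[OF yA] obtain y' where y': "y \<in> JL" "y' > 0" "y' > b" "y' - b \<in> JR" "fR (y' - b) + b = fL y"
      "u (s + (tL y + tR (y' - b))) = (0, y')" by blast
    then have "(0, y') \<in> range u" by (metis rangeI)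
    then show ?thesis using y' by (auto simp: A_def)
  qed
  then obtain P where P: "\<And>y. y \<in> A \<Longrightarrow> y \<in> JL \<and> P y \<in> A \<and> P y - b \<in> JR \<and> fR (P y - b) + b = fL y" by metis
  have Pmono: "P x \<le> P y" if xy: "x \<in> A" "y \<in> A" "x \<le> y" for x y
  proof (rule ccontr)
    assume "\<not> ?thesis"
    then have "fR (P x - b) < fR (P y - b)" using half_return_decreasing[OF admR', of "P y - b" "P x - b"] P xy by auto
    moreover have "fL y \<le> fL x" using half_return_decreasing[OF admL, of x y] P xy by (cases "x = y") auto
    ultimately show False using P[OF xy(1)] P[OF xy(2)] by simp
  qed
  have Ane: "A \<noteq> {}"
  proof -
    obtain t y where t: "u t = (0, y)" using hit by (metis prod.collapse)
    show ?thesis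
    proof (cases "y > 0")
      case True
      then have "y > b" using u_cross[OF t] by auto
      moreover have "(0, y) \<in> range u" using t by (metis rangeI)
      ultimately have "y \<in> A" using True by (simp add: A_def)
      then show ?thesis by blast
    next
      case False
      then have "y < 0" using u_cross[OF t] by auto
      moreover have "t < t + p" "fst (u (t + p)) = 0" using p t by auto
      ultimately obtain y' where "y' > 0" "y' > b" "u (t + tR (y' - b)) = (0, y')" using right_passage[OF t] by blast
      moreover from this have "(0, y') \<in> range u" by (metis rangeI)
      ultimately have "y' \<in> A" by (simp add: A_def)
      then show ?thesis by blast
    qed
  qed
  \<comment> \<open>The supremum of the points that P does not decrease is a fixed point, as for a monotone map of a complete lattice.\<close>
  define Bs where "Bs = {a \<in> A. a \<le> P a}"
  have "compact A" using Acl Abd by (simp add: compact_eq_bounded_closed)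
  then obtain mn where mn: "mn \<in> A" "\<And>y. y \<in> A \<Longrightarrow> mn \<le> y" using compact_attains_inf[OF _ Ane] by blast
  have Bne: "Bs \<noteq> {}" using mn P by (auto simp: Bs_def)
  have Bbd: "bdd_above Bs" using Abd by (auto simp: Bs_def intro: bdd_above_mono[OF bounded_imp_bdd_above])
  define M where "M = Sup Bs"
  have MA: "M \<in> A"
  proof -
    have "M \<in> closure Bs" unfolding M_def by (rule closure_contains_Sup[OF Bne Bbd])
    moreover have "closure Bs \<subseteq> A" by (rule closure_minimal[OF _ Acl]) (auto simp: Bs_def)
    ultimately show ?thesis by blast
  qed
  have "M \<le> P M" unfolding M_def
  proof (rule cSup_least[OF Bne])
    fix a assume a: "a \<in> Bs"
    then have "a \<le> M" unfolding M_def by (rule cSup_upper[OF _ Bbd])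
    then have "P a \<le> P M" using Pmono MA a by (auto simp: Bs_def)
    then show "a \<le> P (Sup Bs)" using a by (auto simp: Bs_def M_def)
  qed
  moreover have "P M \<le> M"
  proof -
    have "P M \<in> Bs" using P[OF MA] Pmono[OF MA _ \<open>M \<le> P M\<close>] by (auto simp: Bs_def)
    then show ?thesis unfolding M_def by (rule cSup_upper[OF _ Bbd])
  qed
  ultimately have PM: "P M = M" by simp
  have zM: "per_zero M" using P[OF MA] PM by (auto simp: per_zero_def)
  define \<sigma> where "\<sigma> = tL M + tR (M - b)"
  have \<sigma>0: "\<sigma> > 0" using zM ret_domD(4)[of M TL DL aL] ret_domD(4)[of "M - b" "- TR" DR "- aR"] by (simp add: \<sigma>_def per_zero_def)
  have lp: "u (s + \<sigma>) = (0, M) \<and> u ` {s..s + \<sigma>} = loop M" if us: "u s = (0, M)" for s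
  proof -
    have "M > 0" using Ap[OF MA] by simp
    from full_passage[OF us this p] obtain y' where y': "y' - b \<in> JR" "fR (y' - b) + b = fL M"
      "u (s + (tL M + tR (y' - b))) = (0, y')"
      "u ` {s..s + (tL M + tR (y' - b))} = left_orbit TL DL aL M ` {0..tL M} \<union> right_orbit TR DR aR b y' ` {0..tR (y' - b)}" by blast
    have "fR (y' - b) = fR (M - b)" using y'(2) zM by (simp add: per_zero_def)
    then have "y' = M" using half_return_decreasing[OF admR', of "y' - b" "M - b"] half_return_decreasing[OF admR', of "M - b" "y' - b"] y'(1) zM
      by (cases y' M rule: linorder_cases) (auto simp: per_zero_def)
    then show ?thesis using y' by (simp add: \<sigma>_def loop_def)
  qed
  obtain s where s: "u s = (0, M)" using hitA[OF MA] by blast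
  have sn: "u (s + real n * \<sigma>) = (0, M)" for n
  proof (induction n)
    case (Suc n)
    have eq: "s + real (Suc n) * \<sigma> = s + real n * \<sigma> + \<sigma>" by (simp add: algebra_simps)
    show ?case unfolding eq using lp[OF Suc] by (rule conjunct1)
  qed (simp add: s)
  have "range u = loop M"
  proof
    show "loop M \<subseteq> range u" using lp[OF s] by auto
    show "range u \<subseteq> loop M"
    proof
      fix x assume "x \<in> range u"
      then obtain t where t: "x = u t" "t \<ge> s" using ran[of s] by auto
      define n where "n = nat \<lfloor>(t - s) / \<sigma>\<rfloor>"
      have n: "real n = \<lfloor>(t - s) / \<sigma>\<rfloor>" using t \<sigma>0 by (simp add: n_def)
      have "real n \<le> (t - s) / \<sigma>" "(t - s) / \<sigma> < real n + 1" unfolding n by linarith+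
      then have "real n * \<sigma> \<le> t - s" "t - s \<le> (real n + 1) * \<sigma>" using \<sigma>0 by (simp_all add: field_simps)
      then have "t \<in> {s + real n * \<sigma>..s + real n * \<sigma> + \<sigma>}" by (simp add: algebra_simps)
      then have "x \<in> u ` {s + real n * \<sigma>..s + real n * \<sigma> + \<sigma>}" using t by blast
      then show "x \<in> loop M" using lp[OF sn[of n]] by simp
    qed
  qed
  then show ?thesis using zM by blast
qed

end

text \<open>
  The periodic solution runs through the left segment and then through the right one, reversed.
\<close>

lemma loop_is_periodic_orbit:
  assumes z: "per_zero z" shows "crossing_periodic_orbit ZL ZR (loop z)"
proof -
  have J: "z \<in> JL" "z - b \<in> JR" "fR (z - b) + b = fL z" using z by (auto simp: per_zero_def)
  note L = ret_domD[OF J(1)] note R = ret_domD[OF J(2)]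
  define t1 where "t1 = tL z"
  define \<sigma> where "\<sigma> = tL z + tR (z - b)"
  have t1: "0 < t1" "t1 < \<sigma>" "\<sigma> - t1 = tR (z - b)" using L R by (auto simp: t1_def \<sigma>_def)
  define wl where "wl = left_orbit TL DL aL z"
  define wr where "wr = (\<lambda>t. right_orbit TR DR aR b z (\<sigma> - t))"
  have wld: "(wl has_vector_derivative ZL (wl t)) (at t)" for t
    using left_orbit_solves[of TL DL aL UNIV z] by (simp add: solves_on_def wl_def)
  have wrd: "(wr has_vector_derivative ZR (wr t)) (at t)" for t
    using right_orbit_solves[of TR DR aR b UNIV z \<sigma>] by (simp add: solves_on_def wr_def)
  have ends: "wl 0 = (0, z)" "wl t1 = (0, fL z)" "wr t1 = (0, fL z)" "wr \<sigma> = (0, z)"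
    using L(5) R(5) J(3) by (simp_all add: wl_def wr_def left_orbit_def right_orbit_def t1_def \<sigma>_def half_return_def)
  have wln: "fst (wl t) < 0" if "0 < t" "t < t1" for t
    using L(2) that by (auto simp: wl_def left_orbit_def returns_at_def t1_def)
  have wrp: "fst (wr t) > 0" if "t1 < t" "t < \<sigma>" for t
  proof -
    have "0 < \<sigma> - t" "\<sigma> - t < tR (z - b)" using that t1 by auto
    then show ?thesis using R(2) by (auto simp: wr_def right_orbit_def left_orbit_def returns_at_def)
  qed
  have zz: "z > 0" "z > b" "fL z < 0" "fL z < b" using L(1,6) R(1,6) J(3) by auto
  define U where "U = (\<lambda>t. if t \<le> t1 then wl t else wr t)"
  define n where "n = (\<lambda>t::real. real_of_int \<lfloor>t / \<sigma>\<rfloor>)"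
  define u where "u = (\<lambda>t. U (t - n t * \<sigma>))"
  have \<sigma>0: "\<sigma> > 0" using t1 by simp
  have nt: "0 \<le> t - n t * \<sigma>" "t - n t * \<sigma> < \<sigma>" for t
  proof -
    have "n t \<le> t / \<sigma>" "t / \<sigma> < n t + 1" unfolding n_def by linarith+
    then show "0 \<le> t - n t * \<sigma>" "t - n t * \<sigma> < \<sigma>" using \<sigma>0 by (simp_all add: field_simps)
  qed
  have n_eq: "n t = real_of_int k" if "real_of_int k * \<sigma> \<le> t" "t < (real_of_int k + 1) * \<sigma>" for t k
  proof -
    have "\<lfloor>t / \<sigma>\<rfloor> = k" using that \<sigma>0 by (intro floor_unique) (simp_all add: field_simps)
    then show ?thesis by (simp add: n_def)
  qed
  have ueq: "u t = (if t - real_of_int k * \<sigma> \<le> t1 then wl (t - real_of_int k * \<sigma>) else wr (t - real_of_int k * \<sigma>))"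
    if "real_of_int k * \<sigma> \<le> t" "t < (real_of_int k + 1) * \<sigma>" for t k
    using n_eq[OF that] by (simp add: u_def U_def)
  have ueq': "u t = wr (t - real_of_int k * \<sigma>)" if t: "real_of_int k * \<sigma> + t1 \<le> t" "t \<le> (real_of_int k + 1) * \<sigma>" for t k
  proof (cases "t = (real_of_int k + 1) * \<sigma>")
    case True
    have "u t = wl 0" using ueq[of "k + 1" t] True \<sigma>0 t1 by (simp add: algebra_simps)
    moreover have "t - real_of_int k * \<sigma> = \<sigma>" using True by (simp add: algebra_simps)
    ultimately show ?thesis using ends by simp
  next
    case False
    then show ?thesis using ueq[of k t] t t1 ends by (cases "t - real_of_int k * \<sigma> = t1") auto
  qed
  have ueql: "u t = wl (t - real_of_int k * \<sigma>)" if t: "real_of_int k * \<sigma> \<le> t" "t \<le> real_of_int k * \<sigma> + t1" for t k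
    using ueq[of k t] t t1 by (simp add: algebra_simps)
  have shl: "((\<lambda>t. wl (t - c)) has_vector_derivative ZL (wl (t - c))) (at t)" for t c
    using solves_shift[of ZL "- c" UNIV wl] wld by (simp add: solves_on_def)
  have shr: "((\<lambda>t. wr (t - c)) has_vector_derivative ZR (wr (t - c))) (at t)" for t c
    using solves_shift[of ZR "- c" UNIV wr] wrd by (simp add: solves_on_def)
  have per: "u (t + \<sigma>) = u t" for t
  proof -
    have "(t + \<sigma>) / \<sigma> = t / \<sigma> + 1" using \<sigma>0 by (simp add: field_simps)
    then have "n (t + \<sigma>) = n t + 1" by (simp add: n_def)
    then have "t + \<sigma> - n (t + \<sigma>) * \<sigma> = t - n t * \<sigma>" by (simp add: algebra_simps)
    then show ?thesis unfolding u_def by (rule arg_cong)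
  qed
  have cs: "crossing_solution ZL ZR u" unfolding crossing_solution_def Let_def
  proof
    fix t
    define k where "k = \<lfloor>t / \<sigma>\<rfloor>"
    define r where "r = t - real_of_int k * \<sigma>"
    have r: "0 \<le> r" "r < \<sigma>" using nt[of t] by (simp_all add: r_def n_def k_def)
    have t: "t = real_of_int k * \<sigma> + r" by (simp add: r_def)
    consider "r = 0" | "0 < r" "r < t1" | "r = t1" | "t1 < r" using r by force
    then show "(fst (u t) < 0 \<longrightarrow> (u has_vector_derivative ZL (u t)) (at t)) \<and>
         (0 < fst (u t) \<longrightarrow> (u has_vector_derivative ZR (u t)) (at t)) \<and>
         (fst (u t) = 0 \<longrightarrow>
          fst (ZL (u t)) < 0 \<and> fst (ZR (u t)) < 0 \<and> (u has_vector_derivative ZR (u t)) (at_left t) \<and> (u has_vector_derivative ZL (u t)) (at_right t) \<or>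
          0 < fst (ZL (u t)) \<and> 0 < fst (ZR (u t)) \<and> (u has_vector_derivative ZL (u t)) (at_left t) \<and> (u has_vector_derivative ZR (u t)) (at_right t))"
    proof cases
      case 1
      have ut: "u t = (0, z)" using ueql[of k t] t 1 t1 ends by simp
      have "(u has_vector_derivative ZL (wl (t - real_of_int k * \<sigma>))) (at_right t)"
        by (rule has_vector_derivative_join(2)[OF shl t1(1)]) (use t 1 in \<open>auto intro!: ueql\<close>)
      moreover have "(u has_vector_derivative ZR (wr (t - real_of_int (k - 1) * \<sigma>))) (at_left t)"
      proof (rule has_vector_derivative_join(1)[OF shr])
        show "\<sigma> - t1 > 0" using t1 by simp
        fix s assume "t - (\<sigma> - t1) < s" "s \<le> t"
        then show "u s = wr (s - real_of_int (k - 1) * \<sigma>)" using t 1 by (intro ueq') (auto simp: algebra_simps)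
      qed
      moreover have "wl (t - real_of_int k * \<sigma>) = (0, z)" "wr (t - real_of_int (k - 1) * \<sigma>) = (0, z)"
        using t 1 ends by (simp_all add: algebra_simps)
      ultimately show ?thesis using ut zz by (simp add: fst_Z)
    next
      case 2
      have ut: "u t = wl (t - real_of_int k * \<sigma>)" using t 2 by (intro ueql) auto
      have "(u has_vector_derivative ZL (wl (t - real_of_int k * \<sigma>))) (at t)"
      proof (rule has_vector_derivative_join(3)[OF shl])
        show "min r (t1 - r) > 0" using 2 by simp
        fix s assume "t - min r (t1 - r) < s" "s < t + min r (t1 - r)"
        then show "u s = wl (s - real_of_int k * \<sigma>)" using t by (intro ueql) auto
      qed
      moreover have "fst (u t) < 0" unfolding ut using wln[of r] 2 t by simp
      ultimately show ?thesis using ut by simp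
    next
      case 3
      have ut: "u t = (0, fL z)" using ueql[of k t] t 3 t1 ends by simp
      have "(u has_vector_derivative ZL (wl (t - real_of_int k * \<sigma>))) (at_left t)"
        by (rule has_vector_derivative_join(1)[OF shl t1(1)]) (use t 3 in \<open>auto intro!: ueql\<close>)
      moreover have "(u has_vector_derivative ZR (wr (t - real_of_int k * \<sigma>))) (at_right t)"
      proof (rule has_vector_derivative_join(2)[OF shr])
        show "\<sigma> - t1 > 0" using t1 by simp
        fix s assume "t \<le> s" "s < t + (\<sigma> - t1)"
        then show "u s = wr (s - real_of_int k * \<sigma>)" using t 3 by (intro ueq') (auto simp: algebra_simps)
      qed
      moreover have "wl (t - real_of_int k * \<sigma>) = (0, fL z)" "wr (t - real_of_int k * \<sigma>) = (0, fL z)"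
        using t 3 ends by simp_all
      ultimately show ?thesis using ut zz by (simp add: fst_Z)
    next
      case 4
      have ut: "u t = wr (t - real_of_int k * \<sigma>)" using t 4 r by (intro ueq') (auto simp: algebra_simps)
      have "(u has_vector_derivative ZR (wr (t - real_of_int k * \<sigma>))) (at t)"
      proof (rule has_vector_derivative_join(3)[OF shr])
        show "min (r - t1) (\<sigma> - r) > 0" using 4 r by simp
        fix s assume "t - min (r - t1) (\<sigma> - r) < s" "s < t + min (r - t1) (\<sigma> - r)"
        then show "u s = wr (s - real_of_int k * \<sigma>)" using t by (intro ueq') (auto simp: algebra_simps)
      qed
      moreover have "fst (u t) > 0" unfolding ut using wrp[of r] 4 r t by simp
      ultimately show ?thesis using ut by simp
    qed
  qed
  have "range u = loop z"
  proof
    show "range u \<subseteq> loop z"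
    proof
      fix x assume "x \<in> range u"
      then obtain t where t: "x = u t" by blast
      define r where "r = t - n t * \<sigma>"
      have r: "0 \<le> r" "r < \<sigma>" using nt[of t] by (simp_all add: r_def)
      have x: "x = U r" by (simp add: t u_def r_def)
      show "x \<in> loop z"
      proof (cases "r \<le> t1")
        case True
        then show ?thesis unfolding x U_def loop_def wl_def using r t1_def by auto
      next
        case False
        then have "\<sigma> - r \<in> {0..tR (z - b)}" using r t1 by auto
        then show ?thesis unfolding x U_def loop_def wr_def using False by auto
      qed
    qed
    show "loop z \<subseteq> range u"
    proof
      fix x assume "x \<in> loop z"
      then consider t where "t \<in> {0..t1}" "x = wl t" | t where "t \<in> {0..tR (z - b)}" "x = right_orbit TR DR aR b z t"
        unfolding loop_def wl_def t1_def by blast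
      then show "x \<in> range u"
      proof cases
        case 1
        then have "u t = x" using ueql[of 0 t] by simp
        then show ?thesis by blast
      next
        case 2
        then have "u (\<sigma> - t) = wr (\<sigma> - t)" using ueq'[of 0 "\<sigma> - t"] t1 by simp
        then have "u (\<sigma> - t) = x" using 2 by (simp add: wr_def)
        then show ?thesis by blast
      qed
    qed
  qed
  moreover have "\<exists>t. fst (u t) = 0" using ueql[of 0 0] t1 ends by (intro exI[of _ 0]) simp
  ultimately show ?thesis unfolding crossing_periodic_orbit_def using \<sigma>0 cs per by blast
qed

lemma loop_line: assumes z: "per_zero z" and y: "(0, y) \<in> loop z" "y > 0" shows "y = z"
proof -
  have J: "z \<in> JL" "z - b \<in> JR" "fR (z - b) + b = fL z" using z by (auto simp: per_zero_def)
  note L = ret_domD[OF J(1)] note R = ret_domD[OF J(2)]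
  consider t where "t \<in> {0..tL z}" "(0, y) = left_orbit TL DL aL z t" | t where "t \<in> {0..tR (z - b)}" "(0, y) = right_orbit TR DR aR b z t"
    using y(1) unfolding loop_def by blast
  then show ?thesis
  proof cases
    case 1
    then have x0: "xpos TL DL aL z t = 0" "y = - xvel TL DL aL z t" by (auto simp: left_orbit_def)
    have "\<not> (0 < t \<and> t < tL z)" using L(2) x0(1) by (auto simp: returns_at_def)
    then have "t = 0 \<or> t = tL z" using 1(1) by auto
    then show ?thesis using x0(2) y(2) L(3) by auto
  next
    case 2
    then have x0: "xpos (- TR) DR (- aR) (z - b) t = 0" "y = - xvel (- TR) DR (- aR) (z - b) t + b" by (auto simp: right_orbit_def left_orbit_def)
    have "\<not> (0 < t \<and> t < tR (z - b))" using R(2) x0(1) by (auto simp: returns_at_def)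
    then have "t = 0 \<or> t = tR (z - b)" using 2(1) by auto
    then show ?thesis using x0(2) y(2) L(6) J(3) by (auto simp: half_return_def)
  qed
qed

lemma left_orbit_cont2: "continuous_on S (\<lambda>p. left_orbit T D a (fst p) (snd p))"
  unfolding left_orbit_def xpos_def xvel_def
  by (intro continuous_intros continuous_on_compose2[OF alp_cont[of UNIV]] continuous_on_compose2[OF alp'_cont[of UNIV]]
    continuous_on_compose2[OF bet_cont[of UNIV]]) auto

text \<open>
  The times up to the return are rescaled to the compact interval from 0 to 1, and the tube lemma applies.
\<close>

lemma flow_tube:
  assumes M: "M \<in> ret_dom T D a" and V: "open V" and sub: "\<And>t. t \<in> {0..return_time T D a M} \<Longrightarrow> h (left_orbit T D a M t) \<in> V"
    and h: "continuous_on UNIV h"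
  shows "\<exists>e>0. \<forall>z\<in>ret_dom T D a. \<bar>z - M\<bar> < e \<longrightarrow> h ` left_orbit T D a z ` {0..return_time T D a z} \<subseteq> V"
proof -
  let ?J = "ret_dom T D a"
  have rc: "continuous_on ?J (return_time T D a)" by (intro continuous_at_imp_continuous_on ballI return_time_isCont)
  let ?F = "\<lambda>p. h (left_orbit T D a (snd p) (fst p * return_time T D a (snd p)))"
  let ?I = "{0..1::real}"
  have "continuous_on (?I \<times> ?J) (\<lambda>p. (snd p, fst p * return_time T D a (snd p)))"
    by (intro continuous_intros continuous_on_compose2[OF rc]) auto
  from continuous_on_compose2[OF left_orbit_cont2[of UNIV T D a] this]
  have "continuous_on (?I \<times> ?J) (\<lambda>p. left_orbit T D a (snd p) (fst p * return_time T D a (snd p)))" by simp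
  from continuous_on_compose2[OF h this] have Fc: "continuous_on (?I \<times> ?J) ?F" by simp
  let ?U = "(?I \<times> ?J) \<inter> ?F -` V"
  have W: "openin (top_of_set (?I \<times> ?J)) ?U" by (rule continuous_openin_preimage_gen[OF Fc V])
  have slice: "(\<lambda>x. (x, M)) ` ?I \<subseteq> ?U"
  proof
    fix p assume "p \<in> (\<lambda>x. (x, M)) ` ?I"
    then obtain r where r: "p = (r, M)" "0 \<le> r" "r \<le> 1" by auto
    have "r * return_time T D a M \<in> {0..return_time T D a M}" using r ret_domD(4)[OF M] by (auto simp: mult_left_le_one_le)
    then show "p \<in> ?U" using sub M r by auto
  qed
  obtain X0 where X0: "openin (top_of_set ?J) X0" "M \<in> X0" "?I \<times> X0 \<subseteq> ?U"
    by (rule tube_lemma[OF compact_Icc _ slice W]) auto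
  have "open X0" using X0(1) openin_open_eq[OF ret_dom_open] by blast
  then obtain e where e: "e > 0" "\<And>z. \<bar>z - M\<bar> < e \<Longrightarrow> z \<in> X0" using X0(2) unfolding open_dist dist_real_def by blast
  show ?thesis
  proof (intro exI[of _ e] conjI ballI impI subsetI)
    fix z x assume z: "z \<in> ?J" "\<bar>z - M\<bar> < e" "x \<in> h ` left_orbit T D a z ` {0..return_time T D a z}"
    then obtain t where t: "0 \<le> t" "t \<le> return_time T D a z" "x = h (left_orbit T D a z t)" by auto
    have "return_time T D a z > 0" using ret_domD(4)[OF z(1)] .
    then have "t / return_time T D a z \<in> {0..1}" using t by (auto simp: field_simps)
    then have "(t / return_time T D a z, z) \<in> ?I \<times> X0" using e(2) z(2) by auto
    then have "?F (t / return_time T D a z, z) \<in> V" using X0(3) by blast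
    then show "x \<in> V" using t \<open>return_time T D a z > 0\<close> by simp
  qed (rule e)
qed

text \<open>
  The loop of a nearby zero would be a periodic orbit in the neighbourhood \<open>V\<close>, hence the
  same orbit, and a loop meets the line at one point with \<open>y > 0\<close> only.
\<close>

lemma limit_cycle_isolated_zero:
  assumes "crossing_limit_cycle ZL ZR \<Gamma>"
  shows "\<exists>z. per_zero z \<and> \<Gamma> = loop z \<and> (\<exists>e>0. \<forall>z'. per_zero z' \<and> \<bar>z' - z\<bar> < e \<longrightarrow> z' = z)"
proof -
  obtain u p where u: "p > 0" "crossing_solution ZL ZR u" "\<forall>t. u (t + p) = u t" "\<exists>t. fst (u t) = 0" "\<Gamma> = range u"
    using assms unfolding crossing_limit_cycle_def crossing_periodic_orbit_def by blast
  obtain V where V: "open V" "\<Gamma> \<subseteq> V" "\<And>\<Gamma>'. crossing_periodic_orbit ZL ZR \<Gamma>' \<Longrightarrow> \<Gamma>' \<subseteq> V \<Longrightarrow> \<Gamma>' = \<Gamma>"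
    using assms unfolding crossing_limit_cycle_def by blast
  obtain z where z: "per_zero z" "\<Gamma> = loop z" using periodic_orbit_is_loop[OF u(2,1) _ u(4)] u(3,5) by auto
  have J: "z \<in> JL" "z - b \<in> JR" using z(1) by (auto simp: per_zero_def)
  obtain e1 where e1: "e1 > 0" "\<And>z'. z' \<in> JL \<Longrightarrow> \<bar>z' - z\<bar> < e1 \<Longrightarrow> (\<lambda>p. p) ` left_orbit TL DL aL z' ` {0..tL z'} \<subseteq> V"
  proof -
    have "\<exists>e>0. \<forall>z'\<in>JL. \<bar>z' - z\<bar> < e \<longrightarrow> (\<lambda>p. p) ` left_orbit TL DL aL z' ` {0..tL z'} \<subseteq> V"
      by (rule flow_tube[OF J(1) V(1)]) (use V(2) z(2) in \<open>auto simp: loop_def\<close>)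
    then show ?thesis using that by blast
  qed
  let ?h = "\<lambda>p::real\<times>real. (- fst p, snd p + b)"
  have rh: "right_orbit TR DR aR b y ` S = ?h ` left_orbit (- TR) DR (- aR) (y - b) ` S" for y S by (simp add: right_orbit_def image_image)
  have "continuous_on UNIV ?h" by (intro continuous_intros)
  moreover have "?h (left_orbit (- TR) DR (- aR) (z - b) t) \<in> V" if "t \<in> {0..tR (z - b)}" for t
    using V(2) z(2) that unfolding loop_def right_orbit_def by blast
  ultimately obtain e2 where e2: "e2 > 0" "\<And>y. y \<in> JR \<Longrightarrow> \<bar>y - (z - b)\<bar> < e2 \<Longrightarrow> ?h ` left_orbit (- TR) DR (- aR) y ` {0..tR y} \<subseteq> V"
    using flow_tube[OF J(2) V(1), of ?h] by blast
  have "z' = z" if z': "per_zero z'" "\<bar>z' - z\<bar> < min e1 e2" for z'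
  proof -
    have J': "z' \<in> JL" "z' - b \<in> JR" using z'(1) by (auto simp: per_zero_def)
    have "loop z' \<subseteq> V" unfolding loop_def rh using e1(2)[OF J'(1)] e2(2)[OF J'(2)] z'(2) by simp
    then have "loop z' = loop z" using V(3) loop_is_periodic_orbit[OF z'(1)] z(2) by blast
    moreover have "(0, z') \<in> loop z'"
    proof -
      have "left_orbit TL DL aL z' 0 = (0, z')" by (simp add: left_orbit_def)
      moreover have "0 \<in> {0..tL z'}" using ret_domD(4)[OF J'(1)] by simp
      ultimately show ?thesis unfolding loop_def by (metis UnI1 imageI)
    qed
    ultimately show ?thesis using loop_line[OF z(1)] ret_domD(1)[OF J'(1)] by simp
  qed
  then show ?thesis using z e1(1) e2(1) by (intro exI[of _ z] conjI exI[of _ "min e1 e2"]) auto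
qed

end

section \<open>Between two intersections of leaves\<close>

text \<open>
  The first Rolle argument: on a maximal interval where \<open>f1 \<noteq> f2\<close> the graph of \<open>f1\<close> crosses the leaves around
  \<open>f2\<close> in opposite senses at the two ends.
\<close>

lemma rolle_between:
  fixes f1 f2 f1' e :: "real \<Rightarrow> real"
  assumes z: "z < z'" and eq: "f1 z = f2 z" "f1 z' = f2 z'"
    and d1: "\<And>y. y \<in> D \<Longrightarrow> (f1 has_real_derivative f1' y) (at y)" and D: "open D" "{z..z'} \<subseteq> D"
    and c2: "continuous_on {z..z'} f2" and ce: "continuous_on {z..z'} e"
    and leaf: "\<And>y. y \<in> {z..z'} \<Longrightarrow> f1 y = f2 y \<Longrightarrow> leaf_at g f2 y"
    and sg: "\<And>y. y \<in> {z..z'} \<Longrightarrow> f1 y = f2 y \<Longrightarrow> \<exists>d>0. \<forall>t. \<bar>t - y\<bar> < d \<longrightarrow> sgn (e t) = \<kappa> * sgn (f1' t - g (t, f1 t))"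
    and \<kappa>: "\<kappa> = 1 \<or> \<kappa> = (-1::real)"
  shows "\<exists>y. z < y \<and> y < z' \<and> e y = 0"
proof -
  define h where "h = (\<lambda>y. f1 y - f2 y)"
  have c1: "continuous_on {z..z'} f1" using d1 D(2) by (auto intro!: continuous_at_imp_continuous_on DERIV_isCont)
  have hc: "continuous_on {z..z'} h" unfolding h_def by (intro continuous_intros c1 c2)
  show ?thesis
  proof (cases "\<forall>y. z < y \<and> y < z' \<longrightarrow> h y = 0")
    case True
    define y where "y = (z + z') / 2"
    have y: "z < y" "y < z'" using z by (auto simp: y_def)
    then have fy: "f1 y = f2 y" and yI: "y \<in> {z..z'}" using True by (auto simp: h_def)
    obtain d where "d > 0" and f2': "\<And>s. \<bar>s - y\<bar> < d \<Longrightarrow> (f2 has_real_derivative g (s, f2 s)) (at s)"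
      using leaf[OF yI fy] unfolding leaf_at_def by blast
    have f2d: "(f2 has_real_derivative g (y, f2 y)) (at y)" using f2'[of y] \<open>d > 0\<close> by simp
    have ev: "\<forall>\<^sub>F s in nhds y. f2 s = f1 s"
      using eventually_nhds_in_open[of "{z<..<z'}" y] y True by (auto elim!: eventually_mono simp: h_def)
    have "(f1 has_real_derivative g (y, f2 y)) (at y)" using iffD1[OF DERIV_cong_ev[OF refl ev refl] f2d] .
    moreover have "y \<in> D" using yI D by blast
    ultimately have "f1' y = g (y, f1 y)" using DERIV_unique[OF d1] fy by auto
    moreover obtain d where "d > 0" "\<forall>t. \<bar>t - y\<bar> < d \<longrightarrow> sgn (e t) = \<kappa> * sgn (f1' t - g (t, f1 t))" using sg[OF yI fy] by blast
    ultimately have "sgn (e y) = 0" by simp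
    then show ?thesis using y by (auto simp: sgn_0_0)
  next
    case False
    then obtain w where w: "z < w" "w < z'" "h w \<noteq> 0" by blast
    have "\<exists>s1 s2 \<sigma>. z \<le> s1 \<and> s1 < s2 \<and> s2 \<le> z' \<and> h s1 = 0 \<and> h s2 = 0 \<and> (\<sigma> = 1 \<or> \<sigma> = -1) \<and> (\<forall>t. s1 < t \<and> t < s2 \<longrightarrow> \<sigma> * h t > 0)"
      by (rule maximal_nonzero_interval[OF hc _ _ w]) (use eq in \<open>auto simp: h_def\<close>)
    then obtain s1 s2 \<sigma> where s: "z \<le> s1" "s1 < s2" "s2 \<le> z'" "h s1 = 0" "h s2 = 0"
      and sig: "\<sigma> = 1 \<or> \<sigma> = -1" "\<And>t. s1 < t \<Longrightarrow> t < s2 \<Longrightarrow> \<sigma> * h t > (0::real)" by blast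
    have sI: "s1 \<in> {z..z'}" "s2 \<in> {z..z'}" "f1 s1 = f2 s1" "f1 s2 = f2 s2" using s by (auto simp: h_def)
    obtain e1 where e1: "e1 > 0" "\<And>t. \<bar>t - s1\<bar> < e1 \<Longrightarrow> sgn (e t) = \<kappa> * sgn (f1' t - g (t, f1 t))" using sg[OF sI(1,3)] by blast
    obtain e2 where e2: "e2 > 0" "\<And>t. \<bar>t - s2\<bar> < e2 \<Longrightarrow> sgn (e t) = \<kappa> * sgn (f1' t - g (t, f1 t))" using sg[OF sI(2,4)] by blast
    have dd: "(f1 has_real_derivative f1' t) (at t)" if "z \<le> t" "t \<le> z'" for t using d1[of t] D(2) that by auto
    define d where "d = min (min e1 e2) (s2 - s1)"
    have d: "d > 0" "d \<le> e1" "d \<le> e2" "d \<le> s2 - s1" using e1 e2 s by (auto simp: d_def)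
    have "\<exists>t. s1 < t \<and> t < s1 + d \<and> \<sigma> * (f1' t - g ((\<lambda>t. t) t, f1 t) * (\<lambda>_. 1) t) > 0"
    proof (rule leaf_start[where f = f2 and C = 1])
      show "leaf_at g f2 s1" by (rule leaf[OF sI(1,3)])
      fix t assume t: "s1 \<le> t" "t < s1 + d"
      show "(f1 has_real_derivative f1' t) (at t)" using dd[of t] t d s by auto
    next
      fix t assume t: "s1 < t" "t < s1 + d"
      show "0 < \<sigma> * (f1 t - f2 t)" using sig(2)[of t] t d by (auto simp: h_def)
    qed (use sI d sig(1) in \<open>auto intro: DERIV_ident\<close>)
    then obtain a where a: "s1 < a" "a < s1 + d" "\<sigma> * (f1' a - g (a, f1 a)) > 0" by auto
    have "\<exists>t. s2 - d < t \<and> t < s2 \<and> \<sigma> * (f1' t - g ((\<lambda>t. t) t, f1 t) * (\<lambda>_. 1) t) < 0"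
    proof (rule leaf_end[where f = f2 and C = 1])
      show "leaf_at g f2 s2" by (rule leaf[OF sI(2,4)])
      fix t assume t: "s2 - d < t" "t \<le> s2"
      show "(f1 has_real_derivative f1' t) (at t)" using dd[of t] t d s by auto
    next
      fix t assume t: "s2 - d < t" "t < s2"
      show "0 < \<sigma> * (f1 t - f2 t)" using sig(2)[of t] t d by (auto simp: h_def)
    qed (use sI d sig(1) in \<open>auto intro: DERIV_ident\<close>)
    then obtain b where b: "s2 - d < b" "b < s2" "\<sigma> * (f1' b - g (b, f1 b)) < 0" by auto
    have sa: "sgn (e a) = \<kappa> * \<sigma>" using e1(2)[of a] a d sig(1) by (auto simp: sgn_if split: if_splits)
    have sb: "sgn (e b) = - (\<kappa> * \<sigma>)" using e2(2)[of b] b d sig(1) by (auto simp: sgn_if split: if_splits)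
    have ab: "a \<in> {s1<..<s2}" "b \<in> {s1<..<s2}" using a b d by auto
    have "connected (e ` {s1<..<s2})" by (rule connected_continuous_image[OF continuous_on_subset[OF ce]]) (use s in auto)
    moreover have "e a \<in> e ` {s1<..<s2}" "e b \<in> e ` {s1<..<s2}" using ab by blast+
    moreover have "e a \<le> 0 \<and> 0 \<le> e b \<or> e b \<le> 0 \<and> 0 \<le> e a"
      using sa sb \<kappa> sig(1) by (auto simp: sgn_if split: if_splits)
    ultimately have "0 \<in> e ` {s1<..<s2}" by (meson connectedD_interval)
    then obtain t where "s1 < t" "t < s2" "e t = 0" by auto
    then show ?thesis using s by (intro exI[of _ t]) auto
  qed
qed

text \<open>
  If the two fields are parallel along \<open>f1\<close>, then intersections of the graphs form an open and
  closed set.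
\<close>

lemma leaves_coincide:
  fixes f1 f2 f1' :: "real \<Rightarrow> real"
  assumes D: "open D" "connected D" and d1: "\<And>y. y \<in> D \<Longrightarrow> (f1 has_real_derivative f1' y) (at y)"
    and c2: "continuous_on D f2"
    and leaf: "\<And>y. y \<in> D \<Longrightarrow> f1 y = f2 y \<Longrightarrow> leaf_at g f2 y"
    and tan: "\<And>y. y \<in> D \<Longrightarrow> f1 y = f2 y \<Longrightarrow> \<exists>d>0. \<forall>t. \<bar>t - y\<bar> < d \<longrightarrow> f1' t = g (t, f1 t)"
    and z: "z \<in> D" "f1 z = f2 z" and y: "y \<in> D"
  shows "f1 y = f2 y"
proof -
  have c1: "continuous_on D f1" using d1 by (auto intro!: continuous_at_imp_continuous_on DERIV_isCont)
  have "continuous_on D (\<lambda>y. f1 y - f2 y)" by (intro continuous_intros c1 c2)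
  from continuous_closedin_preimage_constant[OF this, of 0]
  have cl: "closedin (top_of_set D) {y \<in> D. f1 y = f2 y}" by simp
  have "openin (top_of_set D) {y \<in> D. f1 y = f2 y}"
    unfolding openin_euclidean_subtopology_iff
  proof (intro conjI ballI)
    fix x assume "x \<in> {y \<in> D. f1 y = f2 y}"
    then have x: "x \<in> D" "f1 x = f2 x" by auto
    obtain d where d: "d > 0" "\<And>t. \<bar>t - x\<bar> < d \<Longrightarrow> f1' t = g (t, f1 t)" using tan[OF x] by blast
    obtain e where e: "e > 0" "\<And>t. \<bar>t - x\<bar> < e \<Longrightarrow> t \<in> D" using D(1) x(1) unfolding open_dist dist_real_def by blast
    have "\<exists>r>0. r \<le> min d e \<and> (\<forall>t. \<bar>t - x\<bar> < r \<longrightarrow> f1 t = f2 ((\<lambda>t. t) t))"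
    proof (rule leaf_tangent[where f = f2 and ?c0.0 = "\<lambda>t. t" and ?c1.0 = f1 and g = g and c0' = "\<lambda>_. 1" and c1' = f1' and C = 1])
      show "leaf_at g f2 x" by (rule leaf[OF x])
      fix t assume t: "\<bar>t - x\<bar> < min d e"
      show "(f1 has_real_derivative f1' t) (at t)" using d1[OF e(2)] t by auto
      show "f1' t - g (t, f1 t) * 1 = 0" using d(2)[of t] t by simp
    qed (use x d e in \<open>auto intro: DERIV_ident\<close>)
    then obtain r where "r > 0" "\<forall>t. \<bar>t - x\<bar> < r \<longrightarrow> f1 t = f2 t" by auto
    then show "\<exists>e>0. \<forall>x'\<in>D. dist x' x < e \<longrightarrow> x' \<in> {y \<in> D. f1 y = f2 y}" by (auto simp: dist_real_def)
  qed auto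
  then have "{y \<in> D. f1 y = f2 y} = {} \<or> {y \<in> D. f1 y = f2 y} = D"
    using D(2) cl unfolding connected_clopen by blast
  then show ?thesis using y z by blast
qed

lemma leaf_at_cong:
  assumes "leaf_at g f y" and e: "e > 0" "\<And>s w. \<bar>s - y\<bar> < e \<Longrightarrow> \<bar>w - f y\<bar> < e \<Longrightarrow> g (s, w) = g' (s, w)"
  shows "leaf_at g' f y"
proof -
  obtain d K where d: "d > 0" "K \<ge> 0" and f': "\<And>s. \<bar>s - y\<bar> < d \<Longrightarrow> (f has_real_derivative g (s, f s)) (at s)"
    and L: "\<And>s w. \<bar>s - y\<bar> < d \<Longrightarrow> \<bar>w - f y\<bar> < d \<Longrightarrow> \<bar>g (s, w) - g (s, f s)\<bar> \<le> K * \<bar>w - f s\<bar>"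
    using assms(1) unfolding leaf_at_def by blast
  have "isCont f y" using f'[of y] d(1) DERIV_isCont by auto
  then obtain r where r: "r > 0" "\<And>s. \<bar>s - y\<bar> < r \<Longrightarrow> \<bar>f s - f y\<bar> < e"
    using e(1) unfolding continuous_at_real_range real_norm_def by blast
  have ge: "g (s, f s) = g' (s, f s)" if "\<bar>s - y\<bar> < min r e" for s using e(2)[of s "f s"] r(2)[of s] that by simp
  show ?thesis unfolding leaf_at_def
  proof (rule exI[of _ "min (min d e) r"], intro conjI)
    show "0 < min (min d e) r" using d e r by simp
    show "\<exists>K\<ge>0. \<forall>s. \<bar>s - y\<bar> < min (min d e) r \<longrightarrow> (f has_real_derivative g' (s, f s)) (at s) \<and>
      (\<forall>w. \<bar>w - f y\<bar> < min (min d e) r \<longrightarrow> \<bar>g' (s, w) - g' (s, f s)\<bar> \<le> K * \<bar>w - f s\<bar>)"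
    proof (rule exI[of _ K], intro conjI allI impI)
      fix s assume s: "\<bar>s - y\<bar> < min (min d e) r"
      show "(f has_real_derivative g' (s, f s)) (at s)" using f'[of s] ge[of s] s by simp
      fix w assume w: "\<bar>w - f y\<bar> < min (min d e) r"
      show "\<bar>g' (s, w) - g' (s, f s)\<bar> \<le> K * \<bar>w - f s\<bar>" using L[of s w] ge[of s] e(2)[of s w] s w by simp
    qed (rule d)
  qed
qed

lemma leaf_at_shift:
  assumes "leaf_at g f (y - b)"
  shows "leaf_at (\<lambda>p. g (p - (b, b))) (\<lambda>y. f (y - b) + b) y"
proof -
  obtain d K where d: "d > 0" "K \<ge> 0" and f': "\<And>s. \<bar>s - (y - b)\<bar> < d \<Longrightarrow> (f has_real_derivative g (s, f s)) (at s)"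
    and L: "\<And>s w. \<bar>s - (y - b)\<bar> < d \<Longrightarrow> \<bar>w - f (y - b)\<bar> < d \<Longrightarrow> \<bar>g (s, w) - g (s, f s)\<bar> \<le> K * \<bar>w - f s\<bar>"
    using assms(1) unfolding leaf_at_def by blast
  show ?thesis unfolding leaf_at_def
  proof (rule exI[of _ d], intro conjI, rule d(1), rule exI[of _ K], intro conjI allI impI)
    fix s assume s: "\<bar>s - y\<bar> < d"
    have "((\<lambda>y. f (y - b)) has_real_derivative g (s - b, f (s - b)) * 1) (at s)"
      by (rule DERIV_chain2[OF f']) (use s in \<open>auto intro!: derivative_eq_intros\<close>)
    then show "((\<lambda>y. f (y - b) + b) has_real_derivative g ((s, f (s - b) + b) - (b, b))) (at s)"
      by (auto intro!: derivative_eq_intros)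
    fix w assume w: "\<bar>w - (f (y - b) + b)\<bar> < d"
    show "\<bar>g ((s, w) - (b, b)) - g ((s, f (s - b) + b) - (b, b))\<bar> \<le> K * \<bar>w - (f (s - b) + b)\<bar>"
      using L[of "s - b" "w - b"] s w by (simp add: algebra_simps)
  qed (rule d)
qed

lemma W_poly_cont: "isCont (W_poly T D a) y"
  unfolding W_poly_def[abs_def] by (intro continuous_intros)

lemma left_leaf:
  assumes y: "y \<in> ret_dom T D a"
  shows "leaf_at (\<lambda>p. snd (X_field T D a p) / fst (X_field T D a p)) (half_return T D a) y"
proof -
  let ?f = "half_return T D a" and ?W = "W_poly T D a"
  have fy: "?f y < 0" "?W y > 0" using ret_domD(6)[OF y] W_pos(1)[OF y] by auto
  have "isCont (\<lambda>s. 1 + \<bar>y / ?W y\<bar> - \<bar>s / ?W s\<bar>) y" using fy(2) by (intro continuous_intros W_poly_cont) auto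
  then obtain d1 where d1: "d1 > 0" "\<And>s. \<bar>s - y\<bar> < d1 \<Longrightarrow> 1 + \<bar>y / ?W y\<bar> - \<bar>s / ?W s\<bar> > 0"
    using cont_pos_near[where f = "\<lambda>s. 1 + \<bar>y / ?W y\<bar> - \<bar>s / ?W s\<bar>" and x = y] by auto
  have "isCont (\<lambda>s. ?f y / 2 - ?f s) y" using DERIV_isCont[OF half_return_deriv[OF y]] by (intro continuous_intros) auto
  then obtain d2 where d2: "d2 > 0" "\<And>s. \<bar>s - y\<bar> < d2 \<Longrightarrow> ?f y / 2 - ?f s > 0"
    using cont_pos_near[where f = "\<lambda>s. ?f y / 2 - ?f s" and x = y] fy(1) by auto
  obtain d3 where d3: "d3 > 0" "\<And>s. \<bar>s - y\<bar> < d3 \<Longrightarrow> s \<in> ret_dom T D a" using ret_dom_open y unfolding open_dist dist_real_def by blast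
  define C where "C = 1 + \<bar>y / ?W y\<bar>"
  define m where "m = (?f y / 2)\<^sup>2"
  have m: "m > 0" using fy(1) by (simp add: m_def)
  define K where "K = C * (\<bar>D\<bar> + a\<^sup>2 / m)"
  have C0: "C \<ge> 0" by (simp add: C_def)
  define d where "d = min (min d1 d2) (min d3 (- ?f y / 2))"
  have d: "d > 0" "d \<le> d1" "d \<le> d2" "d \<le> d3" "d \<le> - ?f y / 2" using d1(1) d2(1) d3(1) fy(1) by (auto simp: d_def)
  let ?g = "\<lambda>p. snd (X_field T D a p) / fst (X_field T D a p)"
  have g: "?g (s, w) = s / ?W s * (?W w / w)" for s w by (simp add: X_field_def)
  have Wd: "?W w / w - ?W v / v = (D - a\<^sup>2 / (w * v)) * (w - v)" if "w \<noteq> 0" "v \<noteq> 0" for w v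
    using that by (simp add: W_poly_def field_simps power2_eq_square)
  show ?thesis unfolding leaf_at_def
  proof (rule exI[of _ d], intro conjI, rule d(1), rule exI[of _ K], intro conjI allI impI)
    show "K \<ge> 0" using C0 m by (simp add: K_def)
    fix s assume s: "\<bar>s - y\<bar> < d"
    have sJ: "s \<in> ret_dom T D a" using d3(2) s d by auto
    show "(?f has_real_derivative ?g (s, ?f s)) (at s)" using half_return_deriv[OF sJ] by (simp add: g mult.commute)
    fix w assume w: "\<bar>w - ?f y\<bar> < d"
    have n: "w < ?f y / 2" "?f s < ?f y / 2" using w d(5) d2(2)[of s] s d by (auto simp: abs_less_iff)
    have "(- ?f y / 2) * (- ?f y / 2) \<le> (- w) * (- ?f s)" using n fy(1) by (intro mult_mono) auto
    then have wv: "w * ?f s \<ge> m" by (simp add: m_def power2_eq_square)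
    have "\<bar>D - a\<^sup>2 / (w * ?f s)\<bar> \<le> \<bar>D\<bar> + \<bar>a\<^sup>2 / (w * ?f s)\<bar>" by (rule abs_triangle_ineq4)
    also have "\<bar>a\<^sup>2 / (w * ?f s)\<bar> = a\<^sup>2 / (w * ?f s)" using wv m by simp
    also have "\<dots> \<le> a\<^sup>2 / m" using wv m by (intro divide_left_mono) auto
    finally have b: "\<bar>D - a\<^sup>2 / (w * ?f s)\<bar> \<le> \<bar>D\<bar> + a\<^sup>2 / m" by simp
    have "\<bar>s / ?W s\<bar> \<le> C" using d1(2)[of s] s d by (simp add: C_def)
    then have "\<bar>s / ?W s\<bar> * \<bar>D - a\<^sup>2 / (w * ?f s)\<bar> \<le> K" unfolding K_def using b C0 by (intro mult_mono) auto
    then have "\<bar>s / ?W s\<bar> * \<bar>D - a\<^sup>2 / (w * ?f s)\<bar> * \<bar>w - ?f s\<bar> \<le> K * \<bar>w - ?f s\<bar>" by (rule mult_right_mono) simp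
    moreover have "?g (s, w) - ?g (s, ?f s) = s / ?W s * ((D - a\<^sup>2 / (w * ?f s)) * (w - ?f s))"
    proof -
      have "w \<noteq> 0" "?f s \<noteq> 0" using n fy(1) by auto
      from Wd[OF this] show ?thesis unfolding g right_diff_distrib[symmetric] by simp
    qed
    ultimately show "\<bar>?g (s, w) - ?g (s, ?f s)\<bar> \<le> K * \<bar>w - ?f s\<bar>" by (simp add: abs_mult mult.assoc)
  qed
qed

text \<open>
  A separating solution on the graph cannot be a cycle because its first coordinate increases; being
  an orbit, it lies over an interval.
\<close>

lemma separating_graph:
  fixes f :: "real \<Rightarrow> real" and X :: "real \<times> real \<Rightarrow> real \<times> real"
  assumes U: "open U" "simply_connected U" and J: "open J"
    and fc: "continuous_on J f" and dec: "\<And>x y. x \<in> J \<Longrightarrow> y \<in> J \<Longrightarrow> x < y \<Longrightarrow> f y < f x"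
    and sep: "separating_solution X U (graph_on J f \<inter> U)"
    and pos: "\<And>y. y \<in> J \<Longrightarrow> fst (X (y, f y)) > 0"
  defines "A \<equiv> {y \<in> J. (y, f y) \<in> U}"
  shows "open A \<and> is_interval A \<and> A \<noteq> {} \<and> (\<lambda>y. (y, f y)) ` A \<subseteq> U \<and> closure ((\<lambda>y. (y, f y)) ` A) - (\<lambda>y. (y, f y)) ` A \<subseteq> frontier U"
proof -
  have gA: "graph_on J f \<inter> U = (\<lambda>y. (y, f y)) ` A" by (auto simp: graph_on_def A_def)
  obtain I u where u: "maximal_integral_curve X U I u" "graph_on J f \<inter> U = u ` I"
    using sep unfolding separating_solution_def is_orbit_def by blast
  then have I: "is_interval I" "I \<noteq> {}" "solves_on X I u"
    by (auto simp: maximal_integral_curve_def integral_curve_def)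
  have cu: "continuous_on I u" using I(3) unfolding solves_on_def by (auto intro!: has_vector_derivative_continuous continuous_on_eq_continuous_within[THEN iffD2])
  have "connected (u ` I)" by (rule connected_continuous_image[OF cu]) (use I(1) in \<open>simp add: is_interval_connected_1\<close>)
  then have "connected ((\<lambda>y. (y, f y)) ` A)" using gA u(2) by simp
  then have "connected (fst ` (\<lambda>y. (y, f y)) ` A)" by (rule connected_continuous_image[OF continuous_on_fst[OF continuous_on_id]])
  moreover have "fst ` (\<lambda>y. (y, f y)) ` A = A" by (force simp: image_image)
  ultimately have Ai: "is_interval A" by (simp add: is_interval_connected_1)
  have Ane: "A \<noteq> {}" using u(2) I(2) gA by auto
  have "continuous_on J (\<lambda>y. (y, f y))" by (intro continuous_intros fc)
  then have "open (J \<inter> (\<lambda>y. (y, f y)) -` U)" by (rule continuous_open_preimage[OF _ J U(1)])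
  moreover have "J \<inter> (\<lambda>y. (y, f y)) -` U = A" by (auto simp: A_def)
  ultimately have Ao: "open A" by simp
  have "\<not> is_cycle X U (graph_on J f \<inter> U)"
  proof
    assume "is_cycle X U (graph_on J f \<inter> U)"
    then obtain v p where v: "integral_curve X U UNIV v" "p > 0" "\<And>t. v (t + p) = v t" "graph_on J f \<inter> U = range v"
      unfolding is_cycle_def by blast
    have "fst (v 0) < fst (v p)"
    proof (rule DERIV_pos_imp_increasing[OF v(2)])
      fix t
      have "(v has_vector_derivative X (v t)) (at t)" using v(1) by (auto simp: integral_curve_def solves_on_def)
      from bounded_linear.has_vector_derivative[OF bounded_linear_fst this]
      have "((\<lambda>t. fst (v t)) has_real_derivative fst (X (v t))) (at t)" by (simp add: has_real_derivative_iff_has_vector_derivative)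
      moreover have "fst (X (v t)) > 0"
      proof -
        have "v t \<in> graph_on J f" using v(4) by blast
        then show ?thesis using pos by (auto simp: graph_on_def)
      qed
      ultimately show "\<exists>y. ((\<lambda>t. fst (v t)) has_real_derivative y) (at t) \<and> 0 < y" by blast
    qed
    then show False using v(3)[of 0] by simp
  qed
  then have "closure (graph_on J f \<inter> U) - graph_on J f \<inter> U \<subseteq> frontier U" using sep unfolding separating_solution_def by blast
  then show ?thesis using Ao Ai Ane unfolding gA by (auto simp: A_def)
qed

text \<open>
  The field \<open>X'\<close> used for comparison may differ from the field \<open>X\<close> of the orbit: if \<open>aR = 0\<close> a common factor of the
  components is removed.
\<close>

lemma separating_graph_side:
  fixes f :: "real \<Rightarrow> real" and X X' :: "real \<times> real \<Rightarrow> real \<times> real"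
  assumes U: "open U" "simply_connected U" and J: "open J"
    and dec: "\<And>x y. x \<in> J \<Longrightarrow> y \<in> J \<Longrightarrow> x < y \<Longrightarrow> f y < f x"
    and sep: "separating_solution X U (graph_on J f \<inter> U)"
    and pos: "\<And>y. y \<in> J \<Longrightarrow> fst (X (y, f y)) > 0" "\<And>y. y \<in> J \<Longrightarrow> fst (X' (y, f y)) > 0"
    and leaf: "\<And>y. y \<in> J \<Longrightarrow> leaf_at (\<lambda>p. snd (X' p) / fst (X' p)) f y"
    and X': "continuous_on U X'"
  defines "A \<equiv> {y \<in> J. (y, f y) \<in> U}"
  shows "\<exists>\<theta>. leaf_separation U A f X' \<theta>"
proof -
  have fd: "isCont f y" if yJ: "y \<in> J" for y
  proof -
    obtain e where "e > 0" "\<And>s. \<bar>s - y\<bar> < e \<Longrightarrow> (f has_real_derivative snd (X' (s, f s)) / fst (X' (s, f s))) (at s)"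
      using leaf[OF yJ] unfolding leaf_at_def by blast
    then show ?thesis using DERIV_isCont[of f _ y] by force
  qed
  then have fc: "continuous_on J f" by (simp add: continuous_at_imp_continuous_on)
  note sg = separating_graph[OF U J fc dec sep pos(1), folded A_def]
  let ?G = "(\<lambda>y. (y, f y)) ` A"
  have "U \<inter> closure ?G \<subseteq> ?G" using sg U(1) by (auto simp: frontier_def interior_open)
  moreover have "continuous_on A f" by (rule continuous_on_subset[OF fc]) (auto simp: A_def)
  ultimately obtain \<theta> where \<theta>: "continuous_on U \<theta>" "\<And>p. p \<in> U \<Longrightarrow> \<theta> p = 0 \<longleftrightarrow> p \<in> ?G"
    "\<And>y. y \<in> A \<Longrightarrow> \<exists>e>0. \<forall>p\<in>U. dist p (y, f y) < e \<longrightarrow> fst p \<in> A \<and> sgn (\<theta> p) = sgn (snd p - f (fst p))"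
    using side_function[OF U, of A f] sg dec by (auto simp: A_def)
  have "leaf_separation U A f X' \<theta>"
  proof
    show "\<theta> p = 0 \<longleftrightarrow> fst p \<in> A \<and> snd p = f (fst p)" if "p \<in> U" for p
      using \<theta>(2)[OF that] by (cases p) auto
  qed (use \<theta> leaf pos X' in \<open>auto simp: A_def\<close>)
  then show ?thesis by blast
qed

section \<open>Persistence of isolated zeros\<close>

locale displacement =
  fixes JL JR :: "real set" and fL fR :: "real \<Rightarrow> real"
  assumes JL: "open JL" and JR: "open JR" and cL: "continuous_on JL fL" and cR: "continuous_on JR fR"
    and decR: "\<And>x y. x \<in> JR \<Longrightarrow> y \<in> JR \<Longrightarrow> x < y \<Longrightarrow> fR y < fR x"
begin

definition "displ b y = fR (y - b) + b - fL y"
definition "displ_dom b = {y \<in> JL. y - b \<in> JR}"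

lemma displ_strict: "y \<in> displ_dom b \<Longrightarrow> y \<in> displ_dom b' \<Longrightarrow> b < b' \<Longrightarrow> displ b y < displ b' y"
  using decR[of "y - b'" "y - b"] by (auto simp: displ_dom_def displ_def)

text \<open>
  The classes are \<open>opp\<close> (change of sign), \<open>pl\<close> (positive on both sides) and \<open>mi\<close> (negative on both sides). The parameter is
  decreased if \<open>pl\<close> is at least as large as \<open>mi\<close>, and increased otherwise.
\<close>

lemma zeros_persist:
  assumes zs: "finite zs" "zs \<noteq> {}" and z0: "\<And>z. z \<in> zs \<Longrightarrow> z \<in> displ_dom b \<and> displ b z = 0"
    and iso: "\<And>z. z \<in> zs \<Longrightarrow> \<exists>e>0. \<forall>y. y \<in> displ_dom b \<and> displ b y = 0 \<and> \<bar>y - z\<bar> < e \<longrightarrow> y = z"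
    and bad: "finite bad" and eta: "\<eta> > 0"
  shows "\<exists>b' B. \<bar>b' - b\<bar> < \<eta> \<and> b' \<notin> bad \<and> finite B \<and> card zs \<le> card B \<and> (\<forall>y\<in>B. y \<in> displ_dom b' \<and> displ b' y = 0) \<and>
    (\<exists>y\<in>displ_dom b'. displ b' y \<noteq> 0)"
proof -
  have "\<exists>r>0. (\<forall>y c. \<bar>y - z\<bar> \<le> r \<and> \<bar>c - b\<bar> \<le> r \<longrightarrow> y \<in> displ_dom c) \<and> (\<forall>y. displ b y = 0 \<and> \<bar>y - z\<bar> \<le> r \<longrightarrow> y = z) \<and> (\<forall>z'\<in>zs. z' \<noteq> z \<longrightarrow> 2 * r < \<bar>z' - z\<bar>)"
    if z: "z \<in> zs" for z
  proof -
    have zD: "z \<in> JL" "z - b \<in> JR" using z0[OF z] by (auto simp: displ_dom_def)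
    obtain e1 where e1: "e1 > 0" "\<And>y. \<bar>y - z\<bar> < e1 \<Longrightarrow> y \<in> JL" using JL zD(1) unfolding open_dist dist_real_def by blast
    obtain e2 where e2: "e2 > 0" "\<And>y. \<bar>y - (z - b)\<bar> < e2 \<Longrightarrow> y \<in> JR" using JR zD(2) unfolding open_dist dist_real_def by blast
    obtain e3 where e3: "e3 > 0" "\<And>y. y \<in> displ_dom b \<Longrightarrow> displ b y = 0 \<Longrightarrow> \<bar>y - z\<bar> < e3 \<Longrightarrow> y = z" using iso[OF z] by blast
    obtain e4 where e4: "e4 > 0" "\<And>z'. z' \<in> zs \<Longrightarrow> z' \<noteq> z \<Longrightarrow> e4 \<le> dist z z'" using finite_set_avoid[OF zs(1), of z] by blast
    define r where "r = Min {e1, e2, e3, e4} / 3"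
    have r: "r > 0" "r < e1" "2 * r < e2" "r < e3" "2 * r < e4" using e1(1) e2(1) e3(1) e4(1)
      by (auto simp: r_def min_def)
    have D: "y \<in> displ_dom c" if "\<bar>y - z\<bar> \<le> r" "\<bar>c - b\<bar> \<le> r" for y c
      using e1(2)[of y] e2(2)[of "y - c"] that r by (auto simp: displ_dom_def abs_le_iff abs_less_iff)
    show ?thesis
    proof (intro exI[of _ r] conjI allI impI ballI)
      fix y assume "displ b y = 0 \<and> \<bar>y - z\<bar> \<le> r"
      then show "y = z" using e3(2)[of y] D[of y b] r by auto
    next
      fix z' assume "z' \<in> zs" "z' \<noteq> z"
      then show "2 * r < \<bar>z' - z\<bar>" using e4(2)[of z'] r by (auto simp: dist_real_def abs_minus_commute)
    qed (use r D in auto)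
  qed
  then have "\<forall>z\<in>zs. \<exists>r. r > 0 \<and> (\<forall>y c. \<bar>y - z\<bar> \<le> r \<and> \<bar>c - b\<bar> \<le> r \<longrightarrow> y \<in> displ_dom c) \<and> (\<forall>y. displ b y = 0 \<and> \<bar>y - z\<bar> \<le> r \<longrightarrow> y = z) \<and> (\<forall>z'\<in>zs. z' \<noteq> z \<longrightarrow> 2 * r < \<bar>z' - z\<bar>)" by simp
  from bchoice[OF this] obtain r where r': "\<forall>z\<in>zs. r z > 0 \<and> (\<forall>y c. \<bar>y - z\<bar> \<le> r z \<and> \<bar>c - b\<bar> \<le> r z \<longrightarrow> y \<in> displ_dom c) \<and> (\<forall>y. displ b y = 0 \<and> \<bar>y - z\<bar> \<le> r z \<longrightarrow> y = z) \<and> (\<forall>z'\<in>zs. z' \<noteq> z \<longrightarrow> 2 * r z < \<bar>z' - z\<bar>)" ..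
  then have r: "\<And>z. z \<in> zs \<Longrightarrow> r z > 0"
    "\<And>z y c. z \<in> zs \<Longrightarrow> \<bar>y - z\<bar> \<le> r z \<Longrightarrow> \<bar>c - b\<bar> \<le> r z \<Longrightarrow> y \<in> displ_dom c"
    "\<And>z y. z \<in> zs \<Longrightarrow> displ b y = 0 \<Longrightarrow> \<bar>y - z\<bar> \<le> r z \<Longrightarrow> y = z"
    "\<And>z z'. z \<in> zs \<Longrightarrow> z' \<in> zs \<Longrightarrow> z' \<noteq> z \<Longrightarrow> 2 * r z < \<bar>z' - z\<bar>" by blast+
  have zb: "z \<in> displ_dom b" if "z \<in> zs" for z using z0[OF that] by simp
  have cont_b: "isCont (\<lambda>c. displ c y) b" if "y \<in> displ_dom b" for y
  proof -
    have "isCont fR (y - b)" using cR JR that by (auto simp: displ_dom_def continuous_on_eq_continuous_at)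
    then have "isCont (\<lambda>c. fR (y - c)) b" by (intro isCont_o2[of b "\<lambda>c. y - c" fR]) (auto intro!: continuous_intros)
    then show ?thesis unfolding displ_def by (intro continuous_intros) auto
  qed
  have sgn_stable: "\<exists>d>0. \<forall>c. \<bar>c - b\<bar> < d \<longrightarrow> sgn (displ c y) = sgn (displ b y)" if y: "y \<in> displ_dom b" "displ b y \<noteq> 0" for y
  proof (cases "displ b y > 0")
    case True
    then show ?thesis using cont_pos_near[where f = "\<lambda>c. displ c y" and x = b] cont_b[OF y(1)] by (metis sgn_pos)
  next
    case False
    then have "isCont (\<lambda>c. - displ c y) b" "- displ b y > 0" using cont_b[OF y(1)] y(2) by (auto intro: continuous_intros)
    then show ?thesis using cont_pos_near[where f = "\<lambda>c. - displ c y" and x = b] by (metis neg_0_less_iff_less sgn_neg)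
  qed
  have ends: "\<exists>d>0. \<forall>c. \<bar>c - b\<bar> < d \<longrightarrow> sgn (displ c (z - r z)) = sgn (displ b (z - r z)) \<and> sgn (displ c (z + r z)) = sgn (displ b (z + r z))"
    and nz: "displ b (z - r z) \<noteq> 0" "displ b (z + r z) \<noteq> 0" if z: "z \<in> zs" for z
  proof -
    have D: "z - r z \<in> displ_dom b" "z + r z \<in> displ_dom b" using r(1,2)[OF z] by (auto simp: less_imp_le)
    show n: "displ b (z - r z) \<noteq> 0" "displ b (z + r z) \<noteq> 0" using r(3)[OF z, of "z - r z"] r(3)[OF z, of "z + r z"] r(1)[OF z] by auto
    obtain d1 where d1: "d1 > 0" "\<forall>c. \<bar>c - b\<bar> < d1 \<longrightarrow> sgn (displ c (z - r z)) = sgn (displ b (z - r z))" using sgn_stable[OF D(1) n(1)] by blast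
    obtain d2 where d2: "d2 > 0" "\<forall>c. \<bar>c - b\<bar> < d2 \<longrightarrow> sgn (displ c (z + r z)) = sgn (displ b (z + r z))" using sgn_stable[OF D(2) n(2)] by blast
    show "\<exists>d>0. \<forall>c. \<bar>c - b\<bar> < d \<longrightarrow> sgn (displ c (z - r z)) = sgn (displ b (z - r z)) \<and> sgn (displ c (z + r z)) = sgn (displ b (z + r z))"
      using d1 d2 by (intro exI[of _ "min d1 d2"]) (metis min_less_iff_conj)
  qed
  have "\<forall>z\<in>zs. \<exists>d. d > 0 \<and> (\<forall>c. \<bar>c - b\<bar> < d \<longrightarrow> sgn (displ c (z - r z)) = sgn (displ b (z - r z)) \<and> sgn (displ c (z + r z)) = sgn (displ b (z + r z)))"
    using ends by simp
  from bchoice[OF this] obtain d where d': "\<forall>z\<in>zs. d z > 0 \<and> (\<forall>c. \<bar>c - b\<bar> < d z \<longrightarrow> sgn (displ c (z - r z)) = sgn (displ b (z - r z)) \<and> sgn (displ c (z + r z)) = sgn (displ b (z + r z)))" ..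
  then have d: "\<And>z. z \<in> zs \<Longrightarrow> d z > 0"
    "\<And>z c. z \<in> zs \<Longrightarrow> \<bar>c - b\<bar> < d z \<Longrightarrow> sgn (displ c (z - r z)) = sgn (displ b (z - r z)) \<and> sgn (displ c (z + r z)) = sgn (displ b (z + r z))" by blast+
  define \<rho> where "\<rho> = Min (insert \<eta> (r ` zs \<union> d ` zs))"
  have \<rho>: "\<rho> > 0" "\<rho> \<le> \<eta>" "\<And>z. z \<in> zs \<Longrightarrow> \<rho> \<le> r z" "\<And>z. z \<in> zs \<Longrightarrow> \<rho> \<le> d z"
    using zs(1) eta r(1) d(1) by (auto simp: \<rho>_def)
  have cdm: "continuous_on {l..h} (displ c)" if "\<And>y. l \<le> y \<Longrightarrow> y \<le> h \<Longrightarrow> y \<in> displ_dom c" for l h c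
  proof -
    have "y - c \<in> JR \<and> y \<in> JL" if "y \<in> {l..h}" for y using \<open>\<And>y. l \<le> y \<Longrightarrow> y \<le> h \<Longrightarrow> y \<in> displ_dom c\<close>[of y] that by (auto simp: displ_dom_def)
    then have s: "(\<lambda>y. y - c) ` {l..h} \<subseteq> JR" "{l..h} \<subseteq> JL" by blast+
    have "continuous_on {l..h} (\<lambda>y. fR (y - c))" by (rule continuous_on_compose2[OF cR _ s(1)]) (intro continuous_intros)
    then show ?thesis unfolding displ_def by (intro continuous_intros continuous_on_subset[OF cL s(2)])
  qed
  have ivt: "\<exists>y. l < y \<and> y < h \<and> displ c y = 0"
    if "l < h" "\<And>y. l \<le> y \<Longrightarrow> y \<le> h \<Longrightarrow> y \<in> displ_dom c" "sgn (displ c l) * sgn (displ c h) < 0" for l h c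
  proof -
    have "\<exists>y. l \<le> y \<and> y \<le> h \<and> displ c y = 0"
    proof (cases "displ c l < 0")
      case True
      then have "displ c h > 0" using that(3) by (auto simp: mult_less_0_iff sgn_if split: if_splits)
      then show ?thesis using IVT'[of "displ c" l 0 h] True that cdm[OF that(2)] by auto
    next
      case False
      then have "displ c l > 0" "displ c h < 0" using that(3) by (auto simp: mult_less_0_iff sgn_if split: if_splits)
      then show ?thesis using IVT2'[of "displ c" h 0 l] that cdm[OF that(2)] by auto
    qed
    then obtain y where "l \<le> y" "y \<le> h" "displ c y = 0" by blast
    moreover have "y \<noteq> l" "y \<noteq> h" using that(3) \<open>displ c y = 0\<close> by auto
    ultimately show ?thesis by (intro exI[of _ y]) auto
  qed
  define opp where "opp = {z \<in> zs. sgn (displ b (z - r z)) * sgn (displ b (z + r z)) < 0}"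
  define pl where "pl = {z \<in> zs. displ b (z - r z) > 0 \<and> displ b (z + r z) > 0}"
  define mi where "mi = {z \<in> zs. displ b (z - r z) < 0 \<and> displ b (z + r z) < 0}"
  have part: "zs = opp \<union> pl \<union> mi"
  proof
    show "zs \<subseteq> opp \<union> pl \<union> mi"
    proof
      fix z assume z: "z \<in> zs"
      then show "z \<in> opp \<union> pl \<union> mi" using nz[OF z] by (auto simp: opp_def pl_def mi_def mult_less_0_iff not_less less_le)
    qed
  qed (auto simp: opp_def pl_def mi_def)
  have disj: "opp \<inter> pl = {}" "(opp \<union> pl) \<inter> mi = {}" by (auto simp: opp_def pl_def mi_def)
  have fin: "finite opp" "finite pl" "finite mi" using zs(1) by (auto simp: opp_def pl_def mi_def)
  have czs: "card zs = card opp + card pl + card mi"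
    unfolding part using disj fin by (simp add: card_Un_disjoint)
  \<comment> \<open>A change of sign at the ends of an interval survives the perturbation, and every zero in good splits into two; these make up for the zeros in other, which may be lost.\<close>
  have key: "\<exists>B. finite B \<and> card zs \<le> card B \<and> (\<forall>y\<in>B. y \<in> displ_dom c \<and> displ c y = 0)"
    if c: "\<bar>c - b\<bar> < \<rho>" and good: "card other \<le> card good" "good \<union> other = pl \<union> mi" "good \<inter> other = {}"
      and gs: "\<And>z. z \<in> good \<Longrightarrow> sgn (displ b (z - r z)) * sgn (displ c z) < 0 \<and> sgn (displ b (z + r z)) * sgn (displ c z) < 0" for c good other
  proof -
    define I where "I = (\<lambda>z. {y. z - r z < y \<and> y < z + r z \<and> y \<in> displ_dom c \<and> displ c y = 0})"
    have Dc: "y \<in> displ_dom c" if "z \<in> zs" "\<bar>y - z\<bar> \<le> r z" for y z using r(2)[OF that, of c] \<rho>(3)[OF that(1)] c by auto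
    have sc: "sgn (displ c (z - r z)) = sgn (displ b (z - r z))" "sgn (displ c (z + r z)) = sgn (displ b (z + r z))" if "z \<in> zs" for z
      using d(2)[OF that, of c] \<rho>(4)[OF that] c by auto
    have gz: "z \<in> zs" if "z \<in> good" for z using that good(2) part by blast
    have B1: "\<exists>S. S \<subseteq> I z \<and> finite S \<and> card S = 1" if z: "z \<in> opp" for z
    proof -
      have zz: "z \<in> zs" using z by (simp add: opp_def)
      have "\<exists>y. z - r z < y \<and> y < z + r z \<and> displ c y = 0"
        by (rule ivt) (use r(1)[OF zz] Dc[OF zz] sc[OF zz] z in \<open>auto simp: opp_def abs_le_iff\<close>)
      then obtain y where y: "z - r z < y" "y < z + r z" "displ c y = 0" by blast
      then have "y \<in> I z" using Dc[OF zz, of y] by (auto simp: I_def abs_le_iff)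
      then show ?thesis by (intro exI[of _ "{y}"]) auto
    qed
    have B2: "\<exists>S. S \<subseteq> I z \<and> finite S \<and> card S = 2" if z: "z \<in> good" for z
    proof -
      note zz = gz[OF z]
      have "\<exists>y. z - r z < y \<and> y < z \<and> displ c y = 0"
        by (rule ivt) (use r(1)[OF zz] Dc[OF zz] sc[OF zz] gs[OF z] in \<open>auto simp: abs_le_iff\<close>)
      then obtain y where y: "z - r z < y" "y < z" "displ c y = 0" by blast
      have "\<exists>y. z < y \<and> y < z + r z \<and> displ c y = 0"
        by (rule ivt) (use r(1)[OF zz] Dc[OF zz] sc[OF zz] gs[OF z] in \<open>auto simp: abs_le_iff mult.commute\<close>)
      then obtain x where x: "z < x" "x < z + r z" "displ c x = 0" by blast
      have "y \<in> I z" "x \<in> I z" using x y Dc[OF zz, of y] Dc[OF zz, of x] r(1)[OF zz] by (auto simp: I_def abs_le_iff)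
      then show ?thesis using x y by (intro exI[of _ "{x, y}"]) auto
    qed
    have "\<exists>S. S \<subseteq> I z \<and> finite S \<and> card S = (if z \<in> opp then 1 else 2)" if "z \<in> opp \<union> good" for z
      using that B1[of z] B2[of z] by (cases "z \<in> opp") auto
    then obtain S where S: "\<And>z. z \<in> opp \<union> good \<Longrightarrow> S z \<subseteq> I z \<and> finite (S z) \<and> card (S z) = (if z \<in> opp then 1 else 2)" by metis
    have fg: "finite good" "finite other" using fin good(2) by (metis finite_Un)+
    have og: "opp \<inter> good = {}" using disj good(2) by blast
    have dj: "S z \<inter> S z' = {}" if zz: "z \<in> opp \<union> good" "z' \<in> opp \<union> good" "z \<noteq> z'" for z z'
    proof (rule equals0I)
      fix y assume "y \<in> S z \<inter> S z'"
      then have "y \<in> I z" "y \<in> I z'" using S zz by blast+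
      then have "\<bar>y - z\<bar> < r z" "\<bar>y - z'\<bar> < r z'" by (auto simp: I_def abs_less_iff)
      moreover have "2 * r z < \<bar>z' - z\<bar>" "2 * r z' < \<bar>z - z'\<bar>" using r(4)[of z z'] r(4)[of z' z] zz gz by (auto simp: opp_def)
      ultimately show False by (simp add: abs_if split: if_splits)
    qed
    have "card (\<Union>z\<in>opp \<union> good. S z) = (\<Sum>z\<in>opp \<union> good. card (S z))"
      by (rule card_UN_disjoint) (use fin fg S dj in auto)
    also have "\<dots> = (\<Sum>z\<in>opp \<union> good. if z \<in> opp then 1 else 2)" using S by (intro sum.cong) auto
    also have "\<dots> = (\<Sum>z\<in>opp. if z \<in> opp then 1 else 2) + (\<Sum>z\<in>good. if z \<in> opp then 1 else (2::nat))"
      by (rule sum.union_disjoint) (use fin fg og in auto)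
    also have "(\<Sum>z\<in>opp. if z \<in> opp then 1 else 2) = card opp" by simp
    also have "(\<Sum>z\<in>good. if z \<in> opp then 1 else (2::nat)) = (\<Sum>z\<in>good. 2)" using og by (intro sum.cong) auto
    finally have "card (\<Union>z\<in>opp \<union> good. S z) = card opp + 2 * card good" by simp
    moreover have "card pl + card mi = card good + card other"
    proof -
      have "card (pl \<union> mi) = card pl + card mi" using fin disj by (intro card_Un_disjoint) auto
      moreover have "card (good \<union> other) = card good + card other" using fg good(3) by (intro card_Un_disjoint) auto
      ultimately show ?thesis using good(2) by simp
    qed
    ultimately have "card zs \<le> card (\<Union>z\<in>opp \<union> good. S z)" using czs good(1) by simp
    moreover have "finite (\<Union>z\<in>opp \<union> good. S z)" using fin fg S by auto
    moreover have "y \<in> displ_dom c \<and> displ c y = 0" if "y \<in> (\<Union>z\<in>opp \<union> good. S z)" for y using that S unfolding I_def by blast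
    ultimately show ?thesis by blast
  qed
  obtain z1 where z1: "z1 \<in> zs" using zs(2) by blast
  have mono: "c < b \<Longrightarrow> displ c z < 0" "c > b \<Longrightarrow> displ c z > 0" "z \<in> displ_dom c" if z: "z \<in> zs" and c: "\<bar>c - b\<bar> < \<rho>" for z c
  proof -
    show zc: "z \<in> displ_dom c" using r(2)[OF z, of z c] \<rho>(3)[OF z] c r(1)[OF z] by auto
    show "c < b \<Longrightarrow> displ c z < 0" "c > b \<Longrightarrow> displ c z > 0" using displ_strict[OF zc zb[OF z]] displ_strict[OF zb[OF z] zc] z0[OF z] by auto
  qed
  show ?thesis
  proof (cases "card mi \<le> card pl")
    case True
    have "infinite {b - \<rho><..<b}" using \<rho>(1) by simp
    then obtain c where c: "c \<in> {b - \<rho><..<b}" "c \<notin> bad" using bad by (metis finite_subset subsetI)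
    then have cb: "\<bar>c - b\<bar> < \<rho>" "c < b" by auto
    have "sgn (displ b (z - r z)) * sgn (displ c z) < 0 \<and> sgn (displ b (z + r z)) * sgn (displ c z) < 0" if "z \<in> pl" for z
      using mono(1)[OF _ cb(1,2), of z] that by (auto simp: pl_def)
    then obtain B where "finite B" "card zs \<le> card B" "\<forall>y\<in>B. y \<in> displ_dom c \<and> displ c y = 0"
      using key[OF cb(1) True _ _] disj by blast
    then show ?thesis using c cb \<rho>(2) mono[OF z1 cb(1)] by (intro exI[of _ c] exI[of _ B]) force
  next
    case False
    have "infinite {b<..<b + \<rho>}" using \<rho>(1) by simp
    then obtain c where c: "c \<in> {b<..<b + \<rho>}" "c \<notin> bad" using bad by (metis finite_subset subsetI)
    then have cb: "\<bar>c - b\<bar> < \<rho>" "c > b" by auto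
    have "sgn (displ b (z - r z)) * sgn (displ c z) < 0 \<and> sgn (displ b (z + r z)) * sgn (displ c z) < 0" if "z \<in> mi" for z
      using mono(2)[OF _ cb(1,2), of z] that by (auto simp: mi_def)
    moreover have "card pl \<le> card mi" "mi \<union> pl = pl \<union> mi" "mi \<inter> pl = {}" using False disj by auto
    ultimately have "\<exists>B. finite B \<and> card zs \<le> card B \<and> (\<forall>y\<in>B. y \<in> displ_dom c \<and> displ c y = 0)"
      by (intro key[OF cb(1), of pl mi])
    then obtain B where "finite B" "card zs \<le> card B" "\<forall>y\<in>B. y \<in> displ_dom c \<and> displ c y = 0" by blast
    then show ?thesis using c cb \<rho>(2) mono[OF z1 cb(1)] by (intro exI[of _ c] exI[of _ B]) force
  qed
qed

end

section \<open>Bounding the zeros at a regular value of b\<close>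

text \<open>
  If \<open>aR = 0\<close>, then the translated field is \<open>- DR (y0 - b) (y1 - b)\<close> times the radial field at \<open>(b, b)\<close>. The factor is
  removed, because with it the field vanishes on the lines \<open>y0 = b\<close> and \<open>y1 = b\<close>.
\<close>

definition X_right :: "real \<Rightarrow> real \<Rightarrow> real \<Rightarrow> real \<Rightarrow> real \<times> real \<Rightarrow> real \<times> real" where
  "X_right TR DR aR b = (if aR = 0 then (\<lambda>p. p - (b, b)) else (\<lambda>p. X_field TR DR aR (p - (b, b))))"

lemma G_tilde_cubic: "\<exists>g. \<forall>P. G_tilde TL DL aL TR DR aR b P = cubic g P"
proof -
  define M1 M2 M3 M4 M5 where "M1 = m1 aL TR DR aR b" and "M2 = m2 TL DL aL TR DR aR b" and "M3 = m3 aL DR b"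
    and "M4 = m4 TL DL aL TR DR aR b" and "M5 = m5 TL DL aL TR DR aR b"
  define K A c where "K = M2 - 2 * M3" and "A = aL * TL" and "c = aL\<^sup>2"
  define g where "g = (\<lambda>i. - ([0, M1 * c, - 2 * A * M1 - 2 * c * K, 2 * M3 * c + c * K,
    M1 * DL - 4 * A * M3 + M4 * c - A * K - 2 * c * M4, - 2 * A * M4 + 2 * DL * K - 4 * c * M5, M4 * c,
    2 * M3 * DL - A * M4 + 2 * M5 * c, M4 * DL + 2 * DL * M4 - 2 * A * M5, 4 * DL * M5] ! i))"
  have "G_tilde TL DL aL TR DR aR b P = cubic g P" for P
    unfolding G_tilde_eq M1_def[symmetric] M2_def[symmetric] M3_def[symmetric] M4_def[symmetric] M5_def[symmetric]
    unfolding K_def[symmetric] A_def[symmetric] c_def[symmetric] cubic_def g_def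
    by (simp add: algebra_simps power2_eq_square power3_eq_cube A_def)
  then show ?thesis by blast
qed

lemma F_tilde_deriv:
  "(F_tilde TL DL aL TR DR aR b has_derivative (\<lambda>h.
     (m1 aL TR DR aR b + 2 * m3 aL DR b * fst P + m4 TL DL aL TR DR aR b * snd P) * fst h +
     (m2 TL DL aL TR DR aR b - 2 * m3 aL DR b + m4 TL DL aL TR DR aR b * fst P + 2 * m5 TL DL aL TR DR aR b * snd P) * snd h)) (at P)"
  unfolding F_tilde_eq by (rule has_derivative_eq_rhs) (auto intro!: derivative_eq_intros simp: fun_eq_iff algebra_simps)

text \<open>
  If \<open>Z\<close> is infinite, then a finite subset of the required size is chosen.
\<close>

lemma zeros_or_more:
  fixes Z :: "real set"
  assumes P: "finite P" and gap: "\<And>a b. a \<in> P \<Longrightarrow> b \<in> P \<Longrightarrow> a < b \<Longrightarrow> \<exists>s\<in>Z. a < s \<and> s < b"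
  shows "\<exists>B. finite B \<and> B \<subseteq> Z \<and> card P \<le> card B + 1"
proof (cases "finite Z")
  case True
  have "card P \<le> card {s \<in> Z. \<exists>p\<in>P. s < p} + card ((\<lambda>_. ()) ` P)"
    by (rule count_by_gaps[OF P True]) (use gap in auto)
  also have "card {s \<in> Z. \<exists>p\<in>P. s < p} \<le> card Z" using True by (intro card_mono) auto
  also have "card ((\<lambda>_. ()) ` P) \<le> 1" using card_mono[of "{()}" "(\<lambda>_. ()) ` P"] by fastforce
  finally show ?thesis using True by auto
next
  case False
  then show ?thesis using infinite_arbitrarily_large[OF False, of "card P"] by auto
qed

lemma X_field_cont: "continuous_on UNIV (X_field T D a)"
  unfolding X_field_def W_poly_def by (auto simp: split_beta' intro!: continuous_intros)

lemma slope_diff: "x0 \<noteq> 0 \<Longrightarrow> r0 \<noteq> (0::real) \<Longrightarrow> x1 / x0 - r1 / r0 = - ((x0 * r1 - x1 * r0) / (x0 * r0))"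
  by (simp add: field_simps)

lemma phi_cont: "continuous_on UNIV \<phi>"
  unfolding \<phi>_def by (auto simp: split_beta' intro!: continuous_intros)

text \<open>
  \<open>E\<close> is the factor of \<open>F_tilde\<close> that decides whether the two fields are parallel, \<open>\<mu>\<close> the remaining
  factor. By \<open>mu0\<close>, \<open>\<mu>\<close> neither meets \<open>E\<close> nor adds solutions of the
  constrained system; by \<open>type\<close>, \<open>E = 0\<close> is a line, a nondegenerate conic, empty or everything.
\<close>

locale contact_factor =
  fixes TL DL aL TR DR aR b n0 n1 n2 q0 q1 q2 qa qb qc \<kappa> :: real
  fixes E E0 E1 \<mu> :: "real \<times> real \<Rightarrow> real" and XL XR :: "real \<times> real \<Rightarrow> real \<times> real"
  assumes E: "\<And>P. E P = q0 + q1 * fst P + q2 * snd P + qa * (fst P)\<^sup>2 + qb * (fst P * snd P) + qc * (snd P)\<^sup>2"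
    and E0: "\<And>P. E0 P = q1 + 2 * qa * fst P + qb * snd P" and E1: "\<And>P. E1 P = q2 + qb * fst P + 2 * qc * snd P"
    and mu: "\<And>P. \<mu> P = n0 + n1 * fst P + n2 * snd P"
    and XL: "XL = X_field TL DL aL" and XR: "XR = X_right TR DR aR b"
    and fac: "\<And>P. F_tilde TL DL aL TR DR aR b P = \<mu> P * E P"
    and kap: "\<kappa> = 1 \<or> \<kappa> = -1"
    and cross: "\<And>p. p \<in> Q_quad \<Longrightarrow> sgn (fst (XL p) * snd (XR p) - snd (XL p) * fst (XR p)) = \<kappa> * sgn (E (\<phi> p))"
    and mu0: "\<And>p. p \<in> Q_quad \<Longrightarrow> \<mu> (\<phi> p) = 0 \<Longrightarrow> E (\<phi> p) \<noteq> 0 \<and>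
       n1 * (fst (XL p) + snd (XL p)) + n2 * (fst (XL p) * snd p + fst p * snd (XL p)) \<noteq> 0"
    and type: "qa = 0 \<and> qb = 0 \<and> qc = 0 \<and> (q1 = 0 \<and> q2 = 0 \<or> (\<exists>P. E P = 0 \<and> \<mu> P \<noteq> 0)) \<or>
       n0 = 1 \<and> n1 = 0 \<and> n2 = 0 \<and> 4 * qa * qc * q0 + q1 * qb * q2 - qa * q2\<^sup>2 - qc * q1\<^sup>2 - q0 * qb\<^sup>2 \<noteq> 0"
    and admL: "(aL \<le> 0 \<and> 4 * DL - TL\<^sup>2 > 0) \<or> aL > 0"
    and admR: "(aR \<ge> 0 \<and> 4 * DR - TR\<^sup>2 > 0) \<or> aR < 0"
begin

abbreviation "Ft \<equiv> F_tilde TL DL aL TR DR aR b"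
abbreviation "Gt \<equiv> G_tilde TL DL aL TR DR aR b"

lemma E_der: "(E has_derivative (\<lambda>h. E0 P * fst h + E1 P * snd h)) (at P)"
  unfolding E[abs_def] by (rule has_derivative_eq_rhs)
    (auto intro!: derivative_eq_intros simp: fun_eq_iff algebra_simps E0 E1)

lemma F_grad:
  "m1 aL TR DR aR b + 2 * m3 aL DR b * fst P + m4 TL DL aL TR DR aR b * snd P = n1 * E P + \<mu> P * E0 P"
  "m2 TL DL aL TR DR aR b - 2 * m3 aL DR b + m4 TL DL aL TR DR aR b * fst P + 2 * m5 TL DL aL TR DR aR b * snd P = n2 * E P + \<mu> P * E1 P"
proof -
  have "((\<lambda>P. \<mu> P * E P) has_derivative (\<lambda>h. (n1 * E P + \<mu> P * E0 P) * fst h + (n2 * E P + \<mu> P * E1 P) * snd h)) (at P)"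
    unfolding mu[abs_def] by (rule has_derivative_eq_rhs)
      (auto intro!: derivative_eq_intros E_der simp: fun_eq_iff algebra_simps)
  from has_derivative_unique[OF F_tilde_deriv this[folded fac[abs_def]]]
  have eq: "(m1 aL TR DR aR b + 2 * m3 aL DR b * fst P + m4 TL DL aL TR DR aR b * snd P) * fst h +
     (m2 TL DL aL TR DR aR b - 2 * m3 aL DR b + m4 TL DL aL TR DR aR b * fst P + 2 * m5 TL DL aL TR DR aR b * snd P) * snd h
     = (n1 * E P + \<mu> P * E0 P) * fst h + (n2 * E P + \<mu> P * E1 P) * snd h" for h :: "real \<times> real" by meson
  show "m1 aL TR DR aR b + 2 * m3 aL DR b * fst P + m4 TL DL aL TR DR aR b * snd P = n1 * E P + \<mu> P * E0 P"
    using eq[of "(1, 0)"] by simp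
  show "m2 TL DL aL TR DR aR b - 2 * m3 aL DR b + m4 TL DL aL TR DR aR b * fst P + 2 * m5 TL DL aL TR DR aR b * snd P = n2 * E P + \<mu> P * E1 P"
    using eq[of "(0, 1)"] by simp
qed

text \<open>
  So \<open>G_tilde\<close> is \<open>\<mu>\<close> times the contact function of \<open>E\<close> on \<open>E = 0\<close>, and \<open>E\<close> times a function without zeros on \<open>\<mu> = 0\<close>.
\<close>

lemma G_eq: "Gt (\<phi> p) = (n1 * E (\<phi> p) + \<mu> (\<phi> p) * E0 (\<phi> p)) * (fst (XL p) + snd (XL p)) +
   (n2 * E (\<phi> p) + \<mu> (\<phi> p) * E1 (\<phi> p)) * (fst (XL p) * snd p + fst p * snd (XL p))"
proof -
  obtain x y where p: "p = (x, y)" by fastforce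
  have X: "fst (XL p) + snd (XL p) = - (DL * (fst (\<phi> p) * snd (\<phi> p)) - 2 * aL * TL * snd (\<phi> p) + aL\<^sup>2 * fst (\<phi> p))"
    "fst (XL p) * snd p + fst p * snd (XL p) = - (2 * DL * (snd (\<phi> p) * snd (\<phi> p)) - aL * TL * (fst (\<phi> p) * snd (\<phi> p))
              + aL^2 * (fst (\<phi> p) * fst (\<phi> p) - 2 * snd (\<phi> p)))"
    by (simp_all add: p XL X_field_def W_poly_def \<phi>_def algebra_simps power2_eq_square)
  show ?thesis unfolding G_tilde_eq F_grad X by (simp add: algebra_simps)
qed

text \<open>
  Only \<open>X_L\<close> enters \<open>G_tilde\<close>; on \<open>E = 0\<close> the two fields are parallel, so tangency to the field of the right zone is
  detected as well, with spurious zeros only where \<open>X_L\<close> vanishes.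
\<close>

lemma contact_count:
  fixes f :: "real \<Rightarrow> real"
  assumes ls: "leaf_separation U A f X \<theta>" and U: "open U" "U \<subseteq> Q_quad" and A: "connected A"
    and par: "\<And>p. p \<in> U \<Longrightarrow> E (\<phi> p) = 0 \<Longrightarrow> \<exists>c. XL p = c *\<^sub>R X p \<and> (p \<notin> Z \<longrightarrow> c \<noteq> 0)" and Z: "finite Z"
    and comps: "finite {C \<in> components {P \<in> \<phi> ` U. Ft P = 0}. \<not> compact C}"
      "card {C \<in> components {P \<in> \<phi> ` U. Ft P = 0}. \<not> compact C} \<le> N"
    and sols: "finite {P. P isolated_in {P \<in> \<phi> ` U. Ft P = 0 \<and> Gt P = 0}}"
      "card {P. P isolated_in {P \<in> \<phi> ` U. Ft P = 0 \<and> Gt P = 0}} \<le> k"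
    and B: "finite B" "B \<subseteq> A" "\<And>y. y \<in> B \<Longrightarrow> E (\<phi> (y, f y)) = 0"
    and notall: "\<exists>y\<in>A. E (\<phi> (y, f y)) \<noteq> 0"
  shows "card B \<le> N + k"
proof (cases "qa = 0 \<and> qb = 0 \<and> qc = 0 \<and> q1 = 0 \<and> q2 = 0")
  case True
  then have "B = {}" using notall B(3) by (auto simp: E)
  then show ?thesis by simp
next
  case False
  interpret leaf_separation U A f X \<theta> by fact
  let ?K = "\<lambda>p Y. E0 (\<phi> p) * (fst (Y p) + snd (Y p)) + E1 (\<phi> p) * (fst (Y p) * snd p + fst p * snd (Y p))"
  have GK: "Gt (\<phi> p) = \<mu> (\<phi> p) * ?K p XL" "\<mu> (\<phi> p) \<noteq> 0" if "p \<in> U" "E (\<phi> p) = 0" for p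
    using G_eq[of p] that mu0[of p] U(2) by (auto simp: algebra_simps)
  have KX: "?K p XL = c * ?K p X" if "XL p = c *\<^sub>R X p" for p c
    unfolding that by (simp add: algebra_simps)
  interpret curve_contact U A f X \<theta> E E0 E1 Ft Gt N k Z
  proof
    fix P assume P: "P \<in> \<phi> ` U"
    then obtain p where p: "P = \<phi> p" "p \<in> U" by blast
    show "Ft P = 0" if "E P = 0" using that fac by simp
    show "E P = 0" if "Ft P = 0" "Gt P = 0"
    proof (cases "\<mu> P = 0")
      case True
      then have "Gt P = E P * (n1 * (fst (XL p) + snd (XL p)) + n2 * (fst (XL p) * snd p + fst p * snd (XL p)))"
        using G_eq[of p] p(1) by (simp add: algebra_simps)
      then show ?thesis using that(2) mu0[of p] True p U(2) by auto
    next
      case False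
      then show ?thesis using that(1) fac[of P] by simp
    qed
    show "E0 P \<noteq> 0 \<or> E1 P \<noteq> 0" if "E P = 0"
    proof (rule ccontr)
      assume "\<not> ?thesis"
      then have z: "E0 P = 0" "E1 P = 0" by auto
      have "qa * (E1 P)\<^sup>2 - qb * E0 P * E1 P + qc * (E0 P)\<^sup>2 = (4 * qa * qc - qb\<^sup>2) * E P - (4 * qa * qc * q0 + q1 * qb * q2 - qa * q2\<^sup>2 - qc * q1\<^sup>2 - q0 * qb\<^sup>2)"
        unfolding E E0 E1 by algebra
      then have "4 * qa * qc * q0 + q1 * qb * q2 - qa * q2\<^sup>2 - qc * q1\<^sup>2 - q0 * qb\<^sup>2 = 0" using z that by simp
      then have "qa = 0 \<and> qb = 0 \<and> qc = 0" using type by auto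
      then show False using z False by (auto simp: E0 E1)
    qed
  next
    fix p assume p: "p \<in> U" "E (\<phi> p) = 0"
    obtain c where c: "XL p = c *\<^sub>R X p" "p \<notin> Z \<Longrightarrow> c \<noteq> 0" using par[OF p] by blast
    show "Gt (\<phi> p) = 0" if "?K p X = 0" using GK[OF p] KX[OF c(1)] that by simp
  next
    fix p assume p: "p \<in> U - Z" "E (\<phi> p) = 0" and G: "Gt (\<phi> p) = 0"
    obtain c where c: "XL p = c *\<^sub>R X p" "p \<notin> Z \<Longrightarrow> c \<noteq> 0" using par[of p] p by blast
    show "?K p X = 0" using GK[of p] KX[OF c(1)] c(2) p G by simp
  qed (fact U A comps sols Z E_der)+
  obtain g where g: "\<And>P. Gt P = cubic g P" using G_tilde_cubic by blast
  show ?thesis using type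
  proof
    assume t: "qa = 0 \<and> qb = 0 \<and> qc = 0 \<and> (q1 = 0 \<and> q2 = 0 \<or> (\<exists>P. E P = 0 \<and> \<mu> P \<noteq> 0))"
    show ?thesis
    proof (rule affine_count[of q0 q1 q2 n0 n1 n2 g B])
      show "\<exists>P. E P = 0 \<and> n0 + n1 * fst P + n2 * snd P \<noteq> 0" using t False unfolding mu by blast
      show "q1 \<noteq> 0 \<or> q2 \<noteq> 0" using t False by blast
      show "E P = q0 + q1 * fst P + q2 * snd P" for P using t by (simp add: E)
      show "Ft P = 0 \<longleftrightarrow> E P = 0 \<or> n0 + n1 * fst P + n2 * snd P = 0" for P using fac[of P] mu[of P] by auto
    qed (fact g B notall)+
  next
    assume t: "n0 = 1 \<and> n1 = 0 \<and> n2 = 0 \<and> 4 * qa * qc * q0 + q1 * qb * q2 - qa * q2\<^sup>2 - qc * q1\<^sup>2 - q0 * qb\<^sup>2 \<noteq> 0"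
    show ?thesis
    proof (rule conic_count[of q0 q1 q2 qa qb qc g B])
      show "4 * qa * qc * q0 + q1 * qb * q2 - qa * q2\<^sup>2 - qc * q1\<^sup>2 - q0 * qb\<^sup>2 \<noteq> 0" using t by blast
      show "Ft P = 0 \<longleftrightarrow> E P = 0" for P using fac[of P] mu[of P] t by simp
    qed (fact E g B notall)+
  qed
qed

text \<open>
  The common part of the two alternatives for the separating solution: \<open>f\<close> is the half-map whose
  graph separates, \<open>f2\<close> the other one.
\<close>

lemma zeros_bound:
  fixes f f2 :: "real \<Rightarrow> real" and X X2 X0 :: "real \<times> real \<Rightarrow> real \<times> real"
  assumes U: "open U" "simply_connected U" "U \<subseteq> Q_quad"
    and J: "open J" "is_interval J" and J2: "open J2" "is_interval J2"
    and dec: "\<And>x y. x \<in> J \<Longrightarrow> y \<in> J \<Longrightarrow> x < y \<Longrightarrow> f y < f x"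
    and lf: "\<And>y. y \<in> J \<Longrightarrow> leaf_at (\<lambda>p. snd (X p) / fst (X p)) f y \<and> fst (X (y, f y)) > 0"
    and lf2: "\<And>y. y \<in> J2 \<Longrightarrow> leaf_at (\<lambda>p. snd (X2 p) / fst (X2 p)) f2 y \<and> fst (X2 (y, f2 y)) > 0"
    and cX: "continuous_on UNIV X" "continuous_on UNIV X2"
    and sep: "separating_solution X0 U (graph_on J f \<inter> U)" and X0: "\<And>y. y \<in> J \<Longrightarrow> fst (X0 (y, f y)) > 0"
    and gU: "\<And>y. y \<in> J \<inter> J2 \<Longrightarrow> (y, f y) \<in> U"
    and cr: "\<And>p. p \<in> Q_quad \<Longrightarrow> sgn (fst (X p) * snd (X2 p) - snd (X p) * fst (X2 p)) = \<kappa>' * sgn (E (\<phi> p))"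
    and k': "\<kappa>' = 1 \<or> \<kappa>' = -1"
    and par: "\<And>p. p \<in> U \<Longrightarrow> E (\<phi> p) = 0 \<Longrightarrow> \<exists>c. XL p = c *\<^sub>R X p \<and> (p \<notin> Z \<longrightarrow> c \<noteq> 0)" and Z: "finite Z"
    and comps: "finite {C \<in> components {P \<in> \<phi> ` U. Ft P = 0}. \<not> compact C}"
      "card {C \<in> components {P \<in> \<phi> ` U. Ft P = 0}. \<not> compact C} \<le> N"
    and sols: "finite {P. P isolated_in {P \<in> \<phi> ` U. Ft P = 0 \<and> Gt P = 0}}"
      "card {P. P isolated_in {P \<in> \<phi> ` U. Ft P = 0 \<and> Gt P = 0}} \<le> k"
    and zs: "finite zs" "\<And>z. z \<in> zs \<Longrightarrow> z \<in> J \<inter> J2 \<and> f z = f2 z"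
    and nz: "y0 \<in> J \<inter> J2" "f y0 \<noteq> f2 y0"
  shows "card zs \<le> N + k + 1"
proof (cases "zs = {}")
  case False
  then obtain z0 where z0: "z0 \<in> J \<inter> J2" "f z0 = f2 z0" using zs by blast
  define A where "A = {y \<in> J. (y, f y) \<in> U}"
  define e where "e = (\<lambda>y. E (\<phi> (y, f y)))"
  let ?g = "\<lambda>p. snd (X2 p) / fst (X2 p)" and ?f' = "\<lambda>t. snd (X (t, f t)) / fst (X (t, f t))"
  have lf1: "leaf_at (\<lambda>p. snd (X p) / fst (X p)) f y" "fst (X (y, f y)) > 0" if "y \<in> J" for y using lf[OF that] by auto
  obtain \<theta> where ls: "leaf_separation U A f X \<theta>"
    using separating_graph_side[OF U(1,2) J(1) dec sep X0 lf1(2,1) continuous_on_subset[OF cX(1)]] unfolding A_def by blast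
  have leafD: "(h has_real_derivative g (y, h y)) (at y)" if l: "leaf_at g h y" for g h and y :: real
  proof -
    obtain e where "e > 0" "\<And>s. \<bar>s - y\<bar> < e \<Longrightarrow> (h has_real_derivative g (s, h s)) (at s)" using l unfolding leaf_at_def by blast
    then show ?thesis by simp
  qed
  have d1: "(f has_real_derivative ?f' y) (at y)" if "y \<in> J" for y using leafD[OF lf1(1)[OF that]] by simp
  have l2: "leaf_at ?g f2 y" if "y \<in> J2" for y using lf2[OF that] by blast
  have c1: "isCont f y" if "y \<in> J" for y using DERIV_isCont[OF d1[OF that]] .
  have c2: "isCont f2 y" if "y \<in> J2" for y using DERIV_isCont[OF leafD[OF l2[OF that]]] .
  have D: "open (J \<inter> J2)" "is_interval (J \<inter> J2)" "connected (J \<inter> J2)" using J J2 by (auto simp: is_interval_Int is_interval_connected)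
  have ce: "continuous_on J e"
  proof -
    have "continuous_on UNIV E" using E_der by (intro has_derivative_continuous_on) (blast intro: has_derivative_at_withinI)
    moreover have "continuous_on J (\<lambda>y. (y, f y))" using c1 by (intro continuous_intros continuous_at_imp_continuous_on) auto
    ultimately show ?thesis unfolding e_def
      by (intro continuous_on_compose2[OF _ continuous_on_compose2[OF phi_cont]]) auto
  qed
  have sg: "\<exists>d>0. \<forall>t. \<bar>t - y\<bar> < d \<longrightarrow> sgn (e t) = - \<kappa>' * sgn (?f' t - ?g (t, f t))" if y: "y \<in> J \<inter> J2" "f y = f2 y" for y
  proof -
    have yJ: "y \<in> J" "y \<in> J2" using y by auto
    have pc: "isCont (\<lambda>t. (t, f t)) y" by (intro continuous_Pair c1[OF yJ(1)] continuous_ident)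
    have cc: "isCont (\<lambda>t. fst (Y (t, f t))) y" if "continuous_on UNIV Y" for Y :: "real \<times> real \<Rightarrow> real \<times> real"
      by (intro continuous_fst isCont_o2[OF pc]) (use that in \<open>simp add: continuous_on_eq_continuous_at\<close>)
    obtain d1 where d1: "d1 > 0" "\<And>t. \<bar>t - y\<bar> < d1 \<Longrightarrow> fst (X (t, f t)) > 0"
      using cont_pos_near[where f = "\<lambda>t. fst (X (t, f t))" and x = y, OF cc[OF cX(1)] lf1(2)[OF yJ(1)]] by blast
    obtain d2 where d2: "d2 > 0" "\<And>t. \<bar>t - y\<bar> < d2 \<Longrightarrow> fst (X2 (t, f t)) > 0"
      using cont_pos_near[where f = "\<lambda>t. fst (X2 (t, f t))" and x = y, OF cc[OF cX(2)]] lf2[OF yJ(2)] y(2) by auto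
    have "y > 0" "- f y > 0" using gU[OF y(1)] U(3) by (auto simp: Q_quad_def)
    then obtain d3 where d3: "d3 > 0" "\<And>t. \<bar>t - y\<bar> < d3 \<Longrightarrow> - f t > 0"
      using cont_pos_near[where f = "\<lambda>t. - f t" and x = y, OF continuous_minus[OF c1[OF yJ(1)]]] by blast
    show ?thesis
    proof (intro exI[of _ "Min {d1, d2, d3, y}"] conjI allI impI)
      show "0 < Min {d1, d2, d3, y}" using d1 d2 d3 \<open>y > 0\<close> by simp
      fix t assume t: "\<bar>t - y\<bar> < Min {d1, d2, d3, y}"
      have pos: "fst (X (t, f t)) > 0" "fst (X2 (t, f t)) > 0" using t d1(2)[of t] d2(2)[of t] by simp_all
      have Q: "(t, f t) \<in> Q_quad" using t d3(2)[of t] by (auto simp: Q_quad_def abs_less_iff)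
      have "?f' t - ?g (t, f t) = - ((fst (X (t, f t)) * snd (X2 (t, f t)) - snd (X (t, f t)) * fst (X2 (t, f t))) / (fst (X (t, f t)) * fst (X2 (t, f t))))"
        by (rule slope_diff) (use pos in auto)
      then have "sgn (?f' t - ?g (t, f t)) = - (\<kappa>' * sgn (e t))"
        using cr[OF Q] pos by (simp add: sgn_minus sgn_divide sgn_mult e_def)
      then show "sgn (e t) = - \<kappa>' * sgn (?f' t - ?g (t, f t))" using k' by auto
    qed
  qed
  define K where "K = {y \<in> J \<inter> J2. e y = 0}"
  have gap: "\<exists>s\<in>K. a < s \<and> s < c" if ac: "a \<in> zs" "c \<in> zs" "a < c" for a c
  proof -
    have acD: "a \<in> J \<inter> J2" "f a = f2 a" "c \<in> J \<inter> J2" "f c = f2 c" using zs(2) ac by auto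
    have "x \<in> J \<inter> J2" if "a \<le> x" "x \<le> c" for x using D(2) acD(1,3) that unfolding is_interval_1 by blast
    then have sub: "{a..c} \<subseteq> J \<inter> J2" by auto
    have "\<exists>y. a < y \<and> y < c \<and> e y = 0"
    proof (rule rolle_between[where ?f1.0 = f and ?f2.0 = f2 and f1' = ?f' and g = ?g and \<kappa> = "- \<kappa>'", OF ac(3) acD(2,4) d1 J(1)])
      show "continuous_on {a..c} f2" using c2 sub by (intro continuous_at_imp_continuous_on) auto
      show "continuous_on {a..c} e" using continuous_on_subset[OF ce] sub by blast
      fix y assume "y \<in> {a..c}" "f y = f2 y"
      then show "\<exists>d>0. \<forall>t. \<bar>t - y\<bar> < d \<longrightarrow> sgn (e t) = - \<kappa>' * sgn (?f' t - ?g (t, f t))" using sg[of y] sub by blast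
    qed (use sub l2 k' in auto)
    then obtain y where "a < y" "y < c" "e y = 0" by blast
    then show ?thesis using sub by (intro bexI[of _ y]) (auto simp: K_def)
  qed
  obtain B where B: "finite B" "B \<subseteq> K" "card zs \<le> card B + 1" using zeros_or_more[OF zs(1) gap] by blast
  have DA: "J \<inter> J2 \<subseteq> A" using gU by (auto simp: A_def)
  have "card B \<le> N + k"
  proof (rule contact_count[OF ls U(1,3) _ par Z comps sols B(1)])
    show "connected A" using separating_graph[OF U(1,2) J(1) _ dec sep X0] c1
      by (simp add: A_def is_interval_connected continuous_at_imp_continuous_on)
    show "B \<subseteq> A" using B(2) DA by (auto simp: K_def)
    show "E (\<phi> (y, f y)) = 0" if "y \<in> B" for y using that B(2) by (auto simp: K_def e_def)
    show "\<exists>y\<in>A. E (\<phi> (y, f y)) \<noteq> 0"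
    proof (rule ccontr)
      assume "\<not> ?thesis"
      then have e0: "e y = 0" if "y \<in> J \<inter> J2" for y using DA that by (auto simp: e_def)
      have "f y0 = f2 y0"
      proof (rule leaves_coincide[where ?f1.0 = f and ?f2.0 = f2 and f1' = ?f' and g = ?g and z = z0, OF D(1,3)])
        show "continuous_on (J \<inter> J2) f2" using c2 by (intro continuous_at_imp_continuous_on) auto
        fix y assume y: "y \<in> J \<inter> J2" "f y = f2 y"
        obtain r where r: "r > 0" "\<And>t. \<bar>t - y\<bar> < r \<Longrightarrow> t \<in> J \<inter> J2" using D(1) y(1) unfolding open_dist dist_real_def by blast
        obtain d where d: "d > 0" "\<And>t. \<bar>t - y\<bar> < d \<Longrightarrow> sgn (e t) = - \<kappa>' * sgn (?f' t - ?g (t, f t))" using sg[OF y] by blast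
        have "?f' t = ?g (t, f t)" if "\<bar>t - y\<bar> < min r d" for t
          using e0[OF r(2)[of t]] d(2)[of t] that k' by (auto simp: sgn_0_0)
        then show "\<exists>d>0. \<forall>t. \<bar>t - y\<bar> < d \<longrightarrow> ?f' t = ?g (t, f t)" using r(1) d(1) by (intro exI[of _ "min r d"]) simp
      qed (use d1 l2 z0 nz in auto)
      then show False using nz by simp
    qed
  qed
  then show ?thesis using B(3) by simp
qed simp

end

lemma X_field_mirror: "X_field (- T) D (- a) = X_field T D a"
  by (simp add: X_field_def W_poly_def fun_eq_iff)

lemma W_mirror: "W_poly (- T) D (- a) = W_poly T D a"
  by (simp add: W_poly_def fun_eq_iff)

lemma X_field_pos: "y \<in> ret_dom T D a \<Longrightarrow> fst (X_field T D a (y, half_return T D a y)) > 0"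
  using ret_domD(6)[of y T D a] W_pos(1)[of y T D a] by (simp add: X_field_def mult_neg_pos)

lemma W_poly_roots:
  assumes "a \<noteq> 0 \<or> D \<noteq> 0" shows "finite {y. W_poly T D a y = 0}"
proof -
  have "finite {y. W_poly T D a y = 0} \<or> (\<forall>y. W_poly T D a y = 0)"
    unfolding W_poly_def by (intro real_poly_finite_or_zero real_poly_intros)
  moreover have "W_poly T D a 0 \<noteq> 0 \<or> W_poly T D a 1 \<noteq> 0" using assms by (auto simp: W_poly_def)
  ultimately show ?thesis by blast
qed

lemma X_field_zero:
  assumes "X_field T D a p = 0" "fst p > snd p" and a: "a \<noteq> 0"
  shows "W_poly T D a (fst p) = 0" "W_poly T D a (snd p) = 0"
proof -
  have z: "snd p * W_poly T D a (fst p) = 0" "fst p * W_poly T D a (snd p) = 0"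
    using assms(1) by (auto simp: X_field_def split_beta zero_prod_def)
  have W0: "W_poly T D a 0 \<noteq> 0" using a by (simp add: W_poly_def)
  have "fst p \<noteq> 0" "snd p \<noteq> 0" using z W0 assms(2) by auto
  then show "W_poly T D a (fst p) = 0" "W_poly T D a (snd p) = 0" using z by auto
qed

lemma quadratic_between:
  fixes D B C :: real
  assumes r: "D * u\<^sup>2 + B * u + C = 0" "D * v\<^sup>2 + B * v + C = 0" "v < t" "t < u" and t: "D * t\<^sup>2 + B * t + C > 0"
  shows "D < 0" "C = D * (u * v)"
proof -
  have "(u - v) * (D * (u + v) + B) = 0" using r(1,2) by (simp add: algebra_simps power2_eq_square)
  then have B: "B = - D * (u + v)" using r by auto
  show C: "C = D * (u * v)" using r(1) unfolding B by (simp add: algebra_simps power2_eq_square)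
  have "D * t\<^sup>2 + B * t + C = - D * ((t - v) * (u - t))" unfolding B C by (simp add: algebra_simps power2_eq_square)
  then have "- D * ((t - v) * (u - t)) > 0" using t by simp
  then show "D < 0" using r(3,4) by (simp add: zero_less_mult_iff mult_less_0_iff)
qed

lemma parallel_factor:
  fixes x r :: "real \<times> real"
  assumes "fst x * snd r - snd x * fst r = 0" "r \<noteq> 0" shows "\<exists>c. x = c *\<^sub>R r"
proof (cases "fst r = 0")
  case True
  then have "snd r \<noteq> 0" using assms(2) by (auto simp: prod_eq_iff)
  then show ?thesis using assms(1) True by (intro exI[of _ "snd x / snd r"]) (auto simp: prod_eq_iff)
next
  case False
  then show ?thesis using assms(1) by (intro exI[of _ "fst x / fst r"]) (auto simp: prod_eq_iff field_simps)
qed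

lemma right_leaf:
  assumes adm: "(aR \<ge> 0 \<and> 4 * DR - TR\<^sup>2 > 0) \<or> aR < 0" and y: "y - b \<in> ret_dom (- TR) DR (- aR)"
  defines "h \<equiv> \<lambda>y. half_return (- TR) DR (- aR) (y - b) + b"
  shows "leaf_at (\<lambda>p. snd (X_right TR DR aR b p) / fst (X_right TR DR aR b p)) h y"
    "fst (X_right TR DR aR b (y, h y)) > 0" "fst (X_field TR DR aR ((y, h y) - (b, b))) > 0"
proof -
  let ?X = "X_field TR DR aR"
  have L: "leaf_at (\<lambda>p. snd (?X (p - (b, b))) / fst (?X (p - (b, b)))) h y"
    using leaf_at_shift[OF left_leaf[OF y]] unfolding X_field_mirror h_def by simp
  have s: "y - b > 0" "h y - b < 0" using ret_domD(1,6)[OF y] by (auto simp: h_def)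
  show P: "fst (?X ((y, h y) - (b, b))) > 0" using X_field_pos[OF y] unfolding X_field_mirror h_def by simp
  show "fst (X_right TR DR aR b (y, h y)) > 0" using P s by (auto simp: X_right_def)
  show "leaf_at (\<lambda>p. snd (X_right TR DR aR b p) / fst (X_right TR DR aR b p)) h y"
  proof (cases "aR = 0")
    case True
    have D: "DR \<noteq> 0" using adm True by (auto simp: not_sum_power2_lt_zero)
    show ?thesis
    proof (rule leaf_at_cong[OF L, of "min (y - b) (b - h y)"])
      fix s w assume "\<bar>s - y\<bar> < min (y - b) (b - h y)" "\<bar>w - h y\<bar> < min (y - b) (b - h y)"
      then have "s - b > 0" "w - b < 0" by (auto simp: abs_less_iff)
      then have n: "s - b \<noteq> 0" "w - b \<noteq> 0" by auto
      show "snd (?X ((s, w) - (b, b))) / fst (?X ((s, w) - (b, b))) = snd (X_right TR DR aR b (s, w)) / fst (X_right TR DR aR b (s, w))"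
        using n D True by (simp add: X_right_def X_field_def W_poly_def power2_eq_square)
    qed (use s in auto)
  qed (use L in \<open>simp add: X_right_def\<close>)
qed

lemma X_right_cont: "continuous_on UNIV (X_right TR DR aR b)"
proof (cases "aR = 0")
  case False
  have "continuous_on UNIV (\<lambda>p. X_field TR DR aR (p - (b, b)))"
    by (rule continuous_on_compose2[OF X_field_cont]) (auto intro!: continuous_intros)
  then show ?thesis using False by (simp add: X_right_def)
qed (auto simp: X_right_def intro!: continuous_intros)

text \<open>
  A zero of the translated field in the quadrant is the corner between the separatrices of a saddle. It would be an
  accumulation point of the separating solution inside \<open>U\<close>.
\<close>

lemma right_field_nonzero:
  fixes TR DR aR b :: real
  assumes adm: "(aR \<ge> 0 \<and> 4 * DR - TR\<^sup>2 > 0) \<or> aR < 0"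
  defines "J \<equiv> (\<lambda>y. y + b) ` ret_dom (- TR) DR (- aR)" and "h \<equiv> \<lambda>y. half_return (- TR) DR (- aR) (y - b) + b"
  assumes U: "open U" "U \<subseteq> Q_quad" and ne: "graph_on J h \<inter> U \<noteq> {}"
    and cl: "closure (graph_on J h \<inter> U) - graph_on J h \<inter> U \<subseteq> frontier U"
    and p: "p \<in> U"
  shows "X_right TR DR aR b p \<noteq> 0"
proof
  assume z: "X_right TR DR aR b p = 0"
  have pQ: "fst p > 0" "snd p < 0" using p U(2) by (auto simp: Q_quad_def)
  show False
  proof (cases "aR = 0")
    case True
    then have "p = (b, b)" using z by (simp add: X_right_def)
    then show False using pQ by simp
  next
    case False
    let ?W = "W_poly TR DR aR"
    define u v where "u = fst p - b" and "v = snd p - b"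
    have "X_field TR DR aR (p - (b, b)) = 0" using z False by (simp add: X_right_def)
    from X_field_zero[OF this _ False] have W: "?W u = 0" "?W v = 0" using pQ by (auto simp: u_def v_def)
    have "\<exists>y. y - b \<in> ret_dom (- TR) DR (- aR) \<and> (y, h y) \<in> U" using ne by (force simp: graph_on_def J_def)
    then obtain y where y: "y - b \<in> ret_dom (- TR) DR (- aR)" "(y, h y) \<in> U" by blast
    have "y > 0" "h y < 0" using y(2) U(2) by (auto simp: Q_quad_def)
    then have "?W (- b) > 0"
      using W_pos_between[OF right_adm[OF adm] _ y(1), of "- b"] False by (auto simp: W_mirror h_def)
    then have "DR < 0 \<and> aR\<^sup>2 = DR * (u * v)"
      using quadratic_between[of DR u "- aR * TR" "aR\<^sup>2" v "- b"] W pQ by (auto simp: W_poly_def u_def v_def)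
    moreover have "aR\<^sup>2 > 0" using False by simp
    ultimately have D: "DR < 0" "u * v < 0" by (auto simp: zero_less_mult_iff)
    have "v < u" using pQ by (simp add: u_def v_def)
    then have uv: "v < 0" "0 < u" using D(2) by (auto simp: mult_less_0_iff)
    have a: "- aR > 0" using adm D(1) by (smt (verit) zero_le_power2)
    have W': "W_poly (- TR) DR (- aR) u = 0" "W_poly (- TR) DR (- aR) v = 0" using W by (simp_all add: W_mirror)
    have "p \<in> closure (graph_on J h \<inter> U)"
      unfolding closure_approachable
    proof (intro allI impI)
      fix e :: real assume e: "e > 0"
      obtain r where r: "r > 0" "ball p r \<subseteq> U" using U(1) p open_contains_ball by blast
      define d where "d = min e r / 2"
      have d: "d > 0" "2 * d \<le> e" "2 * d \<le> r" using e r by (auto simp: d_def)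
      obtain x where x: "x \<in> ret_dom (- TR) DR (- aR)" "\<bar>x - u\<bar> < d" "\<bar>half_return (- TR) DR (- aR) x - v\<bar> < d"
        using saddle_corner[OF a D(1) uv(2) W'(1) uv(1) W'(2) d(1)] by blast
      let ?q = "(x + b, h (x + b))"
      have "dist ?q p \<le> \<bar>x + b - fst p\<bar> + \<bar>h (x + b) - snd p\<bar>"
        by (cases p) (use sqrt_sum_squares_le_sum_abs in \<open>simp add: dist_prod_def dist_real_def\<close>)
      then have q: "dist ?q p < 2 * d" using x(2,3) by (simp add: h_def u_def v_def algebra_simps)
      then have "?q \<in> U" using r(2) d by (auto simp: dist_commute mem_ball subset_iff)
      then have "?q \<in> graph_on J h \<inter> U" using x(1) by (auto simp: graph_on_def J_def)
      then show "\<exists>q\<in>graph_on J h \<inter> U. dist q p < e" using q d by force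
    qed
    moreover have "p \<notin> graph_on J h"
    proof
      assume "p \<in> graph_on J h"
      then have "u \<in> ret_dom (- TR) DR (- aR)" by (auto simp: graph_on_def J_def u_def)
      then show False using W_pos(1) W'(1) by fastforce
    qed
    moreover have "p \<notin> frontier U" using p U(1) by (simp add: frontier_def interior_open)
    ultimately show False using cl by blast
  qed
qed

text \<open>
  In the second alternative \<open>Z\<close> is the set of zeros of \<open>X_L\<close>, which is finite because they are pairs of
  roots of \<open>W_poly\<close>.
\<close>

lemma (in contact_factor) count_zeros:
  defines "JR \<equiv> (\<lambda>y. y + b) ` ret_dom (- TR) DR (- aR)" and "h \<equiv> \<lambda>y. half_return (- TR) DR (- aR) (y - b) + b"
    and "JL \<equiv> ret_dom TL DL aL" and "fL \<equiv> half_return TL DL aL"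
  assumes U: "open U" "simply_connected U" "U \<subseteq> Q_quad"
    and alt: "graph_on (JL \<inter> JR) fL \<subseteq> U \<and> separating_solution (X_field TL DL aL) U (graph_on JL fL \<inter> U) \<or>
      graph_on (JL \<inter> JR) h \<subseteq> U \<and> separating_solution (\<lambda>p. X_field TR DR aR (p - (b, b))) U (graph_on JR h \<inter> U)"
    and comps: "finite {C \<in> components {P \<in> \<phi> ` U. Ft P = 0}. \<not> compact C}"
      "card {C \<in> components {P \<in> \<phi> ` U. Ft P = 0}. \<not> compact C} \<le> N"
    and sols: "finite {P. P isolated_in {P \<in> \<phi> ` U. Ft P = 0 \<and> Gt P = 0}}"
      "card {P. P isolated_in {P \<in> \<phi> ` U. Ft P = 0 \<and> Gt P = 0}} \<le> k"
    and zs: "finite zs" "\<And>z. z \<in> zs \<Longrightarrow> z \<in> JL \<inter> JR \<and> h z = fL z"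
    and nz: "y0 \<in> JL \<inter> JR" "h y0 \<noteq> fL y0"
  shows "card zs \<le> N + k + 1"
proof -
  have L: "leaf_at (\<lambda>p. snd (XL p) / fst (XL p)) fL y \<and> fst (XL (y, fL y)) > 0" if "y \<in> JL" for y
    using left_leaf X_field_pos that by (auto simp: XL JL_def fL_def)
  have JRI: "y - b \<in> ret_dom (- TR) DR (- aR)" if "y \<in> JR" for y using that by (auto simp: JR_def)
  have R: "leaf_at (\<lambda>p. snd (XR p) / fst (XR p)) h y \<and> fst (XR (y, h y)) > 0" if "y \<in> JR" for y
    using right_leaf[OF admR JRI[OF that]] by (auto simp: XR h_def)
  have decL: "fL y < fL x" if "x \<in> JL" "y \<in> JL" "x < y" for x y
    using half_return_decreasing[OF admL] that by (auto simp: JL_def fL_def)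
  have decR: "h y < h x" if "x \<in> JR" "y \<in> JR" "x < y" for x y
    using half_return_decreasing[OF right_adm[OF admR] JRI[OF that(1)] JRI[OF that(2)]] that(3) by (auto simp: h_def)
  have JL: "open JL" "is_interval JL" using ret_dom_open ret_dom_interval[OF admL] by (auto simp: JL_def)
  have JR: "open JR" "is_interval JR"
  proof -
    have t: "(\<lambda>y. y + b) = (+) b" by (auto simp: add.commute)
    show "open JR" unfolding JR_def t by (rule open_translation[OF ret_dom_open])
    show "is_interval JR" unfolding JR_def t using ret_dom_interval[OF right_adm[OF admR]] by (simp add: is_interval_translation)
  qed
  have cL: "continuous_on UNIV XL" and cR: "continuous_on UNIV XR" by (auto simp: XL XR X_field_cont X_right_cont)
  from alt show ?thesis
  proof
    assume a: "graph_on (JL \<inter> JR) fL \<subseteq> U \<and> separating_solution (X_field TL DL aL) U (graph_on JL fL \<inter> U)"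
    show ?thesis
    proof (rule zeros_bound[where f = fL and ?f2.0 = h and X = XL and ?X2.0 = XR and ?X0.0 = XL and \<kappa>' = \<kappa> and Z = "{}",
        OF U JL JR decL L R cL cR _ _ _ cross kap _ _ comps sols zs(1)])
      show "separating_solution XL U (graph_on JL fL \<inter> U)" using a by (simp add: XL)
      show "fst (XL (y, fL y)) > 0" if "y \<in> JL" for y using L[OF that] by blast
      show "(y, fL y) \<in> U" if "y \<in> JL \<inter> JR" for y using a that by (auto simp: graph_on_def)
      show "\<exists>c. XL p = c *\<^sub>R XL p \<and> (p \<notin> {} \<longrightarrow> c \<noteq> 0)" for p by (rule exI[of _ 1]) simp
      show "z \<in> JL \<inter> JR \<and> fL z = h z" if "z \<in> zs" for z using zs(2)[OF that] by auto
    qed (use nz in auto)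
  next
    assume a: "graph_on (JL \<inter> JR) h \<subseteq> U \<and> separating_solution (\<lambda>p. X_field TR DR aR (p - (b, b))) U (graph_on JR h \<inter> U)"
    define Z where "Z = {p \<in> Q_quad. XL p = 0}"
    have Zf: "finite Z"
    proof (rule finite_subset)
      show "Z \<subseteq> {y. W_poly TL DL aL y = 0} \<times> {y. W_poly TL DL aL y = 0}"
        by (auto simp: Z_def XL X_field_def Q_quad_def zero_prod_def)
      show "finite ({y. W_poly TL DL aL y = 0} \<times> {y. W_poly TL DL aL y = 0})"
      proof (intro finite_cartesian_product W_poly_roots)
        show "aL \<noteq> 0 \<or> DL \<noteq> 0" "aL \<noteq> 0 \<or> DL \<noteq> 0"
        using admL zero_le_power2[of TL] by force+
      qed
    qed
    have pos: "fst (X_field TR DR aR ((y, h y) - (b, b))) > 0" if "y \<in> JR" for y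
      using right_leaf(3)[OF admR JRI[OF that]] by (simp add: h_def)
    have hc: "continuous_on JR h"
    proof (intro continuous_at_imp_continuous_on ballI)
      fix y assume "y \<in> JR"
      then obtain e where "e > 0" "\<And>s. \<bar>s - y\<bar> < e \<Longrightarrow> (h has_real_derivative snd (XR (s, h s)) / fst (XR (s, h s))) (at s)"
        using R unfolding leaf_at_def by blast
      then show "isCont h y" using DERIV_isCont[of h _ y] by force
    qed
    have sg: "{y \<in> JR. (y, h y) \<in> U} \<noteq> {} \<and> closure ((\<lambda>y. (y, h y)) ` {y \<in> JR. (y, h y) \<in> U}) - (\<lambda>y. (y, h y)) ` {y \<in> JR. (y, h y) \<in> U} \<subseteq> frontier U"
      using separating_graph[OF U(1,2) JR(1) hc decR conjunct2[OF a] pos] by blast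
    have gr: "(\<lambda>y. (y, h y)) ` {y \<in> JR. (y, h y) \<in> U} = graph_on JR h \<inter> U" by (auto simp: graph_on_def)
    have ne: "graph_on JR h \<inter> U \<noteq> {}" and cl: "closure (graph_on JR h \<inter> U) - graph_on JR h \<inter> U \<subseteq> frontier U"
      using sg unfolding gr[symmetric] by auto
    have nzR: "XR p \<noteq> 0" if "p \<in> U" for p
      using right_field_nonzero[OF admR U(1,3) ne[unfolded JR_def h_def] cl[unfolded JR_def h_def] that] by (simp add: XR)
    show ?thesis
    proof (rule zeros_bound[where f = h and ?f2.0 = fL and X = XR and ?X2.0 = XL and ?X0.0 = "\<lambda>p. X_field TR DR aR (p - (b, b))" and \<kappa>' = "- \<kappa>" and Z = Z,
        OF U JR JL decR R L cR cL _ pos _ _ _ _ Zf comps sols zs(1)])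
      show "separating_solution (\<lambda>p. X_field TR DR aR (p - (b, b))) U (graph_on JR h \<inter> U)" using a by blast
      show "(y, h y) \<in> U" if "y \<in> JR \<inter> JL" for y using a that by (auto simp: graph_on_def)
      show "sgn (fst (XR p) * snd (XL p) - snd (XR p) * fst (XL p)) = - \<kappa> * sgn (E (\<phi> p))" if "p \<in> Q_quad" for p
      proof -
        have "fst (XR p) * snd (XL p) - snd (XR p) * fst (XL p) = - (fst (XL p) * snd (XR p) - snd (XL p) * fst (XR p))" by simp
        then show ?thesis using cross[OF that] by (simp add: sgn_minus del: minus_diff_eq)
      qed
      show "- \<kappa> = 1 \<or> - \<kappa> = -1" using kap by auto
      show "\<exists>c. XL p = c *\<^sub>R XR p \<and> (p \<notin> Z \<longrightarrow> c \<noteq> 0)" if p: "p \<in> U" "E (\<phi> p) = 0" for p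
      proof -
        have pQ: "p \<in> Q_quad" using p U(3) by blast
        then have "fst (XL p) * snd (XR p) - snd (XL p) * fst (XR p) = 0" using cross[of p] p(2) by (simp add: sgn_0_0)
        from parallel_factor[OF this nzR[OF p(1)]] obtain c where c: "XL p = c *\<^sub>R XR p" by blast
        then show ?thesis using pQ by (intro exI[of _ c]) (auto simp: Z_def)
      qed
      show "z \<in> JR \<inter> JL \<and> h z = fL z" if "z \<in> zs" for z using zs(2)[OF that] by auto
    qed (use nz in auto)
  qed
qed

section \<open>Regular values of b\<close>

lemma cross_shifted:
  "fst (X_field TL DL aL (x, y)) * snd (X_field TR DR aR ((x, y) - (b, b))) - snd (X_field TL DL aL (x, y)) * fst (X_field TR DR aR ((x, y) - (b, b)))
    = (x - y) * F_tilde TL DL aL TR DR aR b (\<phi> (x, y))"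
  by (simp add: F_tilde_eq X_field_def W_poly_def \<phi>_def m0_def m1_def m2_def m3_def m4_def m5_def) algebra

lemma cross_radial:
  "fst (X_field TL DL aL (x, y)) * (y - b) - snd (X_field TL DL aL (x, y)) * (x - b)
    = - ((x - y) * (aL\<^sup>2 * b - aL\<^sup>2 * (x + y) + (aL * TL - b * DL) * (x * y)))"
  by (simp add: X_field_def W_poly_def) algebra

lemma F_tilde_origin:
  "F_tilde TL DL aL TR DR 0 b P = (DR * b\<^sup>2 - DR * b * fst P + DR * snd P) * (aL\<^sup>2 * b - aL\<^sup>2 * fst P + (aL * TL - b * DL) * snd P)"
  by (simp add: F_tilde_eq m0_def m1_def m2_def m3_def m4_def m5_def) algebra

lemma F_tilde_origin_left:
  "F_tilde TL DL 0 TR DR aR b P = snd P * (m2 TL DL 0 TR DR aR b + m4 TL DL 0 TR DR aR b * fst P + m5 TL DL 0 TR DR aR b * snd P)"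
  by (simp add: F_tilde_eq m0_def m1_def m3_def algebra_simps)

text \<open>
  The values of \<open>b\<close> at which the zeros can be counted directly.
\<close>

definition "tame TL DL aL TR DR aR b \<longleftrightarrow>
  (\<exists>n0 n1 n2 q0 q1 q2 qa qb qc \<kappa> E E0 E1 \<mu> XL XR. contact_factor TL DL aL TR DR aR b n0 n1 n2 q0 q1 q2 qa qb qc \<kappa> E E0 E1 \<mu> XL XR)"

lemma tameI:
  assumes "contact_factor TL DL aL TR DR aR b n0 n1 n2 q0 q1 q2 qa qb qc \<kappa>
    (\<lambda>P. q0 + q1 * fst P + q2 * snd P + qa * (fst P)\<^sup>2 + qb * (fst P * snd P) + qc * (snd P)\<^sup>2)
    (\<lambda>P. q1 + 2 * qa * fst P + qb * snd P) (\<lambda>P. q2 + qb * fst P + 2 * qc * snd P)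
    (\<lambda>P. n0 + n1 * fst P + n2 * snd P) (X_field TL DL aL) (X_right TR DR aR b)"
  shows "tame TL DL aL TR DR aR b"
  using assms unfolding tame_def by blast

context
  fixes TL DL aL TR DR aR :: real
  assumes admL: "(aL \<le> 0 \<and> 4 * DL - TL\<^sup>2 > 0) \<or> aL > 0"
    and admR: "(aR \<ge> 0 \<and> 4 * DR - TR\<^sup>2 > 0) \<or> aR < 0"
begin

lemma DL_pos: assumes "aL = 0" shows "DL > 0"
proof -
  have "4 * DL - TL\<^sup>2 > 0" using admL assms by simp
  then show ?thesis using zero_le_power2[of TL] by linarith
qed

lemma DR_pos: assumes "aR = 0" shows "DR > 0"
proof -
  have "4 * DR - TR\<^sup>2 > 0" using admR assms by simp
  then show ?thesis using zero_le_power2[of TR] by linarith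
qed

text \<open>
  The factor \<open>E\<close> is \<open>F_tilde\<close> itself.
\<close>

lemma tame_generic:
  assumes aR: "aR \<noteq> 0"
    and F: "\<And>P. F_tilde TL DL aL TR DR aR b P = q0 + q1 * fst P + q2 * snd P + qa * (fst P)\<^sup>2 + qb * (fst P * snd P) + qc * (snd P)\<^sup>2"
    and t: "qa = 0 \<and> qb = 0 \<and> qc = 0 \<or> 4 * qa * qc * q0 + q1 * qb * q2 - qa * q2\<^sup>2 - qc * q1\<^sup>2 - q0 * qb\<^sup>2 \<noteq> 0"
  shows "tame TL DL aL TR DR aR b"
proof (rule tameI[where ?n0.0 = 1 and ?n1.0 = 0 and ?n2.0 = 0 and \<kappa> = 1 and ?q0.0 = q0 and ?q1.0 = q1 and ?q2.0 = q2 and qa = qa and qb = qb and qc = qc],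
    unfold_locales, goal_cases)
  case (9 p)
  then have "fst p - snd p > 0" by (auto simp: Q_quad_def)
  then have "sgn ((fst p - snd p) * F_tilde TL DL aL TR DR aR b (\<phi> p)) = sgn (F_tilde TL DL aL TR DR aR b (\<phi> p))"
    by (simp add: sgn_mult)
  then show ?case using cross_shifted[of TL DL aL "fst p" "snd p" TR DR aR b] aR F[of "\<phi> p"] by (simp add: X_right_def)
next
  case 11
  show ?case
  proof (cases "4 * qa * qc * q0 + q1 * qb * q2 - qa * q2\<^sup>2 - qc * q1\<^sup>2 - q0 * qb\<^sup>2 = 0")
    case True
    then have z: "qa = 0 \<and> qb = 0 \<and> qc = 0" using t by blast
    have "\<exists>P. q0 + q1 * fst P + q2 * snd P = 0" if "\<not> (q1 = 0 \<and> q2 = 0)"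
    proof (cases "q1 = 0")
      case True
      then show ?thesis using that by (intro exI[of _ "(0, - q0 / q2)"]) simp
    next
      case False
      then show ?thesis by (intro exI[of _ "(- q0 / q1, 0)"]) simp
    qed
    then show ?thesis using z by auto
  qed simp
qed (use F admL admR in auto)

text \<open>
  If \<open>aL = 0\<close>, then \<open>F_tilde\<close> is divisible by the second coordinate, which is negative on the image of the quadrant.
\<close>

lemma tame_left_origin:
  assumes aR: "aR \<noteq> 0" and aL: "aL = 0" and b: "W_poly TR DR aR (- b) \<noteq> 0"
  shows "tame TL DL aL TR DR aR b"
proof (rule tameI[where ?n0.0 = 0 and ?n1.0 = 0 and ?n2.0 = 1 and \<kappa> = "-1" and ?q0.0 = "m2 TL DL 0 TR DR aR b" and ?q1.0 = "m4 TL DL 0 TR DR aR b"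
      and ?q2.0 = "m5 TL DL 0 TR DR aR b" and qa = 0 and qb = 0 and qc = 0], unfold_locales, goal_cases)
  case 7
  show ?case by (simp add: aL F_tilde_origin_left)
next
  case (9 p)
  then have pQ: "fst p - snd p > 0" "fst p > 0" "snd p < 0" by (auto simp: Q_quad_def)
  have "sgn ((fst p - snd p) * F_tilde TL DL aL TR DR aR b (\<phi> p)) = - sgn (m2 TL DL 0 TR DR aR b + m4 TL DL 0 TR DR aR b * fst (\<phi> p) + m5 TL DL 0 TR DR aR b * snd (\<phi> p))"
    unfolding aL F_tilde_origin_left using pQ by (simp add: sgn_mult \<phi>_def split_beta)
  then show ?case using cross_shifted[of TL DL aL "fst p" "snd p" TR DR aR b] aR by (simp add: X_right_def)
next
  case (10 p)
  then show ?case by (auto simp: Q_quad_def \<phi>_def mult_pos_neg)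
next
  case 11
  have "m4 TL DL 0 TR DR aR b = DL * W_poly TR DR aR (- b)" by (simp add: m4_def W_poly_def algebra_simps power2_eq_square)
  then have "m4 TL DL 0 TR DR aR b \<noteq> 0" using b DL_pos[OF aL] by simp
  then show ?case
    by (intro disjI1 conjI disjI2 exI[of _ "(- (m2 TL DL 0 TR DR aR b + m5 TL DL 0 TR DR aR b) / m4 TL DL 0 TR DR aR b, 1)"]) auto
qed (use admL admR in auto)

text \<open>
  If \<open>aR = 0\<close>, then \<open>F_tilde\<close> is divisible by \<open>(y0 - b) (y1 - b)\<close>. A point of the quadrant on one of these lines belongs to \<open>E = 0\<close> only if
  \<open>b\<close> is a root of the polynomial of the left zone.
\<close>

lemma tame_right_origin:
  assumes aR: "aR = 0" and b: "W_poly TL DL aL b \<noteq> 0"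
  shows "tame TL DL aL TR DR aR b"
proof (rule tameI[where ?n0.0 = "DR * b\<^sup>2" and ?n1.0 = "- (DR * b)" and ?n2.0 = DR and \<kappa> = "-1" and ?q0.0 = "aL\<^sup>2 * b" and ?q1.0 = "- aL\<^sup>2"
      and ?q2.0 = "aL * TL - b * DL" and qa = 0 and qb = 0 and qc = 0], unfold_locales, goal_cases)
  case (7 P)
  show ?case by (simp add: aR F_tilde_origin algebra_simps)
next
  case (9 p)
  then have pQ: "fst p - snd p > 0" by (auto simp: Q_quad_def)
  have "sgn (- ((fst p - snd p) * (aL\<^sup>2 * b - aL\<^sup>2 * (fst p + snd p) + (aL * TL - b * DL) * (fst p * snd p))))
    = - sgn (aL\<^sup>2 * b - aL\<^sup>2 * (fst p + snd p) + (aL * TL - b * DL) * (fst p * snd p))"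
    using pQ by (simp only: sgn_minus sgn_mult sgn_pos mult_1)
  then show ?case using cross_radial[of TL DL aL "fst p" "snd p" b] aR by (simp add: X_right_def \<phi>_def split_beta)
next
  case (10 p)
  obtain x y where p: "p = (x, y)" "x > 0" "y < 0" using 10(1) by (auto simp: Q_quad_def)
  have "DR * ((x - b) * (y - b)) = 0" using 10(2) by (simp add: p \<phi>_def algebra_simps power2_eq_square)
  then have "x = b \<or> y = b" using DR_pos[OF aR] by auto
  then show ?case
  proof
    assume x: "x = b"
    have "aL\<^sup>2 * b - aL\<^sup>2 * (b + y) + (aL * TL - b * DL) * (b * y) = - (y * W_poly TL DL aL b)"
      by (simp add: W_poly_def algebra_simps power2_eq_square)
    moreover have "- (DR * b) * (- (y * W_poly TL DL aL b) - b * W_poly TL DL aL y) + DR * (- (y * W_poly TL DL aL b) * y + b * - (b * W_poly TL DL aL y))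
       = - (DR * (y * W_poly TL DL aL b) * (y - b))" by (simp add: algebra_simps)
    moreover have "y \<noteq> 0" "y - b \<noteq> 0" using p x by auto
    ultimately show ?thesis using b DR_pos[OF aR] by (simp add: p x \<phi>_def X_field_def)
  next
    assume y: "y = b"
    have "aL\<^sup>2 * b - aL\<^sup>2 * (x + b) + (aL * TL - b * DL) * (x * b) = - (x * W_poly TL DL aL b)"
      by (simp add: W_poly_def algebra_simps power2_eq_square)
    moreover have "- (DR * b) * (- (b * W_poly TL DL aL x) - x * W_poly TL DL aL b) + DR * (- (b * W_poly TL DL aL x) * b + x * - (x * W_poly TL DL aL b))
       = - (DR * (x * W_poly TL DL aL b) * (x - b))" by (simp add: algebra_simps)
    moreover have "x \<noteq> 0" "x - b \<noteq> 0" using p y by auto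
    ultimately show ?thesis using b DR_pos[OF aR] by (simp add: p y \<phi>_def X_field_def)
  qed
next
  case 11
  show ?case
  proof (cases "aL = 0")
    case True
    then have "b \<noteq> 0" using b by (auto simp: W_poly_def)
    then show ?thesis using True DR_pos[OF aR] by (intro disjI1 conjI disjI2 exI[of _ "(0, 0)"]) auto
  next
    case False
    define Y where "Y = b + (aL * TL - b * DL) / aL\<^sup>2"
    have Y: "aL\<^sup>2 * Y = aL\<^sup>2 * b + (aL * TL - b * DL)" using False by (simp add: Y_def field_simps)
    have "aL\<^sup>2 * (DR * b\<^sup>2 + - (DR * b) * Y + DR) = DR * W_poly TL DL aL b"
    proof -
      have "aL\<^sup>2 * (DR * b\<^sup>2 + - (DR * b) * Y + DR) = aL\<^sup>2 * DR * b\<^sup>2 - DR * b * (aL\<^sup>2 * Y) + aL\<^sup>2 * DR" by (simp add: algebra_simps)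
      then show ?thesis unfolding Y by (simp add: W_poly_def algebra_simps power2_eq_square)
    qed
    then have "DR * b\<^sup>2 + - (DR * b) * Y + DR \<noteq> 0" using b DR_pos[OF aR] by (metis less_irrefl mult_eq_0_iff)
    then show ?thesis using Y by (intro disjI1 conjI disjI2 exI[of _ "(Y, 1)"]) (auto simp: algebra_simps)
  qed
qed (use admL admR in auto)

text \<open>
  The determinant of the conic as a polynomial in \<open>b\<close>; apart from the factor \<open>aL^2 aR^2 b\<close> its degree is at most 4.
\<close>

lemma conic_det:
  fixes b :: real
  defines "q0 \<equiv> m0 aL TR DR aR b" and "q1 \<equiv> m1 aL TR DR aR b" and "q2 \<equiv> m2 TL DL aL TR DR aR b - 2 * m3 aL DR b"
    and "qa \<equiv> m3 aL DR b" and "qb \<equiv> m4 TL DL aL TR DR aR b" and "qc \<equiv> m5 TL DL aL TR DR aR b"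
    and "A \<equiv> aL * TL" and "B \<equiv> aR * TR" and "c \<equiv> aL\<^sup>2" and "d \<equiv> aR\<^sup>2"
  shows "4 * qa * qc * q0 + q1 * qb * q2 - qa * q2\<^sup>2 - qc * q1\<^sup>2 - q0 * qb\<^sup>2 = - (c * d * b *
    ((DR\<^sup>2 * c\<^sup>2 - 2 * DL * DR * c * d + DL\<^sup>2 * d\<^sup>2 + B\<^sup>2 * DL * c - A * B * (DR * c + DL * d) + A\<^sup>2 * DR * d)
     + (2 * B * DL * DR * c + 2 * B * DL\<^sup>2 * d - 2 * A * DR\<^sup>2 * c - 2 * A * DL * DR * d - A * B\<^sup>2 * DL + A\<^sup>2 * B * DR) * b
     + (2 * DL * DR\<^sup>2 * c + 2 * DL\<^sup>2 * DR * d + B\<^sup>2 * DL\<^sup>2 - 3 * A * B * DL * DR + A\<^sup>2 * DR\<^sup>2) * b\<^sup>2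
     + (2 * B * DL\<^sup>2 * DR - 2 * A * DL * DR\<^sup>2) * b ^ 3 + (DL\<^sup>2 * DR\<^sup>2) * b ^ 4))"
proof -
  have m: "q0 = c * (d * b + b ^ 3 * DR + B * b\<^sup>2)" "q1 = - (c * b * (2 * b * DR + B))"
    "q2 = - (d * (b * DL + A)) + b * DR * (3 * c - b\<^sup>2 * DL + b * A) + (c - b\<^sup>2 * DL) * B - 2 * (c * b * DR)"
    "qa = c * b * DR" "qb = d * DL - DR * (c - b\<^sup>2 * DL + b * A) + B * b * DL" "qc = A * DR - B * DL - b * DL * DR"
    by (simp_all add: q0_def q1_def q2_def qa_def qb_def qc_def A_def B_def c_def d_def m0_def m1_def m2_def m3_def m4_def m5_def algebra_simps)
  show ?thesis unfolding m by algebra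
qed

text \<open>
  In the generic case the polynomial of \<open>conic_det\<close> has a nonzero coefficient of degree 4, 2 or 0. It vanishes
  identically if \<open>DL = DR = 0\<close>, but then \<open>F_tilde\<close> is affine.
\<close>

lemma eventually_tame: "\<exists>bad. finite bad \<and> (\<forall>b. b \<notin> bad \<longrightarrow> tame TL DL aL TR DR aR b)"
proof (cases "aR = 0")
  case True
  have "finite {b. W_poly TL DL aL b = 0}" using W_poly_roots[of aL DL TL] DL_pos by blast
  then show ?thesis using tame_right_origin[OF True] by blast
next
  case aR: False
  show ?thesis
  proof (cases "aL = 0")
    case True
    have "finite (uminus ` {b. W_poly TR DR aR b = 0})" using W_poly_roots[of aR DR TR] aR by blast
    moreover have "tame TL DL aL TR DR aR b" if "b \<notin> uminus ` {b. W_poly TR DR aR b = 0}" for b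
      by (rule tame_left_origin[OF aR True]) (use that in force)
    ultimately show ?thesis by blast
  next
    case aL: False
    have F: "F_tilde TL DL aL TR DR aR b P = m0 aL TR DR aR b + m1 aL TR DR aR b * fst P + (m2 TL DL aL TR DR aR b - 2 * m3 aL DR b) * snd P
        + m3 aL DR b * (fst P)\<^sup>2 + m4 TL DL aL TR DR aR b * (fst P * snd P) + m5 TL DL aL TR DR aR b * (snd P)\<^sup>2" for b P
      by (simp add: F_tilde_eq power2_eq_square)
    show ?thesis
    proof (cases "DL = 0 \<and> DR = 0")
      case True
      have "tame TL DL aL TR DR aR b" for b
        by (rule tame_generic[OF aR F]) (use True in \<open>simp add: m3_def m4_def m5_def\<close>)
      then show ?thesis by blast
    next
      case False
      define A B c d where "A = aL * TL" and "B = aR * TR" and "c = aL\<^sup>2" and "d = aR\<^sup>2"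
      define r where "r = (\<lambda>i::nat. [DR\<^sup>2 * c\<^sup>2 - 2 * DL * DR * c * d + DL\<^sup>2 * d\<^sup>2 + B\<^sup>2 * DL * c - A * B * (DR * c + DL * d) + A\<^sup>2 * DR * d,
        2 * B * DL * DR * c + 2 * B * DL\<^sup>2 * d - 2 * A * DR\<^sup>2 * c - 2 * A * DL * DR * d - A * B\<^sup>2 * DL + A\<^sup>2 * B * DR,
        2 * DL * DR\<^sup>2 * c + 2 * DL\<^sup>2 * DR * d + B\<^sup>2 * DL\<^sup>2 - 3 * A * B * DL * DR + A\<^sup>2 * DR\<^sup>2,
        2 * B * DL\<^sup>2 * DR - 2 * A * DL * DR\<^sup>2, DL\<^sup>2 * DR\<^sup>2] ! i)"
      have cd: "c \<noteq> 0" "d \<noteq> 0" using aL aR by (auto simp: c_def d_def)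
      have "r 4 \<noteq> 0 \<or> r 2 \<noteq> 0 \<or> r 0 \<noteq> 0"
      proof (cases "DL = 0")
        case True
        then show ?thesis using False cd by (auto simp: r_def)
      next
        case DL: False
        then show ?thesis using cd by (cases "DR = 0") (auto simp: r_def)
      qed
      moreover have "(4::nat) \<le> 4" "(2::nat) \<le> 4" "(0::nat) \<le> 4" by simp_all
      ultimately have "\<exists>i\<le>4. r i \<noteq> 0" by blast
      then have fin: "finite {b. (\<Sum>i\<le>4. r i * b ^ i) = 0}" using polyfun_finite_roots[of r 4] by blast
      have "tame TL DL aL TR DR aR b" if "b \<notin> insert 0 {b. (\<Sum>i\<le>4. r i * b ^ i) = 0}" for b
      proof (rule tame_generic[OF aR F], rule disjI2)
        have "(\<Sum>i\<le>4. r i * b ^ i) = r 0 + r 1 * b + r 2 * b\<^sup>2 + r 3 * b ^ 3 + r 4 * b ^ 4"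
          by (simp add: eval_nat_numeral)
        then show "4 * m3 aL DR b * m5 TL DL aL TR DR aR b * m0 aL TR DR aR b
          + m1 aL TR DR aR b * m4 TL DL aL TR DR aR b * (m2 TL DL aL TR DR aR b - 2 * m3 aL DR b)
          - m3 aL DR b * (m2 TL DL aL TR DR aR b - 2 * m3 aL DR b)\<^sup>2 - m5 TL DL aL TR DR aR b * (m1 aL TR DR aR b)\<^sup>2
          - m0 aL TR DR aR b * (m4 TL DL aL TR DR aR b)\<^sup>2 \<noteq> 0"
          using that cd unfolding conic_det A_def[symmetric] B_def[symmetric] c_def[symmetric] d_def[symmetric] by (simp add: r_def)
      qed
      then show ?thesis using fin by (meson finite_insert)
    qed
  qed
qed

lemma few_zeros:
  defines "JL \<equiv> ret_dom TL DL aL" and "fL \<equiv> half_return TL DL aL" and "JR \<equiv> \<lambda>b. (\<lambda>y. y + b) ` ret_dom (- TR) DR (- aR)"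
    and "fR \<equiv> \<lambda>b y. half_return (- TR) DR (- aR) (y - b) + b"
  assumes W: "open W" "b \<in> W"
    and dom: "\<And>b. b \<in> W \<Longrightarrow> open (U b) \<and> simply_connected (U b) \<and> U b \<subseteq> Q_quad"
    and alt: "\<And>b. b \<in> W \<Longrightarrow> graph_on (JL \<inter> JR b) fL \<subseteq> U b \<and> separating_solution (X_field TL DL aL) (U b) (graph_on JL fL \<inter> U b) \<or>
      graph_on (JL \<inter> JR b) (fR b) \<subseteq> U b \<and> separating_solution (\<lambda>p. X_field TR DR aR (p - (b, b))) (U b) (graph_on (JR b) (fR b) \<inter> U b)"
    and comps: "\<And>b. b \<in> W \<Longrightarrow> finite {C \<in> components {P \<in> \<phi> ` U b. F_tilde TL DL aL TR DR aR b P = 0}. \<not> compact C} \<and>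
      card {C \<in> components {P \<in> \<phi> ` U b. F_tilde TL DL aL TR DR aR b P = 0}. \<not> compact C} \<le> N"
    and sols: "\<And>b. b \<in> W \<Longrightarrow> finite {P. P isolated_in {P \<in> \<phi> ` U b. F_tilde TL DL aL TR DR aR b P = 0 \<and> G_tilde TL DL aL TR DR aR b P = 0}} \<and>
      card {P. P isolated_in {P \<in> \<phi> ` U b. F_tilde TL DL aL TR DR aR b P = 0 \<and> G_tilde TL DL aL TR DR aR b P = 0}} \<le> k"
    and zs: "finite zs" "\<And>z. z \<in> zs \<Longrightarrow> z \<in> JL \<inter> JR b \<and> fR b z = fL z"
    and iso: "\<And>z. z \<in> zs \<Longrightarrow> \<exists>e>0. \<forall>y. y \<in> JL \<inter> JR b \<and> fR b y = fL y \<and> \<bar>y - z\<bar> < e \<longrightarrow> y = z"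
  shows "card zs \<le> N + k + 1"
proof (cases "zs = {}")
  case False
  interpret displacement "ret_dom TL DL aL" "ret_dom (- TR) DR (- aR)" "half_return TL DL aL" "half_return (- TR) DR (- aR)"
  proof
    show "continuous_on (ret_dom T D a) (half_return T D a)" for T D a
      using half_return_deriv DERIV_isCont by (intro continuous_at_imp_continuous_on) blast
    then show "continuous_on (ret_dom (- TR) DR (- aR)) (half_return (- TR) DR (- aR))" .
  qed (use ret_dom_open half_return_decreasing[OF right_adm[OF admR]] in auto)
  have displ_dom: "y \<in> displ_dom b \<longleftrightarrow> y \<in> JL \<inter> JR b" for y b
    by (force simp: displ_dom_def JL_def JR_def)
  have displ: "displ b y = fR b y - fL y" for y b by (simp add: displ_def fR_def fL_def)
  \<comment> \<open>The zeros are moved to a nearby regular value of the parameter and counted there.\<close>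
  obtain bad where bad: "finite bad" "\<And>b. b \<notin> bad \<Longrightarrow> tame TL DL aL TR DR aR b" using eventually_tame by blast
  obtain \<eta> where eta: "\<eta> > 0" "\<And>c. \<bar>c - b\<bar> < \<eta> \<Longrightarrow> c \<in> W" using W unfolding open_dist dist_real_def by blast
  have "\<exists>b' B. \<bar>b' - b\<bar> < \<eta> \<and> b' \<notin> bad \<and> finite B \<and> card zs \<le> card B \<and> (\<forall>y\<in>B. y \<in> displ_dom b' \<and> displ b' y = 0) \<and> (\<exists>y\<in>displ_dom b'. displ b' y \<noteq> 0)"
    by (rule zeros_persist[OF zs(1) False _ _ bad(1) eta(1)]) (use zs(2) iso in \<open>auto simp: displ_dom displ\<close>)
  then obtain b' B y0 where b': "\<bar>b' - b\<bar> < \<eta>" "b' \<notin> bad" and B: "finite B" "card zs \<le> card B" "\<And>y. y \<in> B \<Longrightarrow> y \<in> displ_dom b' \<and> displ b' y = 0"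
    and y0: "y0 \<in> displ_dom b'" "displ b' y0 \<noteq> 0" by blast
  have bW: "b' \<in> W" using eta(2) b'(1) .
  obtain n0 n1 n2 q0 q1 q2 qa qb qc \<kappa> E E0 E1 \<mu> XL XR where "contact_factor TL DL aL TR DR aR b' n0 n1 n2 q0 q1 q2 qa qb qc \<kappa> E E0 E1 \<mu> XL XR"
    using bad(2)[OF b'(2)] unfolding tame_def by blast
  then interpret contact_factor TL DL aL TR DR aR b' n0 n1 n2 q0 q1 q2 qa qb qc \<kappa> E E0 E1 \<mu> XL XR .
  have "card B \<le> N + k + 1"
  proof (rule count_zeros[of "U b'" N k B y0, folded JL_def fL_def])
    show "graph_on (JL \<inter> (\<lambda>y. y + b') ` ret_dom (- TR) DR (- aR)) fL \<subseteq> U b' \<and> separating_solution (X_field TL DL aL) (U b') (graph_on JL fL \<inter> U b') \<or>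
      graph_on (JL \<inter> (\<lambda>y. y + b') ` ret_dom (- TR) DR (- aR)) (\<lambda>y. half_return (- TR) DR (- aR) (y - b') + b') \<subseteq> U b' \<and>
      separating_solution (\<lambda>p. X_field TR DR aR (p - (b', b'))) (U b') (graph_on ((\<lambda>y. y + b') ` ret_dom (- TR) DR (- aR)) (\<lambda>y. half_return (- TR) DR (- aR) (y - b') + b') \<inter> U b')"
      using alt[OF bW] unfolding JR_def fR_def .
  qed (use dom[OF bW] comps[OF bW] sols[OF bW] B y0 in \<open>auto simp: displ_dom displ JR_def fR_def\<close>)
  then show ?thesis using B(2) by simp
qed simp

end

section \<open>The bound on the number of crossing limit cycles\<close>

lemma graph_on_cong: "S = S' \<Longrightarrow> (\<And>y. y \<in> S' \<Longrightarrow> f y = g y) \<Longrightarrow> graph_on S f = graph_on S' g"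
  by (auto simp: graph_on_def)

theorem theorem4:
  fixes TL TR DL DR aL aR bs \<epsilon> :: real
    and U :: "real \<Rightarrow> (real \<times> real) set"
    and N k :: nat
  assumes left: "(aL \<le> 0 \<and> 4 * DL - TL^2 > 0) \<or> aL > 0"
    and right: "(aR \<ge> 0 \<and> 4 * DR - TR^2 > 0) \<or> aR < 0"
    and eps: "\<epsilon> > 0"
    and dom: "\<And>b. b \<in> {bs - \<epsilon><..<bs + \<epsilon>} \<Longrightarrow> simply_connected_domain (U b) \<and> U b \<subseteq> Q_quad"
    and sep: "(\<forall>b\<in>{bs - \<epsilon><..<bs + \<epsilon>}.
          graph_on (interior (I_left TL DL aL \<inter> I_right TR DR aR b)) (y_left TL DL aL) \<subseteq> U b \<and>
          separating_solution (X_field TL DL aL) (U b)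
            (graph_on (interior (I_left TL DL aL)) (y_left TL DL aL) \<inter> U b))
      \<or> (\<forall>b\<in>{bs - \<epsilon><..<bs + \<epsilon>}.
          graph_on (interior (I_left TL DL aL \<inter> I_right TR DR aR b)) (y_right TR DR aR b) \<subseteq> U b \<and>
          separating_solution (\<lambda>p. X_field TR DR aR (p - (b, b))) (U b)
            (graph_on (interior (I_right TR DR aR b)) (y_right TR DR aR b) \<inter> U b))"
    and comps: "\<And>b. b \<in> {bs - \<epsilon><..<bs + \<epsilon>} \<Longrightarrow>
          (let \<C> = {C \<in> components {P \<in> \<phi> ` U b. F_tilde TL DL aL TR DR aR b P = 0}. \<not> compact C}
           in finite \<C> \<and> card \<C> \<le> N)"
    and sols: "\<And>b. b \<in> {bs - \<epsilon><..<bs + \<epsilon>} \<Longrightarrow>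
          (let S = {P \<in> \<phi> ` U b. F_tilde TL DL aL TR DR aR b P = 0 \<and> G_tilde TL DL aL TR DR aR b P = 0};
               Iso = {P. P isolated_in S}
           in finite Iso \<and> card Iso \<le> k)"
  shows "\<forall>b\<in>{bs - \<epsilon><..<bs + \<epsilon>}.
     (let \<L> = {\<Gamma>. crossing_limit_cycle (lin_field TL DL aL 0) (lin_field TR DR aR b) \<Gamma>}
      in finite \<L> \<and> card \<L> \<le> N + k + 1)"
proof
  fix b assume b: "b \<in> {bs - \<epsilon><..<bs + \<epsilon>}"
  let ?W = "{bs - \<epsilon><..<bs + \<epsilon>}"
  let ?JL = "ret_dom TL DL aL" and ?JR = "\<lambda>b. (\<lambda>y. y + b) ` ret_dom (- TR) DR (- aR)"
  let ?fL = "half_return TL DL aL" and ?fR = "\<lambda>b y. half_return (- TR) DR (- aR) (y - b) + b"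
  interpret two_zones TL DL aL TR DR aR b using left right by unfold_locales
  have IL: "interior (I_left TL DL aL) = ?JL" by (rule interior_I_left[OF left])
  have IR: "interior (I_right TR DR aR c) = ?JR c" for c by (rule interior_I_right[OF right])
  have gL: "graph_on S (y_left TL DL aL) = graph_on S ?fL" if "S \<subseteq> ?JL" for S
    using that y_left_eq by (intro graph_on_cong) auto
  have gR: "graph_on S (y_right TR DR aR c) = graph_on S (?fR c)" if "S \<subseteq> ?JR c" for S c
    using that by (intro graph_on_cong y_right_eq) auto
  have alt: "graph_on (?JL \<inter> ?JR c) ?fL \<subseteq> U c \<and> separating_solution (X_field TL DL aL) (U c) (graph_on ?JL ?fL \<inter> U c) \<or>
      graph_on (?JL \<inter> ?JR c) (?fR c) \<subseteq> U c \<and> separating_solution (\<lambda>p. X_field TR DR aR (p - (c, c))) (U c) (graph_on (?JR c) (?fR c) \<inter> U c)"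
    if c: "c \<in> ?W" for c
  proof -
    note g = gL[of ?JL, OF order_refl] gL[of "?JL \<inter> ?JR c", OF Int_lower1] gR[of "?JR c" c, OF order_refl] gR[of "?JL \<inter> ?JR c" c, OF Int_lower2]
    from sep show ?thesis
    proof
      assume "\<forall>b\<in>?W. graph_on (interior (I_left TL DL aL \<inter> I_right TR DR aR b)) (y_left TL DL aL) \<subseteq> U b \<and>
          separating_solution (X_field TL DL aL) (U b) (graph_on (interior (I_left TL DL aL)) (y_left TL DL aL) \<inter> U b)"
      from bspec[OF this c] show ?thesis unfolding interior_Int IL IR g by (rule disjI1)
    next
      assume "\<forall>b\<in>?W. graph_on (interior (I_left TL DL aL \<inter> I_right TR DR aR b)) (y_right TR DR aR b) \<subseteq> U b \<and>
          separating_solution (\<lambda>p. X_field TR DR aR (p - (b, b))) (U b) (graph_on (interior (I_right TR DR aR b)) (y_right TR DR aR b) \<inter> U b)"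
      from bspec[OF this c] show ?thesis unfolding interior_Int IL IR g by (rule disjI2)
    qed
  qed
  define \<L> where "\<L> = {\<Gamma>. crossing_limit_cycle ZL ZR \<Gamma>}"
  have bound: "card F \<le> N + k + 1" if F: "finite F" "F \<subseteq> \<L>" for F
  proof -
    have "\<forall>\<Gamma>\<in>F. \<exists>z. per_zero z \<and> \<Gamma> = loop z \<and> (\<exists>e>0. \<forall>z'. per_zero z' \<and> \<bar>z' - z\<bar> < e \<longrightarrow> z' = z)"
      using F(2) limit_cycle_isolated_zero unfolding \<L>_def by blast
    from bchoice[OF this] obtain \<zeta> where \<zeta>: "\<forall>\<Gamma>\<in>F. per_zero (\<zeta> \<Gamma>) \<and> \<Gamma> = loop (\<zeta> \<Gamma>) \<and>
        (\<exists>e>0. \<forall>z'. per_zero z' \<and> \<bar>z' - \<zeta> \<Gamma>\<bar> < e \<longrightarrow> z' = \<zeta> \<Gamma>)" ..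
    have pz: "per_zero z \<longleftrightarrow> z \<in> ?JL \<inter> ?JR b \<and> ?fR b z = ?fL z" for z
      by (force simp: per_zero_def)
    have "inj_on \<zeta> F"
    proof (rule inj_onI)
      fix x y assume xy: "x \<in> F" "y \<in> F" "\<zeta> x = \<zeta> y"
      then have "x = loop (\<zeta> x)" "y = loop (\<zeta> y)" using \<zeta> by blast+
      then show "x = y" using xy(3) by simp
    qed
    then have "card F = card (\<zeta> ` F)" by (simp add: card_image)
    also have "\<dots> \<le> N + k + 1"
    proof (rule few_zeros[OF left right, where W = ?W and b = b and U = U])
      show "open (U c) \<and> simply_connected (U c) \<and> U c \<subseteq> Q_quad" if "c \<in> ?W" for c
        using dom[OF that] by (simp add: simply_connected_domain_def)
      show "z \<in> ?JL \<inter> ?JR b \<and> ?fR b z = ?fL z" if "z \<in> \<zeta> ` F" for z using that \<zeta> pz by blast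
      show "\<exists>e>0. \<forall>y. y \<in> ?JL \<inter> ?JR b \<and> ?fR b y = ?fL y \<and> \<bar>y - z\<bar> < e \<longrightarrow> y = z" if z: "z \<in> \<zeta> ` F" for z
      proof -
        obtain \<Gamma> where "\<Gamma> \<in> F" "z = \<zeta> \<Gamma>" using z by blast
        then have "\<exists>e>0. \<forall>y. per_zero y \<and> \<bar>y - z\<bar> < e \<longrightarrow> y = z" using bspec[OF \<zeta>, of \<Gamma>] by simp
        then show ?thesis unfolding pz conj_assoc .
      qed
    qed (fact b open_greaterThanLessThan alt comps[unfolded Let_def] sols[unfolded Let_def] finite_imageI[OF F(1)])+
    finally show ?thesis .
  qed
  have "finite \<L>"
  proof (rule ccontr)
    assume "infinite \<L>"
    then obtain F where "F \<subseteq> \<L>" "finite F" "card F = N + k + 2" by (meson infinite_arbitrarily_large)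
    then show False using bound[of F] by simp
  qed
  then show "let \<L> = {\<Gamma>. crossing_limit_cycle (lin_field TL DL aL 0) (lin_field TR DR aR b) \<Gamma>} in finite \<L> \<and> card \<L> \<le> N + k + 1"
    using bound[of \<L>] by (simp add: \<L>_def Let_def)
qed

end
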